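(* Let $\sigma>5$ and suppose $V:\mathbb{Z}\to\mathbb{R}$ is periodic. Consider the discrete nonlinear Schr\"odinger equation (with either choice of sign $\pm$) $$\mathbf{i}\frac{\partial\psi_n}{\partial t}=(H_V\psi)_n\pm|\psi_n|^{\sigma-1}\psi_n,\qquad n\in\mathbb{Z}.$$ There exist constants $C,\delta>0$ such that if $\|\psi(0)\|_1\le\delta$, then $\psi(t)$, the solution to the Cauchy problem for this equation with initial datum $\psi(0)$, satisfies $$\|\psi(t)\|_\infty\le C\langle t\rangle^{-1/3}$$ for all $t\in\mathbb{R}$.
   Context: Notation: $\mathbf{i}$ is the imaginary unit, $\langle t\rangle=\sqrt{1+t^2}$, and $\|\cdot\|_q$ denotes the $\ell^q(\mathbb{Z})$ norm on complex-valued sequences. The operator $H_V:\ell^2(\mathbb{Z})\to\ell^2(\mathbb{Z})$ is the discrete Schr\"odinger operator $[H_V\psi](n)=\psi(n-1)+\psi(n+1)+V(n)\psi(n)$. "Periodic" means there is an integer $p\ge1$ with $V(n+p)=V(n)$ for all $n\in\mathbb{Z}$. The initial datum $\psi(0)$ is a complex sequence in $\ell^1(\mathbb{Z})\subset\ell^2(\mathbb{Z})$, and $\psi(t)=(\psi_n(t))_{n\in\mathbb{Z}}$ is the solution in $\ell^2(\mathbb{Z})$. *)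

theory Defs
  imports "HOL-Analysis.Analysis"
begin

definition ell :: "real \<Rightarrow> (int \<Rightarrow> complex) set" where
  "ell q = {u. (\<lambda>n. cmod (u n) powr q) summable_on UNIV}"

text \<open>The two norms below are the usual ones on \<open>ell q\<close> and on bounded sequences respectively;
  their values carry no meaning elsewhere.\<close>

definition ell_norm :: "real \<Rightarrow> (int \<Rightarrow> complex) \<Rightarrow> real" where
  "ell_norm q u = (\<Sum>\<^sub>\<infinity>n. cmod (u n) powr q) powr (1 / q)"

definition ell_inf_norm :: "(int \<Rightarrow> complex) \<Rightarrow> real" where
  "ell_inf_norm u = (SUP n. cmod (u n))"

definition japanese_bracket :: "real \<Rightarrow> real" where
  "japanese_bracket t = sqrt (1 + t\<^sup>2)"

definition periodic_potential :: "(int \<Rightarrow> real) \<Rightarrow> bool" where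
  "periodic_potential V \<longleftrightarrow> (\<exists>p::int. p \<ge> 1 \<and> (\<forall>n. V (n + p) = V n))"

definition schroedinger_op :: "(int \<Rightarrow> real) \<Rightarrow> (int \<Rightarrow> complex) \<Rightarrow> int \<Rightarrow> complex" where
  "schroedinger_op V u n = u (n - 1) + u (n + 1) + complex_of_real (V n) * u n"

text \<open>Differentiability at \<open>t\<close> of a curve in \<open>ell 2\<close>, with respect to the norm of that space.
  Membership of the curve and of the derivative in \<open>ell 2\<close> is required explicitly, so that
  the norm of the remainder is always meaningful.\<close>

definition has_ell2_derivative ::
  "(real \<Rightarrow> int \<Rightarrow> complex) \<Rightarrow> (int \<Rightarrow> complex) \<Rightarrow> real \<Rightarrow> bool" where
  "has_ell2_derivative \<psi> u t \<longleftrightarrow> (\<forall>r. \<psi> r \<in> ell 2) \<and> u \<in> ell 2 \<and>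
     ((\<lambda>h. ell_norm 2 (\<lambda>n. (\<psi> (t + h) n - \<psi> t n) / complex_of_real h - u n)) \<longlongrightarrow> 0) (at 0)"

text \<open>Global solutions in \<open>ell 2\<close> of the Cauchy problem. The parameter \<open>s\<close> is the sign
  of the nonlinearity, \<open>1\<close> or \<open>-1\<close>. The right-hand side is locally Lipschitz on \<open>ell 2\<close>,
  so differentiable solutions are automatically continuously differentiable.\<close>

definition dnls_solution ::
  "real \<Rightarrow> real \<Rightarrow> (int \<Rightarrow> real) \<Rightarrow> (int \<Rightarrow> complex) \<Rightarrow> (real \<Rightarrow> int \<Rightarrow> complex) \<Rightarrow> bool" where
  "dnls_solution s \<sigma> V \<psi>0 \<psi> \<longleftrightarrow> \<psi> 0 = \<psi>0 \<and>
     (\<exists>\<psi>'. \<forall>t. has_ell2_derivative \<psi> (\<psi>' t) t \<and>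
        (\<forall>n. \<i> * \<psi>' t n = schroedinger_op V (\<psi> t) n
              + complex_of_real (s * cmod (\<psi> t n) powr (\<sigma> - 1)) * \<psi> t n))"

end

theory Submission
  imports Defs "HOL-Complex_Analysis.Complex_Analysis" "HOL-Computational_Algebra.Computational_Algebra"
    "HOL-Probability.Discrete_Topology"
begin

text \<open>Half the discriminant of a periodic operator is a real polynomial \<open>f\<close> that takes values in
  \<open>[-1, 1]\<close> only on the real line. Writing \<open>f = cos \<theta>\<close> defines a map \<open>\<theta>\<close> of the upper half
  plane into itself, and the boundary Schwarz lemma for \<open>- 1 / (\<theta> - \<theta>0)\<close> bounds the Schwarzian
  derivative of the real function \<open>\<theta>\<close> from below on the bands, uniformly up to the band edges.
  Hence the third derivative of a band function \<open>E(\<theta>)\<close> is bounded away from zero wherever its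
  second derivative is small, and van der Corput's lemma, applied to the Bloch representation, shows
  that the propagator decays like \<open>t powr (-1/3)\<close>. For the nonlinear equation, \<open>\<sigma> > 5\<close> makes
  \<open>t powr (- (\<sigma> - 2) / 3)\<close> integrable at infinity, so that conservation of the \<open>ell 2\<close> norm,
  Duhamel's formula and a continuity argument propagate the linear decay. Conservation and Duhamel's formula
  are applied to finite blocks of sites, whose boundary terms are small because the solution stays
  dominated by a summable weight.\<close>

section \<open>Oscillatory integrals\<close>

text \<open>The Schwarzian bound replaces it. A band function E inverts \<theta>, so its Schwarzian
  is that of \<theta> times - E'^2, and where E'' = 0 it equals E''' / E'; a definite sign makes
  every inflection point nondegenerate, which is what the exponent 1/3 needs. The bound is uniform
  because it is read off on half circles of one large radius R about the points of the spectrum: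
  there \<theta> has bounded real part and Im \<theta> between 1 and a quantity of order log R,
  while the removed point mass costs only order 1 / R. The sites enter only through a linear phase,
  harmless to van der Corput's lemma, and through finitely many amplitudes over one period. The
  threshold 5 arises because two of the \<sigma> powers of the solution are spent on the
  \<open>ell 2\<close> norm, and the others must satisfy (\<sigma> - 2) / 3 > 1. Small data keep the
  solution below amplitude 1, so the nonlinearity is truncated there and existence becomes a
  globally Lipschitz problem.\<close>

lemma upward_closed_threshold:
  fixes Q :: "real \<Rightarrow> bool"
  assumes "a \<le> b" and up: "\<And>x y. \<lbrakk>a \<le> x; x < y; y \<le> b; Q x\<rbrakk> \<Longrightarrow> Q y"
  obtains c where "a \<le> c" "c \<le> b" "\<And>x. \<lbrakk>a \<le> x; x < c\<rbrakk> \<Longrightarrow> \<not> Q x" "\<And>x. \<lbrakk>c < x; x \<le> b\<rbrakk> \<Longrightarrow> Q x"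
proof (cases "\<exists>x. a \<le> x \<and> x \<le> b \<and> Q x")
  case False
  then show ?thesis using that[of b] assms(1) by force
next
  case True
  define A where "A = {x. a \<le> x \<and> x \<le> b \<and> Q x}"
  have ne: "A \<noteq> {}" and bd: "bdd_below A" using True by (auto simp: A_def)
  have 1: "a \<le> Inf A" using ne by (auto simp: A_def intro: cInf_greatest)
  have 2: "Inf A \<le> b" using True cInf_lower[OF _ bd] by (force simp: A_def)
  have 3: "\<not> Q x" if "a \<le> x" "x < Inf A" for x
    using cInf_lower[OF _ bd, of x] that 2 by (force simp: A_def)
  have 4: "Q x" if x: "Inf A < x" "x \<le> b" for x
  proof -
    obtain y where "y \<in> A" "y < x" using cInf_lessD[OF ne x(1)] by auto
    then show ?thesis using up[of y x] x by (auto simp: A_def)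
  qed
  show ?thesis using that[of "Inf A"] 1 2 3 4 by blast
qed

lemma continuous_cis [continuous_intros]:
  "continuous_on S f \<Longrightarrow> continuous_on S (\<lambda>x. cis (f x))"
  by (simp add: cis_conv_exp continuous_intros)

lemma cis_integrable:
  fixes \<phi> :: "real \<Rightarrow> real"
  assumes "continuous_on {a..b} \<phi>"
  shows "(\<lambda>x. cis (\<phi> x)) integrable_on {a..b}"
  by (intro integrable_continuous_interval continuous_intros assms)

lemma Re_integral_cis:
  fixes \<phi> :: "real \<Rightarrow> real"
  assumes "continuous_on {a..b} \<phi>"
  shows "Re (integral {a..b} (\<lambda>x. cis (\<phi> x))) = integral {a..b} (\<lambda>x. cos (\<phi> x))"
    and "Im (integral {a..b} (\<lambda>x. cis (\<phi> x))) = integral {a..b} (\<lambda>x. sin (\<phi> x))"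
  using integral_linear[OF cis_integrable[OF assms] bounded_linear_Re]
        integral_linear[OF cis_integrable[OF assms] bounded_linear_Im]
  by (auto simp: o_def)

lemma norm_integral_cis_le_length:
  fixes \<phi> :: "real \<Rightarrow> real"
  assumes "a \<le> b" "continuous_on {a..b} \<phi>"
  shows "cmod (integral {a..b} (\<lambda>x. cis (\<phi> x))) \<le> b - a"
proof -
  have "cmod (integral {a..b} (\<lambda>x. cis (\<phi> x))) \<le> integral {a..b} (\<lambda>x. 1::real)"
    by (rule integral_norm_bound_integral) (auto intro: cis_integrable assms)
  then show ?thesis using assms(1) by simp
qed

lemma integral_cis_uminus:
  "cmod (integral {a..b} (\<lambda>x. cis (- \<phi> x))) = cmod (integral {a..b} (\<lambda>x. cis (\<phi> x)))"
proof -
  have "integral {a..b} (\<lambda>x. cnj (cis (\<phi> x))) = cnj (integral {a..b} (\<lambda>x. cis (\<phi> x)))"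
    by (rule integral_cnj[symmetric])
  then show ?thesis by (simp add: cis_cnj)
qed

text \<open>Dividing by \<open>\<phi>'\<close> writes \<open>C\<close> as a monotone factor times
  the derivative of \<open>S\<close>. The second mean value theorem then takes the place of
  integration by parts, so only monotonicity of \<open>\<phi>'\<close> enters. The value 4 comes
  from two increments of \<open>S\<close>, each at most 2, weighted by at most 1 / L. In the
  applications \<open>S\<close> is the sine or minus the cosine of the phase.\<close>

lemma van_der_corput_first_real:
  fixes S C \<phi>' :: "real \<Rightarrow> real"
  assumes "a \<le> b" "L > 0"
    and S: "\<And>x. x \<in> {a..b} \<Longrightarrow> (S has_real_derivative \<phi>' x * C x) (at x within {a..b})"
    and S1: "\<And>x. \<bar>S x\<bar> \<le> 1"
    and mono: "\<And>x y. \<lbrakk>a \<le> x; x \<le> y; y \<le> b\<rbrakk> \<Longrightarrow> \<phi>' x \<le> \<phi>' y"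
    and large: "(\<forall>x\<in>{a..b}. L \<le> \<phi>' x) \<or> (\<forall>x\<in>{a..b}. \<phi>' x \<le> - L)"
  shows "\<bar>integral {a..b} C\<bar> \<le> 4 / L"
proof -
  have FTC: "((\<lambda>x. \<phi>' x * C x) has_integral (S d - S c)) {c..d}" if "a \<le> c" "c \<le> d" "d \<le> b" for c d
    using that by (intro fundamental_theorem_of_calculus)
      (auto intro: DERIV_subset[OF S] simp flip: has_real_derivative_iff_has_vector_derivative)
  define g where "g x = - 1 / \<phi>' x" for x
  have g: "g x \<le> g y" if "a \<le> x" "x \<le> y" "y \<le> b" for x y
  proof -
    have "x \<in> {a..b}" "y \<in> {a..b}" "\<phi>' x \<le> \<phi>' y" using mono that by auto
    with large consider "L \<le> \<phi>' x" "L \<le> \<phi>' y" | "\<phi>' x \<le> -L" "\<phi>' y \<le> -L" by blast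
    then have "\<phi>' x * \<phi>' y > 0"
    proof cases
      case 2
      then show ?thesis using \<open>L > 0\<close> by (intro mult_neg_neg) linarith+
    qed (use \<open>L > 0\<close> in simp)
    with \<open>\<phi>' x \<le> \<phi>' y\<close> show ?thesis by (auto simp: g_def divide_simps zero_less_mult_iff)
  qed
  have nz: "\<phi>' x \<noteq> 0" "\<bar>g x\<bar> \<le> 1 / L" if "x \<in> {a..b}" for x
  proof -
    have "\<bar>\<phi>' x\<bar> \<ge> L"
      using large
    proof
      assume "\<forall>x\<in>{a..b}. L \<le> \<phi>' x"
      then have "L \<le> \<phi>' x" using that by blast
      then show ?thesis by linarith
    next
      assume "\<forall>x\<in>{a..b}. \<phi>' x \<le> - L"
      then have "\<phi>' x \<le> - L" using that by blast
      then show ?thesis by linarith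
    qed
    then show "\<phi>' x \<noteq> 0" "\<bar>g x\<bar> \<le> 1 / L" using \<open>L > 0\<close> by (auto simp: g_def frac_le)
  qed
  obtain c where c: "c \<in> {a..b}" and eq: "integral {a..b} (\<lambda>x. g x * (\<phi>' x * C x)) =
      g a * integral {a..c} (\<lambda>x. \<phi>' x * C x) + g b * integral {c..b} (\<lambda>x. \<phi>' x * C x)"
    using second_mean_value_theorem[of "\<lambda>x. \<phi>' x * C x" a b g] FTC[of a b] g \<open>a \<le> b\<close> by blast
  have "integral {a..b} (\<lambda>x. g x * (\<phi>' x * C x)) = integral {a..b} (\<lambda>x. - C x)"
    by (rule integral_cong) (use nz in \<open>auto simp: g_def\<close>)
  also have "\<dots> = - integral {a..b} C" by simp
  finally have "\<bar>integral {a..b} C\<bar> = \<bar>g a * (S c - S a) + g b * (S b - S c)\<bar>"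
    using eq FTC[of a c] FTC[of c b] c by (auto simp: integral_unique)
  also have "\<dots> \<le> \<bar>g a\<bar> * \<bar>S c - S a\<bar> + \<bar>g b\<bar> * \<bar>S b - S c\<bar>"
    by (metis abs_mult abs_triangle_ineq)
  also have "\<dots> \<le> (1/L) * 2 + (1/L) * 2"
    using nz \<open>a \<le> b\<close> \<open>L > 0\<close> S1[of a] S1[of b] S1[of c] by (intro add_mono mult_mono) auto
  finally show ?thesis by simp
qed

lemma van_der_corput_first:
  fixes \<phi> \<phi>' :: "real \<Rightarrow> real"
  assumes "a \<le> b" "L > 0"
    and \<phi>: "\<And>x. x \<in> {a..b} \<Longrightarrow> (\<phi> has_real_derivative \<phi>' x) (at x within {a..b})"
    and mono: "\<And>x y. \<lbrakk>a \<le> x; x \<le> y; y \<le> b\<rbrakk> \<Longrightarrow> \<phi>' x \<le> \<phi>' y"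
    and large: "(\<forall>x\<in>{a..b}. L \<le> \<phi>' x) \<or> (\<forall>x\<in>{a..b}. \<phi>' x \<le> - L)"
  shows "cmod (integral {a..b} (\<lambda>x. cis (\<phi> x))) \<le> 8 / L"
proof -
  have c: "continuous_on {a..b} \<phi>" using \<phi> DERIV_continuous_on by blast
  have 1: "\<bar>integral {a..b} (\<lambda>x. cos (\<phi> x))\<bar> \<le> 4 / L"
    by (rule van_der_corput_first_real[where S = "\<lambda>x. sin (\<phi> x)" and \<phi>' = \<phi>'])
       (use assms in \<open>auto intro!: derivative_eq_intros simp: mult.commute\<close>)
  have 2: "\<bar>integral {a..b} (\<lambda>x. sin (\<phi> x))\<bar> \<le> 4 / L"
    by (rule van_der_corput_first_real[where S = "\<lambda>x. - cos (\<phi> x)" and \<phi>' = \<phi>'])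
       (use assms in \<open>auto intro!: derivative_eq_intros simp: mult.commute\<close>)
  show ?thesis using cmod_le[of "integral {a..b} (\<lambda>x. cis (\<phi> x))"] 1 2
    by (simp add: Re_integral_cis[OF c])
qed

lemma continuous_le_on_Ioo:
  fixes g :: "real \<Rightarrow> real"
  assumes "continuous_on {c..d} g" "\<And>x. x \<in> {c<..<d} \<Longrightarrow> g x \<le> a" "c < d" "x \<in> {c..d}"
  shows "g x \<le> a"
  using continuous_ge_on_Ioo[of c d "\<lambda>x. - g x" "- a" x] assms continuous_on_minus[OF assms(1)] by force

text \<open>The stretch where \<open>\<phi>'\<close> has modulus at most sqrt L has length at most 2
  / sqrt L, because \<open>\<phi>'\<close> grows at rate at least L; each side of it costs 8 / sqrt
  L by the first derivative test. Convexity is expressed by difference quotients of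
  \<open>\<phi>'\<close>, so that a lower bound for a second derivative in the interior of the
  interval is enough in the applications.\<close>

lemma van_der_corput_second:
  fixes \<phi> \<phi>' :: "real \<Rightarrow> real"
  assumes "a \<le> b" "L > 0"
    and \<phi>: "\<And>x. x \<in> {a..b} \<Longrightarrow> (\<phi> has_real_derivative \<phi>' x) (at x within {a..b})"
    and cont: "continuous_on {a..b} \<phi>'"
    and slope: "\<And>x y. \<lbrakk>a \<le> x; x \<le> y; y \<le> b\<rbrakk> \<Longrightarrow> L * (y - x) \<le> \<phi>' y - \<phi>' x"
  shows "cmod (integral {a..b} (\<lambda>x. cis (\<phi> x))) \<le> 18 / sqrt L"
proof -
  define \<delta> where "\<delta> = sqrt L"
  have \<delta>: "\<delta> > 0" "\<delta> * \<delta> = L" using assms(2) by (auto simp: \<delta>_def)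
  have mono: "\<phi>' x \<le> \<phi>' y" if "a \<le> x" "x \<le> y" "y \<le> b" for x y
    using slope[OF that] that \<open>L > 0\<close> by (smt (verit) mult_nonneg_nonneg)
  \<comment> \<open>The threshold lemma says nothing about the point \<open>c1\<close> itself, and
    likewise for \<open>c2\<close>; the bounds at these end points are recovered below from the
    continuity of \<open>\<phi>'\<close>.\<close>
  obtain c1 where c1: "a \<le> c1" "c1 \<le> b" "\<And>x. \<lbrakk>a \<le> x; x < c1\<rbrakk> \<Longrightarrow> \<not> -\<delta> \<le> \<phi>' x"
      "\<And>x. \<lbrakk>c1 < x; x \<le> b\<rbrakk> \<Longrightarrow> -\<delta> \<le> \<phi>' x"
  proof (rule upward_closed_threshold[of a b "\<lambda>x. -\<delta> \<le> \<phi>' x"])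
    show "-\<delta> \<le> \<phi>' y" if "a \<le> x" "x < y" "y \<le> b" "-\<delta> \<le> \<phi>' x" for x y
      using mono[of x y] that by linarith
  qed (use assms(1) in blast)+
  obtain c2 where c2: "c1 \<le> c2" "c2 \<le> b" "\<And>x. \<lbrakk>c1 \<le> x; x < c2\<rbrakk> \<Longrightarrow> \<not> \<delta> \<le> \<phi>' x"
      "\<And>x. \<lbrakk>c2 < x; x \<le> b\<rbrakk> \<Longrightarrow> \<delta> \<le> \<phi>' x"
  proof (rule upward_closed_threshold[of c1 b "\<lambda>x. \<delta> \<le> \<phi>' x"])
    show "\<delta> \<le> \<phi>' y" if "c1 \<le> x" "x < y" "y \<le> b" "\<delta> \<le> \<phi>' x" for x y
      using mono[of x y] that c1(1,2) by linarith
  qed (use c1(2) in blast)+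
  have w: "\<phi>' x \<le> -\<delta>" if "a < x" "x < c1" for x
    using c1(3)[of x] that by linarith
  have w': "\<phi>' x \<le> \<delta>" "-\<delta> \<le> \<phi>' x" if "c1 < x" "x < c2" for x
    using c2(3)[of x] c1(4)[of x] c2(2) that by linarith+
  have w'': "\<delta> \<le> \<phi>' x" if "c2 < x" "x < b" for x
    using c2(4)[of x] that by linarith
  have cc: "continuous_on {c..d} \<phi>'" "continuous_on {c..d} \<phi>" if "a \<le> c" "d \<le> b" for c d
    using continuous_on_subset[OF cont] DERIV_continuous_on[OF \<phi>] continuous_on_subset that
    by (metis atLeastatMost_subset_iff)+
  have D: "(\<phi> has_real_derivative \<phi>' x) (at x within {c..d})" if "a \<le> c" "d \<le> b" "x \<in> {c..d}" for c d x
    by (rule DERIV_subset[OF \<phi>]) (use that in auto)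
  have I1: "cmod (integral {a..c1} (\<lambda>x. cis (\<phi> x))) \<le> 8 / \<delta>"
  proof (cases "a < c1")
    case True
    have "\<phi>' x \<le> -\<delta>" if "x \<in> {a..c1}" for x
      by (rule continuous_le_on_Ioo[OF cc(1)[of a c1] _ True that]) (use c1(2) w in auto)
    then show ?thesis
      by (intro van_der_corput_first[where \<phi>' = \<phi>']) (use c1(1,2) \<delta> in \<open>auto intro!: D mono\<close>)
  qed (use c1 \<delta> in simp)
  have I3: "cmod (integral {c2..b} (\<lambda>x. cis (\<phi> x))) \<le> 8 / \<delta>"
  proof (cases "c2 < b")
    case True
    have "\<delta> \<le> \<phi>' x" if "x \<in> {c2..b}" for x
      by (rule continuous_ge_on_Ioo[OF cc(1)[of c2 b] _ True that]) (use c1(1,2) c2(1,2) w' w'' in auto)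
    then show ?thesis
      by (intro van_der_corput_first[where \<phi>' = \<phi>']) (use c1(1,2) c2(1,2) \<delta> in \<open>auto intro!: D mono\<close>)
  qed (use c2 \<delta> in simp)
  have I2: "cmod (integral {c1..c2} (\<lambda>x. cis (\<phi> x))) \<le> 2 / \<delta>"
  proof (cases "c1 < c2")
    case True
    have "\<phi>' c2 \<le> \<delta>"
      by (rule continuous_le_on_Ioo[OF cc(1)[of c1 c2] _ True]) (use c1(1,2) c2(1,2) w' w'' in auto)
    moreover have "-\<delta> \<le> \<phi>' c1"
      by (rule continuous_ge_on_Ioo[OF cc(1)[of c1 c2] _ True]) (use c1(1,2) c2(1,2) w' w'' in auto)
    ultimately have "\<delta> * \<delta> * (c2 - c1) \<le> 2 * \<delta>" using slope[of c1 c2] c1 c2 \<delta> by auto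
    then have "\<delta> * (\<delta> * (c2 - c1)) \<le> \<delta> * 2" by (simp add: mult_ac)
    then have "\<delta> * (c2 - c1) \<le> 2" using \<delta>(1) mult_le_cancel_left_pos by blast
    then have "c2 - c1 \<le> 2 / \<delta>" using \<delta>(1) by (simp add: field_simps)
    then show ?thesis using norm_integral_cis_le_length[of c1 c2 \<phi>] cc[of c1 c2] c1 c2 by force
  qed (use \<delta> c2 in simp)
  have "integral {a..b} (\<lambda>x. cis (\<phi> x)) = integral {a..c1} (\<lambda>x. cis (\<phi> x)) +
     (integral {c1..c2} (\<lambda>x. cis (\<phi> x)) + integral {c2..b} (\<lambda>x. cis (\<phi> x)))"
    using c1(1,2) c2(1,2)
    by (simp add: Henstock_Kurzweil_Integration.integral_combine cis_integrable cc)
  also have "cmod \<dots> \<le> 8/\<delta> + (2/\<delta> + 8/\<delta>)"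
    by (intro order.trans[OF norm_triangle_ineq] add_mono I1 I2 I3)
  finally show ?thesis by (simp add: \<delta>_def)
qed

text \<open>Suppose \<open>q\<close> exceeded \<mu> at some z. At the last point s before z with q s
  \<le> \<mu> the value is exactly \<mu>, and the negative derivative there forces values below
  \<mu> immediately after s, contrary to the choice of s. Equality at y is excluded by looking to
  the left of y, where \<open>q\<close> would then be above \<mu>.\<close>

lemma downcrossing:
  fixes q q' :: "real \<Rightarrow> real"
  assumes q: "\<And>s. \<lbrakk>x \<le> s; s \<le> y\<rbrakk> \<Longrightarrow> (q has_real_derivative q' s) (at s)"
    and neg: "\<And>s. \<lbrakk>x \<le> s; s \<le> y; q s = \<mu>\<rbrakk> \<Longrightarrow> q' s < 0"
    and "x < y" "q x \<le> \<mu>"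
  shows "q y < \<mu>"
proof -
  have *: False if z: "x < z" "z \<le> y" "q z > \<mu>" for z
  proof -
    have cont: "continuous_on {x..z} q"
      by (rule DERIV_continuous_on[where D = q'], rule has_field_derivative_at_within, rule q) (use z in auto)
    define A where "A = {s \<in> {x..z}. q s \<le> \<mu>}"
    have clA: "closed A" unfolding A_def
      using cont continuous_closed_preimage[OF cont closed_atLeastAtMost, of "{..\<mu>}"]
      by (simp add: vimage_def Int_def)
    have ne: "x \<in> A" and bd: "bdd_above A" using assms z by (auto simp: A_def)
    define s where "s = Sup A"
    have s: "s \<in> A" unfolding s_def by (rule closed_contains_Sup) (use ne bd clA in auto)
    then have sz: "s < z" using z by (auto simp: A_def order_le_less)
    have gt: "q r > \<mu>" if "s < r" "r \<le> z" for r
      using cSup_upper[OF _ bd, of r, folded s_def] that s z by (cases "q r \<le> \<mu>") (auto simp: A_def)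
    have "q s \<ge> \<mu>"
      by (rule continuous_ge_on_Ioo[OF continuous_on_subset[OF cont] _ sz])
         (use s gt sz in \<open>auto simp: A_def intro: less_imp_le\<close>)
    then have qs: "q s = \<mu>" using s by (auto simp: A_def)
    have sxy: "x \<le> s" "s \<le> y" using s z by (simp_all add: A_def)
    have "q' s < 0" "(q has_real_derivative q' s) (at s)"
      using neg[OF sxy qs] q[OF sxy] by simp_all
    from DERIV_neg_dec_right[OF this(2,1)] obtain d where d: "d > 0"
      "\<And>h. \<lbrakk>0 < h; h < d\<rbrakk> \<Longrightarrow> q (s + h) < q s" by blast
    obtain h where h: "0 < h" "h < d" "h < z - s" using dense[of 0 "min d (z - s)"] d(1) sz by auto
    show False using d(2)[of h] gt[of "s + h"] h qs by simp
  qed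
  show ?thesis
  proof (rule ccontr)
    assume "\<not> q y < \<mu>"
    then have qy: "q y = \<mu>" using *[of y] assms by force
    then have "q' y < 0" "(q has_real_derivative q' y) (at y)" using neg q assms by auto
    from DERIV_neg_dec_left[OF this(2,1)] obtain d where d: "d > 0"
      "\<And>h. \<lbrakk>0 < h; h < d\<rbrakk> \<Longrightarrow> q y < q (y - h)" by blast
    obtain h where h: "0 < h" "h < d" "h < y - x" using dense[of 0 "min d (y - x)"] d(1) \<open>x < y\<close> by auto
    show False using d(2)[of h] *[of "y - h"] h qy by simp
  qed
qed

lemma slope_ge:
  fixes f f' :: "real \<Rightarrow> real"
  assumes "x \<le> y" "\<And>s. \<lbrakk>x \<le> s; s \<le> y\<rbrakk> \<Longrightarrow> (f has_real_derivative f' s) (at s)"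
    and "\<And>s. \<lbrakk>x < s; s < y\<rbrakk> \<Longrightarrow> m \<le> f' s"
  shows "m * (y - x) \<le> f y - f x"
proof (cases "x < y")
  case True
  from MVT2[OF this, of f f'] assms obtain z where "x < z" "z < y" "f y - f x = (y - x) * f' z" by blast
  then show ?thesis using assms(3)[of z] by (simp add: mult.commute mult_left_mono)
qed (use assms in simp)

text \<open>The hypothesis \<open>dich\<close> lets \<open>e2\<close> cross each level in
  [-\<mu>, \<mu>] only once, and downwards. Hence \<open>e2\<close> \<ge> \<mu> on an initial piece
  and \<open>e2\<close> \<le> -\<mu> on a final one, where the second derivative test applies;
  between them \<open>e2\<close> falls at rate at least c, so the middle piece has length at most 2
  \<mu> / c.\<close>

lemma van_der_corput_inflection_large_time:
  fixes e e1 e2 e3 :: "real \<Rightarrow> real"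
  assumes D1: "\<And>x. x \<in> {a..b} \<Longrightarrow> (e has_real_derivative e1 x) (at x)"
    and D2: "\<And>x. x \<in> {a..b} \<Longrightarrow> (e1 has_real_derivative e2 x) (at x)"
    and D3: "\<And>x. x \<in> {a..b} \<Longrightarrow> (e2 has_real_derivative e3 x) (at x)"
    and dich: "\<And>x. \<lbrakk>x \<in> {a..b}; \<bar>e2 x\<bar> \<le> \<epsilon>\<rbrakk> \<Longrightarrow> e3 x \<le> - c"
    and "c > 0" "a \<le> b" "t > 0" "\<mu> > 0" "\<mu> \<le> \<epsilon>"
  shows "cmod (integral {a..b} (\<lambda>x. cis (\<kappa> * x - t * e x))) \<le> 36 / sqrt (t * \<mu>) + 2 * \<mu> / c"
proof -
  have down: "e2 y < m" if "a \<le> x" "x < y" "y \<le> b" "e2 x \<le> m" "\<bar>m\<bar> \<le> \<mu>" for x y m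
  proof (rule downcrossing[where q = e2 and q' = e3 and x = x and y = y and \<mu> = m])
    fix s assume s: "x \<le> s" "s \<le> y"
    then show "(e2 has_real_derivative e3 s) (at s)" using D3 that by auto
    assume "e2 s = m"
    then have "e3 s \<le> - c" using dich[of s] s that \<open>\<mu> \<le> \<epsilon>\<close> by auto
    then show "e3 s < 0" using \<open>c > 0\<close> by linarith
  qed (use that in auto)
  obtain c1 where c1: "a \<le> c1" "c1 \<le> b" "\<And>x. \<lbrakk>a \<le> x; x < c1\<rbrakk> \<Longrightarrow> \<not> e2 x \<le> \<mu>"
      "\<And>x. \<lbrakk>c1 < x; x \<le> b\<rbrakk> \<Longrightarrow> e2 x \<le> \<mu>"
  proof (rule upward_closed_threshold[of a b "\<lambda>x. e2 x \<le> \<mu>"])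
    show "e2 y \<le> \<mu>" if "a \<le> x" "x < y" "y \<le> b" "e2 x \<le> \<mu>" for x y
      using down[of x y \<mu>] that \<open>\<mu> > 0\<close> by linarith
  qed (use \<open>a \<le> b\<close> in blast)+
  obtain c2 where c2: "c1 \<le> c2" "c2 \<le> b" "\<And>x. \<lbrakk>c1 \<le> x; x < c2\<rbrakk> \<Longrightarrow> \<not> e2 x \<le> -\<mu>"
      "\<And>x. \<lbrakk>c2 < x; x \<le> b\<rbrakk> \<Longrightarrow> e2 x \<le> -\<mu>"
  proof (rule upward_closed_threshold[of c1 b "\<lambda>x. e2 x \<le> -\<mu>"])
    show "e2 y \<le> -\<mu>" if "c1 \<le> x" "x < y" "y \<le> b" "e2 x \<le> -\<mu>" for x y
      using down[of x y "-\<mu>"] that c1(1,2) \<open>\<mu> > 0\<close> by linarith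
  qed (use c1(2) in blast)+
  have w: "\<mu> \<le> e2 x" if "a < x" "x < c1" for x
    using c1(3)[of x] that by linarith
  have w': "e2 x \<le> \<mu>" "-\<mu> \<le> e2 x" if "c1 < x" "x < c2" for x
    using c2(3)[of x] c1(4)[of x] c2(2) that by linarith+
  have w'': "e2 x \<le> -\<mu>" if "c2 < x" "x < b" for x
    using c2(4)[of x] that by linarith
  define \<phi> where "\<phi> x = \<kappa> * x - t * e x" for x
  define \<phi>' where "\<phi>' x = \<kappa> - t * e1 x" for x
  have D\<phi>: "(\<phi> has_real_derivative \<phi>' x) (at x within S)" if "x \<in> {a..b}" for x S
    unfolding \<phi>_def \<phi>'_def
    by (rule derivative_eq_intros refl has_field_derivative_at_within[OF D1[OF that]])+ simp
  have D\<phi>': "(\<phi>' has_real_derivative - t * e2 x) (at x within S)" if "x \<in> {a..b}" for x S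
    unfolding \<phi>'_def
    by (rule derivative_eq_intros refl has_field_derivative_at_within[OF D2[OF that]])+ simp
  have contd: "continuous_on S \<phi>'" if "S \<subseteq> {a..b}" for S
    using D\<phi>' that by (intro DERIV_continuous_on) blast
  have cont: "continuous_on S \<phi>" if "S \<subseteq> {a..b}" for S
    using D\<phi> that by (intro DERIV_continuous_on) blast
  have conte2: "continuous_on S e2" if "S \<subseteq> {a..b}" for S
    using D3 that by (intro DERIV_continuous_on[where D = e3]) (blast intro: has_field_derivative_at_within)
  \<comment> \<open>On this piece \<open>e1\<close> increases, so the phase is concave. Its negative
    satisfies the slope condition, and conjugation leaves the modulus of the integral
    unchanged.\<close>
  have I1: "cmod (integral {a..c1} (\<lambda>x. cis (- \<phi> x))) \<le> 18 / sqrt (t * \<mu>)"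
  proof (rule van_der_corput_second)
    fix x y assume xy: "a \<le> x" "x \<le> y" "y \<le> c1"
    have "\<mu> * (y - x) \<le> e1 y - e1 x"
      by (rule slope_ge[where f' = e2]) (use xy c1(1,2) D2 w in auto)
    then have "t * (\<mu> * (y - x)) \<le> t * (e1 y - e1 x)" using \<open>t > 0\<close> by simp
    then show "t * \<mu> * (y - x) \<le> - \<phi>' y - - \<phi>' x" by (simp add: \<phi>'_def algebra_simps)
  next
    show "((\<lambda>x. - \<phi> x) has_real_derivative - \<phi>' x) (at x within {a..c1})" if "x \<in> {a..c1}" for x
      by (rule DERIV_minus, rule D\<phi>) (use that c1(2) in auto)
    show "continuous_on {a..c1} (\<lambda>x. - \<phi>' x)"
      by (rule continuous_on_minus, rule contd) (use c1(2) in auto)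
  qed (use assms(7,8) c1(1) in auto)
  have I3: "cmod (integral {c2..b} (\<lambda>x. cis (\<phi> x))) \<le> 18 / sqrt (t * \<mu>)"
  proof (rule van_der_corput_second)
    fix x y assume xy: "c2 \<le> x" "x \<le> y" "y \<le> b"
    have "\<mu> * (y - x) \<le> (- e1 y) - (- e1 x)"
      by (rule slope_ge[where f' = "\<lambda>s. - e2 s"])
        (use xy c1(1,2) c2(1,2) D2 w'' in \<open>auto intro!: DERIV_minus simp: le_minus_iff\<close>)
    then have "t * (\<mu> * (y - x)) \<le> t * (- e1 y - (- e1 x))" using \<open>t > 0\<close>
      by (simp only: mult_le_cancel_left_pos)
    then show "t * \<mu> * (y - x) \<le> \<phi>' y - \<phi>' x" by (simp add: \<phi>'_def algebra_simps)
  next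
    show "(\<phi> has_real_derivative \<phi>' x) (at x within {c2..b})" if "x \<in> {c2..b}" for x
      by (rule D\<phi>) (use that c1(1) c2(1) in auto)
    show "continuous_on {c2..b} \<phi>'"
      by (rule contd) (use c1(1) c2(1) in auto)
  qed (use assms(7,8) c2(2) in auto)
  have I2: "cmod (integral {c1..c2} (\<lambda>x. cis (\<phi> x))) \<le> 2 * \<mu> / c"
  proof (cases "c1 < c2")
    case True
    have sub: "{c1..c2} \<subseteq> {a..b}" using c1 c2 by auto
    have lo: "e2 s \<le> \<mu>" if "s \<in> {c1..c2}" for s
      by (rule continuous_le_on_Ioo[OF conte2[OF sub] _ True that]) (use w' in auto)
    have hi: "-\<mu> \<le> e2 s" if "s \<in> {c1..c2}" for s
      by (rule continuous_ge_on_Ioo[OF conte2[OF sub] _ True that]) (use w' in auto)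
    have "c * (c2 - c1) \<le> (- e2 c2) - (- e2 c1)"
    proof (rule slope_ge[where f' = "\<lambda>s. - e3 s"])
      show "c \<le> - e3 s" if "c1 < s" "s < c2" for s
        using dich[of s] lo[of s] hi[of s] that sub \<open>\<mu> \<le> \<epsilon>\<close> by force
    qed (use c1(1,2) c2(1,2) D3 in \<open>auto intro!: DERIV_minus\<close>)
    also have "\<dots> \<le> 2 * \<mu>" using lo[of c1] hi[of c2] True by auto
    finally have "c2 - c1 \<le> 2 * \<mu> / c" using \<open>c > 0\<close> by (simp add: field_simps)
    then show ?thesis using norm_integral_cis_le_length[OF _ cont[OF sub]] c2 by force
  qed (use assms c2 in simp)
  have sub: "{a..c1} \<subseteq> {a..b}" "{c1..c2} \<subseteq> {a..b}" "{c2..b} \<subseteq> {a..b}" "{c1..b} \<subseteq> {a..b}"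
    using c1(1,2) c2(1,2) by auto
  have "integral {a..b} (\<lambda>x. cis (\<phi> x)) = integral {a..c1} (\<lambda>x. cis (\<phi> x)) +
     (integral {c1..c2} (\<lambda>x. cis (\<phi> x)) + integral {c2..b} (\<lambda>x. cis (\<phi> x)))"
    using c1(1,2) c2(1,2)
    by (simp add: Henstock_Kurzweil_Integration.integral_combine cis_integrable cont sub)
  also have "cmod \<dots> \<le> 18 / sqrt (t * \<mu>) + (2 * \<mu> / c + 18 / sqrt (t * \<mu>))"
    using I1 I2 I3 by (intro order.trans[OF norm_triangle_ineq] add_mono) (auto simp: integral_cis_uminus)
  finally show ?thesis by (simp add: \<phi>_def)
qed

text \<open>The choice \<mu> = t^(-1/3) balances 1 / sqrt (t \<mu>) against \<mu>. For times so
  small that \<mu> > \<epsilon>, the length of the interval is already a sufficient bound. The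
  result is independent of \<kappa>, which later carries the distance between two sites.\<close>

lemma van_der_corput_inflection:
  fixes e e1 e2 e3 :: "real \<Rightarrow> real"
  assumes D1: "\<And>x. x \<in> {a..b} \<Longrightarrow> (e has_real_derivative e1 x) (at x)"
    and D2: "\<And>x. x \<in> {a..b} \<Longrightarrow> (e1 has_real_derivative e2 x) (at x)"
    and D3: "\<And>x. x \<in> {a..b} \<Longrightarrow> (e2 has_real_derivative e3 x) (at x)"
    and dich: "\<And>x. \<lbrakk>x \<in> {a..b}; \<bar>e2 x\<bar> \<le> \<epsilon>\<rbrakk> \<Longrightarrow> e3 x \<le> - c"
    and "c > 0" "\<epsilon> > 0" "a \<le> b" "t > 0"
  shows "cmod (integral {a..b} (\<lambda>x. cis (\<kappa> * x - t * e x))) \<le> (36 + 2 / c + (b - a) / \<epsilon>) * t powr (-1/3)"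
proof -
  define \<mu> where "\<mu> = t powr (-1/3)"
  have \<mu>: "\<mu> > 0" using \<open>t > 0\<close> by (simp add: \<mu>_def)
  show ?thesis
  proof (cases "\<mu> \<le> \<epsilon>")
    case True
    have "t * \<mu> = (t powr (1/3)) powr 2"
      using \<open>t > 0\<close> powr_add[of t 1 "-1/3"] by (simp add: \<mu>_def powr_powr)
    then have "sqrt (t * \<mu>) = t powr (1/3)" by simp
    then have "36 / sqrt (t * \<mu>) = 36 * \<mu>" by (simp add: \<mu>_def powr_minus_divide)
    then have "cmod (integral {a..b} (\<lambda>x. cis (\<kappa> * x - t * e x))) \<le> 36 * \<mu> + 2 * \<mu> / c"
      using van_der_corput_inflection_large_time[of a b e e1 e2 e3 \<epsilon> c t \<mu> \<kappa>] assms True \<mu> by auto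
    also have "\<dots> \<le> (36 + 2 / c + (b - a) / \<epsilon>) * \<mu>"
      using assms \<mu> by (simp add: algebra_simps)
    finally show ?thesis by (simp add: \<mu>_def)
  next
    case False
    have "continuous_on {a..b} e"
      by (rule DERIV_continuous_on[where D = e1]) (blast intro: has_field_derivative_at_within D1)
    then have "cmod (integral {a..b} (\<lambda>x. cis (\<kappa> * x - t * e x))) \<le> b - a"
      by (intro norm_integral_cis_le_length continuous_intros assms)
    also have "\<dots> = (b - a) / \<epsilon> * \<epsilon>" using assms by simp
    also have "\<dots> \<le> (b - a) / \<epsilon> * \<mu>" using False assms by (intro mult_left_mono) auto
    also have "\<dots> \<le> (36 + 2 / c + (b - a) / \<epsilon>) * \<mu>"
      using assms \<mu> by (intro mult_right_mono) auto
    finally show ?thesis by (simp add: \<mu>_def)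
  qed
qed

text \<open>The second mean value theorem, applied to the real and the imaginary part separately,
  uses only the monotonicity of \<open>g\<close> and its two end values; each part is then at most 2
  M K.\<close>

lemma integral_cis_mono_amplitude:
  fixes \<phi> g :: "real \<Rightarrow> real"
  assumes "a \<le> b" and cont: "continuous_on {a..b} \<phi>"
    and K: "\<And>c d. \<lbrakk>a \<le> c; c \<le> d; d \<le> b\<rbrakk> \<Longrightarrow> cmod (integral {c..d} (\<lambda>x. cis (\<phi> x))) \<le> K"
    and mono: "mono_on {a..b} g" and M: "\<bar>g a\<bar> \<le> M" "\<bar>g b\<bar> \<le> M"
  shows "(\<lambda>x. of_real (g x) * cis (\<phi> x)) integrable_on {a..b}"
    and "cmod (integral {a..b} (\<lambda>x. of_real (g x) * cis (\<phi> x))) \<le> 4 * M * K"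
proof -
  have g: "g x \<le> g y" if "a \<le> x" "x \<le> y" "y \<le> b" for x y
    using mono that by (auto simp: mono_on_def)
  have cont': "continuous_on {c..d} \<phi>" if "a \<le> c" "d \<le> b" for c d
    using continuous_on_subset[OF cont] that by auto
  have bd: "\<bar>integral {c..d} (\<lambda>x. cos (\<phi> x))\<bar> \<le> K" "\<bar>integral {c..d} (\<lambda>x. sin (\<phi> x))\<bar> \<le> K"
    if "a \<le> c" "c \<le> d" "d \<le> b" for c d
    using K[OF that] abs_Re_le_cmod[of "integral {c..d} (\<lambda>x. cis (\<phi> x))"]
      abs_Im_le_cmod[of "integral {c..d} (\<lambda>x. cis (\<phi> x))"] cont'[of c d] that
    by (auto simp: Re_integral_cis)
  have *: "\<exists>I. ((\<lambda>x. g x * h x) has_integral I) {a..b} \<and> \<bar>I\<bar> \<le> 2 * M * K"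
    if h: "continuous_on {a..b} h" "\<And>c d. \<lbrakk>a \<le> c; c \<le> d; d \<le> b\<rbrakk> \<Longrightarrow> \<bar>integral {c..d} h\<bar> \<le> K" for h :: "real \<Rightarrow> real"
  proof -
    obtain c where c: "c \<in> {a..b}" and I: "((\<lambda>x. g x * h x) has_integral
        (g a * integral {a..c} h + g b * integral {c..b} h)) {a..b}"
      using second_mean_value_theorem_full[of h a b g] integrable_continuous_interval[OF h(1)] \<open>a \<le> b\<close> g
      by blast
    have "\<bar>g a * integral {a..c} h + g b * integral {c..b} h\<bar> \<le> M * K + M * K"
      using c M h(2)[of a c] h(2)[of c b]
      by (intro order.trans[OF abs_triangle_ineq] add_mono) (auto simp: abs_mult intro!: mult_mono)
    with I show ?thesis by (intro exI conjI) (auto simp: mult_ac)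
  qed
  have "continuous_on {a..b} (\<lambda>x. cos (\<phi> x))" "continuous_on {a..b} (\<lambda>x. sin (\<phi> x))"
    by (intro continuous_intros cont)+
  from *[OF this(1) bd(1)] *[OF this(2) bd(2)] obtain I J
    where I: "((\<lambda>x. g x * cos (\<phi> x)) has_integral I) {a..b}" "\<bar>I\<bar> \<le> 2 * M * K"
      and J: "((\<lambda>x. g x * sin (\<phi> x)) has_integral J) {a..b}" "\<bar>J\<bar> \<le> 2 * M * K"
    by blast
  have "((\<lambda>x. of_real (g x * cos (\<phi> x)) + \<i> * of_real (g x * sin (\<phi> x))) has_integral (of_real I + \<i> * of_real J)) {a..b}"
    by (intro has_integral_add has_integral_mult_right has_integral_of_real I J)
  moreover have "(\<lambda>x. of_real (g x * cos (\<phi> x)) + \<i> * of_real (g x * sin (\<phi> x))) = (\<lambda>x. of_real (g x) * cis (\<phi> x))"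
    by (auto simp: complex_eq_iff)
  ultimately have "((\<lambda>x. of_real (g x) * cis (\<phi> x)) has_integral (of_real I + \<i> * of_real J)) {a..b}" by simp
  moreover have "cmod (of_real I + \<i> * of_real J) \<le> 4 * M * K"
    using I(2) J(2) by (intro order.trans[OF norm_triangle_ineq]) (simp add: norm_mult)
  ultimately show "(\<lambda>x. of_real (g x) * cis (\<phi> x)) integrable_on {a..b}"
    "cmod (integral {a..b} (\<lambda>x. of_real (g x) * cis (\<phi> x))) \<le> 4 * M * K"
    by (auto simp: integral_unique)
qed

text \<open>Induction on the set of turning points: cutting the interval at one of them at most
  doubles the bound, whence the factor 2 ^ card S. Points of the set outside the interval do no
  harm, which keeps the same set usable on every subinterval.\<close>

lemma integral_cis_piecewise_mono_amplitude:
  fixes \<phi> g :: "real \<Rightarrow> real"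
  assumes "finite S" "a \<le> b" and cont: "continuous_on {a..b} \<phi>"
    and K: "\<And>c d. \<lbrakk>a \<le> c; c \<le> d; d \<le> b\<rbrakk> \<Longrightarrow> cmod (integral {c..d} (\<lambda>x. cis (\<phi> x))) \<le> K"
    and pieces: "\<And>c d. \<lbrakk>a \<le> c; c \<le> d; d \<le> b; S \<inter> {c<..<d} = {}\<rbrakk> \<Longrightarrow> mono_on {c..d} g \<or> antimono_on {c..d} g"
    and M: "\<And>x. x \<in> {a..b} \<Longrightarrow> \<bar>g x\<bar> \<le> M"
  shows "(\<lambda>x. of_real (g x) * cis (\<phi> x)) integrable_on {a..b} \<and>
    cmod (integral {a..b} (\<lambda>x. of_real (g x) * cis (\<phi> x))) \<le> 2 ^ card S * (4 * M * K)"
  using assms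
proof (induction S arbitrary: a b rule: finite_induct)
  case empty
  then consider "mono_on {a..b} g" | "antimono_on {a..b} g" by blast
  then show ?case
  proof cases
    case 1
    then show ?thesis using integral_cis_mono_amplitude[OF empty(1-3) 1, of M] empty(1,5) by simp
  next
    case 2
    then have "mono_on {a..b} (\<lambda>x. - g x)" by (auto simp: monotone_on_def)
    from integral_cis_mono_amplitude[OF empty(1-3) this, of M] empty(1,5) show ?thesis
      by (auto dest: integrable_neg)
  qed
next
  case (insert s S)
  have MK: "4 * M * K \<ge> 0"
    using order.trans[OF abs_ge_zero insert.prems(5)[of a]] order.trans[OF norm_ge_zero insert.prems(3)[of a b]] insert.prems(1)
    by auto
  show ?case
  proof (cases "s \<in> {a<..<b}")
    case False
    have "(\<lambda>x. of_real (g x) * cis (\<phi> x)) integrable_on {a..b} \<and>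
      cmod (integral {a..b} (\<lambda>x. of_real (g x) * cis (\<phi> x))) \<le> 2 ^ card S * (4 * M * K)"
    proof (rule insert.IH)
      show "mono_on {c..d} g \<or> antimono_on {c..d} g"
        if "a \<le> c" "c \<le> d" "d \<le> b" "S \<inter> {c<..<d} = {}" for c d
        using insert.prems(4)[of c d] that False by auto
    qed (use insert.prems in auto)
    moreover have "2 ^ card S * (4 * M * K) \<le> 2 ^ card (insert s S) * (4 * M * K)"
      using insert MK by (intro mult_right_mono) auto
    ultimately show ?thesis by linarith
  next
    case True
    define F where "F = (\<lambda>x. complex_of_real (g x) * cis (\<phi> x))"
    have 1: "F integrable_on {a..s} \<and> cmod (integral {a..s} F) \<le> 2 ^ card S * (4 * M * K)"
      unfolding F_def
    proof (rule insert.IH)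
      show "mono_on {c..d} g \<or> antimono_on {c..d} g"
        if "a \<le> c" "c \<le> d" "d \<le> s" "S \<inter> {c<..<d} = {}" for c d
        using insert.prems(4)[of c d] that True by auto
    qed (use insert.prems True in \<open>auto intro: continuous_on_subset\<close>)
    have 2: "F integrable_on {s..b} \<and> cmod (integral {s..b} F) \<le> 2 ^ card S * (4 * M * K)"
      unfolding F_def
    proof (rule insert.IH)
      show "mono_on {c..d} g \<or> antimono_on {c..d} g"
        if "s \<le> c" "c \<le> d" "d \<le> b" "S \<inter> {c<..<d} = {}" for c d
        using insert.prems(4)[of c d] that True by auto
    qed (use insert.prems True in \<open>auto intro: continuous_on_subset\<close>)
    have F: "F integrable_on {a..b}"
      using Henstock_Kurzweil_Integration.integrable_combine[of a s b F] 1 2 True by auto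
    have "integral {a..b} F = integral {a..s} F + integral {s..b} F"
      using Henstock_Kurzweil_Integration.integral_combine[of a s b F] F True by auto
    also have "cmod \<dots> \<le> 2 ^ card S * (4 * M * K) + 2 ^ card S * (4 * M * K)"
      using 1 2 by (intro order.trans[OF norm_triangle_ineq] add_mono) auto
    also have "\<dots> = 2 ^ card (insert s S) * (4 * M * K)" using insert.hyps by simp
    finally show ?thesis using F by (simp add: F_def)
  qed
qed

section \<open>A boundary Schwarz lemma\<close>

abbreviation upper_half_plane :: "complex set" where
  "upper_half_plane \<equiv> {z. 0 < Im z}"

lemma convex_upper_half_plane: "convex upper_half_plane"
  by (rule convex_halfspace_Im_gt)

text \<open>A Hopf lemma on a half disc. The maximum modulus principle for exp (i (G - (c / R) z))
  compares Im G with the harmonic function (c / R) Im z, which is at most c on the arc. Boundary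
  values on the real axis are replaced by the linear lower bound \<open>flat\<close>: the domain is
  cut at height \<epsilon>, where \<open>flat\<close> costs a multiple of \<epsilon>, and then
  \<epsilon> tends to 0.\<close>

lemma hopf_half_disc:
  fixes G :: "complex \<Rightarrow> complex" and \<xi> :: real
  assumes hol: "G holomorphic_on upper_half_plane" and "R > 0" "c \<ge> 0" "B \<ge> 0" "eb > 0"
    and flat: "\<And>z. \<lbrakk>0 < Im z; Im z < eb; cmod (z - of_real \<xi>) \<le> R\<rbrakk> \<Longrightarrow> - B * Im z \<le> Im (G z)"
    and arc: "\<And>z. \<lbrakk>0 < Im z; cmod (z - of_real \<xi>) = R\<rbrakk> \<Longrightarrow> c \<le> Im (G z)"
    and z: "0 < Im z" "cmod (z - of_real \<xi>) < R"
  shows "c / R * Im z \<le> Im (G z)"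
proof -
  have step: "c / R * Im z - (B + c / R) * \<epsilon> \<le> Im (G z)" if \<epsilon>: "0 < \<epsilon>" "\<epsilon> < eb" "\<epsilon> < Im z" for \<epsilon>
  proof -
    define S where "S = {\<zeta>. \<epsilon> < Im \<zeta>} \<inter> ball (of_real \<xi>) R"
    define F where "F \<zeta> = exp (\<i> * (G \<zeta> - of_real (c / R) * \<zeta>))" for \<zeta>
    have nF: "cmod (F \<zeta>) = exp (c / R * Im \<zeta> - Im (G \<zeta>))" for \<zeta>
      by (simp add: F_def)
    have "open S" unfolding S_def by (intro open_Int open_halfspace_Im_gt open_ball)
    have "closed ({\<zeta>. \<epsilon> \<le> Im \<zeta>} \<inter> cball (of_real \<xi>) R)"
      by (intro closed_Int closed_halfspace_Im_ge closed_cball)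
    then have cl: "closure S \<subseteq> {\<zeta>. \<epsilon> \<le> Im \<zeta>} \<inter> cball (of_real \<xi>) R"
      by (rule closure_minimal[rotated]) (auto simp: S_def)
    have sub: "closure S \<subseteq> upper_half_plane" using cl \<epsilon> by auto
    have holF: "F holomorphic_on upper_half_plane"
      unfolding F_def by (intro holomorphic_intros hol)
    have "cmod (F z) \<le> exp ((B + c / R) * \<epsilon>)"
    proof (rule maximum_modulus_frontier[of F S])
      show "F holomorphic_on interior S"
        by (rule holomorphic_on_subset[OF holF]) (use sub interior_subset closure_subset in blast)
      show "continuous_on (closure S) F"
        using holF sub holomorphic_on_imp_continuous_on continuous_on_subset by blast
      show "bounded S" unfolding S_def by (simp add: bounded_Int)
      show "z \<in> S" using z \<epsilon> by (simp add: S_def dist_norm norm_minus_commute)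
      fix \<zeta> assume "\<zeta> \<in> frontier S"
      then have \<zeta>: "\<epsilon> \<le> Im \<zeta>" "cmod (\<zeta> - of_real \<xi>) \<le> R" "\<zeta> \<notin> S"
        using cl \<open>open S\<close> by (auto simp: frontier_def interior_open dist_norm norm_minus_commute)
      show "cmod (F \<zeta>) \<le> exp ((B + c / R) * \<epsilon>)"
      proof (cases "cmod (\<zeta> - of_real \<xi>) = R")
        case True
        have "Im \<zeta> \<le> R" using True abs_Im_le_cmod[of "\<zeta> - of_real \<xi>"] by simp
        then have "c / R * Im \<zeta> \<le> c / R * R" using assms by (intro mult_left_mono) auto
        then have "c / R * Im \<zeta> \<le> c" using \<open>R > 0\<close> by simp
        also have "c \<le> Im (G \<zeta>)" using arc True \<zeta> \<epsilon> by simp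
        finally have "c / R * Im \<zeta> - Im (G \<zeta>) \<le> 0" by simp
        also have "0 \<le> (B + c / R) * \<epsilon>" using assms \<epsilon> by simp
        finally show ?thesis by (simp add: nF)
      next
        case False
        then have I: "Im \<zeta> = \<epsilon>" using \<zeta> by (auto simp: S_def dist_norm norm_minus_commute)
        then have "- B * \<epsilon> \<le> Im (G \<zeta>)" using flat[of \<zeta>] \<zeta> \<epsilon> by simp
        then show ?thesis by (simp add: nF I algebra_simps)
      qed
    qed
    then have "c / R * Im z - Im (G z) \<le> (B + c / R) * \<epsilon>" by (simp add: nF)
    then show ?thesis by linarith
  qed
  have "((\<lambda>\<epsilon>. c / R * Im z - (B + c / R) * \<epsilon>) \<longlongrightarrow> c / R * Im z - (B + c / R) * 0) (at_right 0)"
    by (intro tendsto_intros)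
  moreover have "eventually (\<lambda>\<epsilon>. c / R * Im z - (B + c / R) * \<epsilon> \<le> Im (G z)) (at_right 0)"
  proof -
    have "0 < min eb (Im z)" using \<open>eb > 0\<close> z by simp
    from eventually_at_right_real[OF this] show ?thesis
      by eventually_elim (rule step, auto)
  qed
  ultimately show ?thesis
    using tendsto_upperbound[of _ "c / R * Im z - (B + c / R) * 0" "at_right (0::real)"] by force
qed

text \<open>Since \<open>H\<close> is real on the axis, Im (H z) is at most the variation of
  \<open>H\<close> along the vertical segment from Re z to z, and the derivative of \<open>H\<close>
  is bounded on a smaller disc.\<close>

lemma Im_bound_near_real_axis:
  fixes H :: "complex \<Rightarrow> complex" and \<xi> :: real
  assumes hol: "H holomorphic_on ball (of_real \<xi>) r" and "r > 0"
    and real: "\<And>x::real. \<bar>x - \<xi>\<bar> < r \<Longrightarrow> Im (H (of_real x)) = 0"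
  obtains r' L where "0 < r'" "r' < r" "0 \<le> L"
    "\<And>z. cmod (z - of_real \<xi>) < r' \<Longrightarrow> \<bar>Im (H z)\<bar> \<le> L * \<bar>Im z\<bar>"
proof -
  have sub: "cball (complex_of_real \<xi>) (r/2) \<subseteq> ball (of_real \<xi>) r" using \<open>r > 0\<close> by auto
  have "continuous_on (cball (of_real \<xi>) (r/2)) (deriv H)"
    using holomorphic_on_subset[OF holomorphic_deriv[OF hol open_ball] sub]
    by (rule holomorphic_on_imp_continuous_on)
  then have "bounded (deriv H ` cball (of_real \<xi>) (r/2))"
    using compact_continuous_image[OF _ compact_cball] compact_imp_bounded by blast
  then obtain L where L: "L > 0" "\<And>z. z \<in> cball (of_real \<xi>) (r/2) \<Longrightarrow> cmod (deriv H z) \<le> L"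
    unfolding bounded_pos by auto
  have "\<bar>Im (H z)\<bar> \<le> L * \<bar>Im z\<bar>" if z: "cmod (z - of_real \<xi>) < r/2" for z
  proof -
    have rz: "\<bar>Re z - \<xi>\<bar> < r/2" using abs_Re_le_cmod[of "z - of_real \<xi>"] z by simp
    have "cmod (H z - H (of_real (Re z))) \<le> L * cmod (z - of_real (Re z))"
    proof (rule field_differentiable_bound[of "cball (of_real \<xi>) (r/2)" H "deriv H"])
      fix w assume w: "w \<in> cball (complex_of_real \<xi>) (r/2)"
      show "(H has_field_derivative deriv H w) (at w within cball (of_real \<xi>) (r/2))"
        using holomorphic_derivI[OF hol open_ball, of w] w sub
        by (blast intro: has_field_derivative_at_within)
    next
      show "complex_of_real (Re z) \<in> cball (of_real \<xi>) (r/2)"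
        using rz by (simp add: dist_norm abs_minus_commute flip: of_real_diff)
    qed (use z L in \<open>auto simp: dist_norm norm_minus_commute\<close>)
    moreover have "cmod (z - of_real (Re z)) = \<bar>Im z\<bar>" by (simp add: cmod_def)
    moreover have "Im (H (of_real (Re z))) = 0" using real[of "Re z"] rz \<open>r > 0\<close> by simp
    ultimately show ?thesis using abs_Im_le_cmod[of "H z - H (of_real (Re z))"] by simp
  qed
  then show ?thesis using that[of "r/2" L] \<open>r > 0\<close> L by auto
qed

text \<open>For a vertical approach the difference quotient has denominator i y, and dividing by i
  turns the imaginary part of \<open>H\<close> into a real part.\<close>

lemma Re_deriv_eq_vertical_limit:
  fixes H :: "complex \<Rightarrow> complex" and \<xi> :: real
  assumes "(H has_field_derivative D) (at (of_real \<xi>))" "Im (H (of_real \<xi>)) = 0"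
  shows "((\<lambda>y. Im (H (Complex \<xi> y)) / y) \<longlongrightarrow> Re D) (at_right 0)"
proof -
  have *: "((\<lambda>w. (H w - H (of_real \<xi>)) / (w - of_real \<xi>)) \<longlongrightarrow> D) (at (of_real \<xi>))"
    using assms(1) by (simp add: has_field_derivative_iff)
  have "filterlim (\<lambda>y. Complex \<xi> y) (at (of_real \<xi>)) (at_right 0)"
  proof (rule filterlim_atI)
    have "((\<lambda>y. of_real \<xi> + \<i> * of_real y) \<longlongrightarrow> of_real \<xi> + \<i> * of_real 0) (at_right 0)"
      by (intro tendsto_intros)
    then show "((\<lambda>y. Complex \<xi> y) \<longlongrightarrow> of_real \<xi>) (at_right 0)" by (simp add: Complex_eq)
    show "\<forall>\<^sub>F y in at_right 0. Complex \<xi> y \<noteq> of_real \<xi>"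
      using eventually_at_right_less[of "0::real"] by eventually_elim (auto simp: complex_eq_iff)
  qed
  from tendsto_Re[OF filterlim_compose[OF * this]]
  have "((\<lambda>y. Re ((H (Complex \<xi> y) - H (of_real \<xi>)) / (Complex \<xi> y - of_real \<xi>))) \<longlongrightarrow> Re D) (at_right 0)" .
  moreover have "\<forall>\<^sub>F y in at_right 0. Re ((H (Complex \<xi> y) - H (of_real \<xi>)) / (Complex \<xi> y - of_real \<xi>))
      = Im (H (Complex \<xi> y)) / y"
    using eventually_at_right_less[of "0::real"]
  proof eventually_elim
    case (elim y)
    have "Complex \<xi> y - of_real \<xi> = \<i> * of_real y" by (simp add: complex_eq_iff)
    then show ?case using elim assms(2) by (simp add: Re_divide power2_eq_square)
  qed
  ultimately show ?thesis by (rule Lim_transform_eventually)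
qed

lemma le_Re_deriv_of_vertical_bound:
  fixes H :: "complex \<Rightarrow> complex" and \<xi> :: real
  assumes "(H has_field_derivative D) (at (of_real \<xi>))" "Im (H (of_real \<xi>)) = 0" "\<eta> > 0"
    and le: "\<And>y. \<lbrakk>0 < y; y < \<eta>\<rbrakk> \<Longrightarrow> k * y \<le> Im (H (Complex \<xi> y))"
  shows "k \<le> Re D"
proof (rule tendsto_lowerbound[OF Re_deriv_eq_vertical_limit[OF assms(1,2)]])
  show "\<forall>\<^sub>F y in at_right 0. k \<le> Im (H (Complex \<xi> y)) / y"
    using eventually_at_right_real[OF \<open>\<eta> > 0\<close>]
    by eventually_elim (use le in \<open>auto simp: field_simps\<close>)
qed simp

text \<open>The Taylor coefficients of \<open>h\<close> at p are those of \<open>H\<close> shifted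
  by one place, which accounts for the factors 2 and 3. Applied twice, the construction strips off
  the value and the first derivative of \<open>H\<close>.\<close>

lemma divided_difference:
  fixes H :: "complex \<Rightarrow> complex"
  assumes hol: "H holomorphic_on ball p r" and "r > 0"
  obtains h where "h holomorphic_on ball p r" "h p = deriv H p"
    "\<And>z. z \<in> ball p r \<Longrightarrow> H z = H p + (z - p) * h z"
    "deriv (deriv H) p = 2 * deriv h p"
    "deriv (deriv (deriv H)) p = 3 * deriv (deriv h) p"
proof -
  define h where "h z = (if z = p then deriv H p else (H z - H p) / (z - p))" for z
  have holh: "h holomorphic_on ball p r"
    unfolding h_def by (rule pole_lemma_open[OF hol open_ball])
  have eq: "H z = H p + (z - p) * h z" for z by (simp add: h_def)
  have d1: "deriv H z = h z + (z - p) * deriv h z" if "z \<in> ball p r" for z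
  proof -
    have "((\<lambda>z. H p + (z - p) * h z) has_field_derivative h z + (z - p) * deriv h z) (at z)"
      by (rule DERIV_cong[OF DERIV_add[OF DERIV_const DERIV_mult[OF DERIV_diff[OF DERIV_ident DERIV_const]
          holomorphic_derivI[OF holh open_ball that]]]]) simp
    moreover have "(\<lambda>z. H p + (z - p) * h z) = H" by (rule ext) (rule eq[symmetric])
    ultimately show ?thesis by (simp add: DERIV_imp_deriv)
  qed
  have hol1: "deriv h holomorphic_on ball p r" by (rule holomorphic_deriv[OF holh open_ball])
  have hol2: "deriv (deriv h) holomorphic_on ball p r" by (rule holomorphic_deriv[OF hol1 open_ball])
  have d2: "deriv (deriv H) z = 2 * deriv h z + (z - p) * deriv (deriv h) z" if z: "z \<in> ball p r" for z
  proof -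
    have "((\<lambda>z. h z + (z - p) * deriv h z) has_field_derivative 2 * deriv h z + (z - p) * deriv (deriv h) z) (at z)"
      by (rule DERIV_cong[OF DERIV_add[OF holomorphic_derivI[OF holh open_ball z] DERIV_mult[OF DERIV_diff[OF DERIV_ident DERIV_const]
          holomorphic_derivI[OF hol1 open_ball z]]]]) simp
    from has_field_derivative_transform_within_open[OF this open_ball z, of "deriv H"] d1
    show ?thesis by (simp add: DERIV_imp_deriv)
  qed
  have "deriv (deriv (deriv H)) p = 3 * deriv (deriv h) p"
  proof -
    have p: "p \<in> ball p r" using \<open>r > 0\<close> by simp
    have "((\<lambda>z. 2 * deriv h z + (z - p) * deriv (deriv h) z) has_field_derivative 3 * deriv (deriv h) p) (at p)"
      by (rule DERIV_cong[OF DERIV_add[OF DERIV_cmult[OF holomorphic_derivI[OF hol1 open_ball p]]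
          DERIV_mult[OF DERIV_diff[OF DERIV_ident DERIV_const]
          holomorphic_derivI[OF hol2 open_ball p]]]]) simp
    from has_field_derivative_transform_within_open[OF this open_ball p, of "deriv (deriv H)"] d2
    show ?thesis by (simp add: DERIV_imp_deriv)
  qed
  moreover have "deriv (deriv H) p = 2 * deriv h p" using d2[of p] \<open>r > 0\<close> by simp
  moreover have "h p = deriv H p" by (simp add: h_def)
  ultimately show ?thesis using that[OF holh] eq by blast
qed

text \<open>The Hopf lemma for \<theta> itself, whose imaginary part is positive, gives Im \<theta>
  \<ge> (m / R) Im z above \<xi>, and the vertical growth rate of Im \<tau> at \<xi> is the real
  derivative a. This keeps the slope of the quasi-momentum away from zero.\<close>

lemma boundary_deriv_ge:
  fixes \<theta> \<tau> :: "complex \<Rightarrow> complex" and \<xi> r R m a :: real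
  assumes hol\<theta>: "\<theta> holomorphic_on upper_half_plane" and Im\<theta>: "\<And>z. 0 < Im z \<Longrightarrow> 0 < Im (\<theta> z)"
    and hol\<tau>: "\<tau> holomorphic_on ball (of_real \<xi>) r" and "r > 0"
    and real: "\<And>x::real. \<bar>x - \<xi>\<bar> < r \<Longrightarrow> Im (\<tau> (of_real x)) = 0"
    and match: "\<And>z. \<lbrakk>z \<in> ball (of_real \<xi>) r; 0 < Im z\<rbrakk> \<Longrightarrow> \<theta> z = \<tau> z"
    and \<tau>1: "deriv \<tau> (of_real \<xi>) = of_real a" and "R > 0" "m \<ge> 0"
    and arc: "\<And>z. \<lbrakk>0 < Im z; cmod (z - of_real \<xi>) = R\<rbrakk> \<Longrightarrow> m \<le> Im (\<theta> z)"
  shows "m / R \<le> a"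
proof -
  have "m / R * y \<le> Im (\<tau> (Complex \<xi> y))" if y: "0 < y" "y < min r R" for y
  proof -
    have e: "cmod (Complex \<xi> y - of_real \<xi>) = y" using y by (simp add: cmod_def complex_of_real_def)
    have "m / R * Im (Complex \<xi> y) \<le> Im (\<theta> (Complex \<xi> y))"
      by (rule hopf_half_disc[where B = 0 and eb = 1 and \<xi> = \<xi>])
         (use assms e y Im\<theta> in \<open>auto intro: less_imp_le\<close>)
    then show ?thesis using match[of "Complex \<xi> y"] e y by (simp add: dist_norm norm_minus_commute)
  qed
  moreover have "(\<tau> has_field_derivative of_real a) (at (of_real \<xi>))"
    using holomorphic_derivI[OF hol\<tau> open_ball, of "of_real \<xi>"] \<open>r > 0\<close> \<tau>1 by simp
  ultimately have "m / R \<le> Re (of_real a)"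
    using real[of \<xi>] \<open>r > 0\<close> \<open>R > 0\<close>
    by (intro le_Re_deriv_of_vertical_bound[where \<eta> = "min r R" and H = \<tau> and \<xi> = \<xi>]) auto
  then show ?thesis by simp
qed

text \<open>Removing from the Nevanlinna function \<open>- 1 / (\<theta> - \<theta>0)\<close> its point mass at \<open>\<xi>\<close> leaves a
  function with non-negative imaginary part, whose derivative at \<open>\<xi>\<close> is a sixth of
  \<open>1 / \<tau>'\<close> times the Schwarzian derivative of \<open>\<tau>\<close>.\<close>

lemma boundary_schwarzian_ge:
  fixes \<theta> \<tau> :: "complex \<Rightarrow> complex" and \<xi> r R m a b c :: real
  assumes hol\<theta>: "\<theta> holomorphic_on upper_half_plane" and Im\<theta>: "\<And>z. 0 < Im z \<Longrightarrow> 0 < Im (\<theta> z)"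
    and hol\<tau>: "\<tau> holomorphic_on ball (of_real \<xi>) r" and "r > 0"
    and real: "\<And>x::real. \<bar>x - \<xi>\<bar> < r \<Longrightarrow> Im (\<tau> (of_real x)) = 0"
    and match: "\<And>z. \<lbrakk>z \<in> ball (of_real \<xi>) r; 0 < Im z\<rbrakk> \<Longrightarrow> \<theta> z = \<tau> z"
    and \<tau>1: "deriv \<tau> (of_real \<xi>) = of_real a" and \<tau>2: "deriv (deriv \<tau>) (of_real \<xi>) = of_real b"
    and \<tau>3: "deriv (deriv (deriv \<tau>)) (of_real \<xi>) = of_real c"
    and "a > 0" "R > 0" "k \<ge> 0"
    and arc: "\<And>z. \<lbrakk>0 < Im z; cmod (z - of_real \<xi>) = R\<rbrakk> \<Longrightarrow>
        k + 1 / (a * R) \<le> Im (\<theta> z) / (cmod (\<theta> z - \<tau> (of_real \<xi>)))\<^sup>2"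
  shows "k / R * a ^ 3 \<le> a * c / 6 - b\<^sup>2 / 4"
proof -
  define p where "p = complex_of_real \<xi>"
  obtain h where h: "h holomorphic_on ball p r" "h p = of_real a"
    "\<And>z. z \<in> ball p r \<Longrightarrow> \<tau> z = \<tau> p + (z - p) * h z" "of_real b = 2 * deriv h p"
    "of_real c = 3 * deriv (deriv h) p"
    using divided_difference[OF hol\<tau> \<open>r > 0\<close>] \<tau>1 \<tau>2 \<tau>3 unfolding p_def by metis
  obtain h1 where h1: "h1 holomorphic_on ball p r" "h1 p = deriv h p"
    "\<And>z. z \<in> ball p r \<Longrightarrow> h z = h p + (z - p) * h1 z" "deriv (deriv h) p = 2 * deriv h1 p"
    using divided_difference[OF h(1) \<open>r > 0\<close>] by metis
  have pr: "p \<in> ball p r" using \<open>r > 0\<close> by simp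
  have "isCont h p" using holomorphic_on_imp_continuous_on[OF h(1)] pr open_ball
    by (simp add: continuous_on_eq_continuous_at)
  then have "\<exists>d>0. \<forall>z. dist p z < d \<longrightarrow> h z \<noteq> 0"
    using continuous_at_avoid[of p h 0] h(2) \<open>a > 0\<close> by force
  then obtain d where d: "d > 0" "\<And>z. z \<in> ball p d \<Longrightarrow> h z \<noteq> 0" by auto
  define s where "s = min r d"
  have s: "s > 0" "ball p s \<subseteq> ball p r" "\<And>z. z \<in> ball p s \<Longrightarrow> h z \<noteq> 0"
    using d \<open>r > 0\<close> by (auto simp: s_def)
  define H where "H z = h1 z / (of_real a * h z)" for z
  have holH: "H holomorphic_on ball p s"
    unfolding H_def using s \<open>a > 0\<close>
    by (intro holomorphic_intros holomorphic_on_subset[OF h(1)] holomorphic_on_subset[OF h1(1)]) auto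
  \<comment> \<open>Near p the function - 1 / (\<theta> - \<tau> p) has the singular part - 1 / (a
    (z - p)). The second summand cancels it and leaves \<open>H\<close>, which is holomorphic and
    real across the axis.\<close>
  define G where "G z = - 1 / (\<theta> z - \<tau> p) + 1 / (of_real a * (z - p))" for z
  have Im\<tau>p: "Im (\<tau> p) = 0" using real[of \<xi>] \<open>r > 0\<close> by (simp add: p_def)
  have holG: "G holomorphic_on upper_half_plane"
    unfolding G_def using Im\<theta> Im\<tau>p \<open>a > 0\<close>
    by (intro holomorphic_intros hol\<theta>) (fastforce simp: p_def complex_eq_iff)+
  have GH: "G z = H z" if z: "z \<in> ball p s" "0 < Im z" for z
  proof -
    have zp: "z \<noteq> p" using z by (auto simp: p_def)
    have zr: "z \<in> ball p r" using z s by auto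
    have "\<theta> z - \<tau> p = (z - p) * h z" using match[of z] z zr h(3)[of z] by (simp add: p_def)
    then have "G z = - 1 / ((z - p) * h z) + 1 / (of_real a * (z - p))" by (simp add: G_def)
    also have "\<dots> = (h z - of_real a) / (of_real a * h z * (z - p))"
      using zp s(3)[OF z(1)] \<open>a > 0\<close> by (simp add: divide_simps) (simp add: algebra_simps)?
    also have "h z - of_real a = (z - p) * h1 z" using h1(3)[OF zr] h(2) by simp
    finally show ?thesis using zp by (simp add: H_def)
  qed
  have realH: "Im (H (of_real x)) = 0" if x: "\<bar>x - \<xi>\<bar> < s" for x :: real
  proof -
    have xs: "complex_of_real x \<in> ball p s"
      using x by (simp add: p_def dist_norm norm_minus_commute flip: of_real_diff)
    then have xr: "complex_of_real x \<in> ball p r" using s by auto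
    have "H (of_real x) \<in> \<real>"
    proof (cases "x = \<xi>")
      case True
      have "h1 p = of_real (b / 2)" using h1(2) h(4) by simp
      show ?thesis unfolding H_def True p_def[symmetric] h(2) \<open>h1 p = of_real (b / 2)\<close>
        by (intro Reals_divide Reals_mult Reals_of_real)
    next
      case False
      then have ne: "complex_of_real x - p = of_real (x - \<xi>)" "complex_of_real x - p \<noteq> 0"
        by (auto simp: p_def)
      have "\<tau> (of_real x) \<in> \<real>" "\<tau> p \<in> \<real>"
        using real[of x] x s Im\<tau>p by (auto simp: complex_is_Real_iff s_def)
      moreover have "h (of_real x) = (\<tau> (of_real x) - \<tau> p) / of_real (x - \<xi>)"
        using h(3)[OF xr] ne by (simp add: field_simps)
      ultimately have hR: "h (of_real x) \<in> \<real>" by auto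
      have "h1 (of_real x) = (h (of_real x) - of_real a) / of_real (x - \<xi>)"
        using h1(3)[OF xr] h(2) ne by (simp add: field_simps)
      then have "h1 (of_real x) \<in> \<real>" using hR by auto
      then show ?thesis using hR by (simp add: H_def)
    qed
    then show ?thesis by (simp add: complex_is_Real_iff)
  qed
  obtain s' L where L: "0 < s'" "s' < s" "0 \<le> L"
    "\<And>z. cmod (z - of_real \<xi>) < s' \<Longrightarrow> \<bar>Im (H z)\<bar> \<le> L * \<bar>Im z\<bar>"
    using Im_bound_near_real_axis[of H \<xi> s] holH s realH by (metis p_def)
  have ImG: "Im (G z) = Im (\<theta> z) / (cmod (\<theta> z - \<tau> p))\<^sup>2 - Im z / (a * (cmod (z - p))\<^sup>2)" for z
  proof -
    have "Im (- 1 / (\<theta> z - \<tau> p)) = Im (\<theta> z) / (cmod (\<theta> z - \<tau> p))\<^sup>2"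
      by (simp add: Im_divide cmod_power2 Im\<tau>p)
    moreover have "Im (1 / (of_real a * (z - p))) = - Im z / (a * (cmod (z - p))\<^sup>2)"
    proof -
      have "1 / (of_real a * (z - p)) = of_real (1 / a) * (1 / (z - p))" by simp
      also have "Im \<dots> = 1 / a * Im (1 / (z - p))" by (simp only: Im_complex_of_real Re_complex_of_real times_complex.sel)
      also have "Im (1 / (z - p)) = - Im z / (cmod (z - p))\<^sup>2" by (simp add: Im_divide cmod_power2 p_def)
      finally show ?thesis by simp
    qed
    ultimately show ?thesis by (simp add: G_def)
  qed
  \<comment> \<open>Close to \<xi> the function \<open>G\<close> equals \<open>H\<close> and is
    controlled by \<open>L\<close>. At distance at least s' from \<xi> only the removed pole can
    contribute negatively, by at most Im z / (a s'^2).\<close>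
  define B where "B = L + 1 / (a * s'\<^sup>2)"
  have hopf: "k / R * Im z \<le> Im (G z)" if z: "0 < Im z" "cmod (z - of_real \<xi>) < R" for z
  proof (rule hopf_half_disc[where B = B and eb = 1 and \<xi> = \<xi>])
    fix z assume z: "0 < Im z" "Im z < 1" "cmod (z - of_real \<xi>) \<le> R"
    show "- B * Im z \<le> Im (G z)"
    proof (cases "cmod (z - of_real \<xi>) < s'")
      case True
      have "z \<in> ball p s" using True L by (simp add: p_def dist_norm norm_minus_commute)
      then have "Im (G z) = Im (H z)" using GH z by simp
      moreover have "- (L * Im z) \<le> Im (H z)" using L(4)[OF True] z by simp
      moreover have "L * Im z \<le> B * Im z" using z \<open>a > 0\<close> by (intro mult_right_mono) (auto simp: B_def)
      ultimately show ?thesis by simp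
    next
      case False
      have "Im z / (a * (cmod (z - p))\<^sup>2) \<le> Im z / (a * s'\<^sup>2)"
        using False z L \<open>a > 0\<close> by (intro divide_left_mono mult_left_mono power_mono mult_pos_pos) (auto simp: p_def)
      also have "\<dots> \<le> B * Im z" using z L by (simp add: B_def algebra_simps)
      finally have "Im z / (a * (cmod (z - p))\<^sup>2) \<le> B * Im z" .
      moreover have "0 \<le> Im (\<theta> z) / (cmod (\<theta> z - \<tau> p))\<^sup>2" using Im\<theta>[of z] z by simp
      ultimately show ?thesis by (simp add: ImG)
    qed
  next
    fix z assume z: "0 < Im z" "cmod (z - of_real \<xi>) = R"
    \<comment> \<open>On the arc the removed pole costs at most 1 / (a R), exactly the surplus over
      k that the hypothesis \<open>arc\<close> provides.\<close>
    have "Im z \<le> R" using z abs_Im_le_cmod[of "z - of_real \<xi>"] by simp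
    then have "Im z / (a * R\<^sup>2) \<le> R / (a * R\<^sup>2)"
      using \<open>a > 0\<close> \<open>R > 0\<close> by (intro divide_right_mono) auto
    also have "\<dots> = 1 / (a * R)" using \<open>R > 0\<close> by (simp add: power2_eq_square)
    finally show "k \<le> Im (G z)" using arc[OF z] z by (simp add: ImG p_def)
  qed (use assms holG z L in \<open>auto simp: B_def\<close>)
  \<comment> \<open>Put w = z - p. From \<tau> = \<tau> p + a w + (b/2) w^2 + (c/6) w^3 + ... one
    reads off h = a + (b/2) w + ... and h1 = b/2 + (c/6) w + ..., and the quotient rule for h1 / (a
    h) yields the Schwarzian expression.\<close>
  have dH: "(H has_field_derivative of_real ((a * c / 6 - b\<^sup>2 / 4) / a ^ 3)) (at p)"
  proof -
    have dh: "(h has_field_derivative of_real (b/2)) (at p)"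
      using holomorphic_derivI[OF h(1) open_ball pr] h(4) by simp
    have dh1: "(h1 has_field_derivative of_real (c/6)) (at p)"
      using holomorphic_derivI[OF h1(1) open_ball pr] h(5) h1(4) by simp
    have h1p: "h1 p = of_real (b/2)" using h1(2) h(4) by simp
    have "(H has_field_derivative (of_real (c/6) * (of_real a * h p) - h1 p * (of_real a * of_real (b/2))) /
        ((of_real a * h p) * (of_real a * h p))) (at p)"
      unfolding H_def by (rule DERIV_divide[OF dh1 DERIV_cmult[OF dh]]) (use h(2) \<open>a > 0\<close> in simp)
    also have "(of_real (c/6) * (of_real a * h p) - h1 p * (of_real a * of_real (b/2))) /
        ((of_real a * h p) * (of_real a * h p)) =
        complex_of_real ((c/6 * (a * a) - b/2 * (a * (b/2))) / ((a * a) * (a * a)))"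
      unfolding h(2) h1p by simp
    also have "(c/6 * (a * a) - b/2 * (a * (b/2))) / ((a * a) * (a * a)) = (a * c / 6 - b\<^sup>2 / 4) / a ^ 3"
      using \<open>a > 0\<close> by (simp add: field_simps power2_eq_square power3_eq_cube)
    finally show ?thesis .
  qed
  have "k / R \<le> Re (of_real ((a * c / 6 - b\<^sup>2 / 4) / a ^ 3))"
  proof (rule le_Re_deriv_of_vertical_bound[where \<eta> = "min s R" and H = H and \<xi> = \<xi>])
    fix y assume y: "0 < y" "y < min s R"
    have e: "cmod (Complex \<xi> y - of_real \<xi>) = y" using y by (simp add: cmod_def complex_of_real_def)
    then have "Complex \<xi> y \<in> ball p s" using y by (simp add: p_def dist_norm norm_minus_commute)
    then show "k / R * y \<le> Im (H (Complex \<xi> y))"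
      using hopf[of "Complex \<xi> y"] GH[of "Complex \<xi> y"] e y by simp
  qed (use dH realH[of \<xi>] s \<open>R > 0\<close> in \<open>auto simp: p_def\<close>)
  then have "k / R \<le> (a * c / 6 - b\<^sup>2 / 4) / a ^ 3" by simp
  then show ?thesis using \<open>a > 0\<close> by (simp add: pos_le_divide_eq)
qed

section \<open>Spectral bands\<close>

abbreviation cpoly :: "real poly \<Rightarrow> complex \<Rightarrow> complex" where
  "cpoly q \<equiv> poly (map_poly complex_of_real q)"

lemma cpoly_of_real [simp]: "cpoly q (of_real x) = of_real (poly q x)"
  by (induct q) (auto simp: map_poly_pCons)

lemma cpoly_pCons [simp]: "cpoly (pCons a q) z = of_real a + z * cpoly q z"
  by (simp add: map_poly_pCons)

lemma map_poly_of_real_mult: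
  "map_poly complex_of_real (p * q) = map_poly of_real p * map_poly of_real q"
  by (simp add: poly_eq_iff coeff_map_poly coeff_mult)

lemma cpoly_mult [simp]: "cpoly (p * q) z = cpoly p z * cpoly q z"
  by (simp add: map_poly_of_real_mult)

lemma cpoly_diff [simp]: "cpoly (p - q) z = cpoly p z - cpoly q z"
proof -
  have "map_poly complex_of_real (p - q) = map_poly of_real p - map_poly of_real q"
    by (simp add: poly_eq_iff coeff_map_poly)
  then show ?thesis by simp
qed

lemma map_poly_of_real_add:
  "map_poly complex_of_real (p + q) = map_poly of_real p + map_poly of_real q"
  by (simp add: poly_eq_iff coeff_map_poly)

lemma cpoly_smult [simp]: "cpoly (smult c p) z = of_real c * cpoly p z"
proof -
  have "map_poly complex_of_real (smult c p) = smult (of_real c) (map_poly of_real p)"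
    by (simp add: poly_eq_iff coeff_map_poly)
  then show ?thesis by simp
qed

lemma DERIV_cpoly [derivative_intros]:
  "(cpoly q has_field_derivative cpoly (pderiv q) z) (at z)"
proof -
  have "pderiv (map_poly complex_of_real q) = map_poly of_real (pderiv q)"
    by (simp add: poly_eq_iff coeff_map_poly coeff_pderiv)
  then show ?thesis using poly_DERIV[of "map_poly complex_of_real q" z] by simp
qed

lemma real_rooted_splits:
  fixes q :: "real poly"
  assumes "q \<noteq> 0" "\<And>z. cpoly q z = 0 \<Longrightarrow> Im z = 0"
  shows "\<exists>rs. q = smult (lead_coeff q) (\<Prod>r\<leftarrow>rs. [:- r, 1:])"
  using assms
proof (induction "degree q" arbitrary: q)
  case 0
  then obtain c where "q = [:c:]" using degree_eq_zeroE by metis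
  then show ?case by (intro exI[of _ "[]"]) simp
next
  case (Suc n)
  have "\<not> constant (poly (map_poly complex_of_real q))"
    using Suc(2) by (simp add: constant_degree degree_map_poly)
  then obtain z where z: "cpoly q z = 0" using fundamental_theorem_of_algebra by blast
  then have "z = of_real (Re z)" using Suc.prems(2) by (simp add: complex_eq_iff)
  then have "poly q (Re z) = 0" using z by (metis cpoly_of_real of_real_eq_0_iff)
  then obtain q' where q': "q = [:- Re z, 1:] * q'" by (auto simp: poly_eq_0_iff_dvd)
  have q'0: "q' \<noteq> 0" using q' Suc.prems by auto
  have "\<exists>rs. q' = smult (lead_coeff q') (\<Prod>r\<leftarrow>rs. [:- r, 1:])"
  proof (rule Suc.hyps(1))
    have "degree q = Suc (degree q')"
      unfolding q' using q'0 by (subst degree_mult_eq) auto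
    then show "n = degree q'" using Suc(2) by simp
    show "Im w = 0" if "cpoly q' w = 0" for w
      using Suc.prems(2)[of w] that by (simp add: q')
  qed (fact q'0)
  then obtain rs where rs: "q' = smult (lead_coeff q') (\<Prod>r\<leftarrow>rs. [:- r, 1:])" by blast
  have "lead_coeff q = lead_coeff q'" unfolding q' lead_coeff_mult by simp
  have "q = [:- Re z, 1:] * smult (lead_coeff q') (\<Prod>r\<leftarrow>rs. [:- r, 1:])"
    by (subst q', subst rs) (rule refl)
  also have "\<dots> = smult (lead_coeff q) (\<Prod>r\<leftarrow>Re z # rs. [:- r, 1:])"
    unfolding \<open>lead_coeff q = lead_coeff q'\<close> by (simp only: mult_smult_right list.map prod_list.Cons)
  finally have "q = smult (lead_coeff q) (\<Prod>r\<leftarrow>Re z # rs. [:- r, 1:])" .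
  then show ?case by blast
qed

text \<open>For P = (X - r) Q the expression P'^2 - P P'' equals Q^2 + (x - r)^2 (Q'^2 - Q Q'').
  Nonnegativity is thus inherited factor by factor, and the term Q^2 makes it strict where P does
  not vanish.\<close>

lemma laguerre_inequality:
  fixes rs :: "real list"
  defines "P \<equiv> \<Prod>r\<leftarrow>rs. [:- r, 1:]"
  shows "0 \<le> (poly (pderiv P) x)\<^sup>2 - poly P x * poly (pderiv (pderiv P)) x"
    and "rs \<noteq> [] \<Longrightarrow> poly P x \<noteq> 0 \<Longrightarrow> 0 < (poly (pderiv P) x)\<^sup>2 - poly P x * poly (pderiv (pderiv P)) x"
proof -
  have *: "0 \<le> (poly (pderiv P) x)\<^sup>2 - poly P x * poly (pderiv (pderiv P)) x \<and>
     (rs \<noteq> [] \<longrightarrow> poly P x \<noteq> 0 \<longrightarrow> 0 < (poly (pderiv P) x)\<^sup>2 - poly P x * poly (pderiv (pderiv P)) x)"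
    unfolding P_def
  proof (induction rs)
    case (Cons r rs)
    define Q where "Q = (\<Prod>r\<leftarrow>rs. [:- r, 1:])"
    define A B C where "A = poly Q x" "B = poly (pderiv Q) x" "C = poly (pderiv (pderiv Q)) x"
    have IH: "0 \<le> B\<^sup>2 - A * C" using Cons by (simp add: Q_def A_B_C_def)
    have P: "(\<Prod>r\<leftarrow>r # rs. [:- r, 1:]) = [:- r, 1:] * Q" by (simp add: Q_def)
    have p1: "pderiv [:- r, 1:] = 1" by (simp add: pderiv_pCons)
    have d1: "pderiv ([:- r, 1:] * Q) = [:- r, 1:] * pderiv Q + Q"
      by (simp only: pderiv_mult p1 mult_1_right)
    have d2: "pderiv (pderiv ([:- r, 1:] * Q)) = [:- r, 1:] * pderiv (pderiv Q) + pderiv Q + pderiv Q"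
      by (simp only: d1 pderiv_add pderiv_mult p1 mult_1_right)
    have "(poly (pderiv ([:- r, 1:] * Q)) x)\<^sup>2 - poly ([:- r, 1:] * Q) x * poly (pderiv (pderiv ([:- r, 1:] * Q))) x
      = A\<^sup>2 + (x - r)\<^sup>2 * (B\<^sup>2 - A * C)"
      unfolding d2 unfolding d1 by (simp add: A_B_C_def power2_eq_square algebra_simps)
    then show ?case unfolding P using IH by (auto simp: A_B_C_def add_pos_nonneg)
  qed simp
  show "0 \<le> (poly (pderiv P) x)\<^sup>2 - poly P x * poly (pderiv (pderiv P)) x"
    and "rs \<noteq> [] \<Longrightarrow> poly P x \<noteq> 0 \<Longrightarrow> 0 < (poly (pderiv P) x)\<^sup>2 - poly P x * poly (pderiv (pderiv P)) x"
    using * by auto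
qed

text \<open>The polynomial \<open>f\<close> stands for half the discriminant of a periodic operator, and \<open>reality\<close>
  expresses that the spectrum of the operator is real.\<close>

locale banded_poly =
  fixes f :: "real poly"
  assumes degree_pos: "degree f > 0" and lead_pos: "lead_coeff f > 0"
    and reality: "\<And>z c. \<lbrakk>cpoly f z = of_real c; \<bar>c\<bar> \<le> 1\<rbrakk> \<Longrightarrow> Im z = 0"
begin

lemma shifted_splits:
  assumes "\<bar>c\<bar> \<le> 1"
  obtains rs where "f - [:c:] = smult (lead_coeff f) (\<Prod>r\<leftarrow>rs. [:- r, 1:])" "rs \<noteq> []"
proof -
  have d: "degree (f - [:c:]) = degree f"
  proof -
    have eq: "f - [:c:] = - [:c:] + f" by simp
    show ?thesis unfolding eq by (rule degree_add_eq_right) (use degree_pos in simp)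
  qed
  then have l: "lead_coeff (f - [:c:]) = lead_coeff f" using degree_pos by (simp add: coeff_pCons split: nat.split)
  have "f - [:c:] \<noteq> 0" using d degree_pos by auto
  moreover have "Im z = 0" if "cpoly (f - [:c:]) z = 0" for z
    using that reality[of z c] assms by simp
  ultimately obtain rs where rs: "f - [:c:] = smult (lead_coeff f) (\<Prod>r\<leftarrow>rs. [:- r, 1:])"
    using real_rooted_splits[of "f - [:c:]"] unfolding l by auto
  moreover have "rs \<noteq> []" using rs d degree_pos by (metis degree_smult_le degree_1 leD list.simps(8) prod_list.Nil)
  ultimately show ?thesis using that by blast
qed

text \<open>At a critical point x, Laguerre's inequality for the real-rooted polynomial f - c reads
  (f x - c) f''(x) < 0. The choices c = 1 and c = -1 demand opposite signs of f''(x).\<close>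

lemma pderiv_nonzero:
  assumes "\<bar>poly f x\<bar> < 1"
  shows "poly (pderiv f) x \<noteq> 0"
proof
  assume 0: "poly (pderiv f) x = 0"
  have key: "(poly f x - c) * poly (pderiv (pderiv f)) x < 0" if c: "\<bar>c\<bar> \<le> 1" "c \<noteq> poly f x" for c
  proof -
    obtain rs where rs: "f - [:c:] = smult (lead_coeff f) (\<Prod>r\<leftarrow>rs. [:- r, 1:])" "rs \<noteq> []"
      using shifted_splits c by metis
    define P where "P = (\<Prod>r\<leftarrow>rs. [:- r, 1:])"
    define l where "l = lead_coeff f"
    have P: "f - [:c:] = smult l P" using rs by (simp add: P_def l_def)
    have l: "l > 0" using lead_pos by (simp add: l_def)
    have d: "pderiv f = smult l (pderiv P)"
      using arg_cong[OF P, of pderiv] by (simp add: pderiv_diff pderiv_pCons pderiv_smult)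
    have d0: "poly (pderiv P) x = 0" using 0 l by (simp add: d)
    have e: "poly f x - c = l * poly P x" using arg_cong[OF P, of "\<lambda>p. poly p x"] by simp
    then have "poly P x \<noteq> 0" using c l by auto
    then have "poly P x * poly (pderiv (pderiv P)) x < 0"
      using laguerre_inequality(2)[of rs x] rs(2) d0 by (simp add: P_def)
    then have "l * l * (poly P x * poly (pderiv (pderiv P)) x) < 0"
      using l by (simp add: mult_pos_neg)
    then show ?thesis unfolding e d pderiv_smult by (simp add: mult_ac)
  qed
  define y w where "y = poly f x" "w = poly (pderiv (pderiv f)) x"
  have "(y - 1) * w < 0" "(y - (-1)) * w < 0"
    using key[of 1] key[of "-1"] assms by (auto simp: y_w_def)
  then show False using assms by (smt (verit) mult_less_0_iff y_w_def(1))
qed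

definition zeros :: "real set" where "zeros = {x. poly f x = 0}"

lemma finite_zeros: "finite zeros"
  unfolding zeros_def using degree_pos by (intro poly_roots_finite) auto

text \<open>A repeated zero would be a critical point with value 0, so the real-rooted polynomial
  \<open>f\<close> has simple zeros, as many as its degree. This count later supplies exactly p
  bands and with them a complete system of Bloch vectors over one period.\<close>

lemma factorization: "f = smult (lead_coeff f) (\<Prod>r\<in>zeros. [:- r, 1:])"
  and card_zeros: "card zeros = degree f"
proof -
  obtain rs where rs: "f = smult (lead_coeff f) (\<Prod>r\<leftarrow>rs. [:- r, 1:])"
    using shifted_splits[of 0] by auto
  have dist: "distinct rs"
  proof (rule ccontr)
    assume "\<not> distinct rs"
    then obtain xs r ys zs where "rs = xs @ [r] @ ys @ [r] @ zs" using not_distinct_decomp by blast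
    then have "\<exists>g. f = [:- r, 1:] * ([:- r, 1:] * g)"
      by (intro exI[of _ "smult (lead_coeff f) ((\<Prod>r\<leftarrow>xs. [:- r, 1:]) * (\<Prod>r\<leftarrow>ys. [:- r, 1:]) * (\<Prod>r\<leftarrow>zs. [:- r, 1:]))"])
         (subst rs, simp only: map_append prod_list.append list.simps prod_list.Cons prod_list.Nil mult_1_left mult_1_right mult_smult_right mult_ac)
    then obtain g where g: "f = [:- r, 1:] * ([:- r, 1:] * g)" by blast
    have "poly f r = 0" unfolding g by simp
    moreover have "poly (pderiv f) r = 0" unfolding g pderiv_mult by simp
    ultimately show False using pderiv_nonzero[of r] by simp
  qed
  have "set rs = zeros"
  proof -
    have "poly (\<Prod>r\<leftarrow>rs. [:- r, 1:]) x = (\<Prod>r\<leftarrow>rs. x - r)" for x :: real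
      by (induct rs) (auto simp: left_diff_distrib)
    then have "poly f x = lead_coeff f * (\<Prod>r\<leftarrow>rs. x - r)" for x
      using rs by (metis poly_smult)
    then show ?thesis using lead_pos by (auto simp: zeros_def prod_list_zero_iff)
  qed
  then have e: "(\<Prod>r\<leftarrow>rs. [:- r, 1:]) = (\<Prod>r\<in>zeros. [:- r, 1:])"
    using prod.distinct_set_conv_list[OF dist, of "\<lambda>r. [:- r, 1:]"] by simp
  show 1: "f = smult (lead_coeff f) (\<Prod>r\<in>zeros. [:- r, 1:])" using rs e by simp
  have "degree f = degree (smult (lead_coeff f) (\<Prod>r\<in>zeros. [:- r, 1:]))"
    by (rule arg_cong[OF 1])
  also have "\<dots> = degree (\<Prod>r\<in>zeros. [:- r, 1:])"
    using degree_pos by (subst degree_smult_eq) auto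
  also have "\<dots> = (\<Sum>r\<in>zeros. degree [:- r, 1:])"
    by (rule degree_prod_eq_sum_degree) auto
  also have "\<dots> = card zeros" by simp
  finally show "card zeros = degree f" by simp
qed

lemma cpoly_f_eq_prod: "cpoly f z = of_real (lead_coeff f) * (\<Prod>r\<in>zeros. z - of_real r)"
proof -
  have "cpoly (\<Prod>r\<in>S. [:- r, 1:]) z = (\<Prod>r\<in>S. z - of_real r)" if "finite S" for S
    using that by (induction S) (auto simp: algebra_simps)
  then show ?thesis by (subst factorization) (simp add: finite_zeros)
qed

text \<open>The function \<open>\<theta>\<close> is the quasi-momentum. Since \<open>w = exp (\<i> \<theta>)\<close> satisfies
  \<open>2 f w = 1 + w\<^sup>2\<close> and \<open>cmod w < 1\<close>, a logarithm of \<open>w\<close> is given by principal logarithms, and the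
  real part of \<open>\<theta>\<close> is bounded.\<close>

lemma quasi_momentum:
  obtains \<theta> where "\<theta> holomorphic_on upper_half_plane"
    "\<And>z. 0 < Im z \<Longrightarrow> cos (\<theta> z) = cpoly f z"
    "\<And>z. 0 < Im z \<Longrightarrow> 0 < Im (\<theta> z)"
    "\<And>z. 0 < Im z \<Longrightarrow> \<bar>Re (\<theta> z)\<bar> \<le> (real (degree f) + 1) * pi"
    "\<And>z. 0 < Im z \<Longrightarrow> ln (cmod (cpoly f z)) \<le> Im (\<theta> z)"
    "\<And>z. 0 < Im z \<Longrightarrow> Im (\<theta> z) \<le> ln (2 * cmod (cpoly f z) + 1)"
proof -
  have holF: "cpoly f holomorphic_on S" for S
    by (rule holomorphic_intros | simp add: poly_holomorphic_on)+
  have nz: "(cpoly f z)\<^sup>2 - 1 \<noteq> 0" if "0 < Im z" for z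
  proof
    assume "(cpoly f z)\<^sup>2 - 1 = 0"
    then have "cpoly f z = of_real 1 \<or> cpoly f z = of_real (-1)" by (simp add: power2_eq_1_iff)
    then show False using reality[of z 1] reality[of z "-1"] that by auto
  qed
  \<comment> \<open>Solving w + 1 / w = 2 f needs a square root of f^2 - 1. It exists because the
    half plane is simply connected and f takes the values 1 and -1 only at real points.\<close>
  obtain g where g: "g holomorphic_on upper_half_plane" "\<And>z. z \<in> upper_half_plane \<Longrightarrow> (cpoly f z)\<^sup>2 - 1 = (g z)\<^sup>2"
  proof (rule contractible_imp_holomorphic_sqrt)
    show "(\<lambda>z. (cpoly f z)\<^sup>2 - 1) holomorphic_on upper_half_plane"
      by (intro holomorphic_intros holF)
  qed (use convex_imp_contractible[OF convex_upper_half_plane] nz in auto)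
  have not1: "cmod w \<noteq> 1" if w: "w * w' = 1" "w + w' = 2 * cpoly f z" "0 < Im z" for w w' z
  proof
    assume n: "cmod w = 1"
    have "w' = cnj w" using w(1) n complex_norm_square[of w]
      by (metis complex_cnj_zero_iff mult_cancel_left mult_zero_left norm_zero of_real_1 power_one zero_neq_one)
    then have "cpoly f z = of_real (Re w)" using w(2) complex_add_cnj[of w] by simp
    moreover have "\<bar>Re w\<bar> \<le> 1" using n abs_Re_le_cmod[of w] by simp
    ultimately show False using reality[of z "Re w"] w(3) by simp
  qed
  obtain w where holw: "w holomorphic_on upper_half_plane"
    and w: "\<And>z. 0 < Im z \<Longrightarrow> cmod (w z) < 1" "\<And>z. 0 < Im z \<Longrightarrow> 1 + (w z)\<^sup>2 = 2 * cpoly f z * w z"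
  proof -
    \<comment> \<open>The roots f + g and f - g have product 1 and never have modulus 1, since f
      would then be real and in [-1, 1]. By connectedness one of the two stays inside the unit disc
      throughout.\<close>
    define u where "u s z = cpoly f z + s * g z" for s z
    have holu: "u s holomorphic_on upper_half_plane" for s
      unfolding u_def by (intro holomorphic_intros holF g)
    have uu: "u s z * u (-s) z = 1" "u s z + u (-s) z = 2 * cpoly f z" if "0 < Im z" "s\<^sup>2 = 1" for s z
      using g(2)[of z] that by (auto simp: u_def algebra_simps power2_eq_square)
        (metis (no_types, opaque_lifting) diff_add_cancel mult.assoc mult.left_commute mult_1 )?
    have ne: "cmod (u s z) \<noteq> 1" if "0 < Im z" "s\<^sup>2 = 1" for s z
      using not1[OF uu[OF that] that(1)] .
    have quad: "1 + (u s z)\<^sup>2 = 2 * cpoly f z * u s z" if "0 < Im z" "s\<^sup>2 = 1" for s z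
      using uu[OF that] by (metis add.commute distrib_right mult.commute power2_eq_square)
    have conn: "connected ((\<lambda>z. cmod (u 1 z)) ` upper_half_plane)"
      using holu by (intro connected_continuous_image convex_connected convex_upper_half_plane continuous_on_norm
          holomorphic_on_imp_continuous_on)
    show ?thesis
    proof (cases "\<exists>z. 0 < Im z \<and> cmod (u 1 z) < 1")
      case True
      then obtain z0 where z0: "0 < Im z0" "cmod (u 1 z0) < 1" by blast
      have "cmod (u 1 z) < 1" if "0 < Im z" for z
      proof (rule ccontr)
        assume "\<not> cmod (u 1 z) < 1"
        then have "1 \<in> (\<lambda>z. cmod (u 1 z)) ` upper_half_plane"
          using connectedD_interval[OF conn, of "cmod (u 1 z0)" "cmod (u 1 z)" 1] z0 that by auto
        then show False using ne[of _ 1] by force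
      qed
      then show ?thesis using that[of "u 1"] holu quad[of _ 1] by auto
    next
      case False
      have "cmod (u (-1) z) < 1" if z: "0 < Im z" for z
      proof -
        have "1 < cmod (u 1 z)" using False ne[of z 1] z by force
        moreover have "cmod (u 1 z) * cmod (u (-1) z) = 1"
          using uu(1)[of z 1] z by (metis norm_mult norm_one power_one)
        ultimately show ?thesis
          by (smt (verit) mult_le_cancel_left1 norm_ge_zero mult_less_cancel_left1)
      qed
      then show ?thesis using that[of "u (-1)"] holu quad[of _ "-1"] by auto
    qed
  qed
  \<comment> \<open>This is - i log w with log w written as log (1 + w^2) - log (2 f). Principal
    logarithms may be used: 1 + w^2 has positive real part, and each linear factor of f lies in the
    upper half plane. Each of the degree + 1 logarithms with a nonreal argument adds at most pi to
    the real part of \<theta>.\<close>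
  define \<theta> where "\<theta> z = \<i> * ((\<Sum>r\<in>zeros. Ln (z - of_real r)) + of_real (ln (2 * lead_coeff f)) - Ln (1 + (w z)\<^sup>2))" for z
  have pos: "0 < Re (1 + (w z)\<^sup>2)" if "0 < Im z" for z
  proof -
    have "cmod ((w z)\<^sup>2) < 1" using w(1)[OF that] by (simp add: norm_power power_less_one_iff)
    then show ?thesis using abs_Re_le_cmod[of "(w z)\<^sup>2"] by simp
  qed
  have pos': "1 + (w z)\<^sup>2 \<notin> \<real>\<^sub>\<le>\<^sub>0" if "0 < Im z" for z
    using pos[OF that] by (simp add: complex_nonpos_Reals_iff)
  have ex: "exp (\<i> * \<theta> z) = w z" if z: "0 < Im z" for z
  proof -
    have nz': "1 + (w z)\<^sup>2 \<noteq> 0" using pos[OF z] by (metis less_irrefl zero_complex.sel(1))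
    have zr: "z - of_real r \<noteq> 0" for r using z by auto
    have "\<i> * \<theta> z = Ln (1 + (w z)\<^sup>2) - ((\<Sum>r\<in>zeros. Ln (z - of_real r)) + of_real (ln (2 * lead_coeff f)))"
      by (simp add: \<theta>_def algebra_simps)
    then have "exp (\<i> * \<theta> z) = (1 + (w z)\<^sup>2) / ((\<Prod>r\<in>zeros. z - of_real r) * of_real (2 * lead_coeff f))"
      using nz' zr lead_pos by (simp add: exp_diff exp_add exp_sum finite_zeros exp_of_real exp_ln del: of_real_mult)
    also have "(\<Prod>r\<in>zeros. z - of_real r) * of_real (2 * lead_coeff f) = 2 * cpoly f z"
      by (simp add: cpoly_f_eq_prod)
    finally have "exp (\<i> * \<theta> z) = 2 * cpoly f z * w z / (2 * cpoly f z)" using w(2)[OF z] by simp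
    moreover have "cpoly f z \<noteq> 0" using reality[of z 0] z by auto
    ultimately show ?thesis by simp
  qed
  have wnz: "w z \<noteq> 0" if "0 < Im z" for z using ex[OF that] by (metis exp_not_eq_zero)
  have nw: "cmod (w z) = exp (- Im (\<theta> z))" if "0 < Im z" for z
    using ex[OF that] by (metis norm_exp_eq_Re Re_i_times)
  show ?thesis
  proof
    show "\<theta> holomorphic_on upper_half_plane"
      unfolding \<theta>_def using pos'
      by (intro holomorphic_intros holw) (auto simp: complex_nonpos_Reals_iff)
    fix z assume z: "0 < Im z"
    have "cos (\<theta> z) = (w z + inverse (w z)) / 2"
      using ex[OF z] by (simp add: cos_exp_eq exp_minus)
    also have "\<dots> = (1 + (w z)\<^sup>2) / (2 * w z)" using wnz[OF z] by (simp add: field_simps power2_eq_square)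
    also have "\<dots> = cpoly f z" using w(2)[OF z] wnz[OF z] by simp
    finally show "cos (\<theta> z) = cpoly f z" .
    show Im: "0 < Im (\<theta> z)" using nw[OF z] w(1)[OF z] by simp
    have ImLn: "\<bar>Im (Ln u)\<bar> \<le> pi" if "u \<noteq> 0" for u
      using mpi_less_Im_Ln[OF that] Im_Ln_le_pi[OF that] by linarith
    have "\<bar>Re (\<theta> z)\<bar> = \<bar>Im (Ln (1 + (w z)\<^sup>2)) - (\<Sum>r\<in>zeros. Im (Ln (z - of_real r)))\<bar>"
      by (simp add: \<theta>_def)
    also have "\<dots> \<le> pi + (\<Sum>r\<in>zeros. pi)"
    proof -
      have "\<bar>Im (Ln (1 + (w z)\<^sup>2))\<bar> \<le> pi" using pos'[OF z] by (intro ImLn) auto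
      moreover have "\<bar>\<Sum>r\<in>zeros. Im (Ln (z - of_real r))\<bar> \<le> (\<Sum>r\<in>zeros. pi)"
        using z by (intro order.trans[OF sum_abs] sum_mono ImLn) auto
      ultimately show ?thesis by linarith
    qed
    also have "\<dots> = (real (degree f) + 1) * pi" by (simp add: card_zeros algebra_simps)
    finally show "\<bar>Re (\<theta> z)\<bar> \<le> (real (degree f) + 1) * pi" .
    have n1: "1 = cmod (w z) * exp (Im (\<theta> z))" using nw[OF z] by (simp flip: exp_add)
    have "2 * cmod (cpoly f z) * cmod (w z) = cmod (1 + (w z)\<^sup>2)"
      using w(2)[OF z] by (metis norm_mult norm_numeral)
    also have "\<dots> \<le> 1 + 1"
      using w(1)[OF z] by (intro order.trans[OF norm_triangle_ineq] add_mono) (auto simp: norm_power power_le_one)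
    finally have "cmod (cpoly f z) * cmod (w z) \<le> cmod (w z) * exp (Im (\<theta> z))" using n1 by simp
    then have "cmod (cpoly f z) \<le> exp (Im (\<theta> z))" using wnz[OF z] by simp
    moreover have Fnz: "cpoly f z \<noteq> 0" using reality[of z 0] z by auto
    ultimately show "ln (cmod (cpoly f z)) \<le> Im (\<theta> z)" by (metis ln_exp ln_le_cancel_iff exp_gt_zero zero_less_norm_iff)
    have "1 \<le> cmod (1 + (w z)\<^sup>2) + cmod ((w z)\<^sup>2)" by (metis add_diff_cancel_right' norm_one norm_triangle_ineq4)
    also have "\<dots> = 2 * cmod (cpoly f z) * cmod (w z) + cmod (w z) * cmod (w z)"
      using w(2)[OF z] by (metis norm_mult norm_numeral power2_eq_square)
    also have "\<dots> \<le> 2 * cmod (cpoly f z) * cmod (w z) + 1 * cmod (w z)"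
      using w(1)[OF z] by (intro add_mono mult_right_mono) auto
    finally have "cmod (w z) * exp (Im (\<theta> z)) \<le> cmod (w z) * (2 * cmod (cpoly f z) + 1)"
      using n1 by (simp add: algebra_simps)
    then have "exp (Im (\<theta> z)) \<le> 2 * cmod (cpoly f z) + 1" using wnz[OF z] by simp
    then show "Im (\<theta> z) \<le> ln (2 * cmod (cpoly f z) + 1)"
      by (subst ln_ge_iff) (auto simp: add_nonneg_pos)
  qed
qed

end

text \<open>Three differentiations of cos T = F. These relations convert information on the
  derivatives of the polynomial into information on those of the angle.\<close>

lemma derivs_of_cos_eq:
  fixes T F F1 F2 F3 :: "complex \<Rightarrow> complex"
  assumes hol: "T holomorphic_on ball p r" and cos: "\<And>z. z \<in> ball p r \<Longrightarrow> cos (T z) = F z"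
    and F: "\<And>z. (F has_field_derivative F1 z) (at z)" "\<And>z. (F1 has_field_derivative F2 z) (at z)"
      "\<And>z. (F2 has_field_derivative F3 z) (at z)"
    and "r > 0"
  defines "a \<equiv> deriv T p" and "b \<equiv> deriv (deriv T) p" and "c \<equiv> deriv (deriv (deriv T)) p" and "S \<equiv> sin (T p)"
  shows "F1 p = - S * a" "F2 p = - F p * a\<^sup>2 - S * b" "F3 p = S * a ^ 3 - 3 * F p * a * b - S * c"
proof -
  have p: "p \<in> ball p r" using \<open>r > 0\<close> by simp
  note hol1 = holomorphic_deriv[OF hol open_ball] note hol2 = holomorphic_deriv[OF hol1 open_ball]
  note D = holomorphic_derivI[OF hol open_ball] holomorphic_derivI[OF hol1 open_ball] holomorphic_derivI[OF hol2 open_ball]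
  have e1: "F1 z = - sin (T z) * deriv T z" if z: "z \<in> ball p r" for z
  proof -
    have "((\<lambda>z. cos (T z)) has_field_derivative - sin (T z) * deriv T z) (at z)"
      by (rule derivative_eq_intros refl D(1)[OF z])+
    from has_field_derivative_transform_within_open[OF this open_ball z, of F] cos
    show ?thesis using DERIV_unique[OF F(1)] by blast
  qed
  have e2: "F2 z = - F z * (deriv T z)\<^sup>2 - sin (T z) * deriv (deriv T) z" if z: "z \<in> ball p r" for z
  proof -
    have "((\<lambda>z. - sin (T z) * deriv T z) has_field_derivative
        - F z * (deriv T z)\<^sup>2 - sin (T z) * deriv (deriv T) z) (at z)"
      by (rule derivative_eq_intros refl D(1)[OF z] D(2)[OF z])+ (simp add: cos[OF z] power2_eq_square)
    from has_field_derivative_transform_within_open[OF this open_ball z, of F1] e1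
    show ?thesis using DERIV_unique[OF F(2)] by fastforce
  qed
  have "((\<lambda>z. - F z * (deriv T z)\<^sup>2 - sin (T z) * deriv (deriv T) z) has_field_derivative
        S * a ^ 3 - 3 * F p * a * b - S * c) (at p)"
    apply (rule derivative_eq_intros refl F(1) D(1)[OF p] D(2)[OF p] D(3)[OF p])+
    apply (simp add: e1[OF p] cos[OF p] a_def b_def c_def S_def power2_eq_square power3_eq_cube algebra_simps)
    done
  from has_field_derivative_transform_within_open[OF this open_ball p, of F2] e2
  show "F3 p = S * a ^ 3 - 3 * F p * a * b - S * c" using DERIV_unique[OF F(3)] by fastforce
  show "F1 p = - S * a" "F2 p = - F p * a\<^sup>2 - S * b"
    using e1[OF p] e2[OF p] by (auto simp: a_def b_def S_def)
qed

section \<open>Real branches of the quasi-momentum and the uniform Schwarzian bound\<close>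

context banded_poly
begin

abbreviation "f' \<equiv> pderiv f"
abbreviation "f'' \<equiv> pderiv f'"
abbreviation "f''' \<equiv> pderiv f''"

text \<open>A sign is attached to the arccosine so that the real branch \<open>T\<close> is
  increasing, as the boundary values of a map of the upper half plane into itself must be.
  \<open>S\<close> stands for the sine of T at x; its sign is opposite to that of
  \<open>f'\<close>.\<close>

lemma local_quasi_momentum:
  fixes x :: real
  assumes x: "\<bar>poly f x\<bar> < 1"
  obtains T r S a b c where "r > 0" "T holomorphic_on ball (of_real x) r"
    "\<And>y::real. \<bar>y - x\<bar> < r \<Longrightarrow> Im (T (of_real y)) = 0"
    "\<And>z. z \<in> ball (of_real x) r \<Longrightarrow> cos (T z) = cpoly f z"
    "\<And>z. \<bar>Re (T z)\<bar> \<le> pi"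
    "deriv T (of_real x) = of_real a" "deriv (deriv T) (of_real x) = of_real b"
    "deriv (deriv (deriv T)) (of_real x) = of_real c"
    "a > 0" "S\<^sup>2 = 1 - (poly f x)\<^sup>2" "poly f' x = - S * a" "poly f'' x = - poly f x * a\<^sup>2 - S * b"
    "poly f''' x = S * a ^ 3 - 3 * poly f x * a * b - S * c"
proof -
  define \<sigma> :: real where "\<sigma> = (if poly f' x < 0 then 1 else -1)"
  have \<sigma>: "\<sigma> = 1 \<or> \<sigma> = -1" by (simp add: \<sigma>_def)
  define T where "T z = of_real \<sigma> * Arccos (cpoly f z)" for z
  have "open {z. \<bar>Re (cpoly f z)\<bar> < 1}" by (intro open_Collect_less continuous_intros)
  moreover have "complex_of_real x \<in> {z. \<bar>Re (cpoly f z)\<bar> < 1}" using x by simp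
  ultimately obtain r where r: "r > 0" "ball (of_real x) r \<subseteq> {z. \<bar>Re (cpoly f z)\<bar> < 1}"
    using open_contains_ball by metis
  have holF: "cpoly f holomorphic_on S" for S
    by (rule holomorphic_intros | simp add: poly_holomorphic_on)+
  have "(Arccos \<circ> cpoly f) holomorphic_on ball (of_real x) r"
    by (rule holomorphic_on_compose[OF holF]) (use r in \<open>auto intro!: holomorphic_on_Arccos\<close>)
  then have holT: "T holomorphic_on ball (of_real x) r"
    unfolding T_def by (intro holomorphic_intros) (simp add: o_def)
  have cosT: "cos (T z) = cpoly f z" for z using \<sigma> by (auto simp: T_def)
  have fy: "\<bar>poly f y\<bar> < 1" if "\<bar>y - x\<bar> < r" for y
  proof -
    have "complex_of_real y \<in> ball (of_real x) r"
      using that by (simp add: dist_norm abs_minus_commute flip: of_real_diff)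
    then have "complex_of_real y \<in> {z. \<bar>Re (cpoly f z)\<bar> < 1}" using r(2) by blast
    then show ?thesis by simp
  qed
  have Treal: "T (of_real y) = of_real (\<sigma> * arccos (poly f y))" if "\<bar>y - x\<bar> < r" for y
    using fy[OF that] by (simp add: T_def of_real_arccos)
  define S where "S = \<sigma> * sin (arccos (poly f x))"
  have sp: "sin (arccos (poly f x)) = sqrt (1 - (poly f x)\<^sup>2)"
    using x by (intro sin_arccos) auto
  have lt: "(poly f x)\<^sup>2 < 1" using x by (simp add: abs_square_less_1)
  have S2: "S\<^sup>2 = 1 - (poly f x)\<^sup>2" using \<sigma> lt by (auto simp: S_def sp power_mult_distrib)
  have S0: "S \<noteq> 0" using S2 lt by auto
  have sinT: "sin (T (of_real x)) = of_real S"
    using Treal[of x] r(1) \<sigma> by (auto simp: S_def sin_of_real[symmetric] simp del: sin_of_real)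
  note R = derivs_of_cos_eq[OF holT cosT DERIV_cpoly DERIV_cpoly DERIV_cpoly r(1), simplified sinT cpoly_of_real]
  define a where "a = - poly f' x / S"
  define b where "b = (- poly f'' x - poly f x * a\<^sup>2) / S"
  define c where "c = (- poly f''' x + S * a ^ 3 - 3 * poly f x * a * b) / S"
  have T1: "deriv T (of_real x) = of_real a"
    using R(1) S0 by (simp add: a_def field_simps)
  have T2: "deriv (deriv T) (of_real x) = of_real b"
  proof -
    have "S * b = - poly f'' x - poly f x * a\<^sup>2" using S0 by (simp add: b_def)
    then have "complex_of_real (S * b) = - of_real (poly f'' x) - of_real (poly f x) * (of_real a)\<^sup>2" by simp
    then have "of_real S * deriv (deriv T) (of_real x) = of_real (S * b)"
      by (simp only: R(2) T1) simp
    then show ?thesis using S0 by simp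
  qed
  have T3: "deriv (deriv (deriv T)) (of_real x) = of_real c"
  proof -
    have "S * c = - poly f''' x + S * a ^ 3 - 3 * poly f x * a * b" using S0 by (simp add: c_def)
    then have "complex_of_real (S * c) = - of_real (poly f''' x) + of_real S * (of_real a) ^ 3
        - 3 * of_real (poly f x) * of_real a * of_real b" by simp
    then have "of_real S * deriv (deriv (deriv T)) (of_real x) = of_real (S * c)"
      by (simp only: R(3) T1 T2) simp
    then show ?thesis using S0 by simp
  qed
  have "a > 0"
    using pderiv_nonzero[OF x] lt by (auto simp: a_def S_def sp \<sigma>_def zero_less_divide_iff divide_less_0_iff not_less)
  moreover have "poly f' x = - S * a" "poly f'' x = - poly f x * a\<^sup>2 - S * b"
    "poly f''' x = S * a ^ 3 - 3 * poly f x * a * b - S * c"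
  proof -
    show "poly f' x = - S * a" using S0 by (simp add: a_def)
    have "S * b = - poly f'' x - poly f x * a\<^sup>2" using S0 by (simp add: b_def)
    then show "poly f'' x = - poly f x * a\<^sup>2 - S * b" by simp
    have "S * c = - poly f''' x + S * a ^ 3 - 3 * poly f x * a * b" using S0 by (simp add: c_def)
    then show "poly f''' x = S * a ^ 3 - 3 * poly f x * a * b - S * c" by simp
  qed
  moreover have "\<bar>Re (T z)\<bar> \<le> pi" for z using \<sigma> Re_Arccos_bound by (auto simp: T_def)
  ultimately show ?thesis using that[OF r(1) holT _ cosT _ T1 T2 T3 _ S2] Treal by auto
qed

text \<open>Equal cosines leave \<theta> = T + 2 k pi or \<theta> = - T + 2 k pi. The second is
  impossible since both imaginary parts are positive: Im T has no zero in the half disc, and a > 0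
  decides its sign. In the first, continuity and discreteness make k constant, and the bounds on
  both real parts limit the shift uniformly in x.\<close>

lemma quasi_momentum_local_match:
  fixes x :: real
  assumes "r > 0" and hol\<theta>: "\<theta> holomorphic_on upper_half_plane"
    and cos\<theta>: "\<And>z. 0 < Im z \<Longrightarrow> cos (\<theta> z) = cpoly f z" and Im\<theta>: "\<And>z. 0 < Im z \<Longrightarrow> 0 < Im (\<theta> z)"
    and Re\<theta>: "\<And>z. 0 < Im z \<Longrightarrow> \<bar>Re (\<theta> z)\<bar> \<le> C"
    and holT: "T holomorphic_on ball (of_real x) r"
    and realT: "\<And>y::real. \<bar>y - x\<bar> < r \<Longrightarrow> Im (T (of_real y)) = 0"
    and cosT: "\<And>z. z \<in> ball (of_real x) r \<Longrightarrow> cos (T z) = cpoly f z"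
    and ReT: "\<And>z. \<bar>Re (T z)\<bar> \<le> pi" and T1: "deriv T (of_real x) = of_real a" and "a > 0"
  obtains n :: real where "\<bar>n\<bar> \<le> C + pi" "\<And>z. \<lbrakk>z \<in> ball (of_real x) r; 0 < Im z\<rbrakk> \<Longrightarrow> \<theta> z - of_real n = T z"
proof -
  define D where "D = ball (complex_of_real x) r \<inter> upper_half_plane"
  have conn: "connected D" unfolding D_def
    by (intro convex_connected convex_Int convex_ball convex_upper_half_plane)
  have contT: "continuous_on D T"
    using holomorphic_on_imp_continuous_on[OF holT] continuous_on_subset D_def by blast
  have ne: "Im (T z) \<noteq> 0" if z: "z \<in> D" for z
  proof
    assume "Im (T z) = 0"
    then have "T z = of_real (Re (T z))" by (simp add: complex_eq_iff)
    then have "cpoly f z = of_real (cos (Re (T z)))" using cosT[of z] z by (metis D_def IntD1 cos_of_real)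
    then show False using reality[of z "cos (Re (T z))"] z by (auto simp: D_def)
  qed
  have pos: "0 < Im (T z)" if z: "z \<in> D" for z
  proof (rule ccontr)
    assume neg: "\<not> 0 < Im (T z)"
    have all: "Im (T w) \<le> 0" if w: "w \<in> D" for w
    proof (rule ccontr)
      assume "\<not> Im (T w) \<le> 0"
      moreover have "connected ((\<lambda>z. Im (T z)) ` D)"
        by (intro connected_continuous_image conn continuous_intros contT)
      ultimately have "0 \<in> (\<lambda>z. Im (T z)) ` D"
        using connectedD_interval[of _ "Im (T z)" "Im (T w)" 0] neg z w by auto
      then show False using ne by force
    qed
    have "(T has_field_derivative of_real a) (at (of_real x))"
      using holomorphic_derivI[OF holT open_ball, of "of_real x"] \<open>r > 0\<close> T1 by simp
    then have "((\<lambda>z. - T z) has_field_derivative - of_real a) (at (of_real x))" by (rule DERIV_minus)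
    then have "0 \<le> Re (- of_real a)"
    proof (rule le_Re_deriv_of_vertical_bound[where \<eta> = r])
      show "0 * y \<le> Im (- T (Complex x y))" if "0 < y" "y < r" for y
      proof -
        have "cmod (Complex x y - of_real x) = y" using that by (simp add: cmod_def complex_of_real_def)
        then show ?thesis using all[of "Complex x y"] that by (simp add: D_def dist_norm norm_minus_commute)
      qed
    qed (use realT[of x] \<open>r > 0\<close> in auto)
    then show False using \<open>a > 0\<close> by simp
  qed
  have diff: "\<exists>k\<in>\<int>. \<theta> z - T z = of_real (2 * k * pi)" if z: "z \<in> D" for z
  proof -
    have "cos (\<theta> z) = cos (T z)" using z cos\<theta> cosT by (auto simp: D_def)
    then obtain k where k: "k \<in> \<int>" "\<theta> z = T z + of_real (2 * k * pi) \<or> \<theta> z = - T z + of_real (2 * k * pi)"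
      unfolding complex_cos_eq by blast
    moreover have "\<theta> z \<noteq> - T z + of_real (2 * k * pi)"
    proof
      assume "\<theta> z = - T z + of_real (2 * k * pi)"
      then have "Im (\<theta> z) = - Im (T z)" by simp
      then show False using pos[OF z] Im\<theta>[of z] z by (simp add: D_def)
    qed
    ultimately have "\<theta> z - T z = of_real (2 * k * pi)" by (simp add: algebra_simps)
    with k(1) show ?thesis by blast
  qed
  have "(\<lambda>z. \<theta> z - T z) constant_on D"
  proof (rule continuous_discrete_range_constant[OF conn])
    show "continuous_on D (\<lambda>z. \<theta> z - T z)"
      using holomorphic_on_imp_continuous_on[OF hol\<theta>] contT
      by (intro continuous_intros) (auto simp: D_def intro: continuous_on_subset)
    fix z assume z: "z \<in> D"
    show "\<exists>e>0. \<forall>w. w \<in> D \<and> \<theta> w - T w \<noteq> \<theta> z - T z \<longrightarrow> e \<le> cmod (\<theta> w - T w - (\<theta> z - T z))"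
    proof (intro exI[of _ "2 * pi"] conjI allI impI)
      fix w assume w: "w \<in> D \<and> \<theta> w - T w \<noteq> \<theta> z - T z"
      obtain k l where kl: "k \<in> \<int>" "l \<in> \<int>" "\<theta> z - T z = of_real (2 * k * pi)" "\<theta> w - T w = of_real (2 * l * pi)"
        using diff z w by meson
      then have "l \<noteq> k" using w by auto
      moreover have "l - k \<in> \<int>" using kl by simp
      ultimately have "1 \<le> \<bar>l - k\<bar>" by (intro Ints_nonzero_abs_ge1) auto
      then have "2 * pi * 1 \<le> 2 * pi * \<bar>l - k\<bar>" by (intro mult_left_mono) auto
      also have "\<dots> = \<bar>2 * pi * (l - k)\<bar>" by (simp add: abs_mult)
      also have "\<dots> = \<bar>2 * l * pi - 2 * k * pi\<bar>"
        by (rule arg_cong[where f = abs]) (simp add: algebra_simps)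
      also have "\<dots> = cmod (\<theta> w - T w - (\<theta> z - T z))"
        unfolding kl of_real_diff[symmetric] norm_of_real ..
      finally show "2 * pi \<le> cmod (\<theta> w - T w - (\<theta> z - T z))" by simp
    qed simp
  qed
  then obtain d where d: "\<And>z. z \<in> D \<Longrightarrow> \<theta> z - T z = d" unfolding constant_on_def by blast
  have z0: "Complex x (r/2) \<in> D"
    using \<open>r > 0\<close> by (simp add: D_def dist_norm norm_minus_commute cmod_def complex_of_real_def)
  obtain k where k: "d = of_real (2 * k * pi)" using diff[OF z0] d[OF z0] by metis
  have "\<bar>2 * k * pi\<bar> = \<bar>Re (\<theta> (Complex x (r/2)) - T (Complex x (r/2)))\<bar>" using d[OF z0] k by simp
  also have "\<dots> \<le> C + pi" using Re\<theta>[of "Complex x (r/2)"] ReT[of "Complex x (r/2)"] \<open>r > 0\<close> by simp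
  finally show ?thesis using that[of "2 * k * pi"] d k by (force simp: D_def algebra_simps)
qed

lemma norm_cpoly_f_le:
  assumes "cmod z \<le> X" "\<And>r. r \<in> zeros \<Longrightarrow> \<bar>r\<bar> \<le> D"
  shows "cmod (cpoly f z) \<le> lead_coeff f * (X + D) ^ degree f"
proof -
  have "cmod (\<Prod>r\<in>zeros. z - of_real r) \<le> (\<Prod>r\<in>zeros. X + D)"
    unfolding prod_norm[symmetric]
  proof (intro prod_mono conjI)
    fix r assume "r \<in> zeros"
    then show "cmod (z - of_real r) \<le> X + D"
      using assms norm_triangle_ineq4[of z "of_real r"] by fastforce
  qed simp
  also have "\<dots> = (X + D) ^ degree f" by (simp add: card_zeros)
  finally show ?thesis using lead_pos
    by (simp add: cpoly_f_eq_prod norm_mult)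
qed

text \<open>On the half circle of radius R about a point x of the spectrum, v = Im \<theta> lies in
  [1, L] with L of order log R, and real parts are bounded, so v divided by the squared distance of
  \<theta> from its value at x is at least 1 / (M L). The point mass costs 1 / (a R), where a \<ge>
  1 / (2 \<rho>) by the boundary derivative bound on the circle of radius 2 \<rho>. For R large this
  cost is at most half of 1 / (M L); the other half is the constant k.\<close>

lemma uniform_schwarzian:
  obtains k where "k > 0" "\<And>x. \<bar>poly f x\<bar> < 1 \<Longrightarrow>
    \<exists>S a b c. S\<^sup>2 = 1 - (poly f x)\<^sup>2 \<and> a > 0 \<and> poly f' x = - S * a \<and>
      poly f'' x = - poly f x * a\<^sup>2 - S * b \<and> poly f''' x = S * a ^ 3 - 3 * poly f x * a * b - S * c \<and>
      k * a ^ 3 \<le> a * c / 6 - b\<^sup>2 / 4"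
proof -
  obtain \<theta> where hol\<theta>: "\<theta> holomorphic_on upper_half_plane"
    and cos\<theta>: "\<And>z. 0 < Im z \<Longrightarrow> cos (\<theta> z) = cpoly f z"
    and Im\<theta>: "\<And>z. 0 < Im z \<Longrightarrow> 0 < Im (\<theta> z)"
    and Re\<theta>: "\<And>z. 0 < Im z \<Longrightarrow> \<bar>Re (\<theta> z)\<bar> \<le> (real (degree f) + 1) * pi"
    and low: "\<And>z. 0 < Im z \<Longrightarrow> ln (cmod (cpoly f z)) \<le> Im (\<theta> z)"
    and upp: "\<And>z. 0 < Im z \<Longrightarrow> Im (\<theta> z) \<le> ln (2 * cmod (cpoly f z) + 1)"
    using quasi_momentum by metis
  define C where "C = (real (degree f) + 1) * pi"
  have "C \<ge> 0" by (simp add: C_def)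
  \<comment> \<open>The level exp 1 is chosen because its logarithm, 1, becomes the lower bound for
    Im \<theta> on large circles.\<close>
  obtain r0 where r0: "\<And>z. r0 \<le> cmod z \<Longrightarrow> exp 1 \<le> cmod (cpoly f z)"
  proof -
    obtain a q where aq: "map_poly complex_of_real f = pCons a q" by (cases "map_poly complex_of_real f")
    have "degree (map_poly complex_of_real f) > 0" using degree_pos by (simp add: degree_map_poly)
    then have "q \<noteq> 0" using aq by auto
    from poly_infinity[OF this, of "exp 1" a] that show ?thesis by (auto simp: aq)
  qed
  define \<rho> where "\<rho> = max r0 1"
  have bd: "\<bar>x\<bar> \<le> \<rho>" if "\<bar>poly f x\<bar> < 1" for x
  proof (rule ccontr)
    assume "\<not> \<bar>x\<bar> \<le> \<rho>"
    then have "exp 1 \<le> cmod (cpoly f (of_real x))" by (intro r0) (simp add: \<rho>_def)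
    then have "exp 1 \<le> \<bar>poly f x\<bar>" by simp
    with that have "exp 1 < (1::real)" by linarith
    moreover have "(1::real) < exp 1" by simp
    ultimately show False by linarith
  qed
  have one: "1 \<le> Im (\<theta> z)" if z: "0 < Im z" "cmod (z - of_real x) = R" "R \<ge> 2 * \<rho>" "\<bar>poly f x\<bar> < 1" for z x R
  proof -
    have "R - \<rho> \<le> cmod z" using z(2) bd[OF z(4)] norm_triangle_ineq4[of z "of_real x"] by simp
    then have "exp 1 \<le> cmod (cpoly f z)" using z by (intro r0) (simp add: \<rho>_def)
    then have "1 \<le> ln (cmod (cpoly f z))"
      by (subst ln_ge_iff) (auto intro: less_le_trans[OF exp_gt_zero])
    with low[OF z(1)] show ?thesis by simp
  qed
  define D where "D = Max (insert 0 (abs ` zeros))"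
  have D: "\<bar>r\<bar> \<le> D" if "r \<in> zeros" for r using that finite_zeros by (simp add: D_def)
  have "D \<ge> 0" using finite_zeros by (simp add: D_def)
  \<comment> \<open>The comparison to be achieved is 2 \<rho> / R \<le> 1 / (2 M L) with M = (2 C +
    2 pi)^2 + 1, that is, L Q \<le> R.\<close>
  define Q where "Q = ((2 * C + 2 * pi)\<^sup>2 + 1) * (2 * (2 * \<rho>))"
  have \<rho>1: "\<rho> \<ge> 1" by (simp add: \<rho>_def)
  have "Q > 0" using \<rho>1 by (simp add: Q_def add_nonneg_pos)
  define A where "A = ln (2 * lead_coeff f + 1)"
  define p where "p = real (degree f)"
  have "((\<lambda>X. (A / X + p * (ln X / X)) * Q) \<longlongrightarrow> (0 + p * 0) * Q) at_top"
    by (intro tendsto_intros ln_x_over_x_tendsto_0 tendsto_divide_0[OF tendsto_const] filterlim_at_top_imp_at_infinity filterlim_ident)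
  then have "eventually (\<lambda>X. (A / X + p * (ln X / X)) * Q < 1/2) at_top"
    by (rule order_tendstoD) simp
  then obtain X :: real where X: "(A / X + p * (ln X / X)) * Q < 1/2" "X \<ge> 2 * (D + 4 * \<rho>)"
    using eventually_conj[OF _ eventually_ge_at_top[of "2 * (D + 4 * \<rho>)"]]
    by (metis (no_types, lifting) eventually_happens' trivial_limit_at_top_linorder)
  have X1: "X \<ge> 1" using X(2) \<rho>1 \<open>D \<ge> 0\<close> by (smt (verit))
  \<comment> \<open>On the circle |z| + D \<le> R + \<rho> + D = X, so the product over the zeros
    bounds the modulus of f by the leading coefficient times X ^ degree f.\<close>
  define R where "R = X - (D + \<rho>)"
  have R: "R \<ge> 2 * \<rho>" "R > 0" "X / 2 \<le> R" using X(2) \<rho>1 \<open>D \<ge> 0\<close> by (auto simp: R_def)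
  define L where "L = A + p * ln X"
  have L0: "L > 0"
    unfolding L_def A_def p_def using lead_pos X1 by (intro add_pos_nonneg) auto
  have LQ: "L * Q \<le> R"
  proof -
    have "L * Q = X * ((A / X + p * (ln X / X)) * Q)" using X1 by (simp add: L_def field_simps)
    also have "\<dots> \<le> X * (1/2)" using X X1 by (intro mult_left_mono) auto
    finally show ?thesis using R by simp
  qed
  define M where "M = (2 * C + 2 * pi)\<^sup>2 + 1"
  have "M > 0" by (simp add: M_def add_nonneg_pos)
  define k where "k = 1 / (2 * M * L)"
  have "k > 0" using \<open>M > 0\<close> L0 by (simp add: k_def)
  show ?thesis
  proof (rule that[of "k / R"])
    show "k / R > 0" using \<open>k > 0\<close> R by simp
    fix x assume x: "\<bar>poly f x\<bar> < 1"
    obtain T r S a b c where r: "r > 0" and holT: "T holomorphic_on ball (of_real x) r"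
      and realT: "\<And>y::real. \<bar>y - x\<bar> < r \<Longrightarrow> Im (T (of_real y)) = 0"
      and cosT: "\<And>z. z \<in> ball (of_real x) r \<Longrightarrow> cos (T z) = cpoly f z"
      and ReT: "\<And>z. \<bar>Re (T z)\<bar> \<le> pi"
      and T1: "deriv T (of_real x) = of_real a" and T2: "deriv (deriv T) (of_real x) = of_real b"
      and T3: "deriv (deriv (deriv T)) (of_real x) = of_real c" and "a > 0"
      and rel: "S\<^sup>2 = 1 - (poly f x)\<^sup>2" "poly f' x = - S * a" "poly f'' x = - poly f x * a\<^sup>2 - S * b"
         "poly f''' x = S * a ^ 3 - 3 * poly f x * a * b - S * c"
      using local_quasi_momentum[OF x] by metis
    obtain n where n: "\<bar>n\<bar> \<le> C + pi"
      and match: "\<And>z. \<lbrakk>z \<in> ball (of_real x) r; 0 < Im z\<rbrakk> \<Longrightarrow> \<theta> z - of_real n = T z"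
      using quasi_momentum_local_match[OF r hol\<theta> cos\<theta> Im\<theta> Re\<theta> holT realT cosT ReT T1 \<open>a > 0\<close>]
      unfolding C_def by metis
    define \<theta>' where "\<theta>' z = \<theta> z - of_real n" for z
    have hol': "\<theta>' holomorphic_on upper_half_plane" unfolding \<theta>'_def by (intro holomorphic_intros hol\<theta>)
    have Im': "0 < Im (\<theta>' z)" if "0 < Im z" for z using Im\<theta>[OF that] by (simp add: \<theta>'_def)
    have a0: "1 / (2 * \<rho>) \<le> a"
      by (rule boundary_deriv_ge[OF hol' Im' holT r realT match[folded \<theta>'_def] T1])
         (use \<rho>1 one[of _ x "2 * \<rho>"] x in \<open>auto simp: \<theta>'_def\<close>)
    have "k / R * a ^ 3 \<le> a * c / 6 - b\<^sup>2 / 4"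
    proof (rule boundary_schwarzian_ge[OF hol' Im' holT r realT match[folded \<theta>'_def] T1 T2 T3 \<open>a > 0\<close> R(2)])
      show "0 \<le> k" using \<open>k > 0\<close> by simp
      fix z assume z: "0 < Im z" "cmod (z - of_real x) = R"
      define v where "v = Im (\<theta> z)"
      have v1: "1 \<le> v" unfolding v_def by (rule one[OF z R(1) x])
      have "cmod z \<le> R + \<rho>" using z(2) bd[OF x] norm_triangle_ineq2[of z "of_real x"] by simp
      then have "cmod (cpoly f z) \<le> lead_coeff f * X ^ degree f"
        using norm_cpoly_f_le[of z "R + \<rho>" D] D by (simp add: R_def)
      then have "2 * cmod (cpoly f z) + 1 \<le> (2 * lead_coeff f + 1) * X ^ degree f"
        using one_le_power[OF X1, of "degree f"] by (simp add: algebra_simps)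
      then have "ln (2 * cmod (cpoly f z) + 1) \<le> ln ((2 * lead_coeff f + 1) * X ^ degree f)"
        by (intro ln_mono) (auto simp: add_nonneg_pos)
      also have "\<dots> = L" using X1 lead_pos by (simp add: L_def A_def p_def ln_mult ln_realpow)
      finally have vL: "v \<le> L" using upp[OF z(1)] by (simp add: v_def)
      have "Re (T (of_real x)) = Re (T (of_real x)) \<and> Im (T (of_real x)) = 0" using realT[of x] r by simp
      have "(cmod (\<theta>' z - T (of_real x)))\<^sup>2 = (Re (\<theta> z) - n - Re (T (of_real x)))\<^sup>2 + v\<^sup>2"
        using realT[of x] r by (simp add: cmod_power2 \<theta>'_def v_def)
      also have "(Re (\<theta> z) - n - Re (T (of_real x)))\<^sup>2 \<le> (2 * C + 2 * pi)\<^sup>2"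
        using Re\<theta>[OF z(1)] n ReT[of "of_real x"] \<open>C \<ge> 0\<close>
        by (intro abs_le_square_iff[THEN iffD1]) (simp add: C_def[symmetric])
      finally have "(cmod (\<theta>' z - T (of_real x)))\<^sup>2 \<le> (2 * C + 2 * pi)\<^sup>2 * 1 + v\<^sup>2" by simp
      also have "\<dots> \<le> (2 * C + 2 * pi)\<^sup>2 * v\<^sup>2 + v\<^sup>2"
        using v1 by (intro add_right_mono mult_left_mono) auto
      finally have nb: "(cmod (\<theta>' z - T (of_real x)))\<^sup>2 \<le> M * v\<^sup>2" by (simp add: M_def algebra_simps)
      have npos: "0 < (cmod (\<theta>' z - T (of_real x)))\<^sup>2"
        using Im'[OF z(1)] realT[of x] r by (auto simp: complex_eq_iff)
      have "1 / (a * R) \<le> 2 * \<rho> / R"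
        using a0 \<open>a > 0\<close> \<rho>1 R(2) by (simp add: field_simps)
      also have "\<dots> \<le> k"
      proof -
        have "L * (M * (4 * \<rho>)) \<le> R" using LQ by (simp add: Q_def M_def)
        then show ?thesis using R(2) \<open>M > 0\<close> L0 by (simp add: k_def field_simps)
      qed
      finally have "k + 1 / (a * R) \<le> k + k" by simp
      also have "k + k = 1 / (M * L)" using \<open>M > 0\<close> L0 by (simp add: k_def field_simps)
      also have "\<dots> \<le> 1 / (M * v)" using vL v1 \<open>M > 0\<close> by (intro divide_left_mono mult_left_mono mult_pos_pos) auto
      also have "\<dots> = v / (M * v\<^sup>2)" using v1 by (simp add: power2_eq_square)
      also have "\<dots> \<le> v / (cmod (\<theta>' z - T (of_real x)))\<^sup>2"
        using nb npos v1 \<open>M > 0\<close> by (intro divide_left_mono mult_pos_pos) auto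
      finally show "k + 1 / (a * R) \<le> Im (\<theta>' z) / (cmod (\<theta>' z - T (of_real x)))\<^sup>2"
        by (simp add: v_def \<theta>'_def)
    qed
    with rel \<open>a > 0\<close> show "\<exists>S a b c. S\<^sup>2 = 1 - (poly f x)\<^sup>2 \<and> a > 0 \<and> poly f' x = - S * a \<and>
      poly f'' x = - poly f x * a\<^sup>2 - S * b \<and> poly f''' x = S * a ^ 3 - 3 * poly f x * a * b - S * c \<and>
      k / R * a ^ 3 \<le> a * c / 6 - b\<^sup>2 / 4" by blast
  qed
qed

end

section \<open>Bands and band functions\<close>

context banded_poly
begin

text \<open>The band of a zero r is the component of the set where |f| < 1 that contains r. As
  \<open>f\<close> is strictly monotone on it, it contains no second zero, and zeros serve as labels
  of bands. Two open bands may share an end point; the gap between them is then closed.\<close>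

definition upper_edge :: "real \<Rightarrow> real" where
  "upper_edge r = Inf {x. r \<le> x \<and> 1 \<le> \<bar>poly f x\<bar>}"

definition lower_edge :: "real \<Rightarrow> real" where
  "lower_edge r = Sup {x. x \<le> r \<and> 1 \<le> \<bar>poly f x\<bar>}"

definition band :: "real \<Rightarrow> real set" where
  "band r = {lower_edge r<..<upper_edge r}"

definition band_point :: "real \<Rightarrow> real \<Rightarrow> real" where
  "band_point r c = (THE x. x \<in> band r \<and> poly f x = c)"

definition energy :: "real \<Rightarrow> real \<Rightarrow> real" where
  "energy r \<theta> = band_point r (cos \<theta>)"

text \<open>This formula and the next two result from differentiating f (E \<theta>) = cos \<theta>
  implicitly. In this form they can be compared with the derivatives of the angle by algebra
  alone.\<close>

definition energy' :: "real \<Rightarrow> real \<Rightarrow> real" where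
  "energy' r \<theta> = - sin \<theta> / poly f' (energy r \<theta>)"

definition energy'' :: "real \<Rightarrow> real \<Rightarrow> real" where
  "energy'' r \<theta> = - (cos \<theta> + poly f'' (energy r \<theta>) * (energy' r \<theta>)\<^sup>2) / poly f' (energy r \<theta>)"

definition energy''' :: "real \<Rightarrow> real \<Rightarrow> real" where
  "energy''' r \<theta> = (sin \<theta> - 3 * poly f'' (energy r \<theta>) * energy' r \<theta> * energy'' r \<theta>
     - poly f''' (energy r \<theta>) * energy' r \<theta> ^ 3) / poly f' (energy r \<theta>)"

lemma spectrum_bounded:
  obtains \<rho> where "\<rho> > 0" "\<And>x. \<bar>poly f x\<bar> < 1 \<Longrightarrow> \<bar>x\<bar> \<le> \<rho>"
proof -
  obtain a q where aq: "f = pCons a q" by (cases f)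
  then have "q \<noteq> 0" using degree_pos by auto
  from poly_infinity[OF this, of 1 a] obtain r0 where r0: "\<And>x. r0 \<le> \<bar>x\<bar> \<Longrightarrow> 1 \<le> \<bar>poly f x\<bar>"
    by (auto simp: aq)
  have "\<bar>x\<bar> \<le> max r0 1" if "\<bar>poly f x\<bar> < 1" for x using r0[of x] that by linarith
  then show ?thesis by (intro that[of "max r0 1"]) auto
qed

lemma upper_edge:
  assumes r: "r \<in> zeros"
  shows "r < upper_edge r" "1 \<le> \<bar>poly f (upper_edge r)\<bar>"
    "\<And>x. \<lbrakk>r \<le> x; x < upper_edge r\<rbrakk> \<Longrightarrow> \<bar>poly f x\<bar> < 1"
proof -
  define U where "U = {x. r \<le> x \<and> 1 \<le> \<bar>poly f x\<bar>}"
  obtain \<rho> where \<rho>: "\<rho> > 0" "\<And>x. \<bar>poly f x\<bar> < 1 \<Longrightarrow> \<bar>x\<bar> \<le> \<rho>" using spectrum_bounded by blast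
  have "max r (\<rho> + 1) \<in> U" using \<rho>(2)[of "max r (\<rho> + 1)"] \<rho>(1) by (force simp: U_def)
  moreover have "closed U" unfolding U_def
    by (intro closed_Collect_conj closed_Collect_le continuous_intros)
  moreover have bd: "bdd_below U" by (auto simp: U_def)
  ultimately have "upper_edge r \<in> U"
    unfolding upper_edge_def U_def[symmetric] by (intro closed_contains_Inf) auto
  then show "r < upper_edge r" "1 \<le> \<bar>poly f (upper_edge r)\<bar>"
    using r by (auto simp: U_def zeros_def order_le_less)
  show "\<bar>poly f x\<bar> < 1" if "r \<le> x" "x < upper_edge r" for x
    using cInf_lower[OF _ bd, of x] that unfolding upper_edge_def U_def[symmetric] by (force simp: U_def)
qed

lemma lower_edge:
  assumes r: "r \<in> zeros"
  shows "lower_edge r < r" "1 \<le> \<bar>poly f (lower_edge r)\<bar>"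
    "\<And>x. \<lbrakk>lower_edge r < x; x \<le> r\<rbrakk> \<Longrightarrow> \<bar>poly f x\<bar> < 1"
proof -
  define U where "U = {x. x \<le> r \<and> 1 \<le> \<bar>poly f x\<bar>}"
  obtain \<rho> where \<rho>: "\<rho> > 0" "\<And>x. \<bar>poly f x\<bar> < 1 \<Longrightarrow> \<bar>x\<bar> \<le> \<rho>" using spectrum_bounded by blast
  have "min r (- \<rho> - 1) \<in> U" using \<rho>(2)[of "min r (- \<rho> - 1)"] \<rho>(1) by (force simp: U_def)
  moreover have "closed U" unfolding U_def
    by (intro closed_Collect_conj closed_Collect_le continuous_intros)
  moreover have bd: "bdd_above U" by (auto simp: U_def)
  ultimately have "lower_edge r \<in> U"
    unfolding lower_edge_def U_def[symmetric] by (intro closed_contains_Sup) auto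
  then show "lower_edge r < r" "1 \<le> \<bar>poly f (lower_edge r)\<bar>"
    using r by (auto simp: U_def zeros_def order_le_less)
  show "\<bar>poly f x\<bar> < 1" if "lower_edge r < x" "x \<le> r" for x
    using cSup_upper[OF _ bd, of x] that unfolding lower_edge_def U_def[symmetric] by (force simp: U_def)
qed

lemma abs_f_less_one_on_band:
  assumes "r \<in> zeros" "x \<in> band r" shows "\<bar>poly f x\<bar> < 1"
  using upper_edge(3)[OF assms(1), of x] lower_edge(3)[OF assms(1), of x] assms(2)
  by (cases "r \<le> x") (auto simp: band_def)

lemma zero_in_band: "r \<in> zeros \<Longrightarrow> r \<in> band r"
  using upper_edge lower_edge by (simp add: band_def)

lemma pderiv_nonzero_on_band:
  assumes "r \<in> zeros" "x \<in> band r" shows "poly f' x \<noteq> 0"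
  by (rule pderiv_nonzero[OF abs_f_less_one_on_band[OF assms]])

lemma pderiv_sign_on_band:
  assumes r: "r \<in> zeros" and x: "x \<in> band r"
  shows "0 < poly f' x * sgn (poly f' r)"
proof (rule ccontr)
  assume neg: "\<not> 0 < poly f' x * sgn (poly f' r)"
  have nr: "poly f' r \<noteq> 0" using pderiv_nonzero_on_band[OF r zero_in_band[OF r]] .
  have nx: "poly f' x \<noteq> 0" using pderiv_nonzero_on_band[OF r x] .
  have "connected (poly f' ` band r)" unfolding band_def
    by (intro connected_continuous_image continuous_intros connected_Ioo)
  moreover have "poly f' r \<in> poly f' ` band r" "poly f' x \<in> poly f' ` band r"
    using x zero_in_band[OF r] by auto
  ultimately have "0 \<in> poly f' ` band r"
    using neg nr nx connectedD_interval[of "poly f' ` band r" "poly f' r" "poly f' x" 0]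
      connectedD_interval[of "poly f' ` band r" "poly f' x" "poly f' r" 0]
    by (auto simp: sgn_if not_less mult_le_0_iff split: if_splits)
  then show False using pderiv_nonzero_on_band[OF r] by force
qed

lemma poly_f_strict_mono_on_closed_band:
  assumes r: "r \<in> zeros" and xy: "lower_edge r \<le> x" "x < y" "y \<le> upper_edge r"
  shows "sgn (poly f' r) * poly f x < sgn (poly f' r) * poly f y"
proof -
  obtain z where z: "x < z" "z < y" "poly f y - poly f x = (y - x) * poly f' z"
    using poly_MVT[OF xy(2), of f] by auto
  then have "z \<in> band r" using xy by (simp add: band_def)
  from pderiv_sign_on_band[OF r this] have "0 < (y - x) * (poly f' z * sgn (poly f' r))"
    using mult_pos_pos[of "y - x" "poly f' z * sgn (poly f' r)"] xy by simp
  also have "\<dots> = sgn (poly f' r) * poly f y - sgn (poly f' r) * poly f x"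
    using z(3) by (metis (no_types, opaque_lifting) mult.assoc mult.commute right_diff_distrib)
  finally show ?thesis by simp
qed

lemma inj_on_band: "r \<in> zeros \<Longrightarrow> inj_on (poly f) (band r)"
proof (rule linorder_inj_onI')
  fix x y assume "r \<in> zeros" "x \<in> band r" "y \<in> band r" "x < y"
  then show "poly f x \<noteq> poly f y"
    using poly_f_strict_mono_on_closed_band[of r x y] by (auto simp: band_def)
qed

lemma band_surj:
  assumes r: "r \<in> zeros" and c: "\<bar>c\<bar> < 1"
  shows "\<exists>x \<in> band r. poly f x = c"
proof -
  define s where "s = sgn (poly f' r)"
  have s: "s = 1 \<or> s = -1"
    using pderiv_nonzero_on_band[OF r zero_in_band[OF r]] by (auto simp: s_def sgn_if)
  have "poly f r = 0" using r by (simp add: zeros_def)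
  then have "0 < s * poly f (upper_edge r)" "s * poly f (lower_edge r) < 0"
    using poly_f_strict_mono_on_closed_band[OF r, of r "upper_edge r"]
      poly_f_strict_mono_on_closed_band[OF r, of "lower_edge r" r] upper_edge(1)[OF r] lower_edge(1)[OF r]
    by (auto simp: s_def)
  then have "1 \<le> s * poly f (upper_edge r)" "s * poly f (lower_edge r) \<le> -1"
    using s upper_edge(2)[OF r] lower_edge(2)[OF r] by auto
  then have "poly (smult s (f - [:c:])) (lower_edge r) < 0" "0 < poly (smult s (f - [:c:])) (upper_edge r)"
    using s c by (auto simp: algebra_simps)
  moreover have "lower_edge r < upper_edge r" using upper_edge(1)[OF r] lower_edge(1)[OF r] by simp
  ultimately obtain x where "lower_edge r < x" "x < upper_edge r" "poly (smult s (f - [:c:])) x = 0"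
    using poly_IVT_pos by blast
  then show ?thesis using s by (intro bexI[of _ x]) (auto simp: band_def)
qed

lemma band_point:
  assumes r: "r \<in> zeros" and c: "\<bar>c\<bar> < 1"
  shows "band_point r c \<in> band r" "poly f (band_point r c) = c"
proof -
  have "\<exists>!x. x \<in> band r \<and> poly f x = c"
    using band_surj[OF r c] inj_on_band[OF r] by (auto simp: inj_on_def)
  from theI'[OF this] show "band_point r c \<in> band r" "poly f (band_point r c) = c"
    by (auto simp: band_point_def)
qed

lemma band_point_eq:
  assumes "r \<in> zeros" "x \<in> band r" shows "band_point r (poly f x) = x"
  using band_point[OF assms(1) abs_f_less_one_on_band[OF assms]] inj_on_band[OF assms(1)] assms(2)
  by (auto simp: inj_on_def)

lemma DERIV_band_point:
  assumes r: "r \<in> zeros" and c: "\<bar>c\<bar> < 1"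
  shows "(band_point r has_real_derivative inverse (poly f' (band_point r c))) (at c)"
proof (rule DERIV_inverse_function[where f = "poly f" and a = "-1" and b = 1])
  have "open (band r)" by (simp add: band_def)
  then obtain d where d: "d > 0" "cball (band_point r c) d \<subseteq> band r"
    using band_point(1)[OF r c] open_contains_cball by blast
  have "isCont (band_point r) (poly f (band_point r c))"
  proof (rule isCont_inverse_function[where f = "poly f" and x = "band_point r c", OF d(1)])
    fix z assume "\<bar>z - band_point r c\<bar> \<le> d"
    then have "z \<in> band r" using d(2) by (auto simp: dist_real_def abs_minus_commute)
    then show "band_point r (poly f z) = z" by (rule band_point_eq[OF r])
  qed simp
  then show "isCont (band_point r) c" by (simp add: band_point(2)[OF r c])
  show "poly f' (band_point r c) \<noteq> 0" by (rule pderiv_nonzero_on_band[OF r band_point(1)[OF r c]])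
  show "(poly f has_real_derivative poly f' (band_point r c)) (at (band_point r c))" by (rule poly_DERIV)
  show "poly f (band_point r y) = y" if "-1 < y" "y < 1" for y using band_point(2)[OF r, of y] that by auto
qed (use c in auto)

lemma abs_cos_less_one: "\<lbrakk>0 < \<theta>; \<theta> < pi\<rbrakk> \<Longrightarrow> \<bar>cos \<theta>\<bar> < 1"
  using cos_monotone_0_pi[of 0 \<theta>] cos_monotone_0_pi[of \<theta> pi] by (auto simp: abs_less_iff)

lemma energy:
  assumes "r \<in> zeros" "0 < \<theta>" "\<theta> < pi"
  shows "energy r \<theta> \<in> band r" "poly f (energy r \<theta>) = cos \<theta>" "poly f' (energy r \<theta>) \<noteq> 0"
  using band_point[OF assms(1) abs_cos_less_one[OF assms(2,3)]] pderiv_nonzero_on_band[OF assms(1)]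
  by (auto simp: energy_def)

lemma DERIV_energy:
  assumes r: "r \<in> zeros" and \<theta>: "0 < \<theta>" "\<theta> < pi"
  shows "(energy r has_real_derivative energy' r \<theta>) (at \<theta>)"
    and "(energy' r has_real_derivative energy'' r \<theta>) (at \<theta>)"
    and "(energy'' r has_real_derivative energy''' r \<theta>) (at \<theta>)"
proof -
  note nz = energy(3)[OF r \<theta>]
  have "((\<lambda>\<theta>. band_point r (cos \<theta>)) has_real_derivative
      inverse (poly f' (band_point r (cos \<theta>))) * - sin \<theta>) (at \<theta>)"
    by (rule DERIV_chain2[OF DERIV_band_point[OF r abs_cos_less_one[OF \<theta>]] DERIV_cos])
  then show 1: "(energy r has_real_derivative energy' r \<theta>) (at \<theta>)"
    unfolding energy_def[abs_def] energy'_def by (simp add: field_simps)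
  have p: "((\<lambda>\<theta>. poly q (energy r \<theta>)) has_real_derivative poly (pderiv q) (energy r \<theta>) * energy' r \<theta>) (at \<theta>)" for q
    by (rule DERIV_chain2[OF poly_DERIV 1])
  have "((\<lambda>\<theta>. - sin \<theta> / poly f' (energy r \<theta>)) has_real_derivative energy'' r \<theta>) (at \<theta>)"
    by (rule DERIV_cong, (rule derivative_eq_intros refl p nz)+)
       (use nz in \<open>simp add: energy''_def energy'_def field_simps power2_eq_square\<close>)
  then show 2: "(energy' r has_real_derivative energy'' r \<theta>) (at \<theta>)"
    unfolding energy'_def[abs_def] .
  have eq: "energy' r \<theta> * poly f' (energy r \<theta>) = - sin \<theta>"
    "energy'' r \<theta> * poly f' (energy r \<theta>) = - (cos \<theta> + poly f'' (energy r \<theta>) * (energy' r \<theta>)\<^sup>2)"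
    using nz by (simp_all add: energy'_def energy''_def)
  have "((\<lambda>\<theta>. - (cos \<theta> + poly f'' (energy r \<theta>) * (energy' r \<theta>)\<^sup>2) / poly f' (energy r \<theta>))
      has_real_derivative energy''' r \<theta>) (at \<theta>)"
  proof (rule DERIV_cong)
    show "((\<lambda>\<theta>. - (cos \<theta> + poly f'' (energy r \<theta>) * (energy' r \<theta>)\<^sup>2) / poly f' (energy r \<theta>))
      has_real_derivative ((- (- sin \<theta> + (poly f''' (energy r \<theta>) * energy' r \<theta> * (energy' r \<theta>)\<^sup>2
        + 2 * energy'' r \<theta> * energy' r \<theta> * poly f'' (energy r \<theta>)))) * poly f' (energy r \<theta>)
        - (- (cos \<theta> + poly f'' (energy r \<theta>) * (energy' r \<theta>)\<^sup>2)) * (poly f'' (energy r \<theta>) * energy' r \<theta>))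
        / (poly f' (energy r \<theta>) * poly f' (energy r \<theta>))) (at \<theta>)"
      by (rule derivative_eq_intros refl p 2 nz)+ simp
  qed (unfold eq(2)[symmetric], use nz in \<open>simp add: energy'''_def field_simps power2_eq_square power3_eq_cube\<close>)
  then show "(energy'' r has_real_derivative energy''' r \<theta>) (at \<theta>)"
    unfolding energy''_def[abs_def] .
qed

lemma energy'_sign:
  assumes r: "r \<in> zeros" and \<theta>: "0 < \<theta>" "\<theta> < pi"
  shows "energy' r \<theta> * sgn (poly f' r) < 0"
proof -
  have "0 < poly f' (energy r \<theta>) * sgn (poly f' r)" by (rule pderiv_sign_on_band[OF r energy(1)[OF r \<theta>]])
  then have "0 < sgn (poly f' r) / poly f' (energy r \<theta>)"
    by (auto simp: zero_less_mult_iff zero_less_divide_iff)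
  then have "0 < sin \<theta> * (sgn (poly f' r) / poly f' (energy r \<theta>))"
    using mult_pos_pos sin_gt_zero[OF \<theta>] by blast
  also have "\<dots> = - (energy' r \<theta> * sgn (poly f' r))" by (simp add: energy'_def)
  finally show ?thesis by simp
qed

text \<open>The band of the smaller zero cannot reach the larger zero, by injectivity of
  \<open>f\<close>, and its upper edge, where |f| \<ge> 1, cannot lie inside the other band.
  Disjointness makes the energies of different bands at equal \<theta> distinct, as orthogonality
  requires.\<close>

lemma bands_disjoint:
  assumes "r \<in> zeros" "s \<in> zeros" "r \<noteq> s"
  shows "band r \<inter> band s = {}"
proof -
  have *: "band r \<inter> band s = {}" if rs: "r \<in> zeros" "s \<in> zeros" "r < s" for r s
  proof -
    have "upper_edge r \<le> s"
    proof (rule ccontr)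
      assume "\<not> upper_edge r \<le> s"
      then have "s \<in> band r" using rs lower_edge(1)[OF rs(1)] by (simp add: band_def)
      then show False using inj_on_band[OF rs(1)] zero_in_band[OF rs(1)] rs by (auto simp: inj_on_def zeros_def)
    qed
    moreover have "upper_edge r \<le> lower_edge s"
    proof (rule ccontr)
      assume "\<not> upper_edge r \<le> lower_edge s"
      then have "upper_edge r \<in> band s" using \<open>upper_edge r \<le> s\<close> upper_edge(1)[OF rs(2)] by (simp add: band_def)
      then show False using abs_f_less_one_on_band[OF rs(2)] upper_edge(2)[OF rs(1)] by fastforce
    qed
    ultimately show ?thesis by (auto simp: band_def)
  qed
  show ?thesis using *[of r s] *[of s r] assms by (cases r s rule: linorder_cases) auto
qed

text \<open>If a, b, c are the derivatives of the increasing angle at E, then |E'| = 1 / a, E'' = -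
  b / a^3, and up to sign E''' = c / a^4 - 3 b^2 / a^5. The Schwarzian bound gives c / a^4 \<ge> 6 k
  / a^2 + (3/2) b^2 / a^5, so it remains to make b^2 / a^5 = a E''^2 small and to keep 1 / a away
  from zero. The latter also follows from E'' being small: a small E' forces a small sine, hence a
  cosine of modulus at least 1/2 and a sizeable E''. This covers the band edges.\<close>

lemma energy_inflection:
  obtains \<epsilon> c where "\<epsilon> > 0" "c > 0"
    "\<And>r \<theta>. \<lbrakk>r \<in> zeros; 0 < \<theta>; \<theta> < pi; \<bar>energy'' r \<theta>\<bar> \<le> \<epsilon>\<rbrakk> \<Longrightarrow> sgn (poly f' r) * energy''' r \<theta> \<ge> c"
proof -
  obtain \<rho> where \<rho>: "\<rho> > 0" "\<And>x. \<bar>poly f x\<bar> < 1 \<Longrightarrow> \<bar>x\<bar> \<le> \<rho>" using spectrum_bounded by blast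
  have bp: "\<exists>D. \<forall>x\<in>{-\<rho>..\<rho>}. \<bar>poly q x\<bar> \<le> D" for q
  proof -
    have "bounded (poly q ` {-\<rho>..\<rho>})"
      by (intro compact_imp_bounded compact_continuous_image continuous_intros) auto
    then show ?thesis by (auto simp: bounded_iff)
  qed
  from bp[of f'] bp[of f''] obtain D1 D2 where D12: "\<And>x. x\<in>{-\<rho>..\<rho>} \<Longrightarrow> \<bar>poly f' x\<bar> \<le> D1"
    "\<And>x. x\<in>{-\<rho>..\<rho>} \<Longrightarrow> \<bar>poly f'' x\<bar> \<le> D2" by blast
  define D where "D = max 1 (max D1 D2)"
  have D: "D \<ge> 1" "\<And>x. \<bar>x\<bar> \<le> \<rho> \<Longrightarrow> \<bar>poly f' x\<bar> \<le> D" "\<And>x. \<bar>x\<bar> \<le> \<rho> \<Longrightarrow> \<bar>poly f'' x\<bar> \<le> D"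
  proof -
    fix x :: real assume "\<bar>x\<bar> \<le> \<rho>"
    then have "x \<in> {-\<rho>..\<rho>}" by auto
    from D12(1)[OF this] D12(2)[OF this] show "\<bar>poly f' x\<bar> \<le> D" "\<bar>poly f'' x\<bar> \<le> D"
      by (auto simp: D_def)
  qed (simp add: D_def)
  obtain k where k: "k > 0" and schw: "\<And>x. \<bar>poly f x\<bar> < 1 \<Longrightarrow>
    \<exists>S a b c. S\<^sup>2 = 1 - (poly f x)\<^sup>2 \<and> a > 0 \<and> poly f' x = - S * a \<and>
      poly f'' x = - poly f x * a\<^sup>2 - S * b \<and> poly f''' x = S * a ^ 3 - 3 * poly f x * a * b - S * c \<and>
      k * a ^ 3 \<le> a * c / 6 - b\<^sup>2 / 4"
    using uniform_schwarzian by metis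
  \<comment> \<open>If |E'| \<le> \<eta>, then sin \<theta> \<le> D \<eta> = 1/2, which leaves at
    least 1/2 for the modulus of the cosine.\<close>
  define \<eta> where "\<eta> = 1 / (2 * D)"
  have \<eta>: "\<eta> > 0" "D * \<eta> = 1/2" using D(1) by (auto simp: \<eta>_def)
  \<comment> \<open>The first entry contradicts the inequality 1/4 \<le> |E''| D reached in
    \<open>big\<close>. The second makes (3/2) a E''^2 at most 3 k \<eta>^2, which is half of the
    main term 6 k \<eta>^2.\<close>
  define \<epsilon> where "\<epsilon> = min (1 / (8 * D)) (sqrt (2 * k * \<eta> ^ 3))"
  have \<epsilon>: "\<epsilon> > 0" "\<epsilon> * D \<le> 1/8" "\<epsilon>\<^sup>2 \<le> 2 * k * \<eta> ^ 3"
  proof -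
    show "\<epsilon> > 0" using D(1) k \<eta> by (simp add: \<epsilon>_def)
    have "\<epsilon> * D \<le> 1 / (8 * D) * D" using D(1) by (intro mult_right_mono) (auto simp: \<epsilon>_def)
    then show "\<epsilon> * D \<le> 1/8" using D(1) by simp
    have "\<epsilon>\<^sup>2 \<le> (sqrt (2 * k * \<eta> ^ 3))\<^sup>2" using \<open>\<epsilon> > 0\<close> by (intro power_mono) (auto simp: \<epsilon>_def)
    then show "\<epsilon>\<^sup>2 \<le> 2 * k * \<eta> ^ 3" using k \<eta> by simp
  qed
  show ?thesis
  proof (rule that[of \<epsilon> "3 * k * \<eta>\<^sup>2"])
    show "3 * k * \<eta>\<^sup>2 > 0" using k \<eta> by simp
    fix r \<theta> assume r: "r \<in> zeros" and \<theta>: "0 < \<theta>" "\<theta> < pi" and small: "\<bar>energy'' r \<theta>\<bar> \<le> \<epsilon>"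
    define x where "x = energy r \<theta>"
    define E1 E2 where "E1 = energy' r \<theta>" "E2 = energy'' r \<theta>"
    have fx: "poly f x = cos \<theta>" "poly f' x \<noteq> 0" using energy[OF r \<theta>] by (auto simp: x_def)
    have lt: "\<bar>poly f x\<bar> < 1" using abs_cos_less_one[OF \<theta>] by (simp add: fx)
    have b1: "\<bar>poly f' x\<bar> \<le> D" and b2: "\<bar>poly f'' x\<bar> \<le> D" using D \<rho>(2)[OF lt] by auto
    define s where "s = sin \<theta>"
    have s: "s > 0" "s\<^sup>2 = 1 - (cos \<theta>)\<^sup>2" using sin_gt_zero[OF \<theta>] by (auto simp: s_def sin_squared_eq)
    have e1: "E1 * poly f' x = - s" and e2: "E2 * poly f' x = - (cos \<theta> + poly f'' x * E1\<^sup>2)"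
      using fx by (simp_all add: E1_E2_def energy'_def energy''_def s_def x_def)
    have big: "\<eta> < \<bar>E1\<bar>"
    proof (rule ccontr)
      assume "\<not> \<eta> < \<bar>E1\<bar>"
      then have le: "\<bar>E1\<bar> \<le> \<eta>" by simp
      have "s = \<bar>E1\<bar> * \<bar>poly f' x\<bar>" using e1 s(1) by (metis abs_minus_cancel abs_mult abs_of_pos)
      also have "\<dots> \<le> \<eta> * D" using le b1 by (intro mult_mono) auto
      finally have "s \<le> 1/2" using \<eta> by (simp add: mult.commute)
      then have "s\<^sup>2 \<le> (1/2)\<^sup>2" using s(1) by (intro power_mono) auto
      then have "(1/2)\<^sup>2 \<le> (cos \<theta>)\<^sup>2" using s(2) by (simp add: power2_eq_square)
      then have c: "1/2 \<le> \<bar>cos \<theta>\<bar>" using abs_le_square_iff[of "1/2" "cos \<theta>"] by simp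
      have "\<bar>poly f'' x * E1\<^sup>2\<bar> \<le> D * \<eta>\<^sup>2" unfolding abs_mult
        using b2 le by (intro mult_mono) (auto simp: abs_le_square_iff[symmetric])
      also have "\<dots> = 1/2 * \<eta>" using \<eta>(2) by (simp add: power2_eq_square)
      also have "\<dots> \<le> 1/4" using D(1) by (simp add: \<eta>_def field_simps)
      finally have "1/4 \<le> \<bar>cos \<theta> + poly f'' x * E1\<^sup>2\<bar>" using c by linarith
      also have "\<dots> = \<bar>E2\<bar> * \<bar>poly f' x\<bar>" using e2 by (metis abs_minus_cancel abs_mult)
      also have "\<dots> \<le> \<epsilon> * D" using small b1 \<epsilon>(1) by (intro mult_mono) (auto simp: E1_E2_def)
      finally show False using \<epsilon>(2) by simp
    qed
    obtain S a b c where S: "S\<^sup>2 = 1 - (poly f x)\<^sup>2" and "a > 0" and p1: "poly f' x = - S * a"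
      and p2: "poly f'' x = - poly f x * a\<^sup>2 - S * b"
      and p3: "poly f''' x = S * a ^ 3 - 3 * poly f x * a * b - S * c"
      and ge: "k * a ^ 3 \<le> a * c / 6 - b\<^sup>2 / 4" using schw[OF lt] by blast
    have "S\<^sup>2 = s\<^sup>2" using S s(2) fx by simp
    then consider "S = s" | "S = -s" using power2_eq_iff by blast
    then obtain \<sigma> where \<sigma>: "\<sigma> = 1 \<or> \<sigma> = -1" "S = \<sigma> * s" by cases force+
    have S0: "S \<noteq> 0" using \<sigma> s by auto
    have E1: "E1 = \<sigma> / a"
    proof -
      have "E1 = s / (S * a)" using e1 fx(2) by (simp add: p1 field_simps)
      then show ?thesis using \<sigma> s \<open>a > 0\<close> by (auto simp: field_simps)
    qed
    have E1sq: "E1\<^sup>2 = 1 / a\<^sup>2" "E1 ^ 3 = \<sigma> / a ^ 3" using \<sigma>(1) by (auto simp: E1 power_divide)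
    have E2: "E2 = - b / a ^ 3"
    proof -
      have "E2 * (- S * a) = S * b / a\<^sup>2" using e2 \<open>a > 0\<close> by (simp add: p1 p2 fx E1sq field_simps)
      then have "S * (E2 * a ^ 3 + b) = 0"
        using \<open>a > 0\<close> by (simp add: field_simps power2_eq_square power3_eq_cube)
      then have "E2 * a ^ 3 + b = 0" using S0 by (simp only: mult_eq_0_iff) simp
      then show ?thesis using \<open>a > 0\<close> by (simp add: field_simps)
    qed
    have E3: "energy''' r \<theta> = \<sigma> * (3 * b\<^sup>2 / a ^ 5 - c / a ^ 4)"
    proof -
      have s': "s = \<sigma> * S" using \<sigma> by auto
      have "energy''' r \<theta> * poly f' x = s - 3 * poly f'' x * E1 * E2 - poly f''' x * E1 ^ 3"
        using fx(2) by (simp add: energy'''_def E1_E2_def x_def s_def)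
      then have "energy''' r \<theta> * (- S * a) = s - 3 * poly f'' x * E1 * E2 - poly f''' x * E1 ^ 3"
        by (simp only: p1)
      also have "\<dots> = \<sigma> * (3 * b\<^sup>2 / a ^ 5 - c / a ^ 4) * (- S * a)"
        using \<sigma>(1) \<open>a > 0\<close> unfolding p2 p3 fx(1) E1sq E2 E1 s'
        by (elim disjE) (simp_all add: field_simps eval_nat_numeral)
      finally show ?thesis using S0 \<open>a > 0\<close> by simp
    qed
    have "E1 * sgn (poly f' r) < 0" using energy'_sign[OF r \<theta>] by (simp add: E1_E2_def)
    then have sg: "sgn (poly f' r) = - \<sigma>"
      using \<sigma>(1) \<open>a > 0\<close> by (auto simp: E1 sgn_if zero_less_divide_iff divide_less_0_iff split: if_splits)
    have "sgn (poly f' r) * energy''' r \<theta> = c / a ^ 4 - 3 * b\<^sup>2 / a ^ 5"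
      using \<sigma>(1) by (auto simp: sg E3)
    moreover have "6 * k / a\<^sup>2 + 3/2 * (b\<^sup>2 / a ^ 5) \<le> c / a ^ 4"
    proof -
      have "6 * k * a ^ 3 + 3/2 * b\<^sup>2 \<le> a * c" using ge by simp
      then have "(6 * k * a ^ 3 + 3/2 * b\<^sup>2) / a ^ 5 \<le> a * c / a ^ 5" using \<open>a > 0\<close> by (intro divide_right_mono) auto
      moreover have "a * c / a ^ 5 = c / a ^ 4" "6 * k * a ^ 3 / a ^ 5 = 6 * k / a\<^sup>2"
        using \<open>a > 0\<close> by (simp_all add: eval_nat_numeral)
      ultimately show ?thesis by (simp add: add_divide_distrib)
    qed
    moreover have "3/2 * (b\<^sup>2 / a ^ 5) \<le> 3 * k * \<eta>\<^sup>2" "6 * k * \<eta>\<^sup>2 \<le> 6 * k / a\<^sup>2"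
    proof -
      have a\<eta>: "\<eta> < 1 / a" using big \<sigma>(1) \<open>a > 0\<close> by (auto simp: E1)
      have "\<eta>\<^sup>2 \<le> (1 / a)\<^sup>2" using a\<eta> \<eta> by (intro power_mono) auto
      then have "6 * k * \<eta>\<^sup>2 \<le> 6 * k * (1 / a)\<^sup>2" using k by (intro mult_left_mono) auto
      then show "6 * k * \<eta>\<^sup>2 \<le> 6 * k / a\<^sup>2" by (simp add: power_divide)
      have "b\<^sup>2 / a ^ 5 = a * E2\<^sup>2"
        using \<open>a > 0\<close> by (simp add: E2 power_divide field_simps eval_nat_numeral)
      also have "\<dots> \<le> 1 / \<eta> * \<epsilon>\<^sup>2"
      proof (intro mult_mono)
        show "a \<le> 1 / \<eta>" using a\<eta> \<eta> \<open>a > 0\<close> by (simp add: field_simps)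
        show "E2\<^sup>2 \<le> \<epsilon>\<^sup>2" using small \<epsilon>(1) by (auto simp: E1_E2_def abs_le_square_iff[symmetric])
      qed (use \<eta> in auto)
      also have "\<dots> \<le> 1 / \<eta> * (2 * k * \<eta> ^ 3)" using \<epsilon>(3) \<eta> by (intro mult_left_mono) auto
      also have "\<dots> = 2 * k * \<eta>\<^sup>2" using \<eta> by (simp add: power2_eq_square power3_eq_cube)
      finally show "3/2 * (b\<^sup>2 / a ^ 5) \<le> 3 * k * \<eta>\<^sup>2" by simp
    qed
    ultimately show "sgn (poly f' r) * energy''' r \<theta> \<ge> 3 * k * \<eta>\<^sup>2" by simp
  qed (fact \<epsilon>(1))
qed

end

section \<open>Periodic Schroedinger operators\<close>

text \<open>The matrix D = 1 - X X^* is an orthogonal projection, so the sum of the squared moduli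
  of its entries equals its trace, which is p - p = 0. For Bloch vectors this turns orthonormality
  into completeness.\<close>

lemma orthonormal_columns_imp_rows:
  fixes X :: "nat \<Rightarrow> nat \<Rightarrow> complex"
  assumes "\<And>i j. \<lbrakk>i < p; j < p\<rbrakk> \<Longrightarrow> (\<Sum>m<p. cnj (X m i) * X m j) = (if i = j then 1 else 0)"
    and "m < p" "n < p"
  shows "(\<Sum>j<p. X m j * cnj (X n j)) = (if m = n then 1 else 0)"
proof -
  define P where "P m n = (\<Sum>j<p. X m j * cnj (X n j))" for m n
  define D where "D m n = (if m = n then 1 else 0) - P m n" for m n
  have PP: "(\<Sum>n<p. P m n * P n m) = P m m" for m
  proof -
    have "(\<Sum>n<p. P m n * P n m) = (\<Sum>n<p. \<Sum>j<p. \<Sum>k<p. (X m j * cnj (X m k)) * (cnj (X n j) * X n k))"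
      unfolding P_def sum_product by (intro sum.cong refl) (simp add: mult_ac)
    also have "\<dots> = (\<Sum>j<p. \<Sum>n<p. \<Sum>k<p. (X m j * cnj (X m k)) * (cnj (X n j) * X n k))"
      by (rule sum.swap)
    also have "\<dots> = (\<Sum>j<p. \<Sum>k<p. \<Sum>n<p. (X m j * cnj (X m k)) * (cnj (X n j) * X n k))"
      by (intro sum.cong refl sum.swap)
    also have "\<dots> = (\<Sum>j<p. \<Sum>k<p. (X m j * cnj (X m k)) * (if j = k then 1 else 0))"
      by (intro sum.cong refl) (simp add: assms(1) flip: sum_distrib_left)
    also have "\<dots> = P m m" by (simp add: P_def if_distrib cong: if_cong)
    finally show ?thesis .
  qed
  have DD: "(\<Sum>n<p. of_real ((cmod (D m n))\<^sup>2)) = D m m" if "m < p" for m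
  proof -
    have cD: "cnj (D m n) = D n m" for n by (simp add: D_def P_def mult.commute)
    have "(\<Sum>n<p. of_real ((cmod (D m n))\<^sup>2)) = (\<Sum>n<p. D m n * D n m)"
      by (simp add: complex_norm_square cD del: of_real_power)
    also have "\<dots> = (\<Sum>n<p. (if m = n then 1 - 2 * P m m else 0) + P m n * P n m)"
      by (intro sum.cong refl) (simp add: D_def algebra_simps)
    also have "\<dots> = D m m" using that by (simp add: sum.distrib PP D_def)
    finally show ?thesis .
  qed
  have "of_real (\<Sum>m<p. \<Sum>n<p. (cmod (D m n))\<^sup>2) = (\<Sum>m<p. D m m)"
    using DD by simp
  also have "\<dots> = of_nat p - (\<Sum>m<p. \<Sum>j<p. cnj (X m j) * X m j)"
    by (simp add: D_def P_def sum_subtractf mult.commute)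
  also have "(\<Sum>m<p. \<Sum>j<p. cnj (X m j) * X m j) = (\<Sum>j<p. \<Sum>m<p. cnj (X m j) * X m j)"
    by (rule sum.swap)
  also have "\<dots> = of_nat p" using assms(1) by simp
  finally have "(\<Sum>m<p. \<Sum>n<p. (cmod (D m n))\<^sup>2) = 0"
    by (metis diff_self of_real_eq_0_iff)
  then have "(cmod (D m n))\<^sup>2 = 0"
    using assms(2,3) by (simp add: sum_nonneg_eq_0_iff sum_nonneg)
  then have "D m n = 0" by simp
  then show ?thesis by (simp add: D_def P_def)
qed

locale periodic_op =
  fixes V :: "int \<Rightarrow> real" and p :: nat
  assumes p_pos: "p > 0" and periodic: "V (n + int p) = V n"
begin

text \<open>Solutions of u (n + 1) = (z - V n) u n - u (n - 1) with u 0 = a and u 1 = b, as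
  polynomials in the spectral parameter z. The potential at site n + 1 produces the value at n + 2,
  which explains the index in the last equation.\<close>

fun transfer :: "real poly \<Rightarrow> real poly \<Rightarrow> nat \<Rightarrow> real poly" where
  "transfer a b 0 = a"
| "transfer a b (Suc 0) = b"
| "transfer a b (Suc (Suc n)) = [:- V (int n + 1), 1:] * transfer a b (Suc n) - transfer a b n"

abbreviation "C \<equiv> transfer 1 0"
abbreviation "S \<equiv> transfer 0 1"

lemma wronskian: "C n * S (Suc n) - C (Suc n) * S n = 1"
proof (induction n)
  case (Suc n)
  have "C (Suc n) * S (Suc (Suc n)) - C (Suc (Suc n)) * S (Suc n) = C n * S (Suc n) - C (Suc n) * S n"
  proof -
    have "a * (L * b - d) - (L * a - c) * b = c * b - a * d" for a b c d L :: "real poly"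
      by (simp add: algebra_simps)
    then show ?thesis unfolding transfer.simps .
  qed
  with Suc show ?case by simp
qed simp

lemma degree_C: "degree (C (Suc n)) \<le> n \<and> degree (C n) \<le> n"
proof (induction n)
  case (Suc n)
  have "degree ([:- V (int n + 1), 1:] * C (Suc n)) \<le> 1 + n"
    by (rule order.trans[OF degree_mult_le]) (use Suc in auto)
  then have "degree (C (Suc (Suc n))) \<le> Suc n"
    unfolding transfer.simps using Suc by (intro degree_diff_le) auto
  with Suc show ?case by auto
qed simp

lemma degree_S: "degree (S (Suc n)) = n \<and> coeff (S (Suc n)) n = 1 \<and> degree (S n) \<le> n"
proof (induction n)
  case (Suc n)
  let ?L = "[:- V (int n + 1), 1:] * S (Suc n)"
  have ne: "S (Suc n) \<noteq> 0" using Suc by auto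
  have L: "degree ?L = Suc n" by (subst degree_mult_eq) (use Suc ne in simp_all)
  have L': "lead_coeff ?L = 1" by (subst lead_coeff_mult) (use Suc in simp)
  have d: "degree (S (Suc (Suc n))) = Suc n"
    unfolding transfer.simps diff_conv_add_uminus
    by (subst degree_add_eq_left) (use Suc L in simp_all)
  have "coeff (S n) (Suc n) = 0" using Suc by (intro coeff_eq_0) simp
  then have "coeff (S (Suc (Suc n))) (Suc n) = 1"
    using L L' by (simp add: transfer.simps coeff_diff)
  with d Suc show ?case by auto
qed simp

text \<open>Half the trace of the monodromy matrix, which maps the values of a solution at sites 0
  and 1 to those at p and p + 1.\<close>

definition half_disc :: "real poly" where
  "half_disc = smult (1/2) (C p + S (Suc p))"

lemma degree_half_disc: "degree half_disc = p" and lead_coeff_half_disc: "lead_coeff half_disc = 1/2"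
proof -
  obtain q where q: "p = Suc q" using p_pos by (cases p) auto
  have lt: "degree (C p) < degree (S (Suc p))" using degree_C[of q] degree_S[of p] q by simp
  then have "degree (C p + S (Suc p)) = p" using degree_S[of p] by (simp add: degree_add_eq_right)
  moreover have "lead_coeff (C p + S (Suc p)) = 1"
    using lead_coeff_add_le[OF lt] degree_S[of p] by simp
  ultimately show "degree half_disc = p" "lead_coeff half_disc = 1/2" by (simp_all add: half_disc_def)
qed

lemma transfer_recurrence:
  fixes a b z :: complex
  defines "u \<equiv> \<lambda>n. a * cpoly (C n) z + b * cpoly (S n) z"
  shows "u (Suc (Suc n)) = (z - of_real (V (int n + 1))) * u (Suc n) - u n"
  unfolding u_def transfer.simps cpoly_diff cpoly_mult by (simp add: algebra_simps)

text \<open>The Wronskian of u and the conjugate of w changes at each site by the difference of the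
  spectral parameters times their product, because the real potential cancels. With equal parameters
  this gives reality of the spectrum; with two energies at equal quasi-momentum it gives
  orthogonality.\<close>

lemma green_identity:
  fixes u w :: "nat \<Rightarrow> complex"
  assumes u: "\<And>n. u (Suc (Suc n)) = (y - of_real (V (int n + 1))) * u (Suc n) - u n"
    and w: "\<And>n. w (Suc (Suc n)) = (z - of_real (V (int n + 1))) * w (Suc n) - w n"
  shows "(y - cnj z) * (\<Sum>n=1..N. u n * cnj (w n)) =
    (cnj (w N) * u (Suc N) - u N * cnj (w (Suc N))) - (cnj (w 0) * u 1 - u 0 * cnj (w 1))"
proof (induction N)
  case (Suc N)
  have "(\<Sum>n=1..Suc N. u n * cnj (w n)) = (\<Sum>n=1..N. u n * cnj (w n)) + u (Suc N) * cnj (w (Suc N))" by simp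
  then show ?case using Suc unfolding u[of N] w[of N] by (simp add: algebra_simps)
qed simp

lemma period_sum_shift:
  fixes g :: "nat \<Rightarrow> 'a::ab_group_add"
  assumes "g p = g 0"
  shows "(\<Sum>n=1..p. g n) = (\<Sum>n<p. g n)"
proof -
  have "(\<Sum>n<p. g (Suc n)) + g 0 = (\<Sum>n<p. g n) + g p"
    using sum.lessThan_Suc_shift[of g p] by (simp add: add.commute)
  moreover have "(\<Sum>n<p. g (Suc n)) = (\<Sum>n=1..p. g n)"
    by (rule sum.reindex_bij_witness[of _ "\<lambda>n. n - 1" Suc]) auto
  ultimately show ?thesis using assms by simp
qed

text \<open>If half the trace is c in [-1, 1], there is a solution with a multiplier \<mu> of
  modulus 1 over one period. The flux in Green's identity is then the same at both ends, so z - cnj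
  z times a positive sum vanishes.\<close>

lemma half_disc_reality:
  assumes "cpoly half_disc z = of_real c" "\<bar>c\<bar> \<le> 1"
  shows "Im z = 0"
proof -
  define cn sn where "cn n = cpoly (C n) z" "sn n = cpoly (S n) z" for n
  define \<mu> where "\<mu> = cis (arccos c)"
  have \<mu>: "cnj \<mu> * \<mu> = 1" "\<mu>\<^sup>2 = 2 * of_real c * \<mu> - 1"
  proof -
    show 1: "cnj \<mu> * \<mu> = 1" by (simp add: \<mu>_def cis_cnj cis_mult)
    have "\<mu> + cnj \<mu> = 2 * of_real c" using assms(2) by (simp add: \<mu>_def complex_eq_iff)
    then show "\<mu>\<^sup>2 = 2 * of_real c * \<mu> - 1" using 1
      by (metis add_diff_cancel_right' distrib_right power2_eq_square)
  qed
  have tr: "cn p + sn (Suc p) = 2 * of_real c"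
    using assms(1) by (simp add: half_disc_def cn_sn_def map_poly_of_real_add)
  have wr: "cn n * sn (Suc n) - cn (Suc n) * sn n = 1" for n
    using arg_cong[OF wronskian[of n], of "\<lambda>q. cpoly q z"] by (simp add: cn_sn_def del: transfer.simps)
  have base: "cn 0 = 1" "cn (Suc 0) = 0" "sn 0 = 0" "sn (Suc 0) = 1" by (simp_all add: cn_sn_def)
  have flux: "Im z = 0" if "\<And>n. u (Suc (Suc n)) = (z - of_real (V (int n + 1))) * u (Suc n) - u n"
    "cnj (u p) * u (Suc p) = cnj (u 0) * u (Suc 0)" "\<exists>n\<in>{1..p}. u n \<noteq> 0" for u
  proof -
    have "u p * cnj (u (Suc p)) = u 0 * cnj (u (Suc 0))"
      using arg_cong[OF that(2), of cnj] by simp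
    then have "(z - cnj z) * (\<Sum>n=1..p. u n * cnj (u n)) = 0"
      unfolding green_identity[of u z u z p, OF that(1) that(1)] by (simp add: that(2))
    moreover have "(\<Sum>n=1..p. u n * cnj (u n)) = of_real (\<Sum>n=1..p. (cmod (u n))\<^sup>2)"
      by (simp add: complex_norm_square del: of_real_power)
    moreover have "(\<Sum>n=1..p. (cmod (u n))\<^sup>2) > 0"
      using that(3) by (auto intro!: sum_pos2)
    ultimately show ?thesis by (auto simp: complex_eq_iff)
  qed
  show ?thesis
  proof (cases "sn p = 0 \<and> \<mu> = cn p")
    case True
    show ?thesis
    proof (rule flux[of sn])
      show "sn (Suc (Suc n)) = (z - of_real (V (int n + 1))) * sn (Suc n) - sn n" for n
        using transfer_recurrence[where a = 0 and b = 1 and z = z and n = n] by (simp add: cn_sn_def del: transfer.simps)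
      show "\<exists>n\<in>{1..p}. sn n \<noteq> 0" using base p_pos by (intro bexI[of _ "Suc 0"]) auto
    qed (use True base in simp)
  next
    case False
    \<comment> \<open>The values of \<open>u\<close> at sites 0 and 1 form an eigenvector of the
      monodromy matrix for \<mu>, unless both coefficients vanish. In that case, treated above,
      \<open>sn\<close> itself vanishes at 0 and at p, so both of its fluxes are zero.\<close>
    define u where "u n = sn p * cn n + (\<mu> - cn p) * sn n" for n
    have rec: "u (Suc (Suc n)) = (z - of_real (V (int n + 1))) * u (Suc n) - u n" for n
      using transfer_recurrence[where a = "sn p" and b = "\<mu> - cn p" and z = z and n = n] by (simp only: u_def cn_sn_def)
    have up: "u p = \<mu> * u 0" by (simp add: u_def base algebra_simps)
    have "u (Suc p) = \<mu> * u (Suc 0)"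
    proof -
      have s: "sn (Suc p) = 2 * of_real c - cn p" using tr by (simp add: algebra_simps)
      have "sn p * cn (Suc p) = cn p * sn (Suc p) - 1" using wr[of p] by (simp add: algebra_simps)
      then have "u (Suc p) = \<mu> * sn (Suc p) - 1" by (simp add: u_def algebra_simps)
      also have "\<dots> = \<mu>\<^sup>2 - \<mu> * cn p" unfolding \<mu>(2) s by (simp add: algebra_simps)
      finally show ?thesis by (simp add: u_def base power2_eq_square algebra_simps)
    qed
    show ?thesis
    proof (rule flux[of u])
      show "cnj (u p) * u (Suc p) = cnj (u 0) * u (Suc 0)"
        unfolding up \<open>u (Suc p) = \<mu> * u (Suc 0)\<close> using \<mu>(1)
        by (metis complex_cnj_mult mult.assoc mult.commute mult_1)
      show "\<exists>n\<in>{1..p}. u n \<noteq> 0"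
      proof (rule ccontr)
        assume "\<not> (\<exists>n\<in>{1..p}. u n \<noteq> 0)"
        then have "u (Suc 0) = 0" "u p = 0" using p_pos by auto
        moreover have "\<mu> \<noteq> 0" by (simp add: \<mu>_def)
        ultimately have "u 0 = 0" using up by simp
        with \<open>u (Suc 0) = 0\<close> False show False by (simp add: u_def base)
      qed
    qed (fact rec)
  qed
qed

sublocale banded_poly half_disc
  by unfold_locales (use p_pos half_disc_reality lead_coeff_half_disc in \<open>auto simp: degree_half_disc\<close>)

end

section \<open>Bloch waves and the propagator\<close>

text \<open>Integrands in the quasi-momentum are controlled only inside the open interval, because
  normalized Bloch vectors need not be regular at band edges; boundedness and continuity inside
  suffice.\<close>

lemma bounded_continuous_integrable_on_Ioo:
  fixes h :: "real \<Rightarrow> complex"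
  assumes "continuous_on {a<..<b} h" "\<And>x. x \<in> {a<..<b} \<Longrightarrow> cmod (h x) \<le> B"
  shows "h integrable_on {a<..<b}"
proof (rule measurable_bounded_by_integrable_imp_integrable)
  show "h \<in> borel_measurable (lebesgue_on {a<..<b})"
    by (intro continuous_imp_measurable_on_sets_lebesgue assms(1)) auto
  have "(\<lambda>x. B) integrable_on {a..b}" by (rule integrable_const_ivl)
  then show "(\<lambda>x. B) integrable_on {a<..<b}" by (simp add: integrable_on_open_interval_real)
qed (use assms(2) in auto)

context periodic_op
begin

lemma V_shift: "V (n + int k * int p) = V n"
proof (induction k)
  case (Suc k)
  have "V (n + int (Suc k) * int p) = V ((n + int k * int p) + int p)" by (simp add: algebra_simps)
  then show ?case using periodic Suc by simp
qed simp

text \<open>The real part of the Bloch vector after cos \<theta> has been replaced by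
  \<open>half_disc\<close>; its imaginary part is sin \<theta> times \<open>S n\<close>. This
  splitting makes products of Bloch vectors algebraic in the energy.\<close>

definition base_poly :: "nat \<Rightarrow> real poly" where
  "base_poly n = S p * C n + (half_disc - C p) * S n"

definition base :: "real \<Rightarrow> real \<Rightarrow> nat \<Rightarrow> complex" where
  "base r \<theta> n = Complex (poly (base_poly n) (energy r \<theta>)) (sin \<theta> * poly (S n) (energy r \<theta>))"

definition bloch :: "real \<Rightarrow> real \<Rightarrow> int \<Rightarrow> complex" where
  "bloch r \<theta> n = cis (\<theta> * of_int (n div int p)) * base r \<theta> (nat (n mod int p))"

definition bloch_norm :: "real \<Rightarrow> real \<Rightarrow> real" where
  "bloch_norm r \<theta> = (\<Sum>n<p. (cmod (base r \<theta> n))\<^sup>2)"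

text \<open>Only \<theta> in (0, pi) is used. The Bloch wave at - \<theta> is the complex conjugate
  and has the same energy, so taking the real part accounts for both.\<close>

definition density :: "real \<Rightarrow> int \<Rightarrow> int \<Rightarrow> real \<Rightarrow> real" where
  "density r m n \<theta> = Re (bloch r \<theta> m * cnj (bloch r \<theta> n)) / bloch_norm r \<theta>"

context
  fixes r \<theta> :: real
  assumes r: "r \<in> zeros" and \<theta>: "0 < \<theta>" "\<theta> < pi"
begin

lemma base_eq:
  "base r \<theta> n = of_real (poly (S p) (energy r \<theta>)) * cpoly (C n) (of_real (energy r \<theta>))
    + (cis \<theta> - of_real (poly (C p) (energy r \<theta>))) * cpoly (S n) (of_real (energy r \<theta>))"
  using energy(2)[OF r \<theta>] by (simp add: base_def base_poly_def complex_eq_iff)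

lemma base_recurrence:
  "base r \<theta> (Suc (Suc n)) = (of_real (energy r \<theta>) - of_real (V (int n + 1))) * base r \<theta> (Suc n) - base r \<theta> n"
  unfolding base_eq by (rule transfer_recurrence)

lemma base_1: "base r \<theta> (Suc 0) = cis \<theta> - of_real (poly (C p) (energy r \<theta>))"
  by (simp add: base_eq)

text \<open>The values of \<open>base\<close> at sites 0 and 1 form an eigenvector of the monodromy
  matrix for cis \<theta>, since that matrix has determinant 1 and trace 2 cos \<theta>. The
  periodic recurrence carries the relation to all sites.\<close>

lemma base_quasi_periodic: "base r \<theta> (n + p) = cis \<theta> * base r \<theta> n"
proof -
  define E where "E = energy r \<theta>"
  define cn sn where "cn n = complex_of_real (poly (C n) E)" "sn n = complex_of_real (poly (S n) E)" for n
  have b: "base r \<theta> n = sn p * cn n + (cis \<theta> - cn p) * sn n" for n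
    by (simp add: base_eq cn_sn_def E_def)
  have wr: "cn p * sn (Suc p) - cn (Suc p) * sn p = 1"
    using arg_cong[OF wronskian[of p], of "\<lambda>q. complex_of_real (poly q E)"] by (simp add: cn_sn_def del: transfer.simps)
  have tr: "cn p + sn (Suc p) = 2 * of_real (cos \<theta>)"
    using arg_cong[OF energy(2)[OF r \<theta>], of complex_of_real] by (simp add: half_disc_def cn_sn_def E_def)
  have sq: "cis \<theta> * cis \<theta> = 2 * of_real (cos \<theta>) * cis \<theta> - 1"
    using sin_cos_squared_add[of \<theta>] by (simp add: complex_eq_iff power2_eq_square algebra_simps)
  have 0: "base r \<theta> p = cis \<theta> * base r \<theta> 0" by (simp add: b cn_sn_def algebra_simps)
  have 1: "base r \<theta> (Suc p) = cis \<theta> * base r \<theta> (Suc 0)"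
  proof -
    have s: "sn (Suc p) = 2 * of_real (cos \<theta>) - cn p" using tr by (simp add: algebra_simps)
    have "sn p * cn (Suc p) = cn p * sn (Suc p) - 1" using wr by (simp add: algebra_simps)
    then have "base r \<theta> (Suc p) = cis \<theta> * sn (Suc p) - 1" by (simp add: b algebra_simps)
    also have "\<dots> = cis \<theta> * cis \<theta> - cis \<theta> * cn p" unfolding sq s by (simp add: algebra_simps)
    finally show ?thesis by (simp add: b cn_sn_def algebra_simps)
  qed
  have "base r \<theta> (n + p) = cis \<theta> * base r \<theta> n \<and> base r \<theta> (Suc n + p) = cis \<theta> * base r \<theta> (Suc n)" for n
  proof (induction n)
    case (Suc n)
    have "V (int (n + p) + 1) = V (int n + 1)" using periodic[of "int n + 1"] by (simp add: algebra_simps)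
    then have "base r \<theta> (Suc (Suc (n + p))) = cis \<theta> * base r \<theta> (Suc (Suc n))"
      using Suc by (simp add: base_recurrence[of "n + p"] base_recurrence[of n] right_diff_distrib mult.left_commute)
    then show ?case using Suc by simp
  qed (use 0 1 in simp)
  then show ?thesis by blast
qed

lemma bloch_shift: "bloch r \<theta> (n + int k * int p) = cis (\<theta> * real k) * bloch r \<theta> n"
proof -
  have "(n + int k * int p) div int p = n div int p + int k" "(n + int k * int p) mod int p = n mod int p"
    using p_pos by simp_all
  then show ?thesis by (simp add: bloch_def cis_mult algebra_simps)
qed

lemma bloch_of_nat: "bloch r \<theta> (int n) = base r \<theta> n"
proof -
  have *: "base r \<theta> (k * p + m) = cis (\<theta> * real k) * base r \<theta> m" for k m
  proof (induction k)
    case (Suc k)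
    have "base r \<theta> (Suc k * p + m) = base r \<theta> ((k * p + m) + p)" by (simp add: algebra_simps)
    then show ?case using base_quasi_periodic[of "k * p + m"] Suc by (simp add: cis_mult algebra_simps flip: mult.assoc)
  qed simp
  have "base r \<theta> n = cis (\<theta> * real (n div p)) * base r \<theta> (n mod p)"
    using *[of "n div p" "n mod p"] by simp
  moreover have "int n div int p = int (n div p)" "nat (int n mod int p) = n mod p"
    by (simp_all add: zdiv_int nat_mod_as_int)
  ultimately show ?thesis by (simp add: bloch_def)
qed

text \<open>A shift by k periods moves the sites n - 1, n and n + 1 to nonnegative indices, where
  the recurrence of \<open>base\<close> is available.\<close>

lemma bloch_recurrence:
  "bloch r \<theta> (n - 1) + bloch r \<theta> (n + 1) + of_real (V n) * bloch r \<theta> n = of_real (energy r \<theta>) * bloch r \<theta> n"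
proof -
  define k where "k = nat \<bar>n\<bar> + 1"
  have "int k * 1 \<le> int k * int p" using p_pos by (intro mult_left_mono) auto
  moreover have "int k = \<bar>n\<bar> + 1" by (simp add: k_def)
  ultimately have "n + int k * int p \<ge> 1" by linarith
  then obtain j where j: "n + int k * int p = int (Suc j)" by (metis Suc_pred' nat_int zero_less_imp_eq_int of_nat_0_less_iff zle_iff_zadd order_less_le_trans zero_less_one)
  have "V (int j + 1) = V n" using V_shift[of n k] j by (simp add: add.commute)
  moreover have "base r \<theta> (Suc j) = cis (\<theta> * real k) * bloch r \<theta> n"
    using bloch_shift[of n k] j bloch_of_nat[of "Suc j"] by simp
  moreover have "base r \<theta> j = cis (\<theta> * real k) * bloch r \<theta> (n - 1)"
    using bloch_shift[of "n - 1" k] j bloch_of_nat[of j] by (simp add: algebra_simps)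
  moreover have "base r \<theta> (Suc (Suc j)) = cis (\<theta> * real k) * bloch r \<theta> (n + 1)"
    using bloch_shift[of "n + 1" k] j bloch_of_nat[of "Suc (Suc j)"] by (simp add: algebra_simps)
  ultimately have "cis (\<theta> * real k) * bloch r \<theta> (n + 1) =
     cis (\<theta> * real k) * ((of_real (energy r \<theta>) - of_real (V n)) * bloch r \<theta> n - bloch r \<theta> (n - 1))"
    using base_recurrence[of j] by (simp add: algebra_simps)
  then have "bloch r \<theta> (n + 1) = (of_real (energy r \<theta>) - of_real (V n)) * bloch r \<theta> n - bloch r \<theta> (n - 1)"
    by simp
  then show ?thesis by (simp add: algebra_simps)
qed

text \<open>The imaginary part of \<open>base\<close> at site 1 is sin \<theta> > 0. For p = 1 that
  site lies outside the sum and is reached from site 0 by quasi-periodicity.\<close>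

lemma bloch_norm_pos: "0 < bloch_norm r \<theta>"
proof (rule ccontr)
  assume "\<not> 0 < bloch_norm r \<theta>"
  then have "bloch_norm r \<theta> = 0" unfolding bloch_norm_def using sum_nonneg by (smt (verit) zero_le_power2)
  then have z: "base r \<theta> n = 0" if "n < p" for n
    using that by (simp add: bloch_norm_def sum_nonneg_eq_0_iff)
  have "base r \<theta> (Suc 0) = 0"
  proof (cases "p = 1")
    case True
    then show ?thesis using base_quasi_periodic[of 0] z[of 0] by simp
  qed (use z p_pos in simp)
  then have "Im (base r \<theta> (Suc 0)) = 0" by simp
  then show False using sin_gt_zero[OF \<theta>] by (simp add: base_1)
qed

lemma cmod_base_le: "n < p \<Longrightarrow> (cmod (base r \<theta> n))\<^sup>2 \<le> bloch_norm r \<theta>"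
  unfolding bloch_norm_def by (rule member_le_sum) auto

lemma cmod_base_mult_le:
  assumes "m < p" "n < p"
  shows "cmod (base r \<theta> m * cnj (base r \<theta> n)) \<le> bloch_norm r \<theta>"
proof -
  have "2 * (cmod (base r \<theta> m) * cmod (base r \<theta> n)) \<le> (cmod (base r \<theta> m))\<^sup>2 + (cmod (base r \<theta> n))\<^sup>2"
    using sum_squares_bound[of "cmod (base r \<theta> m)"] by (simp add: mult.assoc)
  then show ?thesis using cmod_base_le[OF assms(1)] cmod_base_le[OF assms(2)] by (simp add: norm_mult)
qed

lemma nat_mod_p_less: "nat (n mod int p) < p"
  using p_pos by (simp add: nat_less_iff)

lemma bloch_mult: "bloch r \<theta> m * cnj (bloch r \<theta> n) = cis (\<theta> * of_int (m div int p - n div int p)) *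
    (base r \<theta> (nat (m mod int p)) * cnj (base r \<theta> (nat (n mod int p))))"
proof -
  have "(cis a * x) * (cis (- b) * y) = cis (a - b) * (x * y)" for a b x y
  proof -
    have "cis (a - b) = cis a * cis (- b)" by (simp add: cis_mult)
    then show ?thesis by (simp add: mult_ac)
  qed
  then show ?thesis unfolding bloch_def complex_cnj_mult cis_cnj by (simp add: right_diff_distrib)
qed

lemma abs_density_le: "\<bar>density r m n \<theta>\<bar> \<le> 1"
proof -
  have "\<bar>Re (bloch r \<theta> m * cnj (bloch r \<theta> n))\<bar> \<le> cmod (bloch r \<theta> m * cnj (bloch r \<theta> n))"
    by (rule abs_Re_le_cmod)
  also have "\<dots> \<le> bloch_norm r \<theta>"
    using cmod_base_mult_le[OF nat_mod_p_less nat_mod_p_less, of m n] by (simp add: bloch_mult norm_mult)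
  finally show ?thesis using bloch_norm_pos by (simp add: density_def)
qed

lemma density_recurrence:
  "density r m (n - 1) \<theta> + density r m (n + 1) \<theta> + V n * density r m n \<theta> = energy r \<theta> * density r m n \<theta>"
proof -
  have "Re (bloch r \<theta> m * cnj (bloch r \<theta> (n - 1) + bloch r \<theta> (n + 1) + of_real (V n) * bloch r \<theta> n))
    = energy r \<theta> * Re (bloch r \<theta> m * cnj (bloch r \<theta> n))"
    unfolding bloch_recurrence by (simp add: algebra_simps)
  then have "Re (bloch r \<theta> m * cnj (bloch r \<theta> (n - 1))) + Re (bloch r \<theta> m * cnj (bloch r \<theta> (n + 1)))
     + V n * Re (bloch r \<theta> m * cnj (bloch r \<theta> n)) = energy r \<theta> * Re (bloch r \<theta> m * cnj (bloch r \<theta> n))"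
    by (simp add: algebra_simps)
  then show ?thesis
    unfolding density_def times_divide_eq_right add_divide_distrib[symmetric] by (simp only:)
qed

end

text \<open>At equal \<theta> the multipliers of both vectors cancel in the boundary terms of
  Green's identity over one period, while the energies differ because the bands are
  disjoint.\<close>

lemma base_orthogonal:
  assumes "r \<in> zeros" "s \<in> zeros" "r \<noteq> s" "0 < \<theta>" "\<theta> < pi"
  shows "(\<Sum>n<p. base r \<theta> n * cnj (base s \<theta> n)) = 0"
proof -
  have ne: "energy r \<theta> \<noteq> energy s \<theta>"
    using bands_disjoint[OF assms(1-3)] energy(1)[of r \<theta>] energy(1)[of s \<theta>] assms by auto
  have cc: "cnj (cis \<theta>) * cis \<theta> = 1" by (simp add: cis_cnj cis_mult)
  have k1: "cnj (cis \<theta> * a) * (cis \<theta> * b) = cnj a * b" for a b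
  proof -
    have "cnj (cis \<theta> * a) * (cis \<theta> * b) = (cnj (cis \<theta>) * cis \<theta>) * (cnj a * b)" by (simp add: mult_ac)
    then show ?thesis unfolding cc by simp
  qed
  have k2: "(cis \<theta> * b) * cnj (cis \<theta> * a) = b * cnj a" for a b
    using k1[of a b] by (simp only: mult.commute)
  have q: "base x \<theta> p = cis \<theta> * base x \<theta> 0" "base x \<theta> (Suc p) = cis \<theta> * base x \<theta> (Suc 0)" if "x \<in> zeros" for x
    using base_quasi_periodic[OF that assms(4,5), of 0] base_quasi_periodic[OF that assms(4,5), of "Suc 0"] by simp_all
  have "(of_real (energy r \<theta>) - cnj (of_real (energy s \<theta>))) * (\<Sum>n=1..p. base r \<theta> n * cnj (base s \<theta> n)) = 0"
    unfolding green_identity[OF base_recurrence[OF assms(1,4,5)] base_recurrence[OF assms(2,4,5)], of p]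
    unfolding q[OF assms(1)] q[OF assms(2)] k1 k2 by simp
  then have "(\<Sum>n=1..p. base r \<theta> n * cnj (base s \<theta> n)) = 0" using ne by simp
  moreover have "base r \<theta> p * cnj (base s \<theta> p) = base r \<theta> 0 * cnj (base s \<theta> 0)"
    unfolding q[OF assms(1)] q[OF assms(2)] k2 ..
  ultimately show ?thesis using period_sum_shift[of "\<lambda>n. base r \<theta> n * cnj (base s \<theta> n)"] by simp
qed

text \<open>There are as many bands as sites in a period, so the normalized Bloch vectors are the
  orthonormal columns of a square matrix.\<close>

lemma base_complete:
  assumes \<theta>: "0 < \<theta>" "\<theta> < pi" and "m < p" "n < p"
  shows "(\<Sum>r\<in>zeros. base r \<theta> m * cnj (base r \<theta> n) / of_real (bloch_norm r \<theta>)) = (if m = n then 1 else 0)"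
proof -
  have "card zeros = p" using card_zeros degree_half_disc by simp
  then obtain h where h: "bij_betw h {..<p} zeros"
    using ex_bij_betw_nat_finite[OF finite_zeros] by (auto simp: lessThan_atLeast0)
  define X where "X m j = base (h j) \<theta> m / of_real (sqrt (bloch_norm (h j) \<theta>))" for m j
  have hz: "h j \<in> zeros" if "j < p" for j using h that by (auto simp: bij_betw_def)
  have sq: "complex_of_real (sqrt (bloch_norm (h j) \<theta>)) * of_real (sqrt (bloch_norm (h j) \<theta>)) = of_real (bloch_norm (h j) \<theta>)"
    if "j < p" for j
    using bloch_norm_pos[OF hz[OF that] \<theta>] by (simp flip: of_real_mult)
  have "(\<Sum>j<p. X m j * cnj (X n j)) = (if m = n then 1 else 0)"
  proof (rule orthonormal_columns_imp_rows)
    fix i j assume ij: "i < p" "j < p"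
    have "(\<Sum>m<p. cnj (X m i) * X m j) = (\<Sum>m<p. base (h j) \<theta> m * cnj (base (h i) \<theta> m))
        / (of_real (sqrt (bloch_norm (h i) \<theta>)) * of_real (sqrt (bloch_norm (h j) \<theta>)))"
      by (simp add: X_def sum_divide_distrib mult_ac)
    also have "\<dots> = (if i = j then 1 else 0)"
    proof (cases "i = j")
      case True
      have "(\<Sum>m<p. base (h j) \<theta> m * cnj (base (h j) \<theta> m)) = of_real (bloch_norm (h j) \<theta>)"
        by (simp add: bloch_norm_def complex_norm_square del: of_real_power)
      then show ?thesis using True sq[OF ij(2)] bloch_norm_pos[OF hz[OF ij(2)] \<theta>] by simp
    next
      case False
      then have "h j \<noteq> h i" using h ij by (auto simp: bij_betw_def inj_on_def)
      then show ?thesis using base_orthogonal[OF hz[OF ij(2)] hz[OF ij(1)] _ \<theta>] False by simp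
    qed
    finally show "(\<Sum>m<p. cnj (X m i) * X m j) = (if i = j then 1 else 0)" .
  qed (use assms in auto)
  moreover have "(\<Sum>j<p. X m j * cnj (X n j)) = (\<Sum>j<p. base (h j) \<theta> m * cnj (base (h j) \<theta> n) / of_real (bloch_norm (h j) \<theta>))"
    by (intro sum.cong refl) (simp add: X_def sq)
  moreover have "\<dots> = (\<Sum>r\<in>zeros. base r \<theta> m * cnj (base r \<theta> n) / of_real (bloch_norm r \<theta>))"
    by (rule sum.reindex_bij_betw[OF h])
  ultimately show ?thesis by simp
qed

lemma sum_density:
  assumes \<theta>: "0 < \<theta>" "\<theta> < pi"
  shows "(\<Sum>r\<in>zeros. density r m n \<theta>) =
    (if m mod int p = n mod int p then cos (\<theta> * of_int (m div int p - n div int p)) else 0)"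
proof -
  let ?m = "nat (m mod int p)" and ?n = "nat (n mod int p)" and ?c = "cis (\<theta> * of_int (m div int p - n div int p))"
  have "density r m n \<theta> = Re (?c * (base r \<theta> ?m * cnj (base r \<theta> ?n) / of_real (bloch_norm r \<theta>)))"
    if "r \<in> zeros" for r
    unfolding density_def bloch_mult[OF that \<theta>] Re_divide_of_real[symmetric] by (simp add: mult_ac)
  then have "(\<Sum>r\<in>zeros. density r m n \<theta>) = Re (?c * (\<Sum>r\<in>zeros. base r \<theta> ?m * cnj (base r \<theta> ?n) / of_real (bloch_norm r \<theta>)))"
    by (simp add: sum_distrib_left)
  also have "\<dots> = Re (?c * (if ?m = ?n then 1 else 0))"
    using base_complete[OF \<theta>, of ?m ?n] p_pos by (simp add: nat_less_iff)
  also have "?m = ?n \<longleftrightarrow> m mod int p = n mod int p" using p_pos by (auto simp: nat_eq_iff2)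
  finally show ?thesis by simp
qed

lemma continuous_on_energy: "r \<in> zeros \<Longrightarrow> continuous_on {0<..<pi} (energy r)"
  by (rule DERIV_continuous_on[where D = "energy' r"])
     (auto intro: has_field_derivative_at_within DERIV_energy(1))

lemma continuous_on_density:
  assumes r: "r \<in> zeros" shows "continuous_on {0<..<pi} (density r m n)"
proof -
  have b: "continuous_on {0<..<pi} (\<lambda>\<theta>. base r \<theta> k)" for k
    unfolding base_def Complex_eq by (intro continuous_intros continuous_on_energy[OF r])
  have c: "continuous_on {0<..<pi} (\<lambda>\<theta>. cis (\<theta> * x))" for x :: real
    unfolding cis_conv_exp by (intro continuous_intros)
  show ?thesis
    unfolding density_def bloch_def bloch_norm_def
    by (intro continuous_intros b c) (use bloch_norm_pos[OF r] in \<open>force simp: bloch_norm_def\<close>)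
qed

end

lemma cmod_cis_minus_one_le: "cmod (cis x - 1) \<le> \<bar>x\<bar>"
proof -
  have "cmod (cis x - 1) = 2 * \<bar>sin (x / 2)\<bar>"
    by (simp add: cis_conv_exp dist_exp_i_1)
  also have "\<dots> \<le> 2 * \<bar>x / 2\<bar>" by (intro mult_left_mono abs_sin_x_le_abs_x) auto
  finally show ?thesis by simp
qed

text \<open>The function cis y - i y has derivative i (cis y - 1), of modulus at most |y|. The
  quadratic remainder is what differentiation under the integral sign uses.\<close>

lemma cmod_cis_taylor: "cmod (cis x - 1 - \<i> * of_real x) \<le> x\<^sup>2"
proof -
  have "cmod ((cis x - \<i> * of_real x) - (cis 0 - \<i> * of_real 0)) \<le> \<bar>x\<bar> * cmod (of_real x - of_real 0)"
  proof -
    have "norm ((\<lambda>y. cis y - \<i> * of_real y) x - (\<lambda>y. cis y - \<i> * of_real y) 0) \<le> \<bar>x\<bar> * norm (x - 0)"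
    proof (rule differentiable_bound[of "{-\<bar>x\<bar>..\<bar>x\<bar>}" _ "\<lambda>y h. of_real h * (\<i> * (cis y - 1))"])
      fix y :: real assume y: "y \<in> {-\<bar>x\<bar>..\<bar>x\<bar>}"
      show "((\<lambda>y. cis y - \<i> * of_real y) has_derivative (\<lambda>h. of_real h * (\<i> * (cis y - 1)))) (at y within {-\<bar>x\<bar>..\<bar>x\<bar>})"
      proof -
        have "((\<lambda>z. exp (\<i> * z) - \<i> * z) has_field_derivative (exp (\<i> * of_real y) * \<i> - \<i>)) (at (of_real y))"
          by (auto intro!: derivative_eq_intros)
        then have "((\<lambda>y. exp (\<i> * of_real y) - \<i> * of_real y) has_vector_derivative (exp (\<i> * of_real y) * \<i> - \<i>)) (at y within {-\<bar>x\<bar>..\<bar>x\<bar>})"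
          by (rule has_vector_derivative_real_field)
        then show ?thesis
          by (simp add: has_vector_derivative_def cis_conv_exp scaleR_conv_of_real algebra_simps)
      qed
      show "onorm (\<lambda>h. complex_of_real h * (\<i> * (cis y - 1))) \<le> \<bar>x\<bar>"
      proof (rule onorm_le)
        fix h :: real
        have "norm (complex_of_real h * (\<i> * (cis y - 1))) = \<bar>h\<bar> * cmod (cis y - 1)" by (simp add: norm_mult)
        also have "\<dots> \<le> \<bar>h\<bar> * \<bar>x\<bar>" using cmod_cis_minus_one_le[of y] y by (intro mult_left_mono) auto
        finally show "norm (complex_of_real h * (\<i> * (cis y - 1))) \<le> \<bar>x\<bar> * norm h" by (simp add: mult.commute)
      qed
    qed auto
    then show ?thesis by (simp flip: of_real_diff)
  qed
  then show ?thesis by (simp add: power2_eq_square algebra_simps)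
qed

section \<open>The kernel of the linear evolution\<close>

context periodic_op
begin

text \<open>The Bloch representation of the kernel of exp (- i t H). The nonlinear argument uses
  three of its properties: the identity at time 0, the differential equation in \<open>n\<close>,
  and the decay in \<open>t\<close>.\<close>

definition propagator :: "real \<Rightarrow> int \<Rightarrow> int \<Rightarrow> complex" where
  "propagator t m n = (1 / of_real pi) *
     (\<Sum>r\<in>zeros. integral {0<..<pi} (\<lambda>\<theta>. cis (- t * energy r \<theta>) * of_real (density r m n \<theta>)))"

lemma energy_bounded:
  obtains \<rho> where "\<rho> > 0" "\<And>r \<theta>. \<lbrakk>r \<in> zeros; 0 < \<theta>; \<theta> < pi\<rbrakk> \<Longrightarrow> \<bar>energy r \<theta>\<bar> \<le> \<rho>"
proof -
  obtain \<rho> where "\<rho> > 0" "\<And>x. \<bar>poly half_disc x\<bar> < 1 \<Longrightarrow> \<bar>x\<bar> \<le> \<rho>" using spectrum_bounded by blast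
  then show ?thesis using that abs_f_less_one_on_band energy(1) by meson
qed

lemma propagator_integrable:
  assumes r: "r \<in> zeros"
  shows "(\<lambda>\<theta>. cis (- t * energy r \<theta>) * of_real (density r m n \<theta>)) integrable_on {0<..<pi}"
    and "(\<lambda>\<theta>. of_real (energy r \<theta>) * (cis (- t * energy r \<theta>) * of_real (density r m n \<theta>))) integrable_on {0<..<pi}"
proof -
  obtain \<rho> where \<rho>: "\<rho> > 0" "\<And>r \<theta>. \<lbrakk>r \<in> zeros; 0 < \<theta>; \<theta> < pi\<rbrakk> \<Longrightarrow> \<bar>energy r \<theta>\<bar> \<le> \<rho>"
    using energy_bounded by blast
  have c: "continuous_on {0<..<pi} (\<lambda>\<theta>. cis (- t * energy r \<theta>))"
    by (intro continuous_cis continuous_intros continuous_on_energy[OF r])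
  show "(\<lambda>\<theta>. cis (- t * energy r \<theta>) * of_real (density r m n \<theta>)) integrable_on {0<..<pi}"
  proof (rule bounded_continuous_integrable_on_Ioo[where B = 1])
    show "continuous_on {0<..<pi} (\<lambda>\<theta>. cis (- t * energy r \<theta>) * of_real (density r m n \<theta>))"
      by (intro continuous_intros c continuous_on_density[OF r])
  qed (use abs_density_le[OF r] in \<open>auto simp: norm_mult\<close>)
  show "(\<lambda>\<theta>. of_real (energy r \<theta>) * (cis (- t * energy r \<theta>) * of_real (density r m n \<theta>))) integrable_on {0<..<pi}"
  proof (rule bounded_continuous_integrable_on_Ioo[where B = "\<rho> * 1"])
    show "continuous_on {0<..<pi} (\<lambda>\<theta>. of_real (energy r \<theta>) * (cis (- t * energy r \<theta>) * of_real (density r m n \<theta>)))"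
      by (intro continuous_intros c continuous_on_density[OF r] continuous_on_energy[OF r])
    show "cmod (of_real (energy r x) * (cis (- t * energy r x) * of_real (density r m n x))) \<le> \<rho> * 1"
      if "x \<in> {0<..<pi}" for x
      unfolding norm_mult using abs_density_le[OF r, of x] \<rho>(2)[OF r, of x] \<rho>(1) that
      by (intro mult_mono) auto
  qed
qed

lemma cmod_propagator_le: "cmod (propagator t m n) \<le> real p"
proof -
  have "cmod (integral {0<..<pi} (\<lambda>\<theta>. cis (- t * energy r \<theta>) * of_real (density r m n \<theta>))) \<le> pi"
    if r: "r \<in> zeros" for r
  proof -
    have "cmod (integral {0<..<pi} (\<lambda>\<theta>. cis (- t * energy r \<theta>) * of_real (density r m n \<theta>)))
      \<le> integral {0<..<pi} (\<lambda>_. 1::real)"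
      by (rule integral_norm_bound_integral[OF propagator_integrable(1)[OF r]])
         (use abs_density_le[OF r] in \<open>auto simp: norm_mult integrable_on_open_interval_real\<close>)
    also have "\<dots> = pi" using integral_open_interval_real[of 0 pi "\<lambda>_. 1::real"] by simp
    finally show ?thesis .
  qed
  then have "cmod (\<Sum>r\<in>zeros. integral {0<..<pi} (\<lambda>\<theta>. cis (- t * energy r \<theta>) * of_real (density r m n \<theta>))) \<le> (\<Sum>r\<in>zeros. pi)"
    by (intro sum_norm_le)
  also have "\<dots> = real p * pi" using card_zeros degree_half_disc by simp
  finally show ?thesis by (simp add: propagator_def norm_divide field_simps)
qed

lemma integral_cos_multiple: "j \<noteq> 0 \<Longrightarrow> integral {0<..<pi} (\<lambda>\<theta>. cos (\<theta> * of_int j)) = 0"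
proof -
  assume j: "j \<noteq> 0"
  have "((\<lambda>\<theta>. cos (\<theta> * of_int j)) has_integral sin (pi * of_int j) / of_int j - sin (0 * of_int j) / of_int j) {0..pi}"
    using j by (intro fundamental_theorem_of_calculus)
      (auto intro!: derivative_eq_intros simp flip: has_real_derivative_iff_has_vector_derivative)
  moreover have "sin (pi * of_int j) = 0" by (simp add: sin_zero_iff_int2)
  ultimately have "integral {0..pi} (\<lambda>\<theta>. cos (\<theta> * of_int j)) = 0" by (simp add: integral_unique)
  then show ?thesis by (simp add: integral_open_interval_real)
qed

text \<open>Completeness over one period removes the sum over the bands; the orthogonality of
  cosines on (0, pi) then separates different periods.\<close>

lemma propagator_0: "propagator 0 m n = (if m = n then 1 else 0)"
proof -
  have "(\<Sum>r\<in>zeros. integral {0<..<pi} (\<lambda>\<theta>. cis (- 0 * energy r \<theta>) * of_real (density r m n \<theta>)))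
    = integral {0<..<pi} (\<lambda>\<theta>. \<Sum>r\<in>zeros. cis (- 0 * energy r \<theta>) * of_real (density r m n \<theta>))"
    by (rule integral_sum[symmetric, OF finite_zeros propagator_integrable(1)])
  also have "\<dots> = integral {0<..<pi} (\<lambda>\<theta>. of_real (if m mod int p = n mod int p then cos (\<theta> * of_int (m div int p - n div int p)) else 0))"
    by (rule integral_cong) (simp add: sum_density flip: of_real_sum)
  also have "\<dots> = of_real (integral {0<..<pi} (\<lambda>\<theta>. if m mod int p = n mod int p then cos (\<theta> * of_int (m div int p - n div int p)) else 0))"
  proof (rule integral_unique, rule has_integral_of_real, rule integrable_integral)
    have "(\<lambda>\<theta>::real. cos (\<theta> * x)) integrable_on {0<..<pi}" for x
      unfolding integrable_on_open_interval_real by (intro integrable_continuous_interval continuous_intros)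
    then show "(\<lambda>\<theta>. if m mod int p = n mod int p then cos (\<theta> * of_int (m div int p - n div int p)) else 0) integrable_on {0<..<pi}"
      by (cases "m mod int p = n mod int p") (auto intro: integrable_0)
  qed
  also have "integral {0<..<pi} (\<lambda>\<theta>. if m mod int p = n mod int p then cos (\<theta> * of_int (m div int p - n div int p)) else 0)
      = (if m = n then pi else 0)"
  proof (cases "m mod int p = n mod int p")
    case True
    then have "m div int p - n div int p = 0 \<longleftrightarrow> m = n"
      by (metis div_mult_mod_eq eq_iff_diff_eq_0)
    then show ?thesis using True integral_cos_multiple[of "m div int p - n div int p"]
        integral_open_interval_real[of 0 pi "\<lambda>_. 1::real"] by auto
  qed auto
  finally show ?thesis by (simp add: propagator_def)
qed

text \<open>The quadratic remainder of \<open>cis\<close> is uniform in \<theta> because energies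
  are bounded, which justifies differentiation under the integral. Multiplication by the energy
  becomes the Schroedinger operator acting on \<open>n\<close> through
  \<open>density_recurrence\<close>.\<close>

lemma propagator_has_derivative:
  "((\<lambda>t. propagator t m n) has_vector_derivative
     - \<i> * (propagator t m (n - 1) + propagator t m (n + 1) + of_real (V n) * propagator t m n)) (at t)"
proof -
  obtain \<rho> where \<rho>: "\<rho> > 0" "\<And>r \<theta>. \<lbrakk>r \<in> zeros; 0 < \<theta>; \<theta> < pi\<rbrakk> \<Longrightarrow> \<bar>energy r \<theta>\<bar> \<le> \<rho>"
    using energy_bounded by blast
  define I where "I t r = integral {0<..<pi} (\<lambda>\<theta>. cis (- t * energy r \<theta>) * of_real (density r m n \<theta>))" for t r
  define J where "J r = integral {0<..<pi} (\<lambda>\<theta>. of_real (energy r \<theta>) * (cis (- t * energy r \<theta>) * of_real (density r m n \<theta>)))" for r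
  have IJ: "cmod (I (t + h) r - I t r - of_real h * (- \<i> * J r)) \<le> pi * \<rho>\<^sup>2 * h\<^sup>2" if r: "r \<in> zeros" for h r
  proof -
    let ?D = "\<lambda>\<theta>. cis (- t * energy r \<theta>) * of_real (density r m n \<theta>)"
    have "I (t + h) r - I t r - of_real h * (- \<i> * J r) =
      integral {0<..<pi} (\<lambda>\<theta>. cis (- (t + h) * energy r \<theta>) * of_real (density r m n \<theta>) - ?D \<theta>
        - of_real h * (- \<i> * (of_real (energy r \<theta>) * ?D \<theta>)))"
      unfolding I_def J_def using propagator_integrable[OF r]
      by (simp only: Henstock_Kurzweil_Integration.integral_diff integral_mult_right integrable_diff integrable_on_mult_right)
    also have "\<dots> = integral {0<..<pi} (\<lambda>\<theta>. (cis (- h * energy r \<theta>) - 1 - \<i> * of_real (- h * energy r \<theta>)) * ?D \<theta>)"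
    proof (rule integral_cong)
      fix \<theta>
      have "cis (- (t + h) * energy r \<theta>) = cis (- h * energy r \<theta>) * cis (- t * energy r \<theta>)"
        by (simp add: cis_mult algebra_simps)
      then show "cis (- (t + h) * energy r \<theta>) * of_real (density r m n \<theta>) - ?D \<theta>
        - of_real h * (- \<i> * (of_real (energy r \<theta>) * ?D \<theta>)) = (cis (- h * energy r \<theta>) - 1 - \<i> * of_real (- h * energy r \<theta>)) * ?D \<theta>"
        by (simp add: algebra_simps)
    qed
    finally have eq: "I (t + h) r - I t r - of_real h * (- \<i> * J r) =
      integral {0<..<pi} (\<lambda>\<theta>. (cis (- h * energy r \<theta>) - 1 - \<i> * of_real (- h * energy r \<theta>)) * ?D \<theta>)" .
    have "cmod (I (t + h) r - I t r - of_real h * (- \<i> * J r)) \<le> integral {0<..<pi} (\<lambda>_. \<rho>\<^sup>2 * h\<^sup>2)"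
      unfolding eq
    proof (rule integral_norm_bound_integral)
      have c: "continuous_on {0<..<pi} (\<lambda>\<theta>. cis (x * energy r \<theta>))" for x
        by (intro continuous_cis continuous_intros continuous_on_energy[OF r])
      have b: "cmod ((cis (- h * energy r \<theta>) - 1 - \<i> * of_real (- h * energy r \<theta>)) * ?D \<theta>) \<le> \<rho>\<^sup>2 * h\<^sup>2"
        if "\<theta> \<in> {0<..<pi}" for \<theta>
      proof -
        have "cmod ((cis (- h * energy r \<theta>) - 1 - \<i> * of_real (- h * energy r \<theta>)) * ?D \<theta>) \<le> (- h * energy r \<theta>)\<^sup>2 * 1"
          unfolding norm_mult[of "_ - _" "?D \<theta>"] using cmod_cis_taylor[of "- h * energy r \<theta>"] abs_density_le[OF r, of \<theta>] that
          by (intro mult_mono) (auto simp: norm_mult)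
        also have "\<dots> = (energy r \<theta>)\<^sup>2 * h\<^sup>2" by (simp add: power_mult_distrib)
        also have "\<dots> \<le> \<rho>\<^sup>2 * h\<^sup>2" using \<rho>(2)[OF r, of \<theta>] \<rho>(1) that
          by (intro mult_right_mono) (auto simp flip: abs_le_square_iff)
        finally show ?thesis .
      qed
      then show "\<And>\<theta>. \<theta> \<in> {0<..<pi} \<Longrightarrow> cmod ((cis (- h * energy r \<theta>) - 1 - \<i> * of_real (- h * energy r \<theta>)) * ?D \<theta>) \<le> \<rho>\<^sup>2 * h\<^sup>2" .
      show "(\<lambda>\<theta>. (cis (- h * energy r \<theta>) - 1 - \<i> * of_real (- h * energy r \<theta>)) * ?D \<theta>) integrable_on {0<..<pi}"
        by (rule bounded_continuous_integrable_on_Ioo[OF _ b])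
           (intro continuous_intros c continuous_on_density[OF r] continuous_on_energy[OF r])
    qed (simp add: integrable_on_open_interval_real integrable_const_ivl)
    also have "\<dots> = pi * \<rho>\<^sup>2 * h\<^sup>2" by (simp only: integral_open_interval_real[symmetric]) simp
    finally show ?thesis .
  qed
  have J: "J r = integral {0<..<pi} (\<lambda>\<theta>. cis (- t * energy r \<theta>) * of_real (density r m (n - 1) \<theta>))
     + integral {0<..<pi} (\<lambda>\<theta>. cis (- t * energy r \<theta>) * of_real (density r m (n + 1) \<theta>))
     + of_real (V n) * I t r" if r: "r \<in> zeros" for r
  proof -
    have "J r = integral {0<..<pi} (\<lambda>\<theta>. cis (- t * energy r \<theta>) * of_real (density r m (n - 1) \<theta>)
     + cis (- t * energy r \<theta>) * of_real (density r m (n + 1) \<theta>)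
     + of_real (V n) * (cis (- t * energy r \<theta>) * of_real (density r m n \<theta>)))"
      unfolding J_def
    proof (rule integral_cong)
      fix \<theta> :: real assume "\<theta> \<in> {0<..<pi}"
      then have eq: "energy r \<theta> * density r m n \<theta> =
        density r m (n - 1) \<theta> + density r m (n + 1) \<theta> + V n * density r m n \<theta>"
        using density_recurrence[OF r, of \<theta> m n] by simp
      have "complex_of_real (energy r \<theta>) * (cis (- t * energy r \<theta>) * of_real (density r m n \<theta>)) =
        cis (- t * energy r \<theta>) * of_real (energy r \<theta> * density r m n \<theta>)"
        by (simp add: mult_ac)
      then show "complex_of_real (energy r \<theta>) * (cis (- t * energy r \<theta>) * of_real (density r m n \<theta>)) =
        cis (- t * energy r \<theta>) * of_real (density r m (n - 1) \<theta>) + cis (- t * energy r \<theta>) * of_real (density r m (n + 1) \<theta>)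
         + of_real (V n) * (cis (- t * energy r \<theta>) * of_real (density r m n \<theta>))"
        unfolding eq by (simp add: algebra_simps)
    qed
    also have "\<dots> = integral {0<..<pi} (\<lambda>\<theta>. cis (- t * energy r \<theta>) * of_real (density r m (n - 1) \<theta>))
     + integral {0<..<pi} (\<lambda>\<theta>. cis (- t * energy r \<theta>) * of_real (density r m (n + 1) \<theta>)) + of_real (V n) * I t r"
      unfolding I_def using propagator_integrable(1)[OF r]
      by (simp only: Henstock_Kurzweil_Integration.integral_add integral_mult_right integrable_add integrable_on_mult_right)
    finally show ?thesis .
  qed
  define L where "L = - \<i> * ((1 / of_real pi) * (\<Sum>r\<in>zeros. J r))"
  have L: "L = - \<i> * (propagator t m (n - 1) + propagator t m (n + 1) + of_real (V n) * propagator t m n)"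
  proof -
    have "(\<Sum>r\<in>zeros. J r) = (\<Sum>r\<in>zeros. integral {0<..<pi} (\<lambda>\<theta>. cis (- t * energy r \<theta>) * of_real (density r m (n - 1) \<theta>)))
     + (\<Sum>r\<in>zeros. integral {0<..<pi} (\<lambda>\<theta>. cis (- t * energy r \<theta>) * of_real (density r m (n + 1) \<theta>)))
     + of_real (V n) * (\<Sum>r\<in>zeros. I t r)"
      by (simp add: J sum.distrib sum_distrib_left)
    then show ?thesis unfolding L_def propagator_def I_def by (simp add: algebra_simps)
  qed
  have est: "cmod (propagator (t + h) m n - propagator t m n - of_real h * L) \<le> real p * \<rho>\<^sup>2 * h\<^sup>2" for h
  proof -
    have "propagator (t + h) m n - propagator t m n - of_real h * L =
       (1 / of_real pi) * (\<Sum>r\<in>zeros. I (t + h) r - I t r - of_real h * (- \<i> * J r))"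
      unfolding propagator_def L_def I_def[symmetric]
      by (simp add: sum_subtractf sum.distrib sum_distrib_left sum_negf right_diff_distrib diff_divide_distrib
          add_divide_distrib mult_ac sum_divide_distrib)
    also have "cmod \<dots> \<le> (1 / pi) * (\<Sum>r\<in>zeros. pi * \<rho>\<^sup>2 * h\<^sup>2)"
      unfolding norm_mult using IJ by (intro mult_mono sum_norm_le) (auto simp: norm_divide)
    also have "\<dots> = real p * \<rho>\<^sup>2 * h\<^sup>2" using card_zeros degree_half_disc by simp
    finally show ?thesis .
  qed
  have "(\<lambda>h. norm (propagator (t + h) m n - propagator t m n - h *\<^sub>R L) / norm h) \<midarrow>0\<rightarrow> 0"
  proof (rule Lim_null_comparison)
    have "norm (norm (propagator (t + h) m n - propagator t m n - h *\<^sub>R L) / norm h) \<le> real p * \<rho>\<^sup>2 * \<bar>h\<bar>" if "h \<noteq> 0" for h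
    proof -
      have "norm (propagator (t + h) m n - propagator t m n - h *\<^sub>R L) / norm h \<le> (real p * \<rho>\<^sup>2 * h\<^sup>2) / \<bar>h\<bar>"
        using est[of h] by (simp add: scaleR_conv_of_real divide_right_mono)
      also have "\<dots> = real p * \<rho>\<^sup>2 * \<bar>h\<bar>" using that by (simp add: power2_eq_square abs_if)
      finally show ?thesis by simp
    qed
    then show "\<forall>\<^sub>F h in at 0. norm (norm (propagator (t + h) m n - propagator t m n - h *\<^sub>R L) / norm h) \<le> real p * \<rho>\<^sup>2 * \<bar>h\<bar>"
      by (auto simp: eventually_at intro!: exI[of _ 1])
    have "((\<lambda>h. real p * \<rho>\<^sup>2 * \<bar>h\<bar>) \<longlongrightarrow> real p * \<rho>\<^sup>2 * \<bar>0\<bar>) (at 0)" by (intro tendsto_intros)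
    then show "((\<lambda>h. real p * \<rho>\<^sup>2 * \<bar>h\<bar>) \<longlongrightarrow> 0) (at 0)" by simp
  qed
  then have "((\<lambda>t. propagator t m n) has_vector_derivative L) (at t)"
    unfolding has_vector_derivative_def has_derivative_at by (simp add: bounded_linear_scaleR_left)
  then show ?thesis by (simp only: L)
qed

end

section \<open>Decay of the linear evolution, uniform in the sites\<close>

lemma uniform_bound_over_finite:
  fixes P :: "'a \<Rightarrow> real \<Rightarrow> bool"
  assumes "finite A" "\<And>x. x \<in> A \<Longrightarrow> \<exists>B. P x B" and mono: "\<And>x B B'. \<lbrakk>P x B; B \<le> B'\<rbrakk> \<Longrightarrow> P x B'"
  shows "\<exists>B>0. \<forall>x\<in>A. P x B"
  using assms(1,2)
proof (induction A rule: finite_induct)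
  case empty
  then show ?case by (intro exI[of _ 1]) auto
next
  case (insert a A)
  then obtain B B' where "B > 0" "\<forall>x\<in>A. P x B" "P a B'" by blast
  then have "max B B' > 0 \<and> (\<forall>x\<in>insert a A. P x (max B B'))" using mono by (metis insert_iff max.cobounded1 max.cobounded2 less_max_iff_disj)
  then show ?case by blast
qed

lemma nonzero_continuous_sign:
  fixes w :: "real \<Rightarrow> real"
  assumes "continuous_on {c<..<d} w" "\<And>x. x \<in> {c<..<d} \<Longrightarrow> w x \<noteq> 0"
  shows "(\<forall>x\<in>{c<..<d}. 0 < w x) \<or> (\<forall>x\<in>{c<..<d}. w x < 0)"
proof (rule ccontr)
  assume "\<not> ?thesis"
  then obtain x y where xy: "x \<in> {c<..<d}" "y \<in> {c<..<d}" "w x < 0" "0 < w y"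
    using assms(2) by (metis linorder_neqE_linordered_idom)
  have "connected (w ` {c<..<d})" by (intro connected_continuous_image assms(1) connected_Ioo)
  then have "0 \<in> w ` {c<..<d}" using connectedD_interval[of _ "w x" "w y" 0] xy by auto
  then show False using assms(2) by force
qed

text \<open>A primitive of \<open>F\<close> is continuous up to both ends, so bounds on compact
  subintervals pass to the limit, one end at a time.\<close>

lemma tendsto_le_from_open_interval:
  fixes F :: "real \<Rightarrow> complex"
  assumes "l < u" and int: "F integrable_on {l..u}" and bd: "\<And>x. \<lbrakk>l < x; x < u\<rbrakk> \<Longrightarrow> cmod (F x) \<le> 1"
    and B: "\<And>a b. \<lbrakk>l < a; a \<le> b; b < u\<rbrakk> \<Longrightarrow> cmod (integral {a..b} F) \<le> B"
  shows "cmod (integral {l<..<u} F) \<le> B"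
proof -
  have cont: "continuous_on {l..u} (\<lambda>x. integral {l..x} F)"
    by (rule indefinite_integral_continuous_1[OF int])
  define G where "G x = integral {l..x} F" for x
  have G: "integral {a..b} F = G b - G a" if "l < a" "a \<le> b" "b < u" for a b
  proof -
    have "F integrable_on {l..b}" using integrable_on_subinterval[OF int] that by auto
    then show ?thesis unfolding G_def
      using Henstock_Kurzweil_Integration.integral_combine[of l a b F] that by (simp add: algebra_simps)
  qed
  have contG: "continuous_on {l..u} G" using cont by (simp add: G_def[abs_def])
  have lim1: "(G \<longlongrightarrow> G l) (at_right l)" and lim2: "(G \<longlongrightarrow> G u) (at_left u)"
    using contG \<open>l < u\<close> by (auto simp: continuous_on_Icc_at_rightD continuous_on_Icc_at_leftD)
  define m where "m = (l + u) / 2"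
  have m: "l < m" "m < u" using \<open>l < u\<close> by (auto simp: m_def)
  have step: "cmod (G b - G l) \<le> B" if b: "m \<le> b" "b < u" for b
  proof (rule tendsto_upperbound)
    show "((\<lambda>a. cmod (G b - G a)) \<longlongrightarrow> cmod (G b - G l)) (at_right l)" by (intro tendsto_intros lim1)
    show "\<forall>\<^sub>F a in at_right l. cmod (G b - G a) \<le> B"
      using eventually_at_right_real[OF m(1)] by eventually_elim (use B G b in auto)
  qed simp
  have "cmod (G u - G l) \<le> B"
  proof (rule tendsto_upperbound)
    show "((\<lambda>b. cmod (G b - G l)) \<longlongrightarrow> cmod (G u - G l)) (at_left u)" by (intro tendsto_intros lim2)
    show "\<forall>\<^sub>F b in at_left u. cmod (G b - G l) \<le> B"
      using eventually_at_left_real[OF m(2)] by eventually_elim (use step in auto)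
  qed simp
  then show ?thesis by (simp add: G_def flip: integral_open_interval_real)
qed

context periodic_op
begin

text \<open>With \<sigma> the sign of the derivative of the half discriminant on the band, -
  \<sigma> E has third derivative at most - c wherever its second derivative is small. The change of
  sign of the phase for \<sigma> = 1 is undone by conjugation and by replacing \<kappa> by -
  \<kappa>.\<close>

lemma oscillatory_integral_bound:
  obtains B where "B > 0" "\<And>r t \<kappa> a b. \<lbrakk>r \<in> zeros; t > 0; 0 < a; a \<le> b; b < pi\<rbrakk> \<Longrightarrow>
    cmod (integral {a..b} (\<lambda>\<theta>. cis (\<kappa> * \<theta> - t * energy r \<theta>))) \<le> B * t powr (-1/3)"
proof -
  obtain \<epsilon> c where \<epsilon>: "\<epsilon> > 0" "c > 0"
    "\<And>r \<theta>. \<lbrakk>r \<in> zeros; 0 < \<theta>; \<theta> < pi; \<bar>energy'' r \<theta>\<bar> \<le> \<epsilon>\<rbrakk> \<Longrightarrow> sgn (poly f' r) * energy''' r \<theta> \<ge> c"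
    using energy_inflection by blast
  show ?thesis
  proof (rule that[of "36 + 2 / c + pi / \<epsilon>"])
    show "0 < 36 + 2 / c + pi / \<epsilon>" using \<epsilon> by (simp add: add_pos_pos)
    fix r t \<kappa> a b :: real
    assume r: "r \<in> zeros" and t: "t > 0" and ab: "0 < a" "a \<le> b" "b < pi"
    define \<sigma> where "\<sigma> = sgn (poly f' r)"
    have \<sigma>: "\<sigma> = 1 \<or> \<sigma> = -1"
      using pderiv_nonzero_on_band[OF r zero_in_band[OF r]] by (auto simp: \<sigma>_def sgn_if)
    have "cmod (integral {a..b} (\<lambda>\<theta>. cis (\<kappa>' * \<theta> - t * (- \<sigma> * energy r \<theta>)))) \<le> (36 + 2 / c + (b - a) / \<epsilon>) * t powr (-1/3)" for \<kappa>'
    proof (rule van_der_corput_inflection)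
      fix x assume x: "x \<in> {a..b}"
      then have x0: "0 < x" "x < pi" using ab by auto
      show "((\<lambda>x. - \<sigma> * energy r x) has_real_derivative - \<sigma> * energy' r x) (at x)"
        "((\<lambda>x. - \<sigma> * energy' r x) has_real_derivative - \<sigma> * energy'' r x) (at x)"
        "((\<lambda>x. - \<sigma> * energy'' r x) has_real_derivative - \<sigma> * energy''' r x) (at x)"
        by (intro DERIV_cmult DERIV_energy r x0)+
      assume "\<bar>- \<sigma> * energy'' r x\<bar> \<le> \<epsilon>"
      then have "\<bar>energy'' r x\<bar> \<le> \<epsilon>" using \<sigma> by auto
      from \<epsilon>(3)[OF r x0 this] show "- \<sigma> * energy''' r x \<le> - c" by (simp add: \<sigma>_def)
    qed (use \<epsilon> ab t in auto)
    note * = this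
    have "cmod (integral {a..b} (\<lambda>\<theta>. cis (\<kappa> * \<theta> - t * energy r \<theta>))) \<le> (36 + 2 / c + (b - a) / \<epsilon>) * t powr (-1/3)"
      using \<sigma>
    proof
      assume "\<sigma> = -1"
      then show ?thesis using *[of \<kappa>] by simp
    next
      assume "\<sigma> = 1"
      then have "cmod (integral {a..b} (\<lambda>\<theta>. cis (- (\<kappa> * \<theta> - t * energy r \<theta>)))) \<le> (36 + 2 / c + (b - a) / \<epsilon>) * t powr (-1/3)"
        using *[of "- \<kappa>"] by (simp add: algebra_simps)
      then show ?thesis by (simp only: integral_cis_uminus)
    qed
    also have "\<dots> \<le> (36 + 2 / c + pi / \<epsilon>) * t powr (-1/3)"
      using ab \<epsilon> by (intro mult_right_mono add_mono divide_right_mono) auto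
    finally show "cmod (integral {a..b} (\<lambda>\<theta>. cis (\<kappa> * \<theta> - t * energy r \<theta>))) \<le> (36 + 2 / c + pi / \<epsilon>) * t powr (-1/3)" .
  qed
qed

lemma inj_on_energy: "r \<in> zeros \<Longrightarrow> inj_on (energy r) {0<..<pi}"
proof (rule inj_onI)
  fix x y assume r: "r \<in> zeros" and x: "x \<in> {0<..<pi}" and y: "y \<in> {0<..<pi}" and eq: "energy r x = energy r y"
  have "cos x = cos y" using energy(2)[OF r, of x] energy(2)[OF r, of y] x y eq by simp
  then show "x = y" using x y cos_inj_pi[of x y] by simp
qed

text \<open>The energy is injective in \<theta>, so a nonzero polynomial in it has finitely many
  zeros in (0, pi), and between them the derivative of \<open>g\<close> keeps its sign, as
  \<open>h\<close> does. If \<open>W\<close> is the zero polynomial, \<open>g\<close> is constant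
  and no cut is made. Together with a bound on \<open>g\<close> this controls its variation up to
  the band edges.\<close>

lemma algebraic_piecewise_mono:
  fixes g h :: "real \<Rightarrow> real"
  assumes r: "r \<in> zeros"
    and D: "\<And>\<theta>. \<lbrakk>0 < \<theta>; \<theta> < pi\<rbrakk> \<Longrightarrow> (g has_real_derivative poly W (energy r \<theta>) * h \<theta>) (at \<theta>)"
    and h: "\<And>\<theta>. \<lbrakk>0 < \<theta>; \<theta> < pi\<rbrakk> \<Longrightarrow> 0 < \<sigma> * h \<theta>"
  obtains X where "finite X" "\<And>c d. \<lbrakk>0 < c; c \<le> d; d < pi; X \<inter> {c<..<d} = {}\<rbrakk> \<Longrightarrow> mono_on {c..d} g \<or> antimono_on {c..d} g"
proof -
  define X where "X = (if W = 0 then {} else {\<theta> \<in> {0<..<pi}. poly W (energy r \<theta>) = 0})"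
  have "finite X"
  proof (cases "W = 0")
    case False
    have "energy r ` X \<subseteq> {x. poly W x = 0}" by (auto simp: X_def)
    then have "finite (energy r ` X)" using poly_roots_finite[OF False] finite_subset by blast
    moreover have "inj_on (energy r) X" using inj_on_energy[OF r] by (rule inj_on_subset) (auto simp: X_def)
    ultimately show ?thesis by (rule finite_imageD)
  qed (simp add: X_def)
  moreover have "mono_on {c..d} g \<or> antimono_on {c..d} g" if cd: "0 < c" "c \<le> d" "d < pi" "X \<inter> {c<..<d} = {}" for c d
  proof -
    have cont: "continuous_on {c<..<d} (\<lambda>\<theta>. poly W (energy r \<theta>))"
      by (intro continuous_intros continuous_on_subset[OF continuous_on_energy[OF r]]) (use cd in auto)
    have \<sigma>0: "\<sigma> \<noteq> 0" using h[of 1] pi_gt3 by auto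
    have hs: "0 < h x * sgn \<sigma>" if "x \<in> {c<..<d}" for x
      using h[of x] that cd \<sigma>0 by (auto simp: sgn_if zero_less_mult_iff)
    consider "\<forall>x\<in>{c<..<d}. 0 \<le> poly W (energy r x)" | "\<forall>x\<in>{c<..<d}. poly W (energy r x) \<le> 0"
    proof (cases "W = 0")
      case True
      then show ?thesis using that(1) by simp
    next
      case False
      have "poly W (energy r x) \<noteq> 0" if x: "x \<in> {c<..<d}" for x
      proof
        assume "poly W (energy r x) = 0"
        then have "x \<in> X \<inter> {c<..<d}" using cd(1,3) x False by (simp add: X_def)
        then show False using cd(4) by blast
      qed
      from nonzero_continuous_sign[OF cont this] show ?thesis using that by (auto intro: less_imp_le)
    qed
    then have "(\<forall>x\<in>{c<..<d}. 0 \<le> poly W (energy r x) * h x) \<or> (\<forall>x\<in>{c<..<d}. poly W (energy r x) * h x \<le> 0)"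
    proof cases
      case 1
      show ?thesis
      proof (cases "\<sigma> > 0")
        case True
        then have "0 \<le> poly W (energy r x) * h x" if "x \<in> {c<..<d}" for x
          using 1 hs[OF that] that by (intro mult_nonneg_nonneg) auto
        then show ?thesis by blast
      next
        case False
        then have "poly W (energy r x) * h x \<le> 0" if "x \<in> {c<..<d}" for x
          using 1 hs[OF that] that \<sigma>0 by (intro mult_nonneg_nonpos) auto
        then show ?thesis by blast
      qed
    next
      case 2
      show ?thesis
      proof (cases "\<sigma> > 0")
        case True
        then have "poly W (energy r x) * h x \<le> 0" if "x \<in> {c<..<d}" for x
          using 2 hs[OF that] that by (intro mult_nonpos_nonneg) auto
        then show ?thesis by blast
      next
        case False
        then have "0 \<le> poly W (energy r x) * h x" if "x \<in> {c<..<d}" for x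
          using 2 hs[OF that] that \<sigma>0 by (intro mult_nonpos_nonpos) auto
        then show ?thesis by blast
      qed
    qed
    then show ?thesis
    proof
      assume 1: "\<forall>x\<in>{c<..<d}. 0 \<le> poly W (energy r x) * h x"
      have "g x \<le> g y" if "c \<le> x" "x \<le> y" "y \<le> d" for x y
        using slope_ge[of x y g "\<lambda>\<theta>. poly W (energy r \<theta>) * h \<theta>" 0] D 1 cd that by force
      then show ?thesis by (auto simp: monotone_on_def)
    next
      assume 2: "\<forall>x\<in>{c<..<d}. poly W (energy r x) * h x \<le> 0"
      have "g y \<le> g x" if "c \<le> x" "x \<le> y" "y \<le> d" for x y
        using slope_ge[of x y "\<lambda>x. - g x" "\<lambda>\<theta>. - (poly W (energy r \<theta>) * h \<theta>)" 0] D 2 cd that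
        by (force intro!: DERIV_minus)
      then show ?thesis by (auto simp: monotone_on_def)
    qed
  qed
  ultimately show ?thesis using that by blast
qed

text \<open>The squared norm of the Bloch vector as a polynomial in the energy, with sin^2 \<theta>
  replaced by 1 - half_disc^2. It can vanish at the edge of a closed gap, which is why the variation
  of the normalized amplitudes is controlled by monotonicity and not by their derivatives.\<close>

definition norm_poly :: "real poly" where
  "norm_poly = (\<Sum>n<p. base_poly n * base_poly n + (1 - half_disc * half_disc) * (S n * S n))"

lemma poly_norm_poly:
  assumes "r \<in> zeros" "0 < \<theta>" "\<theta> < pi"
  shows "poly norm_poly (energy r \<theta>) = bloch_norm r \<theta>"
proof -
  have "(sin \<theta>)\<^sup>2 = 1 - (poly half_disc (energy r \<theta>))\<^sup>2"
    using energy(2)[OF assms] by (simp add: sin_squared_eq)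
  then show ?thesis
    by (simp add: norm_poly_def bloch_norm_def poly_sum base_def cmod_power2 power_mult_distrib)
       (simp add: power2_eq_square)
qed

definition amp_re :: "real \<Rightarrow> nat \<Rightarrow> nat \<Rightarrow> real \<Rightarrow> real" where
  "amp_re r m n \<theta> = Re (base r \<theta> m * cnj (base r \<theta> n)) / bloch_norm r \<theta>"

definition amp_im :: "real \<Rightarrow> nat \<Rightarrow> nat \<Rightarrow> real \<Rightarrow> real" where
  "amp_im r m n \<theta> = Im (base r \<theta> m * cnj (base r \<theta> n)) / bloch_norm r \<theta>"

text \<open>This amplitude is a rational function of the energy. \<open>W\<close> is the numerator
  of its derivative, and the remaining factor E' over the squared denominator has a fixed
  sign.\<close>

lemma amp_re_piecewise_mono:
  assumes r: "r \<in> zeros"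
  obtains X where "finite X" "\<And>c d. \<lbrakk>0 < c; c \<le> d; d < pi; X \<inter> {c<..<d} = {}\<rbrakk> \<Longrightarrow> mono_on {c..d} (amp_re r m n) \<or> antimono_on {c..d} (amp_re r m n)"
proof -
  define P where "P = base_poly m * base_poly n + (1 - half_disc * half_disc) * (S m * S n)"
  define W where "W = pderiv P * norm_poly - P * pderiv norm_poly"
  have eq: "poly P (energy r \<theta>) / poly norm_poly (energy r \<theta>) = amp_re r m n \<theta>" if "0 < \<theta>" "\<theta> < pi" for \<theta>
  proof -
    have "sin \<theta> * sin \<theta> = 1 - poly half_disc (energy r \<theta>) * poly half_disc (energy r \<theta>)"
      using energy(2)[OF r that] sin_squared_eq[of \<theta>] by (simp add: power2_eq_square)
    then show ?thesis using poly_norm_poly[OF r that]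
      by (simp add: amp_re_def P_def base_def mult_ac) (metis mult.assoc mult.left_commute)?
  qed
  show ?thesis
  proof (rule algebraic_piecewise_mono[where \<sigma> = "- sgn (poly f' r)" and W = W and g = "amp_re r m n"
        and h = "\<lambda>\<theta>. energy' r \<theta> / (bloch_norm r \<theta> * bloch_norm r \<theta>)", OF r])
    fix \<theta> assume \<theta>: "0 < \<theta>" "\<theta> < pi"
    have N: "0 < bloch_norm r \<theta>" by (rule bloch_norm_pos[OF r \<theta>])
    have "((\<lambda>\<theta>. poly P (energy r \<theta>) / poly norm_poly (energy r \<theta>)) has_real_derivative
        (poly (pderiv P) (energy r \<theta>) * energy' r \<theta> * poly norm_poly (energy r \<theta>)
          - poly P (energy r \<theta>) * (poly (pderiv norm_poly) (energy r \<theta>) * energy' r \<theta>))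
        / (poly norm_poly (energy r \<theta>) * poly norm_poly (energy r \<theta>))) (at \<theta>)"
      by (intro DERIV_divide DERIV_chain2[OF poly_DERIV] DERIV_energy(1) r \<theta>)
         (use N poly_norm_poly[OF r \<theta>] in simp)
    then have "((\<lambda>\<theta>. poly P (energy r \<theta>) / poly norm_poly (energy r \<theta>)) has_real_derivative
      poly W (energy r \<theta>) * (energy' r \<theta> / (bloch_norm r \<theta> * bloch_norm r \<theta>))) (at \<theta>)"
      by (rule DERIV_cong) (use N in \<open>simp add: W_def poly_norm_poly[OF r \<theta>] field_simps\<close>)
    then show "(amp_re r m n has_real_derivative poly W (energy r \<theta>) * (energy' r \<theta> / (bloch_norm r \<theta> * bloch_norm r \<theta>))) (at \<theta>)"
      by (rule has_field_derivative_transform_within_open[of _ _ _ "{0<..<pi}"]) (use \<theta> eq in auto)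
    have "0 < - (energy' r \<theta> * sgn (poly f' r)) / (bloch_norm r \<theta> * bloch_norm r \<theta>)"
      using energy'_sign[OF r \<theta>] N by (intro divide_pos_pos mult_pos_pos) auto
    then show "0 < - sgn (poly f' r) * (energy' r \<theta> / (bloch_norm r \<theta> * bloch_norm r \<theta>))"
      by (simp add: mult.commute)
  qed (use that in blast)
qed

text \<open>This amplitude is sin \<theta> times a rational function of the energy. As E' contains
  another factor sin \<theta>, the derivative involves only sin^2 \<theta> = 1 - half_disc^2 and is
  again a polynomial in the energy times a factor of fixed sign.\<close>

lemma amp_im_piecewise_mono:
  assumes r: "r \<in> zeros"
  obtains X where "finite X" "\<And>c d. \<lbrakk>0 < c; c \<le> d; d < pi; X \<inter> {c<..<d} = {}\<rbrakk> \<Longrightarrow> mono_on {c..d} (amp_im r m n) \<or> antimono_on {c..d} (amp_im r m n)"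
proof -
  define P where "P = S m * base_poly n - base_poly m * S n"
  define W where "W = half_disc * P * norm_poly * f' - (1 - half_disc * half_disc) * (pderiv P * norm_poly - P * pderiv norm_poly)"
  have eq: "sin \<theta> * (poly P (energy r \<theta>) / poly norm_poly (energy r \<theta>)) = amp_im r m n \<theta>" if "0 < \<theta>" "\<theta> < pi" for \<theta>
    using poly_norm_poly[OF r that] by (simp add: amp_im_def P_def base_def algebra_simps)
  show ?thesis
  proof (rule algebraic_piecewise_mono[where \<sigma> = "sgn (poly f' r)" and W = W and g = "amp_im r m n"
        and h = "\<lambda>\<theta>. 1 / (bloch_norm r \<theta> * bloch_norm r \<theta> * poly f' (energy r \<theta>))", OF r])
    fix \<theta> assume \<theta>: "0 < \<theta>" "\<theta> < pi"
    have N: "0 < bloch_norm r \<theta>" by (rule bloch_norm_pos[OF r \<theta>])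
    have s: "sin \<theta> * sin \<theta> = 1 - poly half_disc (energy r \<theta>) * poly half_disc (energy r \<theta>)"
      using energy(2)[OF r \<theta>] sin_squared_eq[of \<theta>] by (simp add: power2_eq_square)
    have nz: "poly f' (energy r \<theta>) \<noteq> 0" by (rule energy(3)[OF r \<theta>])
    have "((\<lambda>\<theta>. poly P (energy r \<theta>) / poly norm_poly (energy r \<theta>)) has_real_derivative
        (poly (pderiv P) (energy r \<theta>) * energy' r \<theta> * poly norm_poly (energy r \<theta>)
          - poly P (energy r \<theta>) * (poly (pderiv norm_poly) (energy r \<theta>) * energy' r \<theta>))
        / (poly norm_poly (energy r \<theta>) * poly norm_poly (energy r \<theta>))) (at \<theta>)"
      by (intro DERIV_divide DERIV_chain2[OF poly_DERIV] DERIV_energy(1) r \<theta>)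
         (use N poly_norm_poly[OF r \<theta>] in simp)
    from DERIV_mult[OF DERIV_sin this]
    have "((\<lambda>\<theta>. sin \<theta> * (poly P (energy r \<theta>) / poly norm_poly (energy r \<theta>))) has_real_derivative
      poly W (energy r \<theta>) * (1 / (bloch_norm r \<theta> * bloch_norm r \<theta> * poly f' (energy r \<theta>)))) (at \<theta>)"
    proof (rule DERIV_cong)
      define e a a' N' b' d where "e = poly half_disc (energy r \<theta>)" "a = poly P (energy r \<theta>)" "a' = poly (pderiv P) (energy r \<theta>)"
        "N' = bloch_norm r \<theta>" "b' = poly (pderiv norm_poly) (energy r \<theta>)" "d = poly f' (energy r \<theta>)"
      have *: "cos \<theta> = e" "poly norm_poly (energy r \<theta>) = N'" "energy' r \<theta> = - sin \<theta> / d" "N' > 0" "d \<noteq> 0"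
        "poly W (energy r \<theta>) = e * a * N' * d - (sin \<theta> * sin \<theta>) * (a' * N' - a * b')"
        using energy(2)[OF r \<theta>] N nz s
        by (simp_all add: e_a_a'_N'_b'_d_def poly_norm_poly[OF r \<theta>] energy'_def W_def)
      show "cos \<theta> * (poly P (energy r \<theta>) / poly norm_poly (energy r \<theta>)) +
        (poly (pderiv P) (energy r \<theta>) * energy' r \<theta> * poly norm_poly (energy r \<theta>)
          - poly P (energy r \<theta>) * (poly (pderiv norm_poly) (energy r \<theta>) * energy' r \<theta>))
        / (poly norm_poly (energy r \<theta>) * poly norm_poly (energy r \<theta>)) * sin \<theta> =
        poly W (energy r \<theta>) * (1 / (bloch_norm r \<theta> * bloch_norm r \<theta> * poly f' (energy r \<theta>)))"
        unfolding *(1-3,6) unfolding e_a_a'_N'_b'_d_def(2-6)[symmetric]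
        using *(4,5) by (simp add: field_simps)
    qed
    then show "(amp_im r m n has_real_derivative poly W (energy r \<theta>) * (1 / (bloch_norm r \<theta> * bloch_norm r \<theta> * poly f' (energy r \<theta>)))) (at \<theta>)"
      by (rule has_field_derivative_transform_within_open[of _ _ _ "{0<..<pi}"]) (use \<theta> eq in auto)
    have "0 < poly f' (energy r \<theta>) * sgn (poly f' r)" by (rule pderiv_sign_on_band[OF r energy(1)[OF r \<theta>]])
    moreover have "0 < (bloch_norm r \<theta> * poly f' (energy r \<theta>))\<^sup>2" using N nz by simp
    ultimately have "0 < poly f' (energy r \<theta>) * sgn (poly f' r) / (bloch_norm r \<theta> * poly f' (energy r \<theta>))\<^sup>2"
      by (rule divide_pos_pos)
    also have "\<dots> = sgn (poly f' r) * (1 / (bloch_norm r \<theta> * bloch_norm r \<theta> * poly f' (energy r \<theta>)))"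
      using N nz by (simp add: field_simps power2_eq_square)
    finally show "0 < sgn (poly f' r) * (1 / (bloch_norm r \<theta> * bloch_norm r \<theta> * poly f' (energy r \<theta>)))" .
  qed (use that in blast)
qed

lemma amp_bounds:
  assumes "r \<in> zeros" "0 < \<theta>" "\<theta> < pi" "m < p" "n < p"
  shows "\<bar>amp_re r m n \<theta>\<bar> \<le> 1" "\<bar>amp_im r m n \<theta>\<bar> \<le> 1"
  using cmod_base_mult_le[OF assms] bloch_norm_pos[OF assms(1-3)]
    abs_Re_le_cmod[of "base r \<theta> m * cnj (base r \<theta> n)"] abs_Im_le_cmod[of "base r \<theta> m * cnj (base r \<theta> n)"]
  by (auto simp: amp_re_def amp_im_def divide_le_eq_1)

lemma continuous_on_amp:
  assumes r: "r \<in> zeros"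
  shows "continuous_on {0<..<pi} (amp_re r m n)" "continuous_on {0<..<pi} (amp_im r m n)"
proof -
  have b: "continuous_on {0<..<pi} (\<lambda>\<theta>. base r \<theta> k)" for k
    unfolding base_def Complex_eq by (intro continuous_intros continuous_on_energy[OF r])
  have "\<forall>\<theta>\<in>{0<..<pi}. (\<Sum>n<p. (cmod (base r \<theta> n))\<^sup>2) \<noteq> 0"
    using bloch_norm_pos[OF r] by (force simp: bloch_norm_def)
  then show "continuous_on {0<..<pi} (amp_re r m n)" "continuous_on {0<..<pi} (amp_im r m n)"
    unfolding amp_re_def[abs_def] amp_im_def[abs_def] bloch_norm_def
    by (intro continuous_intros b; blast)+
qed

lemma amplitude_integral_bound:
  fixes g :: "real \<Rightarrow> real"
  assumes r: "r \<in> zeros" and "finite X" and cont: "continuous_on {0<..<pi} g"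
    and pieces: "\<And>c d. \<lbrakk>0 < c; c \<le> d; d < pi; X \<inter> {c<..<d} = {}\<rbrakk> \<Longrightarrow> mono_on {c..d} g \<or> antimono_on {c..d} g"
    and bound: "\<And>\<theta>. \<lbrakk>0 < \<theta>; \<theta> < pi\<rbrakk> \<Longrightarrow> \<bar>g \<theta>\<bar> \<le> 1"
  shows "\<exists>B. \<forall>t>0. \<forall>\<kappa>. cmod (integral {0<..<pi} (\<lambda>\<theta>. of_real (g \<theta>) * cis (\<kappa> * \<theta> - t * energy r \<theta>))) \<le> B * t powr (-1/3)"
proof -
  obtain B where B: "B > 0" "\<And>r t \<kappa> a b. \<lbrakk>r \<in> zeros; t > 0; 0 < a; a \<le> b; b < pi\<rbrakk> \<Longrightarrow>
    cmod (integral {a..b} (\<lambda>\<theta>. cis (\<kappa> * \<theta> - t * energy r \<theta>))) \<le> B * t powr (-1/3)"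
    using oscillatory_integral_bound by blast
  have "cmod (integral {0<..<pi} (\<lambda>\<theta>. of_real (g \<theta>) * cis (\<kappa> * \<theta> - t * energy r \<theta>))) \<le> (2 ^ card X * (4 * B)) * t powr (-1/3)"
    if t: "t > 0" for t \<kappa>
  proof (rule tendsto_le_from_open_interval)
    have c: "continuous_on {0<..<pi} (\<lambda>\<theta>. \<kappa> * \<theta> - t * energy r \<theta>)"
      by (intro continuous_intros continuous_on_energy[OF r])
    have b: "cmod (of_real (g x) * cis (\<kappa> * x - t * energy r x)) \<le> 1" if "0 < x" "x < pi" for x
      using bound[OF that] by (simp add: norm_mult)
    then show "\<And>x. 0 < x \<Longrightarrow> x < pi \<Longrightarrow> cmod (of_real (g x) * cis (\<kappa> * x - t * energy r x)) \<le> 1" .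
    have "(\<lambda>\<theta>. of_real (g \<theta>) * cis (\<kappa> * \<theta> - t * energy r \<theta>)) integrable_on {0<..<pi}"
      by (rule bounded_continuous_integrable_on_Ioo[where B = 1])
         (use b in \<open>auto intro!: continuous_intros continuous_cis c cont\<close>)
    then show "(\<lambda>\<theta>. of_real (g \<theta>) * cis (\<kappa> * \<theta> - t * energy r \<theta>)) integrable_on {0..pi}"
      by (simp add: integrable_on_open_interval_real)
    fix a b :: real assume ab: "0 < a" "a \<le> b" "b < pi"
    have "cmod (integral {a..b} (\<lambda>\<theta>. of_real (g \<theta>) * cis (\<kappa> * \<theta> - t * energy r \<theta>))) \<le> 2 ^ card X * (4 * 1 * (B * t powr (-1/3)))"
    proof (rule conjunct2[OF integral_cis_piecewise_mono_amplitude])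
      show "continuous_on {a..b} (\<lambda>\<theta>. \<kappa> * \<theta> - t * energy r \<theta>)" by (rule continuous_on_subset[OF c]) (use ab in auto)
    qed (use assms B(2)[OF r t] ab in auto)
    then show "cmod (integral {a..b} (\<lambda>\<theta>. of_real (g \<theta>) * cis (\<kappa> * \<theta> - t * energy r \<theta>))) \<le> (2 ^ card X * (4 * B)) * t powr (-1/3)"
      by (simp add: mult_ac)
  qed simp
  then show ?thesis by blast
qed

text \<open>Quasi-periodicity reduces both sites to residues modulo p, which leaves finitely many
  amplitudes. The number of periods between the sites enters only as the linear phase \<kappa>
  \<theta>, in which the oscillatory bound is uniform.\<close>

lemma propagator_decay:
  obtains B where "B > 0" "\<And>t m n. t > 0 \<Longrightarrow> cmod (propagator t m n) \<le> B * t powr (-1/3)"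
proof -
  define P where "P = (\<lambda>(r, m, n) B. \<forall>t>0. \<forall>\<kappa>.
     cmod (integral {0<..<pi} (\<lambda>\<theta>. of_real (amp_re r m n \<theta>) * cis (\<kappa> * \<theta> - t * energy r \<theta>))) \<le> B * t powr (-1/3) \<and>
     cmod (integral {0<..<pi} (\<lambda>\<theta>. of_real (amp_im r m n \<theta>) * cis (\<kappa> * \<theta> - t * energy r \<theta>))) \<le> B * t powr (-1/3))"
  have "\<exists>B>0. \<forall>x\<in>zeros \<times> {..<p} \<times> {..<p}. P x B"
  proof (rule uniform_bound_over_finite)
    fix x assume "x \<in> zeros \<times> {..<p} \<times> {..<p}"
    then obtain r m n where x: "x = (r, m, n)" "r \<in> zeros" "m < p" "n < p" by auto
    obtain X where X: "finite X" "\<And>c d. \<lbrakk>0 < c; c \<le> d; d < pi; X \<inter> {c<..<d} = {}\<rbrakk> \<Longrightarrow> mono_on {c..d} (amp_re r m n) \<or> antimono_on {c..d} (amp_re r m n)"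
      by (rule amp_re_piecewise_mono[OF x(2), where m = m and n = n]) (erule that, blast)
    obtain Y where Y: "finite Y" "\<And>c d. \<lbrakk>0 < c; c \<le> d; d < pi; Y \<inter> {c<..<d} = {}\<rbrakk> \<Longrightarrow> mono_on {c..d} (amp_im r m n) \<or> antimono_on {c..d} (amp_im r m n)"
      by (rule amp_im_piecewise_mono[OF x(2), where m = m and n = n]) (erule that, blast)
    obtain B1 where B1: "\<forall>t>0. \<forall>\<kappa>. cmod (integral {0<..<pi} (\<lambda>\<theta>. of_real (amp_re r m n \<theta>) * cis (\<kappa> * \<theta> - t * energy r \<theta>))) \<le> B1 * t powr (-1/3)"
      using amplitude_integral_bound[OF x(2) X(1) continuous_on_amp(1)[OF x(2)] X(2) amp_bounds(1)[OF x(2) _ _ x(3,4)]] by blast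
    obtain B2 where B2: "\<forall>t>0. \<forall>\<kappa>. cmod (integral {0<..<pi} (\<lambda>\<theta>. of_real (amp_im r m n \<theta>) * cis (\<kappa> * \<theta> - t * energy r \<theta>))) \<le> B2 * t powr (-1/3)"
      using amplitude_integral_bound[OF x(2) Y(1) continuous_on_amp(2)[OF x(2)] Y(2) amp_bounds(2)[OF x(2) _ _ x(3,4)]] by blast
    have "B1 * t powr (-1/3) \<le> max B1 B2 * t powr (-1/3)" "B2 * t powr (-1/3) \<le> max B1 B2 * t powr (-1/3)" for t :: real
      by (auto intro!: mult_right_mono)
    note le = this
    have "P x (max B1 B2)" unfolding P_def x(1) prod.case
    proof (intro allI impI conjI)
      fix t \<kappa> :: real assume "t > 0"
      show "cmod (integral {0<..<pi} (\<lambda>\<theta>. of_real (amp_re r m n \<theta>) * cis (\<kappa> * \<theta> - t * energy r \<theta>))) \<le> max B1 B2 * t powr (-1/3)"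
        using B1[rule_format, OF \<open>t > 0\<close>, of \<kappa>] le(1)[of t] by (rule order.trans)
      show "cmod (integral {0<..<pi} (\<lambda>\<theta>. of_real (amp_im r m n \<theta>) * cis (\<kappa> * \<theta> - t * energy r \<theta>))) \<le> max B1 B2 * t powr (-1/3)"
        using B2[rule_format, OF \<open>t > 0\<close>, of \<kappa>] le(2)[of t] by (rule order.trans)
    qed
    then show "\<exists>B. P x B" by blast
  next
    fix x :: "real \<times> nat \<times> nat" and B B' :: real assume "P x B" "B \<le> B'"
    moreover have "B * t powr (-1/3) \<le> B' * t powr (-1/3)" for t :: real
      using \<open>B \<le> B'\<close> by (intro mult_right_mono) auto
    ultimately show "P x B'" unfolding P_def by (auto split: prod.splits intro: order.trans)
  qed (simp add: finite_zeros)
  then obtain B where B: "B > 0" "\<forall>x\<in>zeros \<times> {..<p} \<times> {..<p}. P x B" by blast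
  have osc: "cmod (integral {0<..<pi} (\<lambda>\<theta>. of_real (amp_re r m n \<theta>) * cis (\<kappa> * \<theta> - t * energy r \<theta>))) \<le> B * t powr (-1/3)"
     "cmod (integral {0<..<pi} (\<lambda>\<theta>. of_real (amp_im r m n \<theta>) * cis (\<kappa> * \<theta> - t * energy r \<theta>))) \<le> B * t powr (-1/3)"
    if "r \<in> zeros" "m < p" "n < p" "t > 0" for r m n t \<kappa>
    using B(2) that by (force simp: P_def)+
  have "cmod (propagator t m n) \<le> (real p * (2 * B)) * t powr (-1/3)" if t: "t > 0" for t m n
  proof -
    define m' n' \<kappa> where "m' = nat (m mod int p)" "n' = nat (n mod int p)" "\<kappa> = real_of_int (m div int p - n div int p)"
    have mn: "m' < p" "n' < p" using p_pos by (simp_all add: m'_n'_\<kappa>_def nat_less_iff)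
    have I: "cmod (integral {0<..<pi} (\<lambda>\<theta>. cis (- t * energy r \<theta>) * of_real (density r m n \<theta>))) \<le> 2 * B * t powr (-1/3)"
      if r: "r \<in> zeros" for r
    proof -
      \<comment> \<open>Writing cos (\<kappa> \<theta>) and sin (\<kappa> \<theta>) through
        exponentials produces four oscillatory integrals, with phases \<kappa> and - \<kappa>, each
        of weight 1/2.\<close>
      define F G where "F k \<theta> = complex_of_real (amp_re r m' n' \<theta>) * cis (k * \<theta> - t * energy r \<theta>)"
        "G k \<theta> = complex_of_real (amp_im r m' n' \<theta>) * cis (k * \<theta> - t * energy r \<theta>)" for k \<theta>
      have iF: "F k integrable_on {0<..<pi}" and iG: "G k integrable_on {0<..<pi}" for k
      proof -
        have c: "continuous_on {0<..<pi} (\<lambda>\<theta>. k * \<theta> - t * energy r \<theta>)"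
          by (intro continuous_intros continuous_on_energy[OF r])
        show "F k integrable_on {0<..<pi}" "G k integrable_on {0<..<pi}"
          unfolding F_G_def[abs_def]
          by (rule bounded_continuous_integrable_on_Ioo[where B = 1],
              use amp_bounds[OF r _ _ mn] in \<open>auto simp: norm_mult intro!: continuous_intros continuous_cis c continuous_on_amp[OF r]\<close>)+
      qed
      have "integral {0<..<pi} (\<lambda>\<theta>. cis (- t * energy r \<theta>) * of_real (density r m n \<theta>)) =
        integral {0<..<pi} (\<lambda>\<theta>. (1/2) * F \<kappa> \<theta> + (\<i>/2) * G \<kappa> \<theta> + (1/2) * F (- \<kappa>) \<theta> - (\<i>/2) * G (- \<kappa>) \<theta>)"
      proof (rule integral_cong)
        fix \<theta> :: real assume "\<theta> \<in> {0<..<pi}"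
        then have \<theta>: "0 < \<theta>" "\<theta> < pi" by auto
        have "density r m n \<theta> = cos (\<kappa> * \<theta>) * amp_re r m' n' \<theta> - sin (\<kappa> * \<theta>) * amp_im r m' n' \<theta>"
        proof -
          have e: "Re (cis a * X) / N = cos a * (Re X / N) - sin a * (Im X / N)" for a N X
            by (simp add: diff_divide_distrib)
          have "\<kappa> * \<theta> = \<theta> * of_int (m div int p - n div int p)" by (simp add: m'_n'_\<kappa>_def mult.commute)
          then show ?thesis
            unfolding density_def bloch_mult[OF r \<theta>] amp_re_def amp_im_def m'_n'_\<kappa>_def(1,2) e by (simp only:)
        qed
        moreover have "cis (k * \<theta> - t * energy r \<theta>) = cis (k * \<theta>) * cis (- t * energy r \<theta>)" for k
          by (simp add: cis_mult)
        moreover have "(1/2) * (A * (c1 * E)) + (\<i>/2) * (D * (c1 * E)) + (1/2) * (A * (c2 * E)) - (\<i>/2) * (D * (c2 * E))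
          = E * (((c1 + c2) / 2) * A - ((c1 - c2) / (2 * \<i>)) * D)" for A D c1 c2 E :: complex
          by (simp add: field_simps)
        moreover have "(cis (\<kappa> * \<theta>) + cis (- \<kappa> * \<theta>)) / 2 = of_real (cos (\<kappa> * \<theta>))"
          "(cis (\<kappa> * \<theta>) - cis (- \<kappa> * \<theta>)) / (2 * \<i>) = of_real (sin (\<kappa> * \<theta>))"
          by (simp_all add: complex_eq_iff)
        ultimately show "cis (- t * energy r \<theta>) * of_real (density r m n \<theta>) =
          (1/2) * F \<kappa> \<theta> + (\<i>/2) * G \<kappa> \<theta> + (1/2) * F (- \<kappa>) \<theta> - (\<i>/2) * G (- \<kappa>) \<theta>"
          by (simp only: F_G_def of_real_diff of_real_mult)
      qed
      also have "\<dots> = (1/2) * integral {0<..<pi} (F \<kappa>) + (\<i>/2) * integral {0<..<pi} (G \<kappa>)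
        + (1/2) * integral {0<..<pi} (F (- \<kappa>)) - (\<i>/2) * integral {0<..<pi} (G (- \<kappa>))"
        by (simp only: Henstock_Kurzweil_Integration.integral_add Henstock_Kurzweil_Integration.integral_diff
            integral_mult_right integrable_add integrable_diff integrable_on_mult_right iF iG)
      also have "cmod \<dots> \<le> (1/2) * (B * t powr (-1/3)) + (1/2) * (B * t powr (-1/3))
         + (1/2) * (B * t powr (-1/3)) + (1/2) * (B * t powr (-1/3))"
        using osc[OF r mn t, of \<kappa>] osc[OF r mn t, of "- \<kappa>"] unfolding F_G_def[abs_def]
        by (intro norm_triangle_le_diff order.trans[OF norm_triangle_ineq4] order.trans[OF norm_triangle_ineq] add_mono)
           (simp_all add: norm_mult norm_divide)
      finally show ?thesis by simp
    qed
    have "cmod (propagator t m n) \<le> 1 / pi * (\<Sum>r\<in>zeros. 2 * B * t powr (-1/3))"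
      unfolding propagator_def norm_mult using I by (intro mult_mono sum_norm_le) (auto simp: norm_divide)
    also have "\<dots> \<le> 1 * (\<Sum>r\<in>zeros. 2 * B * t powr (-1/3))"
      using pi_gt3 B(1) by (intro mult_right_mono sum_nonneg) auto
    finally show ?thesis using card_zeros degree_half_disc by (simp add: mult_ac)
  qed
  then show ?thesis using that[of "real p * (2 * B)"] B(1) p_pos by simp
qed

end

section \<open>The nonlinear equation\<close>

text \<open>In the norm sup exp (-2 L t) |x t| the integral operator contracts by 1/2 on the whole
  half line at once, so a global solution appears without continuation. The map
  \<open>\<Phi>\<close> acts on y t = exp (-2 L t) x t, and \<open>max t 0\<close> extends
  everything by constants to negative times, where bounded continuous functions on the real line are
  expected.\<close>

lemma picard_half_line:
  fixes G :: "'a::banach \<Rightarrow> 'a"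
  assumes "L > 0" and lip: "\<And>x y. norm (G x - G y) \<le> L * norm (x - y)"
  shows "\<exists>x. x 0 = x0 \<and> (\<forall>t\<ge>0. (x has_vector_derivative G (x t)) (at t within {0..}))"
proof -
  have contG: "continuous_on S G" for S
    using lip \<open>L > 0\<close> by (intro lipschitz_on_continuous_on[where L = L] lipschitz_onI) (auto simp: dist_norm)
  define W where "W y t = x0 + integral {0..max t 0} (\<lambda>s. G (exp (2 * L * s) *\<^sub>R apply_bcontfun y s))" for y :: "real \<Rightarrow>\<^sub>C 'a" and t
  define \<Phi> where "\<Phi> y t = exp (- 2 * L * max t 0) *\<^sub>R W y t" for y :: "real \<Rightarrow>\<^sub>C 'a" and t
  have contI: "continuous_on S (\<lambda>s. G (exp (2 * L * s) *\<^sub>R apply_bcontfun y s))" for S and y :: "real \<Rightarrow>\<^sub>C 'a"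
    by (rule continuous_on_compose2[OF contG[of UNIV]]) (auto intro!: continuous_intros)
  have int: "(\<lambda>s. G (exp (2 * L * s) *\<^sub>R apply_bcontfun y s)) integrable_on {a..b}" for a b and y :: "real \<Rightarrow>\<^sub>C 'a"
    by (rule integrable_continuous_interval[OF contI])
  have expint: "integral {0..T} (\<lambda>s. L * exp (2 * L * s)) = (exp (2 * L * T) - 1) / 2"
      "(\<lambda>s. L * exp (2 * L * s)) integrable_on {0..T}" if "T \<ge> 0" for T
  proof -
    have "((\<lambda>s. L * exp (2 * L * s)) has_integral (exp (2 * L * T) / 2 - exp (2 * L * 0) / 2)) {0..T}"
      using that by (intro fundamental_theorem_of_calculus)
        (auto intro!: derivative_eq_intros simp flip: has_real_derivative_iff_has_vector_derivative)
    note HI = this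
    show "integral {0..T} (\<lambda>s. L * exp (2 * L * s)) = (exp (2 * L * T) - 1) / 2"
      by (simp only: integral_unique[OF HI]) (simp add: diff_divide_distrib)
    show "(\<lambda>s. L * exp (2 * L * s)) integrable_on {0..T}" by (rule has_integral_integrable[OF HI])
  qed
  have Wdiff: "norm (W y t - W z t) \<le> norm (y - z) * (exp (2 * L * max t 0) / 2)" for y z t
  proof -
    define T where "T = max t 0"
    have "W y t - W z t = integral {0..T} (\<lambda>s. G (exp (2 * L * s) *\<^sub>R apply_bcontfun y s) - G (exp (2 * L * s) *\<^sub>R apply_bcontfun z s))"
      unfolding W_def T_def[symmetric] by (simp add: Henstock_Kurzweil_Integration.integral_diff int)
    also have "norm \<dots> \<le> integral {0..T} (\<lambda>s. norm (y - z) * (L * exp (2 * L * s)))"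
    proof (rule integral_norm_bound_integral)
      fix s
      have "norm (G (exp (2 * L * s) *\<^sub>R apply_bcontfun y s) - G (exp (2 * L * s) *\<^sub>R apply_bcontfun z s))
         \<le> L * norm (exp (2 * L * s) *\<^sub>R apply_bcontfun y s - exp (2 * L * s) *\<^sub>R apply_bcontfun z s)" by (rule lip)
      also have "\<dots> = L * (exp (2 * L * s) * norm (apply_bcontfun (y - z) s))"
        by (simp flip: scaleR_diff_right)
      also have "\<dots> \<le> L * (exp (2 * L * s) * norm (y - z))"
        using \<open>L > 0\<close> by (intro mult_left_mono norm_bounded) auto
      finally show "norm (G (exp (2 * L * s) *\<^sub>R apply_bcontfun y s) - G (exp (2 * L * s) *\<^sub>R apply_bcontfun z s))
        \<le> norm (y - z) * (L * exp (2 * L * s))" by (simp add: mult_ac)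
    qed (use expint(2)[of T] in \<open>auto simp: T_def intro!: integrable_diff int integrable_on_mult_right\<close>)
    also have "\<dots> = norm (y - z) * ((exp (2 * L * T) - 1) / 2)"
      using expint(1)[of T] by (simp add: T_def)
    also have "\<dots> \<le> norm (y - z) * (exp (2 * L * T) / 2)" by (intro mult_left_mono) auto
    finally show ?thesis by (simp add: T_def)
  qed
  have \<Phi>diff: "norm (\<Phi> y t - \<Phi> z t) \<le> norm (y - z) / 2" for y z t
  proof -
    have "norm (\<Phi> y t - \<Phi> z t) = exp (- 2 * L * max t 0) * norm (W y t - W z t)"
      by (simp add: \<Phi>_def flip: scaleR_diff_right)
    also have "\<dots> \<le> exp (- 2 * L * max t 0) * (norm (y - z) * (exp (2 * L * max t 0) / 2))"
      by (intro mult_left_mono Wdiff) auto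
    also have "\<dots> = norm (y - z) / 2 * (exp (- 2 * L * max t 0) * exp (2 * L * max t 0))" by simp
    also have "\<dots> = norm (y - z) / 2" by (simp flip: exp_add)
    finally show ?thesis .
  qed
  have W0: "W 0 t = x0 + max t 0 *\<^sub>R G 0" for t by (simp add: W_def)
  have contW: "continuous_on UNIV (W y)" for y
  proof -
    have c: "continuous_on {0..b} (\<lambda>t. integral {0..t} (\<lambda>s. G (exp (2 * L * s) *\<^sub>R apply_bcontfun y s)))" for b
      by (rule indefinite_integral_continuous_1[OF int])
    have "isCont (\<lambda>t. integral {0..max t 0} (\<lambda>s. G (exp (2 * L * s) *\<^sub>R apply_bcontfun y s))) t" for t
    proof -
      have "continuous_on {-\<bar>t\<bar> - 1..\<bar>t\<bar> + 1} (\<lambda>t. integral {0..max t 0} (\<lambda>s. G (exp (2 * L * s) *\<^sub>R apply_bcontfun y s)))"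
        by (rule continuous_on_compose2[OF c[of "\<bar>t\<bar> + 1"]]) (auto intro!: continuous_intros)
      then show ?thesis
        by (rule continuous_on_interior) (auto simp: interior_atLeastAtMost_real)
    qed
    then show ?thesis unfolding W_def[abs_def] by (intro continuous_intros continuous_at_imp_continuous_on) auto
  qed
  have \<Phi>bcont: "\<Phi> y \<in> bcontfun" for y
  proof (rule bcontfun_normI)
    show "continuous_on UNIV (\<Phi> y)"
      unfolding \<Phi>_def[abs_def] by (intro continuous_intros contW)
    show "norm (\<Phi> y t) \<le> norm y / 2 + (norm x0 + norm (G 0) / (2 * L))" for t
    proof -
      define T where "T = max t 0"
      have T: "T \<ge> 0" by (simp add: T_def)
      have "norm (\<Phi> y t) \<le> norm (\<Phi> y t - \<Phi> 0 t) + norm (\<Phi> 0 t)" by (metis norm_triangle_sub add.commute)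
      moreover have "norm (\<Phi> 0 t) \<le> exp (- 2 * L * T) * (norm x0 + T * norm (G 0))"
        unfolding \<Phi>_def W0 T_def[symmetric] using T
        by (simp add: order.trans[OF norm_triangle_ineq])
      moreover have "exp (- 2 * L * T) * (norm x0 + T * norm (G 0)) \<le> norm x0 + norm (G 0) / (2 * L)"
      proof -
        have "2 * L * T \<le> exp (2 * L * T)" using exp_ge_add_one_self[of "2 * L * T"] by linarith
        then have "exp (- 2 * L * T) * (2 * L * T) \<le> exp (- 2 * L * T) * exp (2 * L * T)" by (intro mult_left_mono) auto
        then have "exp (- 2 * L * T) * (2 * L * T) \<le> 1" by (simp flip: exp_add)
        then have "exp (- 2 * L * T) * T \<le> 1 / (2 * L)" using \<open>L > 0\<close> by (simp add: field_simps)
        then have "exp (- 2 * L * T) * T * norm (G 0) \<le> 1 / (2 * L) * norm (G 0)" by (intro mult_right_mono) auto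
        moreover have "exp (- 2 * L * T) * norm x0 \<le> 1 * norm x0" using T \<open>L > 0\<close> by (intro mult_right_mono) auto
        ultimately show ?thesis by (simp add: algebra_simps)
      qed
      ultimately show ?thesis using \<Phi>diff[of y t 0] by simp
    qed
  qed
  have ap: "apply_bcontfun (Bcontfun (\<Phi> y)) = \<Phi> y" for y by (rule Bcontfun_inverse[OF \<Phi>bcont])
  have "\<exists>!y. Bcontfun (\<Phi> y) = y"
  proof (rule banach_fix_type[of "1/2"])
    show "\<forall>y z. dist (Bcontfun (\<Phi> y)) (Bcontfun (\<Phi> z)) \<le> 1/2 * dist y z"
    proof (intro allI)
      fix y z
      have "dist (Bcontfun (\<Phi> y)) (Bcontfun (\<Phi> z)) \<le> norm (y - z) / 2"
        by (rule dist_bound) (use \<Phi>diff in \<open>simp add: ap dist_norm\<close>)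
      then show "dist (Bcontfun (\<Phi> y)) (Bcontfun (\<Phi> z)) \<le> 1/2 * dist y z" by (simp add: dist_norm)
    qed
  qed auto
  then obtain y where y: "Bcontfun (\<Phi> y) = y" by blast
  have yt: "apply_bcontfun y t = \<Phi> y t" for t using ap[of y] y by simp
  define x where "x t = W y t" for t
  have xy: "exp (2 * L * s) *\<^sub>R apply_bcontfun y s = x s" if "s \<ge> 0" for s
    using that by (simp add: yt \<Phi>_def x_def flip: exp_add)
  have "(x has_vector_derivative G (x t)) (at t within {0..})" if t: "t \<ge> 0" for t
  proof -
    have "((\<lambda>t. integral {0..t} (\<lambda>s. G (exp (2 * L * s) *\<^sub>R apply_bcontfun y s))) has_vector_derivative
        G (exp (2 * L * t) *\<^sub>R apply_bcontfun y t)) (at t within {0..t+1})"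
      by (rule integral_has_vector_derivative[OF contI]) (use t in auto)
    then have "((\<lambda>t. x0 + integral {0..t} (\<lambda>s. G (exp (2 * L * s) *\<^sub>R apply_bcontfun y s))) has_vector_derivative
        G (x t)) (at t within {0..t+1})"
      unfolding xy[OF t] by (auto intro!: derivative_eq_intros)
    then have "(x has_vector_derivative G (x t)) (at t within {0..t+1})"
      by (rule has_vector_derivative_transform[rotated 2]) (use t in \<open>auto simp: x_def W_def\<close>)
    moreover have "at t within {0..} = at t within {0..t+1}"
      by (rule at_within_nhd[of _ "{..<t+1}"]) auto
    ultimately show ?thesis by simp
  qed
  moreover have "x 0 = x0" by (simp add: x_def W_def)
  ultimately show ?thesis by blast
qed

text \<open>Let |w| \<le> |z| and split the difference into the truncated power at z times z - w and
  the difference of the truncated powers times w. The second part is nonzero only if |w| < R; the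
  mean value theorem between |w| and the truncated |z| then gives the factor \<alpha> R^(\<alpha> -
  1), and |w| supplies the missing power of R.\<close>

lemma truncated_power_lipschitz:
  fixes z w :: complex
  assumes "\<alpha> \<ge> 1" "R > 0"
  defines "g \<equiv> \<lambda>z :: complex. complex_of_real (min (cmod z) R powr \<alpha>) * z"
  shows "cmod (g z - g w) \<le> (1 + \<alpha>) * R powr \<alpha> * cmod (z - w)"
proof -
  have *: "cmod (g z - g w) \<le> (1 + \<alpha>) * R powr \<alpha> * cmod (z - w)" if le: "cmod w \<le> cmod z" for z w
  proof -
    define \<phi> where "\<phi> x = min x R powr \<alpha>" for x
    have "g z - g w = of_real (\<phi> (cmod z)) * (z - w) + of_real (\<phi> (cmod z) - \<phi> (cmod w)) * w"
      by (simp add: g_def \<phi>_def algebra_simps)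
    then have "cmod (g z - g w) \<le> cmod (of_real (\<phi> (cmod z)) * (z - w)) + cmod (of_real (\<phi> (cmod z) - \<phi> (cmod w)) * w)"
      by (simp only: norm_triangle_ineq)
    then have "cmod (g z - g w) \<le> \<phi> (cmod z) * cmod (z - w) + \<bar>\<phi> (cmod z) - \<phi> (cmod w)\<bar> * cmod w"
      by (simp add: norm_mult \<phi>_def del: of_real_diff)
    moreover have "\<phi> (cmod z) * cmod (z - w) \<le> R powr \<alpha> * cmod (z - w)"
      using assms by (intro mult_right_mono) (auto simp: \<phi>_def intro!: powr_mono2)
    moreover have "\<bar>\<phi> (cmod z) - \<phi> (cmod w)\<bar> * cmod w \<le> \<alpha> * R powr \<alpha> * cmod (z - w)"
    proof (cases "cmod w < R")
      case False
      then show ?thesis using le assms by (simp add: \<phi>_def)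
    next
      case True
      define a b where "a = cmod w" "b = min (cmod z) R"
      have ab: "0 \<le> a" "a \<le> b" "b \<le> R" using True le by (auto simp: a_b_def)
      have "b powr \<alpha> - a powr \<alpha> \<le> \<alpha> * R powr (\<alpha> - 1) * (b - a)"
      proof (cases "a < b")
        case True
        have "\<exists>l x. a < x \<and> x < b \<and> ((\<lambda>x. x powr \<alpha>) has_real_derivative l) (at x) \<and> b powr \<alpha> - a powr \<alpha> = (b - a) * l"
        proof (rule MVT[OF True])
          show "continuous_on {a..b} (\<lambda>x. x powr \<alpha>)" using ab assms by (intro continuous_on_powr' continuous_intros) auto
          show "(\<lambda>x. x powr \<alpha>) differentiable (at x)" if "a < x" "x < b" for x
            using has_real_derivative_powr[of x \<alpha>] that ab by (auto simp: real_differentiable_def)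
        qed
        then obtain l x where x: "a < x" "x < b" "((\<lambda>x. x powr \<alpha>) has_real_derivative l) (at x)" "b powr \<alpha> - a powr \<alpha> = (b - a) * l" by blast
        have "l = \<alpha> * x powr (\<alpha> - 1)"
          using DERIV_unique[OF x(3) has_real_derivative_powr[of x \<alpha>]] x ab by auto
        also have "\<dots> \<le> \<alpha> * R powr (\<alpha> - 1)" using x ab assms by (intro mult_left_mono powr_mono2) auto
        finally have "(b - a) * l \<le> (b - a) * (\<alpha> * R powr (\<alpha> - 1))" using True by (intro mult_left_mono) auto
        then show ?thesis using x(4) by (simp add: mult_ac)
      qed (use ab in simp)
      moreover have "a powr \<alpha> \<le> b powr \<alpha>" using ab assms by (intro powr_mono2) auto
      moreover have "\<phi> (cmod z) = b powr \<alpha>" "\<phi> (cmod w) = a powr \<alpha>" using True by (simp_all add: \<phi>_def a_b_def)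
      ultimately have "\<bar>\<phi> (cmod z) - \<phi> (cmod w)\<bar> \<le> \<alpha> * R powr (\<alpha> - 1) * (b - a)" by simp
      also have "\<dots> \<le> \<alpha> * R powr (\<alpha> - 1) * cmod (z - w)"
        using assms norm_triangle_ineq2[of z w] by (intro mult_left_mono) (auto simp: a_b_def)
      finally have "\<bar>\<phi> (cmod z) - \<phi> (cmod w)\<bar> * cmod w \<le> (\<alpha> * R powr (\<alpha> - 1) * cmod (z - w)) * R"
        using True assms by (intro mult_mono) auto
      also have "\<dots> = \<alpha> * (R powr (\<alpha> - 1) * R powr 1) * cmod (z - w)" using assms by simp
      also have "\<dots> = \<alpha> * R powr \<alpha> * cmod (z - w)" unfolding powr_add[symmetric] by simp
      finally show ?thesis .
    qed
    ultimately show ?thesis by (simp add: algebra_simps)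
  qed
  show ?thesis using *[of w z] *[of z w] by (cases "cmod w \<le> cmod z") (auto simp: norm_minus_commute)
qed

lemma sum_two_power_abs_le:
  fixes F :: "int set"
  assumes "finite F"
  shows "(\<Sum>n\<in>F. (1/2::real) ^ nat \<bar>n - m\<bar>) \<le> 4"
proof -
  define F' where "F' = (\<lambda>n. n - m) ` F"
  have "(\<Sum>n\<in>F. (1/2::real) ^ nat \<bar>n - m\<bar>) = (\<Sum>k\<in>F'. (1/2) ^ nat \<bar>k\<bar>)"
    unfolding F'_def by (subst sum.reindex) (auto simp: inj_on_def)
  also have "\<dots> \<le> (\<Sum>k\<in>F' \<inter> {0..}. (1/2) ^ nat \<bar>k\<bar>) + (\<Sum>k\<in>F' \<inter> {..0}. (1/2) ^ nat \<bar>k\<bar>)"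
  proof -
    have "(\<Sum>k\<in>F'. (1/2::real) ^ nat \<bar>k\<bar>) = (\<Sum>k\<in>F' \<inter> {0..} \<union> F' \<inter> {..0}. (1/2) ^ nat \<bar>k\<bar>)"
      by (rule sum.cong) auto
    also have "\<dots> \<le> (\<Sum>k\<in>F' \<inter> {0..}. (1/2) ^ nat \<bar>k\<bar>) + (\<Sum>k\<in>F' \<inter> {..0}. (1/2) ^ nat \<bar>k\<bar>)"
      using sum.union_inter[of "F' \<inter> {0..}" "F' \<inter> {..0}" "\<lambda>k. (1/2::real) ^ nat \<bar>k\<bar>"] assms
        sum_nonneg[of "(F' \<inter> {0..}) \<inter> (F' \<inter> {..0})" "\<lambda>k. (1/2::real) ^ nat \<bar>k\<bar>"]
      by (simp add: F'_def)
    finally show ?thesis .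
  qed
  also have "\<dots> \<le> 2 + 2"
  proof (rule add_mono)
    have g: "(\<Sum>k\<in>A. (1/2::real) ^ k) \<le> 2" if "finite A" for A :: "nat set"
      using sum_le_suminf[of "\<lambda>k. (1/2::real) ^ k" A] that by (simp add: suminf_geometric summable_geometric)
    have "(\<Sum>k\<in>F' \<inter> {0..}. (1/2::real) ^ nat \<bar>k\<bar>) = (\<Sum>k\<in>nat ` (F' \<inter> {0..}). (1/2) ^ k)"
      by (subst sum.reindex) (auto simp: inj_on_def)
    also have "\<dots> \<le> 2" by (rule g) (use assms in \<open>auto simp: F'_def\<close>)
    finally show "(\<Sum>k\<in>F' \<inter> {0..}. (1/2::real) ^ nat \<bar>k\<bar>) \<le> 2" .
    have "(\<Sum>k\<in>F' \<inter> {..0}. (1/2::real) ^ nat \<bar>k\<bar>) = (\<Sum>k\<in>(\<lambda>k. nat (-k)) ` (F' \<inter> {..0}). (1/2) ^ k)"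
      by (subst sum.reindex) (auto simp: inj_on_def intro!: sum.cong)
    also have "\<dots> \<le> 2" by (rule g) (use assms in \<open>auto simp: F'_def\<close>)
    finally show "(\<Sum>k\<in>F' \<inter> {..0}. (1/2::real) ^ nat \<bar>k\<bar>) \<le> 2" .
  qed
  finally show ?thesis by simp
qed

text \<open>The bounded oscillation of \<open>b\<close> makes the Schroedinger operator bounded in the supremum norm
  weighted by \<open>b\<close>.\<close>

lemma dominating_weight:
  fixes a :: "int \<Rightarrow> real"
  assumes a: "a summable_on UNIV" and nonneg: "\<And>n. 0 \<le> a n"
  obtains b B where "\<And>n. 0 < b n" "\<And>n. a n \<le> b n" "\<And>n. b (n + 1) \<le> 2 * b n" "\<And>n. b (n - 1) \<le> 2 * b n"
    "\<And>F. finite F \<Longrightarrow> sum b F \<le> B"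
proof -
  define k where "k n m = (1/2::real) ^ nat \<bar>n - m\<bar>" for n m :: int
  have k: "0 < k n m" "k n m \<le> 1" "k n n = 1" for n m by (auto simp: k_def power_le_one)
  have k2: "k (n + 1) m \<le> 2 * k n m" "k (n - 1) m \<le> 2 * k n m" for n m
  proof -
    have "k n' m \<le> 2 * k n m" if "nat \<bar>n - m\<bar> \<le> Suc (nat \<bar>n' - m\<bar>)" for n' n
    proof -
      have "(1/2::real) ^ Suc (nat \<bar>n' - m\<bar>) \<le> (1/2) ^ nat \<bar>n - m\<bar>"
        by (rule power_decreasing) (use that in auto)
      then show ?thesis by (simp add: k_def)
    qed
    then show "k (n + 1) m \<le> 2 * k n m" "k (n - 1) m \<le> 2 * k n m" by force+
  qed
  have s: "(\<lambda>m. k n m * a m) summable_on UNIV" for n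
    by (rule summable_on_comparison_test[OF a]) (use k nonneg in \<open>auto intro: mult_left_le_one_le simp: less_imp_le\<close>)
  \<comment> \<open>This is \<open>a\<close> convolved with 2^(-|n|), a kernel that changes by at
    most a factor 2 between neighbours. The extra copy of the kernel centred at 0 keeps
    \<open>b\<close> positive when \<open>a\<close> vanishes identically.\<close>
  define b where "b n = k n 0 + infsum (\<lambda>m. k n m * a m) UNIV" for n
  have inn: "0 \<le> infsum (\<lambda>m. k n m * a m) UNIV" for n
    using k nonneg by (intro infsum_nonneg) (auto simp: less_imp_le)
  have dbl: "b n' \<le> 2 * b n" if "\<And>m. k n' m \<le> 2 * k n m" for n n'
  proof -
    have "infsum (\<lambda>m. k n' m * a m) UNIV \<le> infsum (\<lambda>m. 2 * (k n m * a m)) UNIV"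
      using that nonneg by (intro infsum_mono s summable_on_cmult_right) (auto simp: mult.assoc[symmetric] intro: mult_right_mono)
    then show ?thesis using that[of 0] by (simp add: b_def infsum_cmult_right')
  qed
  show ?thesis
  proof (rule that[of b "4 + 4 * infsum a UNIV"])
    show "0 < b n" for n unfolding b_def using k(1) inn by (rule add_pos_nonneg)
    show "a n \<le> b n" for n
    proof -
      have "sum (\<lambda>m. k n m * a m) {n} \<le> infsum (\<lambda>m. k n m * a m) UNIV"
        using k nonneg by (intro finite_sum_le_infsum s) (auto simp: less_imp_le)
      then show ?thesis using k(1)[of n 0] by (simp add: b_def k(3))
    qed
    show "b (n + 1) \<le> 2 * b n" "b (n - 1) \<le> 2 * b n" for n by (rule dbl, rule k2)+
    show "sum b F \<le> 4 + 4 * infsum a UNIV" if F: "finite F" for F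
    proof -
      have sF: "(\<lambda>m. \<Sum>n\<in>F. k n m * a m) summable_on UNIV \<and>
          (\<Sum>n\<in>F. infsum (\<lambda>m. k n m * a m) UNIV) = infsum (\<lambda>m. \<Sum>n\<in>F. k n m * a m) UNIV"
        using F by (induction F) (simp_all add: infsum_add s summable_on_add)
      have "sum b F = (\<Sum>n\<in>F. k n 0) + infsum (\<lambda>m. \<Sum>n\<in>F. k n m * a m) UNIV"
        using sF by (simp add: b_def sum.distrib)
      moreover have "infsum (\<lambda>m. \<Sum>n\<in>F. k n m * a m) UNIV \<le> infsum (\<lambda>m. 4 * a m) UNIV"
      proof (rule infsum_mono)
        show "(\<lambda>m. \<Sum>n\<in>F. k n m * a m) summable_on UNIV" using sF by blast
        show "(\<lambda>m. 4 * a m) summable_on UNIV" by (intro summable_on_cmult_right a)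
        show "(\<Sum>n\<in>F. k n m * a m) \<le> 4 * a m" for m
          unfolding sum_distrib_right[symmetric] k_def
          by (intro mult_right_mono sum_two_power_abs_le F nonneg)
      qed
      moreover have "(\<Sum>n\<in>F. k n 0) \<le> 4" unfolding k_def by (rule sum_two_power_abs_le[OF F])
      ultimately show ?thesis by (simp add: infsum_cmult_right')
    qed
  qed
qed

instance bcontfun :: (metric_space, banach) banach ..

section \<open>The truncated equation in a weighted supremum space\<close>

locale dnls =
  fixes \<sigma> s MV :: real and V :: "int \<Rightarrow> real"
  assumes \<sigma>: "\<sigma> > 5" and s: "s = 1 \<or> s = -1" and MV: "\<And>n. \<bar>V n\<bar> \<le> MV"
begin

text \<open>Truncation at amplitude \<open>R\<close> makes the nonlinearity globally Lipschitz.\<close>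

definition trunc :: "real \<Rightarrow> complex \<Rightarrow> complex" where
  "trunc R z = complex_of_real (min (cmod z) R powr (\<sigma> - 1)) * z"

definition rhs :: "real \<Rightarrow> (int \<Rightarrow> complex) \<Rightarrow> int \<Rightarrow> complex" where
  "rhs R u n = - \<i> * (schroedinger_op V u n + of_real s * trunc R (u n))"

text \<open>Each of the two neighbours contributes 2, the factor by which the weight may grow
  between adjacent sites, and \<sigma> R^(\<sigma> - 1) is the Lipschitz constant of the truncated
  power.\<close>

definition lip :: "real \<Rightarrow> real" where
  "lip R = 4 + MV + \<sigma> * R powr (\<sigma> - 1)"

lemma MV_nonneg: "0 \<le> MV"
  using MV[of 0] by linarith

lemma lip_pos: "0 < lip R"
  using MV_nonneg \<sigma> by (simp add: lip_def add_pos_nonneg)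

lemma rhs_diff_le:
  assumes "R > 0"
  shows "cmod (rhs R u n - rhs R v n) \<le> cmod (u (n - 1) - v (n - 1)) + cmod (u (n + 1) - v (n + 1))
    + (MV + \<sigma> * R powr (\<sigma> - 1)) * cmod (u n - v n)"
proof -
  have "rhs R u n - rhs R v n = - \<i> * ((u (n - 1) - v (n - 1)) + (u (n + 1) - v (n + 1))
    + (of_real (V n) * (u n - v n) + of_real s * (trunc R (u n) - trunc R (v n))))"
    by (simp add: rhs_def schroedinger_op_def algebra_simps)
  then have "cmod (rhs R u n - rhs R v n) = cmod ((u (n - 1) - v (n - 1)) + (u (n + 1) - v (n + 1))
    + (of_real (V n) * (u n - v n) + of_real s * (trunc R (u n) - trunc R (v n))))"
    by (simp add: norm_mult)
  also have "\<dots> \<le> cmod (u (n - 1) - v (n - 1)) + cmod (u (n + 1) - v (n + 1))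
    + (MV * cmod (u n - v n) + (1 + (\<sigma> - 1)) * R powr (\<sigma> - 1) * cmod (u n - v n))"
  proof (intro order.trans[OF norm_triangle_ineq] add_mono order.refl)
    show "cmod (of_real (V n) * (u n - v n)) \<le> MV * cmod (u n - v n)"
      using MV[of n] by (simp add: norm_mult mult_right_mono)
    show "cmod (of_real s * (trunc R (u n) - trunc R (v n))) \<le> (1 + (\<sigma> - 1)) * R powr (\<sigma> - 1) * cmod (u n - v n)"
      using truncated_power_lipschitz[of "\<sigma> - 1" R "u n" "v n"] \<sigma> assms s
      by (auto simp: norm_mult trunc_def)
  qed
  finally show ?thesis by (simp add: algebra_simps)
qed

lemma rhs_weighted_lipschitz:
  assumes "R > 0" "c \<ge> 0" "\<And>n. cmod (u n - v n) \<le> c * b n"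
    and b: "\<And>n. b (n + 1) \<le> 2 * b n" "\<And>n. b (n - 1) \<le> 2 * b n"
  shows "cmod (rhs R u n - rhs R v n) \<le> lip R * (c * b n)"
proof -
  have "cmod (u (n - 1) - v (n - 1)) \<le> 2 * (c * b n)"
    using assms(3)[of "n - 1"] mult_left_mono[OF b(2)[of n] \<open>c \<ge> 0\<close>] by simp
  moreover have "cmod (u (n + 1) - v (n + 1)) \<le> 2 * (c * b n)"
    using assms(3)[of "n + 1"] mult_left_mono[OF b(1)[of n] \<open>c \<ge> 0\<close>] by simp
  moreover have "(MV + \<sigma> * R powr (\<sigma> - 1)) * cmod (u n - v n) \<le> (MV + \<sigma> * R powr (\<sigma> - 1)) * (c * b n)"
    using MV_nonneg \<sigma> by (intro mult_left_mono assms(3)) auto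
  ultimately show ?thesis using rhs_diff_le[OF assms(1), of u n v] by (simp add: lip_def algebra_simps)
qed

lemma rhs_zero [simp]: "rhs R (\<lambda>_. 0) n = 0"
  by (simp add: rhs_def schroedinger_op_def trunc_def)

text \<open>Division by \<open>b\<close> turns sequences bounded by a multiple of \<open>b\<close>
  into bounded functions on the integers, realized as bounded continuous functions on a discrete
  space. The truncated vector field is globally Lipschitz there, so Picard's theorem yields
  existence and domination by the weight together. Negative times are obtained later by
  conjugation.\<close>

lemma half_line_solution:
  assumes b: "\<And>n. 0 < b n" "\<And>n. b (n + 1) \<le> 2 * b n" "\<And>n. b (n - 1) \<le> 2 * b n"
    and dom: "\<And>n. cmod (\<psi>0 n) \<le> b n"
  shows "\<exists>x. x 0 = \<psi>0 \<and>
    (\<forall>t\<ge>0. \<forall>n. ((\<lambda>t. x t n) has_vector_derivative rhs 1 (x t) n) (at t within {0..})) \<and>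
    (\<forall>T\<ge>0. \<exists>M\<ge>0. \<forall>t\<in>{0..T}. \<forall>n. cmod (x t n) \<le> M * b n)"
proof -
  define unw where "unw \<eta> n = of_real (b n) * apply_bcontfun \<eta> (discrete n)" for \<eta> :: "int discrete \<Rightarrow>\<^sub>C complex" and n
  define g where "g \<eta> k = rhs 1 (unw \<eta>) (of_discrete k) / of_real (b (of_discrete k))" for \<eta> k
  have cont: "continuous_on UNIV f" for f :: "int discrete \<Rightarrow> complex"
    unfolding continuous_on_open_vimage[OF open_UNIV] by (auto simp: open_discrete)
  have gdiff: "cmod (g \<eta> k - g \<xi> k) \<le> lip 1 * norm (\<eta> - \<xi>)" for \<eta> \<xi> k
  proof -
    define n where "n = of_discrete k"
    have "cmod (unw \<eta> m - unw \<xi> m) \<le> norm (\<eta> - \<xi>) * b m" for m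
    proof -
      have "unw \<eta> m - unw \<xi> m = of_real (b m) * apply_bcontfun (\<eta> - \<xi>) (discrete m)"
        by (simp add: unw_def algebra_simps)
      then show ?thesis using norm_bounded[of "\<eta> - \<xi>" "discrete m"] b(1)[of m]
        by (simp add: norm_mult mult.commute mult_right_mono)
    qed
    then have "cmod (rhs 1 (unw \<eta>) n - rhs 1 (unw \<xi>) n) \<le> lip 1 * (norm (\<eta> - \<xi>) * b n)"
      using b by (intro rhs_weighted_lipschitz) auto
    moreover have eq: "g \<eta> k - g \<xi> k = (rhs 1 (unw \<eta>) n - rhs 1 (unw \<xi>) n) / of_real (b n)"
      by (simp add: g_def n_def diff_divide_distrib)
    ultimately show ?thesis unfolding eq norm_divide using b(1)[of n] by (simp add: divide_le_eq mult_ac)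
  qed
  have unw0: "unw 0 = (\<lambda>_. 0)" by (auto simp: unw_def)
  have g_bcont: "g \<eta> \<in> bcontfun" for \<eta>
    by (rule bcontfun_normI[OF cont, of _ "lip 1 * norm \<eta>"]) (use gdiff[of \<eta> _ 0] in \<open>simp add: g_def unw0\<close>)
  define G where "G \<eta> = Bcontfun (g \<eta>)" for \<eta>
  have G: "apply_bcontfun (G \<eta>) = g \<eta>" for \<eta> unfolding G_def by (rule Bcontfun_inverse[OF g_bcont])
  have "norm (G \<eta> - G \<xi>) \<le> lip 1 * norm (\<eta> - \<xi>)" for \<eta> \<xi>
    by (rule norm_bound) (use gdiff in \<open>simp add: G\<close>)
  from picard_half_line[of "lip 1" G "Bcontfun (\<lambda>k. \<psi>0 (of_discrete k) / of_real (b (of_discrete k)))", OF lip_pos this]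
  obtain \<eta> where \<eta>0: "\<eta> 0 = Bcontfun (\<lambda>k. \<psi>0 (of_discrete k) / of_real (b (of_discrete k)))"
    and \<eta>: "\<And>t. t \<ge> 0 \<Longrightarrow> (\<eta> has_vector_derivative G (\<eta> t)) (at t within {0..})" by blast
  define x where "x t = unw (\<eta> t)" for t
  have "(\<lambda>k. \<psi>0 (of_discrete k) / complex_of_real (b (of_discrete k))) \<in> bcontfun"
    by (rule bcontfun_normI[OF cont, of _ 1]) (use dom b(1) in \<open>simp add: norm_divide less_imp_le\<close>)
  then have "x 0 n = \<psi>0 n" for n
    using b(1)[of n] by (simp add: x_def unw_def \<eta>0 Bcontfun_inverse discrete_inverse)
  moreover have "((\<lambda>t. x t n) has_vector_derivative rhs 1 (x t) n) (at t within {0..})" if "t \<ge> 0" for t n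
  proof -
    have "bounded_linear (\<lambda>\<eta>. unw \<eta> n)"
    proof (rule bounded_linear_intro[where K = "b n"])
      show "norm (unw \<eta> n) \<le> norm \<eta> * b n" for \<eta>
        using norm_bounded[of \<eta> "discrete n"] b(1)[of n]
        by (simp add: unw_def norm_mult mult.commute mult_right_mono)
    qed (simp_all add: unw_def algebra_simps scaleR_conv_of_real)
    from bounded_linear.has_vector_derivative[OF this \<eta>[OF that]]
    have "((\<lambda>t. x t n) has_vector_derivative unw (G (\<eta> t)) n) (at t within {0..})" by (simp add: x_def)
    moreover have "unw (G (\<eta> t)) n = of_real (b n) * (rhs 1 (unw (\<eta> t)) n / of_real (b n))"
      by (subst unw_def) (simp add: G g_def discrete_inverse)
    then have "unw (G (\<eta> t)) n = rhs 1 (x t) n" using b(1)[of n] by (simp add: x_def)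
    ultimately show ?thesis by simp
  qed
  moreover have "\<exists>M\<ge>0. \<forall>t\<in>{0..T}. \<forall>n. cmod (x t n) \<le> M * b n" for T
  proof -
    have "continuous_on {0..T} \<eta>"
      by (rule continuous_on_subset[OF continuous_on_vector_derivative[of "{0..}" \<eta> "\<lambda>t. G (\<eta> t)"]]) (use \<eta> in auto)
    then have "bounded (\<eta> ` {0..T})" by (intro compact_imp_bounded compact_continuous_image) auto
    then obtain M where M: "M > 0" "\<And>t. t \<in> {0..T} \<Longrightarrow> norm (\<eta> t) \<le> M" unfolding bounded_pos by auto
    have "cmod (x t n) \<le> M * b n" if "t \<in> {0..T}" for t n
    proof -
      have "cmod (x t n) \<le> b n * norm (\<eta> t)"
        using norm_bounded[of "\<eta> t" "discrete n"] b(1)[of n] by (simp add: x_def unw_def norm_mult mult_left_mono)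
      also have "\<dots> \<le> b n * M" using M(2)[OF that] b(1)[of n] by (intro mult_left_mono) auto
      finally show ?thesis by (simp add: mult.commute)
    qed
    then show ?thesis using M(1) by (intro exI[of _ M]) auto
  qed
  ultimately show ?thesis by (intro exI[of _ x]) auto
qed

text \<open>The hopping part of the operator is symmetric up to the flux through the two ends of the
  block. All end terms in the conservation law and in Duhamel's formula come from here.\<close>

lemma summation_by_parts:
  fixes a c :: "int \<Rightarrow> complex"
  shows "(\<Sum>n\<in>{- int R..int R}. (a (n - 1) + a (n + 1)) * c n - a n * (c (n - 1) + c (n + 1))) =
    (a (int R + 1) * c (int R) - a (int R) * c (int R + 1)) - (a (- int R) * c (- int R - 1) - a (- int R - 1) * c (- int R))"
proof (induction R)
  case (Suc R)
  have "{- int (Suc R)..int (Suc R)} = insert (int R + 1) (insert (- int R - 1) {- int R..int R})" by auto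
  then have split: "sum f {- int (Suc R)..int (Suc R)} = f (int R + 1) + (f (- int R - 1) + sum f {- int R..int R})"
    for f :: "int \<Rightarrow> complex" by simp
  have e: "int (Suc R) = int R + 1" "- (int R + 1) = - int R - 1" by simp_all
  show ?case unfolding split Suc unfolding e by (simp add: algebra_simps)
qed (simp add: algebra_simps)

end

text \<open>The setting of the a priori estimates: a solution of the truncated equation for t \<ge>
  0, dominated by a summable weight, with data of \<open>ell 1\<close> size at most \<delta>. It is
  instantiated for the forward solution and for the conjugated solution of the reversed
  problem.\<close>

locale half_sol = dnls +
  fixes b :: "int \<Rightarrow> real" and B \<delta> :: real and x :: "real \<Rightarrow> int \<Rightarrow> complex"
  assumes b: "\<And>n. 0 < b n" "\<And>n. b (n + 1) \<le> 2 * b n" "\<And>n. b (n - 1) \<le> 2 * b n"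
    and b_sum: "\<And>F. finite F \<Longrightarrow> sum b F \<le> B"
    and init: "\<And>F. finite F \<Longrightarrow> (\<Sum>n\<in>F. cmod (x 0 n)) \<le> \<delta>" and \<delta>: "0 \<le> \<delta>" "\<delta> \<le> 1"
    and deriv: "\<And>t n. t \<ge> 0 \<Longrightarrow> ((\<lambda>t. x t n) has_vector_derivative rhs 1 (x t) n) (at t within {0..})"
    and dominated: "\<And>T. T \<ge> 0 \<Longrightarrow> \<exists>M\<ge>0. \<forall>t\<in>{0..T}. \<forall>n. cmod (x t n) \<le> M * b n"
begin

lemma b_le: "b n \<le> B"
  using b_sum[of "{n}"] by simp

text \<open>Only finitely many sites carry weight at least \<epsilon>. The pair R and - R - 1 is
  chosen because doubling then bounds \<open>b\<close> by 2 \<epsilon> at R + 1 and at - R, so that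
  all four sites in the flux of the block from - R to R are covered.\<close>

lemma small_weight:
  assumes "\<epsilon> > 0"
  obtains R where "N \<le> R" "b (int R) < \<epsilon>" "b (- int R - 1) < \<epsilon>"
proof -
  have fin: "finite {n. \<epsilon> \<le> b n}"
  proof (rule ccontr)
    assume "infinite {n. \<epsilon> \<le> b n}"
    then obtain F where F: "F \<subseteq> {n. \<epsilon> \<le> b n}" "finite F" "card F = nat \<lceil>B / \<epsilon>\<rceil> + 1"
      using infinite_arbitrarily_large by blast
    have "real (card F) * \<epsilon> \<le> sum b F" using sum_bounded_below[of F \<epsilon> b] F by auto
    also have "\<dots> \<le> B" by (rule b_sum[OF F(2)])
    finally have "real (card F) \<le> B / \<epsilon>" using assms by (simp add: field_simps)
    then show False unfolding F(3) by linarith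
  qed
  have fin': "finite (nat ` {n. \<epsilon> \<le> b n} \<union> (\<lambda>n. nat (- n - 1)) ` {n. \<epsilon> \<le> b n} \<union> {..<N})" using fin by simp
  obtain R where R: "R \<notin> nat ` {n. \<epsilon> \<le> b n} \<union> (\<lambda>n. nat (- n - 1)) ` {n. \<epsilon> \<le> b n} \<union> {..<N}"
    using ex_new_if_finite[OF infinite_UNIV_nat fin'] by (elim exE)
  have "\<not> \<epsilon> \<le> b (int R)" "\<not> \<epsilon> \<le> b (- int R - 1)"
  proof -
    show "\<not> \<epsilon> \<le> b (int R)"
    proof
      assume "\<epsilon> \<le> b (int R)"
      then have "nat (int R) \<in> nat ` {n. \<epsilon> \<le> b n}" by blast
      then show False using R by simp
    qed
    show "\<not> \<epsilon> \<le> b (- int R - 1)"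
    proof
      assume "\<epsilon> \<le> b (- int R - 1)"
      then have "nat (- (- int R - 1) - 1) \<in> (\<lambda>n. nat (- n - 1)) ` {n. \<epsilon> \<le> b n}" by blast
      then show False using R by simp
    qed
  qed
  then show ?thesis using that[of R] R by auto
qed

lemma init_le: "cmod (x 0 n) \<le> \<delta>"
  using init[of "{n}"] by simp

lemma finite_subset_interval:
  fixes F :: "int set" assumes "finite F" obtains N where "\<And>R. N \<le> R \<Longrightarrow> F \<subseteq> {- int R..int R}"
proof -
  define N where "N = nat (Max (insert 0 (abs ` F)))"
  have "\<bar>n\<bar> \<le> int N" if "n \<in> F" for n
    using Max_ge[of "insert 0 (abs ` F)" "\<bar>n\<bar>"] assms that by (auto simp: N_def)
  then show ?thesis using that[of N] by force
qed

lemma continuous_coordinate: "T \<ge> 0 \<Longrightarrow> continuous_on {0..T} (\<lambda>t. x t n)"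
  by (rule continuous_on_subset[OF continuous_on_vector_derivative[of "{0..}"]]) (use deriv in auto)

lemma deriv_interior: "t > 0 \<Longrightarrow> ((\<lambda>t. x t n) has_vector_derivative rhs 1 (x t) n) (at t)"
  using deriv[of t n] at_within_interior[of t "{0..}"] by simp

text \<open>In the derivative of the mass of a block the potential and the nonlinearity, a real
  multiple of the solution at each site, cancel, leaving the flux through the ends. That flux is
  quadratic in the solution, hence of order \<epsilon>^2 at sites of small weight, and \<epsilon>
  tends to 0.\<close>

lemma l2_bound:
  assumes t: "t \<ge> 0" and F: "finite F"
  shows "(\<Sum>n\<in>F. (cmod (x t n))\<^sup>2) \<le> \<delta>\<^sup>2"
proof -
  have init2: "(\<Sum>n\<in>F. (cmod (x 0 n))\<^sup>2) \<le> \<delta>\<^sup>2" if "finite F" for F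
  proof -
    have "(\<Sum>n\<in>F. (cmod (x 0 n))\<^sup>2) \<le> (\<Sum>n\<in>F. \<delta> * cmod (x 0 n))"
      unfolding power2_eq_square using init_le by (intro sum_mono mult_right_mono) auto
    also have "\<dots> \<le> \<delta> * \<delta>" unfolding sum_distrib_left[symmetric] using init[OF that] \<delta> by (intro mult_left_mono) auto
    finally show ?thesis by (simp add: power2_eq_square)
  qed
  show ?thesis
  proof (cases "t = 0")
    case True
    then show ?thesis using init2[OF F] by simp
  next
    case False
    then have tp: "t > 0" using t by simp
    obtain M where M: "M \<ge> 0" "\<And>\<tau> n. \<tau> \<in> {0..t} \<Longrightarrow> cmod (x \<tau> n) \<le> M * b n" using dominated[OF t] by blast
    obtain N where N: "\<And>R. N \<le> R \<Longrightarrow> F \<subseteq> {- int R..int R}" using finite_subset_interval[OF F] by blast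
    have step: "(\<Sum>n\<in>F. (cmod (x t n))\<^sup>2) \<le> \<delta>\<^sup>2 + 8 * M\<^sup>2 * \<epsilon>\<^sup>2 * t" if \<epsilon>: "\<epsilon> > 0" for \<epsilon>
    proof -
      obtain R where R: "N \<le> R" "b (int R) < \<epsilon>" "b (- int R - 1) < \<epsilon>" using small_weight[OF \<epsilon>] by blast
      define I where "I = {- int R..int R}"
      define E where "E \<tau> = (\<Sum>n\<in>I. x \<tau> n * cnj (x \<tau> n))" for \<tau>
      define E' where "E' \<tau> = (\<Sum>n\<in>I. x \<tau> n * cnj (rhs 1 (x \<tau>) n) + rhs 1 (x \<tau>) n * cnj (x \<tau> n))" for \<tau>
      have E'eq: "E' \<tau> = - \<i> * (\<Sum>n\<in>I. (x \<tau> (n - 1) + x \<tau> (n + 1)) * cnj (x \<tau> n) - x \<tau> n * (cnj (x \<tau> (n - 1)) + cnj (x \<tau> (n + 1))))" for \<tau>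
        unfolding E'_def sum_distrib_left
      proof (rule sum.cong[OF refl])
        fix n
        show "x \<tau> n * cnj (rhs 1 (x \<tau>) n) + rhs 1 (x \<tau>) n * cnj (x \<tau> n) =
          - \<i> * ((x \<tau> (n - 1) + x \<tau> (n + 1)) * cnj (x \<tau> n) - x \<tau> n * (cnj (x \<tau> (n - 1)) + cnj (x \<tau> (n + 1))))"
          by (simp add: rhs_def schroedinger_op_def trunc_def algebra_simps)
      qed
      \<comment> \<open>Four products occur at the ends of the block, each with one factor at most 2
        M \<epsilon> and the other at most M \<epsilon>.\<close>
      have E'le: "cmod (E' \<tau>) \<le> 8 * M\<^sup>2 * \<epsilon>\<^sup>2" if \<tau>: "\<tau> \<in> {0..t}" for \<tau>
      proof -
        have e: "cmod (x \<tau> m * cnj (x \<tau> n)) \<le> 2 * M\<^sup>2 * \<epsilon>\<^sup>2" if "b m \<le> 2 * \<epsilon>" "b n \<le> \<epsilon>" for m n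
        proof -
          have "cmod (x \<tau> m) \<le> M * (2 * \<epsilon>)" "cmod (x \<tau> n) \<le> M * \<epsilon>"
            using M(2)[OF \<tau>, of m] M(2)[OF \<tau>, of n] mult_left_mono[OF that(1) M(1)] mult_left_mono[OF that(2) M(1)] by linarith+
          then have "cmod (x \<tau> m) * cmod (x \<tau> n) \<le> (M * (2 * \<epsilon>)) * (M * \<epsilon>)" using M(1) \<epsilon> by (intro mult_mono) auto
          then show ?thesis by (simp add: norm_mult power2_eq_square mult_ac)
        qed
        have e': "cmod (x \<tau> n * cnj (x \<tau> m)) \<le> 2 * M\<^sup>2 * \<epsilon>\<^sup>2" if "b m \<le> 2 * \<epsilon>" "b n \<le> \<epsilon>" for m n
          using e[OF that] by (simp add: norm_mult mult.commute)
        have bb: "b (int R + 1) \<le> 2 * \<epsilon>" "b (int R) \<le> \<epsilon>" "b (- int R) \<le> 2 * \<epsilon>" "b (- int R - 1) \<le> \<epsilon>"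
          using R b(2)[of "int R"] b(2)[of "- int R - 1"] by auto
        have "cmod (E' \<tau>) = cmod ((x \<tau> (int R + 1) * cnj (x \<tau> (int R)) - x \<tau> (int R) * cnj (x \<tau> (int R + 1)))
          - (x \<tau> (- int R) * cnj (x \<tau> (- int R - 1)) - x \<tau> (- int R - 1) * cnj (x \<tau> (- int R))))"
          unfolding E'eq I_def summation_by_parts[of "x \<tau>" "\<lambda>n. cnj (x \<tau> n)"] by (simp add: norm_mult)
        also have "\<dots> \<le> (2 * M\<^sup>2 * \<epsilon>\<^sup>2 + 2 * M\<^sup>2 * \<epsilon>\<^sup>2) + (2 * M\<^sup>2 * \<epsilon>\<^sup>2 + 2 * M\<^sup>2 * \<epsilon>\<^sup>2)"
          by (intro order.trans[OF norm_triangle_ineq4] add_mono e e' bb)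
        finally show ?thesis by simp
      qed
      have "norm (E t - E 0) \<le> 8 * M\<^sup>2 * \<epsilon>\<^sup>2 * t - 8 * M\<^sup>2 * \<epsilon>\<^sup>2 * 0"
      proof (rule differentiable_bound_general[OF tp, of E "\<lambda>\<tau>. 8 * M\<^sup>2 * \<epsilon>\<^sup>2 * \<tau>" E' "\<lambda>_. 8 * M\<^sup>2 * \<epsilon>\<^sup>2"])
        show "continuous_on {0..t} E" unfolding E_def
          by (intro continuous_intros continuous_coordinate[OF t])
        show "(E has_vector_derivative E' \<tau>) (at \<tau>)" if "0 < \<tau>" "\<tau> < t" for \<tau>
          unfolding E_def E'_def
          by (intro has_vector_derivative_sum has_vector_derivative_mult deriv_interior that
              bounded_linear.has_vector_derivative[OF bounded_linear_cnj])
        show "((\<lambda>\<tau>. 8 * M\<^sup>2 * \<epsilon>\<^sup>2 * \<tau>) has_vector_derivative 8 * M\<^sup>2 * \<epsilon>\<^sup>2) (at \<tau>)" for \<tau>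
          by (auto intro!: derivative_eq_intros simp flip: has_real_derivative_iff_has_vector_derivative)
      qed (use E'le in \<open>auto intro!: continuous_intros\<close>)
      then have d: "cmod (E t - E 0) \<le> 8 * M\<^sup>2 * \<epsilon>\<^sup>2 * t" by simp
      have Ere: "E \<tau> = of_real (\<Sum>n\<in>I. (cmod (x \<tau> n))\<^sup>2)" for \<tau>
        by (simp add: E_def complex_norm_square del: of_real_power)
      have "(\<Sum>n\<in>F. (cmod (x t n))\<^sup>2) \<le> (\<Sum>n\<in>I. (cmod (x t n))\<^sup>2)"
        using N[OF R(1)] by (intro sum_mono2) (auto simp: I_def)
      also have "\<dots> \<le> (\<Sum>n\<in>I. (cmod (x 0 n))\<^sup>2) + 8 * M\<^sup>2 * \<epsilon>\<^sup>2 * t"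
        using d unfolding Ere of_real_diff[symmetric] norm_of_real by linarith
      also have "\<dots> \<le> \<delta>\<^sup>2 + 8 * M\<^sup>2 * \<epsilon>\<^sup>2 * t" using init2[of I] by (simp add: I_def)
      finally show ?thesis .
    qed
    have "((\<lambda>\<epsilon>. \<delta>\<^sup>2 + 8 * M\<^sup>2 * \<epsilon>\<^sup>2 * t) \<longlongrightarrow> \<delta>\<^sup>2 + 8 * M\<^sup>2 * 0\<^sup>2 * t) (at_right 0)" by (intro tendsto_intros)
    moreover have "\<forall>\<^sub>F \<epsilon> in at_right 0. (\<Sum>n\<in>F. (cmod (x t n))\<^sup>2) \<le> \<delta>\<^sup>2 + 8 * M\<^sup>2 * \<epsilon>\<^sup>2 * t"
      using eventually_at_right_less[of "0::real"] by eventually_elim (rule step)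
    ultimately have "(\<Sum>n\<in>F. (cmod (x t n))\<^sup>2) \<le> \<delta>\<^sup>2 + 8 * M\<^sup>2 * 0\<^sup>2 * t"
      by (intro tendsto_lowerbound) auto
    then show ?thesis by simp
  qed
qed

text \<open>The derivative is dominated by the weight, which is bounded over all sites. The modulus
  of continuity in time is therefore common to all sites, as the continuity argument
  requires.\<close>

lemma time_lipschitz:
  assumes "T \<ge> 0"
  obtains M where "M \<ge> 0" "\<And>t n. t \<in> {0..T} \<Longrightarrow> cmod (x t n) \<le> M * b n"
    "\<And>t u n. \<lbrakk>t \<in> {0..T}; u \<in> {0..T}\<rbrakk> \<Longrightarrow> cmod (x u n - x t n) \<le> M * b n * \<bar>u - t\<bar>"
proof -
  obtain M where M: "M \<ge> 0" "\<And>t n. t \<in> {0..T} \<Longrightarrow> cmod (x t n) \<le> M * b n" using dominated[OF assms] by blast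
  have r: "cmod (rhs 1 (x t) n) \<le> lip 1 * M * b n" if "t \<in> {0..T}" for t n
    using rhs_weighted_lipschitz[of 1 M "x t" "\<lambda>_. 0" b n] M that b by simp
  have *: "cmod (x u n - x t n) \<le> lip 1 * M * b n * (u - t)" if "t \<in> {0..T}" "u \<in> {0..T}" "t < u" for t u n
  proof -
    have "norm (x u n - x t n) \<le> lip 1 * M * b n * u - lip 1 * M * b n * t"
    proof (rule differentiable_bound_general[OF that(3), of "\<lambda>t. x t n" "\<lambda>\<tau>. lip 1 * M * b n * \<tau>" "\<lambda>t. rhs 1 (x t) n" "\<lambda>_. lip 1 * M * b n"])
      show "continuous_on {t..u} (\<lambda>t. x t n)"
        by (rule continuous_on_subset[OF continuous_coordinate[OF assms]]) (use that in auto)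
      show "((\<lambda>t. x t n) has_vector_derivative rhs 1 (x \<tau>) n) (at \<tau>)" if "t < \<tau>" "\<tau> < u" for \<tau>
        by (rule deriv_interior) (use that \<open>t \<in> _\<close> in auto)
      show "((\<lambda>\<tau>. lip 1 * M * b n * \<tau>) has_vector_derivative lip 1 * M * b n) (at \<tau>)" for \<tau>
        by (auto intro!: derivative_eq_intros simp flip: has_real_derivative_iff_has_vector_derivative)
    qed (use r that in \<open>auto intro!: continuous_intros\<close>)
    then show ?thesis by (simp add: algebra_simps)
  qed
  define M' where "M' = max M (lip 1 * M)"
  have "lip 1 * M * b n * y \<le> M' * b n * y" if "y \<ge> 0" for n y
    using that b(1)[of n] by (intro mult_right_mono) (auto simp: M'_def)
  note le = this
  show ?thesis
  proof (rule that[of M'])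
    show "M' \<ge> 0" using M by (simp add: M'_def)
    show "cmod (x t n) \<le> M' * b n" if "t \<in> {0..T}" for t n
      using M(2)[OF that, of n] b(1)[of n] by (smt (verit) M'_def mult_right_mono)
    show "cmod (x u n - x t n) \<le> M' * b n * \<bar>u - t\<bar>" if "t \<in> {0..T}" "u \<in> {0..T}" for t u n
    proof (cases t u rule: linorder_cases)
      case less
      then show ?thesis using *[OF that less, of n] le[of "u - t" n] by simp
    next
      case greater
      then show ?thesis using *[OF that(2,1) greater, of n] le[of "t - u" n] by (simp add: norm_minus_commute)
    qed simp
  qed
qed

end

section \<open>The decay weight and its convolution estimate\<close>

definition decay_weight :: "real \<Rightarrow> real" where
  "decay_weight t = japanese_bracket t powr (-1/3)"

lemma japanese_bracket_ge: "1 \<le> japanese_bracket t" "\<bar>t\<bar> \<le> japanese_bracket t"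
  by (auto simp: japanese_bracket_def intro!: real_le_rsqrt)

lemma japanese_bracket_mono: "0 \<le> t \<Longrightarrow> t \<le> u \<Longrightarrow> japanese_bracket t \<le> japanese_bracket u"
  by (simp add: japanese_bracket_def power_mono)

lemma japanese_bracket_double: "japanese_bracket (2 * t) \<le> 2 * japanese_bracket t"
proof -
  have "japanese_bracket (2 * t) \<le> sqrt (2\<^sup>2 * (1 + t\<^sup>2))"
    unfolding japanese_bracket_def by (simp add: power_mult_distrib)
  also have "\<dots> = 2 * japanese_bracket t"
    unfolding japanese_bracket_def real_sqrt_mult by simp
  finally show ?thesis .
qed

lemma decay_weight_0 [simp]: "decay_weight 0 = 1"
  by (simp add: decay_weight_def japanese_bracket_def)

lemma decay_weight_minus [simp]: "decay_weight (- t) = decay_weight t"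
  by (simp add: decay_weight_def japanese_bracket_def)

lemma decay_weight_pos: "0 < decay_weight t"
  using japanese_bracket_ge(1)[of t] by (simp add: decay_weight_def)

lemma decay_weight_antimono:
  assumes "0 \<le> t" "t \<le> u" shows "decay_weight u \<le> decay_weight t"
  unfolding decay_weight_def
  using japanese_bracket_mono[OF assms] japanese_bracket_ge(1)[of t] by (intro powr_mono2') auto

lemma decay_weight_le_1: "decay_weight t \<le> 1"
  using decay_weight_antimono[of 0 "\<bar>t\<bar>"] by (cases "t \<ge> 0") (simp_all add: abs_if split: if_splits)

lemma continuous_on_decay_weight: "continuous_on S decay_weight"
proof -
  have "japanese_bracket t \<noteq> 0" for t using japanese_bracket_ge(1)[of t] by simp
  moreover have "continuous_on S japanese_bracket"
    unfolding japanese_bracket_def[abs_def] by (intro continuous_intros)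
  ultimately show ?thesis unfolding decay_weight_def[abs_def] by (intro continuous_intros) auto
qed

lemma decay_weight_powr: "decay_weight t powr q = japanese_bracket t powr (- (q / 3))"
  by (simp add: decay_weight_def powr_powr)

lemma half_powr_minus: "0 \<le> u \<Longrightarrow> (u / 2) powr (- c) = 2 powr c * u powr (- c)" for u c :: real
  by (simp add: powr_divide powr_minus field_simps)

lemma decay_weight_powr_le:
  assumes "t \<ge> 0" "q \<ge> 0"
  shows "decay_weight t powr q \<le> 2 powr (q / 3) * (1 + t) powr (- (q / 3))"
proof -
  have "japanese_bracket t powr (- (q / 3)) \<le> ((1 + t) / 2) powr (- (q / 3))"
    using japanese_bracket_ge[of t] assms by (intro powr_mono2') auto
  also have "\<dots> = 2 powr (q / 3) * (1 + t) powr (- (q / 3))"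
    using assms by (intro half_powr_minus) auto
  finally show ?thesis by (simp add: decay_weight_powr)
qed

lemma decay_weight_half:
  assumes "T \<ge> 0" "T / 2 \<le> t" shows "decay_weight t \<le> 2 * decay_weight T"
proof -
  have "decay_weight t \<le> decay_weight (T / 2)" using assms by (intro decay_weight_antimono) auto
  also have "\<dots> \<le> (japanese_bracket T / 2) powr (- (1/3))"
    unfolding decay_weight_def minus_divide_left[symmetric] using japanese_bracket_double[of "T / 2"] japanese_bracket_ge(1)[of T]
    by (intro powr_mono2') auto
  also have "\<dots> = 2 powr (1/3) * decay_weight T"
    using japanese_bracket_ge(1)[of T] by (subst half_powr_minus) (auto simp: decay_weight_def)
  also have "\<dots> \<le> 2 powr 1 * decay_weight T"
    using decay_weight_pos[of T] by (intro mult_right_mono powr_mono) auto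
  finally show ?thesis by simp
qed

text \<open>One of \<tau> and T - \<tau> is at least T / 2, and its weight is at most twice that of
  T. If it is \<tau>, the other q - 1 powers of its weight are traded for those of T - \<tau>, which
  are larger. Both terms on the right have integrals in \<tau> bounded independently of T as soon as
  q > 3.\<close>

lemma decay_weight_convolution:
  assumes \<tau>: "0 \<le> \<tau>" "\<tau> \<le> T" and q: "q \<ge> 1"
  shows "decay_weight (T - \<tau>) * decay_weight \<tau> powr q
    \<le> 2 * decay_weight T * (2 powr (q / 3) * ((1 + \<tau>) powr (- (q / 3)) + (1 + T - \<tau>) powr (- (q / 3))))"
    (is "_ \<le> 2 * decay_weight T * (?c * (?A + ?B))")
proof (cases "\<tau> \<le> T / 2")
  case True
  have "decay_weight (T - \<tau>) * decay_weight \<tau> powr q \<le> (2 * decay_weight T) * (?c * ?A)"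
    using True \<tau> q decay_weight_pos[of T]
    by (intro mult_mono decay_weight_half decay_weight_powr_le) auto
  also have "\<dots> \<le> (2 * decay_weight T) * (?c * (?A + ?B))"
    using decay_weight_pos[of T] by (intro mult_left_mono) auto
  finally show ?thesis .
next
  case False
  have "decay_weight \<tau> powr (q - 1) \<le> decay_weight (T - \<tau>) powr (q - 1)"
    using False \<tau> q decay_weight_pos[of \<tau>] by (intro powr_mono2 decay_weight_antimono) auto
  then have "decay_weight \<tau> powr (q - 1) * decay_weight (T - \<tau>) \<le> decay_weight (T - \<tau>) powr (q - 1) * decay_weight (T - \<tau>) powr 1"
    using decay_weight_pos[of "T - \<tau>"] by (simp add: mult_right_mono)
  also have "\<dots> = decay_weight (T - \<tau>) powr q" unfolding powr_add[symmetric] by simp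
  finally have 1: "decay_weight \<tau> powr (q - 1) * decay_weight (T - \<tau>) \<le> decay_weight (T - \<tau>) powr q" .
  have "decay_weight \<tau> powr q = decay_weight \<tau> powr 1 * decay_weight \<tau> powr (q - 1)"
    unfolding powr_add[symmetric] by simp
  then have "decay_weight (T - \<tau>) * decay_weight \<tau> powr q = decay_weight \<tau> * (decay_weight \<tau> powr (q - 1) * decay_weight (T - \<tau>))"
    using decay_weight_pos[of \<tau>] by simp
  also have "\<dots> \<le> (2 * decay_weight T) * decay_weight (T - \<tau>) powr q"
    using False \<tau> decay_weight_pos less_imp_le[OF decay_weight_pos]
    by (intro mult_mono 1 decay_weight_half) auto
  also have "\<dots> \<le> (2 * decay_weight T) * (?c * ?B)"
    using decay_weight_powr_le[of "T - \<tau>" q] \<tau> q decay_weight_pos[of T]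
    by (intro mult_left_mono) (auto simp: add_diff_eq)
  also have "\<dots> \<le> (2 * decay_weight T) * (?c * (?A + ?B))"
    using decay_weight_pos[of T] by (intro mult_left_mono) auto
  finally show ?thesis .
qed

section \<open>Duhamel's formula and the continuity argument\<close>

context dnls
begin

text \<open>The multiple of the decay weight that one pass through Duhamel's formula produces for
  data of size \<open>d\<close>. The second term carries the integral of (1 + \<tau>)^(- (\<sigma> -
  2) / 3), which is where \<sigma> > 5 enters. The whole tends to 0 with \<open>d\<close>.\<close>

definition decay_constant :: "real \<Rightarrow> real \<Rightarrow> real" where
  "decay_constant C d = C * d + 4 * C * d\<^sup>2 * 2 powr ((\<sigma> - 2) / 3) / ((\<sigma> - 2) / 3 - 1)"

text \<open>Two powers of |z| are kept for the \<open>ell 2\<close> norm and only the other \<sigma>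
  - 2 are converted into decay. The sum over the sites then costs no more than \<delta>^2.\<close>

lemma trunc_decay:
  assumes "cmod z \<le> r" "r \<le> 1"
  shows "cmod (trunc 1 z) \<le> r powr (\<sigma> - 2) * (cmod z)\<^sup>2"
proof -
  have "cmod (trunc 1 z) = cmod z powr (\<sigma> - 1) * cmod z"
    using assms by (simp add: trunc_def norm_mult)
  also have "cmod z powr (\<sigma> - 1) = cmod z powr (\<sigma> - 2) * cmod z"
    using powr_add[of "cmod z" "\<sigma> - 2" 1] by simp
  also have "cmod z powr (\<sigma> - 2) * cmod z * cmod z \<le> r powr (\<sigma> - 2) * cmod z * cmod z"
    using assms \<sigma> by (intro mult_right_mono powr_mono2) auto
  finally show ?thesis by (simp add: power2_eq_square mult.assoc)
qed

end

context half_sol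
begin

text \<open>The function \<open>J\<close> interpolates between the linear evolution of the data at
  \<tau> = 0 and x T m at \<tau> = T. Its derivative consists of the flux through the ends of the
  block, which vanishes with \<epsilon>, and of the nonlinearity, controlled by the decay of the
  kernel, the assumed decay of the solution and the \<open>ell 2\<close> bound.\<close>

lemma duhamel_estimate:
  fixes K :: "real \<Rightarrow> int \<Rightarrow> int \<Rightarrow> complex"
  assumes K0: "\<And>m n. K 0 m n = (if m = n then 1 else 0)"
    and K': "\<And>t m n. ((\<lambda>t. K t m n) has_vector_derivative
      - \<i> * (K t m (n - 1) + K t m (n + 1) + of_real (V n) * K t m n)) (at t)"
    and Kle: "\<And>t m n. t \<ge> 0 \<Longrightarrow> cmod (K t m n) \<le> C * decay_weight t"
    and T: "T > 0" and ap: "\<And>\<tau> n. \<tau> \<in> {0..T} \<Longrightarrow> cmod (x \<tau> n) \<le> decay_weight \<tau>"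
  shows "cmod (x T m) \<le> decay_constant C \<delta> * decay_weight T"
proof -
  define a where "a = (\<sigma> - 2) / 3"
  define D where "D = 2 * C * \<delta>\<^sup>2 * decay_weight T * 2 powr a / (a - 1)"
  have a1: "a > 1" using \<sigma> by (simp add: a_def)
  have C: "C \<ge> 0" using Kle[of 0 0 0] K0[of 0 0] by simp
  have D: "D \<ge> 0" using C a1 decay_weight_pos[of T] by (simp add: D_def)
  have KC: "cmod (K t m n) \<le> C" if "t \<ge> 0" for t m n
    using Kle[OF that, of m n] mult_left_mono[OF decay_weight_le_1[of t] C] by simp
  obtain M where M: "M \<ge> 0" "\<And>\<tau> n. \<tau> \<in> {0..T} \<Longrightarrow> cmod (x \<tau> n) \<le> M * b n" using dominated[of T] T by auto
  have step: "cmod (x T m) \<le> C * \<delta> * decay_weight T + 2 * D + 8 * C * M * T * \<epsilon>" if \<epsilon>: "\<epsilon> > 0" for \<epsilon>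
  proof -
    obtain R where R: "nat \<bar>m\<bar> \<le> R" "b (int R) < \<epsilon>" "b (- int R - 1) < \<epsilon>" using small_weight[OF \<epsilon>] by blast
    define I where "I = {- int R..int R}"
    define k where "k \<tau> n = K (T - \<tau>) m n" for \<tau> n
    define J where "J \<tau> = (\<Sum>n\<in>I. k \<tau> n * x \<tau> n)" for \<tau>
    define k' where "k' \<tau> n = \<i> * (k \<tau> (n - 1) + k \<tau> (n + 1) + of_real (V n) * k \<tau> n)" for \<tau> n
    define J' where "J' \<tau> = (\<Sum>n\<in>I. k \<tau> n * rhs 1 (x \<tau>) n + k' \<tau> n * x \<tau> n)" for \<tau>
    \<comment> \<open>An explicit primitive of the majorant of |J'|. Its increment over [0, T] is at
      most 8 C M T \<epsilon> + 2 D, the term 8 C M \<epsilon> collecting four end products of size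
      at most 2 C M \<epsilon>.\<close>
    define \<phi> where "\<phi> \<tau> = 8 * C * M * \<epsilon> * \<tau> + D * (- ((1 + \<tau>) powr (1 - a)) + (1 + T - \<tau>) powr (1 - a))" for \<tau>
    define \<phi>' where "\<phi>' \<tau> = 8 * C * M * \<epsilon> + D * ((a - 1) * ((1 + \<tau>) powr (- a) + (1 + T - \<tau>) powr (- a)))" for \<tau>
    have mI: "m \<in> I" using R(1) by (auto simp: I_def)
    have kd: "((\<lambda>\<tau>. k \<tau> n) has_vector_derivative k' \<tau> n) (at \<tau>)" for \<tau> n
    proof -
      have "((\<lambda>\<tau>. T - \<tau>) has_real_derivative -1) (at \<tau>)" by (auto intro!: derivative_eq_intros)
      from vector_diff_chain_at[OF this[unfolded has_real_derivative_iff_has_vector_derivative] K'[of m n "T - \<tau>"]]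
      show ?thesis by (simp add: k_def[abs_def] k'_def comp_def)
    qed
    have J'eq: "J' \<tau> = \<i> * (\<Sum>n\<in>I. (k \<tau> (n - 1) + k \<tau> (n + 1)) * x \<tau> n - k \<tau> n * (x \<tau> (n - 1) + x \<tau> (n + 1)))
        + - \<i> * of_real s * (\<Sum>n\<in>I. k \<tau> n * trunc 1 (x \<tau> n))" for \<tau>
      unfolding J'_def sum_distrib_left sum.distrib[symmetric]
      by (rule sum.cong[OF refl]) (simp add: rhs_def schroedinger_op_def k'_def algebra_simps)
    have J'le: "cmod (J' \<tau>) \<le> \<phi>' \<tau>" if \<tau>: "0 < \<tau>" "\<tau> < T" for \<tau>
    proof -
      have kk: "cmod (k \<tau> n) \<le> C" for n using KC[of "T - \<tau>"] \<tau> by (simp add: k_def)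
      have e: "cmod (k \<tau> n' * x \<tau> n) \<le> C * (M * (2 * \<epsilon>))" if "b n \<le> 2 * \<epsilon>" for n n'
      proof -
        have "cmod (x \<tau> n) \<le> M * (2 * \<epsilon>)"
          using M(2)[of \<tau> n] \<tau> mult_left_mono[OF that M(1)] by simp
        then show ?thesis unfolding norm_mult using kk C by (intro mult_mono) auto
      qed
      have bb: "b (int R + 1) \<le> 2 * \<epsilon>" "b (int R) \<le> 2 * \<epsilon>" "b (- int R) \<le> 2 * \<epsilon>" "b (- int R - 1) \<le> 2 * \<epsilon>"
        using R b(2)[of "int R"] b(2)[of "- int R - 1"] \<epsilon> by auto
      have 1: "cmod (\<Sum>n\<in>I. (k \<tau> (n - 1) + k \<tau> (n + 1)) * x \<tau> n - k \<tau> n * (x \<tau> (n - 1) + x \<tau> (n + 1)))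
        \<le> (C * (M * (2 * \<epsilon>)) + C * (M * (2 * \<epsilon>))) + (C * (M * (2 * \<epsilon>)) + C * (M * (2 * \<epsilon>)))"
        unfolding I_def summation_by_parts by (intro order.trans[OF norm_triangle_ineq4] add_mono e bb)
      have "cmod (\<Sum>n\<in>I. k \<tau> n * trunc 1 (x \<tau> n)) \<le> (\<Sum>n\<in>I. (C * decay_weight (T - \<tau>)) * (decay_weight \<tau> powr (\<sigma> - 2) * (cmod (x \<tau> n))\<^sup>2))"
      proof (rule sum_norm_le)
        fix n
        show "cmod (k \<tau> n * trunc 1 (x \<tau> n)) \<le> (C * decay_weight (T - \<tau>)) * (decay_weight \<tau> powr (\<sigma> - 2) * (cmod (x \<tau> n))\<^sup>2)"
          unfolding norm_mult k_def
          using Kle[of "T - \<tau>" m n] \<tau> C decay_weight_pos[of "T - \<tau>"] ap[of \<tau> n] decay_weight_le_1[of \<tau>]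
          by (intro mult_mono trunc_decay) auto
      qed
      also have "\<dots> = C * (decay_weight (T - \<tau>) * decay_weight \<tau> powr (\<sigma> - 2)) * (\<Sum>n\<in>I. (cmod (x \<tau> n))\<^sup>2)"
        by (simp add: sum_distrib_left mult_ac)
      also have "\<dots> \<le> C * (2 * decay_weight T * (2 powr a * ((1 + \<tau>) powr (- a) + (1 + T - \<tau>) powr (- a)))) * \<delta>\<^sup>2"
      proof (rule mult_mono)
        show "C * (decay_weight (T - \<tau>) * decay_weight \<tau> powr (\<sigma> - 2)) \<le>
          C * (2 * decay_weight T * (2 powr a * ((1 + \<tau>) powr (- a) + (1 + T - \<tau>) powr (- a))))"
          unfolding a_def using \<tau> \<sigma> C by (intro mult_left_mono decay_weight_convolution) auto
      qed (use \<tau> C decay_weight_pos[of T] in \<open>auto simp: I_def intro!: l2_bound mult_nonneg_nonneg add_nonneg_nonneg sum_nonneg\<close>)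
      also have "\<dots> = D * ((a - 1) * ((1 + \<tau>) powr (- a) + (1 + T - \<tau>) powr (- a)))"
        using a1 by (simp add: D_def)
      finally have 2: "cmod (\<Sum>n\<in>I. k \<tau> n * trunc 1 (x \<tau> n)) \<le> D * ((a - 1) * ((1 + \<tau>) powr (- a) + (1 + T - \<tau>) powr (- a)))" .
      have "cmod (J' \<tau>) \<le> cmod (\<Sum>n\<in>I. (k \<tau> (n - 1) + k \<tau> (n + 1)) * x \<tau> n - k \<tau> n * (x \<tau> (n - 1) + x \<tau> (n + 1)))
        + cmod (\<Sum>n\<in>I. k \<tau> n * trunc 1 (x \<tau> n))"
        unfolding J'eq by (rule order.trans[OF norm_triangle_ineq]) (use s in \<open>auto simp: norm_mult\<close>)
      then show ?thesis using 1 2 by (simp add: \<phi>'_def)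
    qed
    have "norm (J T - J 0) \<le> \<phi> T - \<phi> 0"
    proof (rule differentiable_bound_general[OF T, of J \<phi> J' \<phi>'])
      have "continuous_on {0..T} (\<lambda>\<tau>. k \<tau> n)" for n
        by (rule continuous_on_vector_derivative) (use kd has_vector_derivative_at_within in blast)
      then show "continuous_on {0..T} J" unfolding J_def[abs_def]
        by (intro continuous_intros continuous_coordinate) (use T in auto)
      show "continuous_on {0..T} \<phi>" unfolding \<phi>_def[abs_def]
        by (intro continuous_intros) auto
      show "(J has_vector_derivative J' \<tau>) (at \<tau>)" if "0 < \<tau>" "\<tau> < T" for \<tau>
        unfolding J_def[abs_def] J'_def
        by (intro has_vector_derivative_sum has_vector_derivative_mult deriv_interior kd that)
      show "(\<phi> has_vector_derivative \<phi>' \<tau>) (at \<tau>)" if "0 < \<tau>" "\<tau> < T" for \<tau>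
      proof -
        have "((\<lambda>\<tau>. (1 + \<tau>) powr (1 - a)) has_real_derivative (1 - a) * (1 + \<tau>) powr (1 - a - real 1) * 1) (at \<tau>)"
          "((\<lambda>\<tau>. (1 + T - \<tau>) powr (1 - a)) has_real_derivative (1 - a) * (1 + T - \<tau>) powr (1 - a - real 1) * (-1)) (at \<tau>)"
          using that by (auto intro!: DERIV_fun_powr derivative_eq_intros)
        note d = this
        show ?thesis
          unfolding has_real_derivative_iff_has_vector_derivative[symmetric] \<phi>_def[abs_def] \<phi>'_def
          by (rule derivative_eq_intros d refl)+ (simp add: algebra_simps)
      qed
    qed (use J'le in auto)
    moreover have "J T = x T m"
      using mI by (simp add: J_def k_def K0 if_distrib[of "\<lambda>u. u * _"] I_def cong: if_cong)
    moreover have "cmod (J 0) \<le> C * \<delta> * decay_weight T"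
    proof -
      have "cmod (J 0) \<le> (\<Sum>n\<in>I. C * decay_weight T * cmod (x 0 n))"
        unfolding J_def k_def using T by (intro sum_norm_le) (auto simp: norm_mult intro!: mult_right_mono Kle)
      also have "\<dots> \<le> C * decay_weight T * \<delta>"
        unfolding sum_distrib_left[symmetric] using C decay_weight_pos[of T]
        by (intro mult_left_mono init) (auto simp: I_def)
      finally show ?thesis by (simp add: mult_ac)
    qed
    moreover have "\<phi> T - \<phi> 0 \<le> 8 * C * M * T * \<epsilon> + 2 * D"
    proof -
      have "D * (1 - (1 + T) powr (1 - a)) \<le> D * 1" using D by (intro mult_left_mono) auto
      then show ?thesis by (simp add: \<phi>_def algebra_simps)
    qed
    ultimately show ?thesis using norm_triangle_sub[of "x T m" "J 0"] by simp
  qed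
  have "((\<lambda>\<epsilon>. C * \<delta> * decay_weight T + 2 * D + 8 * C * M * T * \<epsilon>) \<longlongrightarrow> C * \<delta> * decay_weight T + 2 * D + 8 * C * M * T * 0) (at_right 0)"
    by (intro tendsto_intros)
  moreover have "\<forall>\<^sub>F \<epsilon> in at_right 0. cmod (x T m) \<le> C * \<delta> * decay_weight T + 2 * D + 8 * C * M * T * \<epsilon>"
    using eventually_at_right_less[of "0::real"] by eventually_elim (rule step)
  ultimately have "cmod (x T m) \<le> C * \<delta> * decay_weight T + 2 * D + 8 * C * M * T * 0"
    by (intro tendsto_lowerbound) auto
  also have "\<dots> = decay_constant C \<delta> * decay_weight T"
    using a1 by (simp add: decay_constant_def D_def a_def[symmetric] field_simps)
  finally show ?thesis .
qed

text \<open>A bound by the weight on [0, u] improves to half the weight at u. Solution and weight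
  vary by at most \<eta> during a time h common to all sites, so the full bound extends to
  [0, u + h], and finitely many steps of this length reach T.\<close>

lemma decay:
  fixes K :: "real \<Rightarrow> int \<Rightarrow> int \<Rightarrow> complex"
  assumes K0: "\<And>m n. K 0 m n = (if m = n then 1 else 0)"
    and K': "\<And>t m n. ((\<lambda>t. K t m n) has_vector_derivative
      - \<i> * (K t m (n - 1) + K t m (n + 1) + of_real (V n) * K t m n)) (at t)"
    and Kle: "\<And>t m n. t \<ge> 0 \<Longrightarrow> cmod (K t m n) \<le> C * decay_weight t"
    and small: "\<delta> \<le> 1/2" "decay_constant C \<delta> \<le> 1/2" and "t \<ge> 0"
  shows "cmod (x t n) \<le> decay_weight t"
proof -
  define T where "T = t"
  have T: "T \<ge> 0" using assms by (simp add: T_def)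
  \<comment> \<open>Half the weight at u, plus \<eta> for the change of the solution and \<eta> for
    the change of the weight, does not exceed the weight at u, which is at least 4 \<eta>.\<close>
  define \<eta> where "\<eta> = decay_weight T / 4"
  have \<eta>: "\<eta> > 0" using decay_weight_pos by (simp add: \<eta>_def)
  obtain M where M: "M \<ge> 0" "\<And>t u n. \<lbrakk>t \<in> {0..T}; u \<in> {0..T}\<rbrakk> \<Longrightarrow> cmod (x u n - x t n) \<le> M * b n * \<bar>u - t\<bar>"
    using time_lipschitz[OF T] by metis
  have "uniformly_continuous_on {0..T} decay_weight"
    by (intro compact_uniformly_continuous continuous_on_decay_weight) auto
  then obtain d where d: "d > 0" "\<And>u v. \<lbrakk>u \<in> {0..T}; v \<in> {0..T}; \<bar>v - u\<bar> < d\<rbrakk> \<Longrightarrow> \<bar>decay_weight v - decay_weight u\<bar> < \<eta>"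
    using \<eta> unfolding uniformly_continuous_on_def dist_real_def by metis
  have B: "B > 0" using b_le[of 0] b(1)[of 0] by simp
  define h where "h = min (d / 2) (\<eta> / (M * B + 1))"
  have MB: "M * B + 1 > 0" using M(1) B by (intro add_nonneg_pos) auto
  have h: "h > 0" "h < d" using d \<eta> MB by (auto simp: h_def)
  have Mh: "M * B * h \<le> \<eta>"
  proof -
    have "h \<le> \<eta> / (M * B + 1)" by (simp add: h_def)
    then have "h * (M * B + 1) \<le> \<eta>" unfolding pos_le_divide_eq[OF MB] .
    then show ?thesis using h(1) by (simp add: algebra_simps)
  qed
  have step: "cmod (x v n) \<le> decay_weight v"
    if u: "u \<in> {0..T}" "v \<in> {0..T}" "\<bar>v - u\<bar> \<le> h" and le: "\<And>\<tau> n. \<tau> \<in> {0..u} \<Longrightarrow> cmod (x \<tau> n) \<le> decay_weight \<tau>" for u v n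
  proof -
    have "cmod (x u n) \<le> 1/2 * decay_weight u"
    proof (cases "u = 0")
      case True
      then show ?thesis using init_le[of n] small by simp
    next
      case False
      then have "cmod (x u n) \<le> decay_constant C \<delta> * decay_weight u"
        using u(1) by (intro duhamel_estimate[OF K0 K' Kle] le) auto
      also have "\<dots> \<le> 1/2 * decay_weight u" using small decay_weight_pos[of u] by (intro mult_right_mono) auto
      finally show ?thesis .
    qed
    moreover have "cmod (x v n - x u n) \<le> \<eta>"
    proof -
      have "cmod (x v n - x u n) \<le> M * b n * \<bar>v - u\<bar>" by (rule M(2)[OF u(1,2)])
      also have "\<dots> \<le> M * B * h" using M(1) b_le[of n] b(1)[of n] u(3) B by (intro mult_mono) auto
      finally show ?thesis using Mh by simp
    qed
    moreover have "\<bar>decay_weight v - decay_weight u\<bar> < \<eta>" using u h by (intro d) auto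
    moreover have "4 * \<eta> \<le> decay_weight u" using decay_weight_antimono[of u T] u(1) by (simp add: \<eta>_def)
    ultimately show ?thesis using norm_triangle_sub[of "x v n" "x u n"] by linarith
  qed
  have "\<forall>\<tau>\<in>{0..min T (real j * h)}. \<forall>n. cmod (x \<tau> n) \<le> decay_weight \<tau>" for j
  proof (induction j)
    case 0
    have "min T 0 = 0" using T by simp
    then show ?case using init_le \<delta>(2) by (auto intro: order.trans)
  next
    case (Suc j)
    show ?case
    proof (intro ballI allI)
      fix \<tau> n assume \<tau>: "\<tau> \<in> {0..min T (real (Suc j) * h)}"
      have "0 \<le> real j * h" using h by simp
      show "cmod (x \<tau> n) \<le> decay_weight \<tau>"
      proof (cases "\<tau> \<le> min T (real j * h)")
        case True
        then show ?thesis using Suc \<tau> by auto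
      next
        case False
        show ?thesis
          by (rule step[of "min T (real j * h)"]) (use False \<tau> T Suc \<open>0 \<le> real j * h\<close> h in \<open>auto simp: algebra_simps\<close>)
      qed
    qed
  qed
  note * = this
  obtain j where "T < real j * h" using reals_Archimedean3[OF h(1)] by blast
  then show ?thesis using *[of j] T by (auto simp: T_def)
qed

end

section \<open>Calculus in the space of square-summable sequences\<close>

lemma ell2_iff: "u \<in> ell 2 \<longleftrightarrow> (\<lambda>n. (cmod (u n))\<^sup>2) summable_on UNIV"
  by (simp add: ell_def)

lemma ell2_norm: "ell_norm 2 u = sqrt (\<Sum>\<^sub>\<infinity>n. (cmod (u n))\<^sup>2)"
  by (simp add: ell_norm_def powr_half_sqrt infsum_nonneg)

lemma ell2_coordinate_le:
  assumes "u \<in> ell 2" shows "cmod (u n) \<le> ell_norm 2 u"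
proof -
  have "(\<Sum>n\<in>{n}. (cmod (u n))\<^sup>2) \<le> (\<Sum>\<^sub>\<infinity>n. (cmod (u n))\<^sup>2)"
    using assms by (intro finite_sum_le_infsum) (auto simp: ell2_iff)
  then show ?thesis by (simp add: ell2_norm real_le_rsqrt)
qed

lemma ell2_add:
  assumes "u \<in> ell 2" "v \<in> ell 2" shows "(\<lambda>n. u n + v n) \<in> ell 2"
  unfolding ell2_iff
proof (rule summable_on_comparison_test)
  show "(\<lambda>n. 2 * (cmod (u n))\<^sup>2 + 2 * (cmod (v n))\<^sup>2) summable_on UNIV"
    using assms by (intro summable_on_add summable_on_cmult_right) (simp_all add: ell2_iff)
  show "(cmod (u n + v n))\<^sup>2 \<le> 2 * (cmod (u n))\<^sup>2 + 2 * (cmod (v n))\<^sup>2" for n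
  proof -
    have "(cmod (u n + v n))\<^sup>2 \<le> (cmod (u n) + cmod (v n))\<^sup>2" by (intro power_mono norm_triangle_ineq) auto
    also have "\<dots> \<le> 2 * (cmod (u n))\<^sup>2 + 2 * (cmod (v n))\<^sup>2"
      using zero_le_power2[of "cmod (u n) - cmod (v n)"] unfolding power2_sum power2_diff by linarith
    finally show ?thesis .
  qed
qed auto

lemma ell2_scale:
  assumes "u \<in> ell 2" shows "(\<lambda>n. c * u n) \<in> ell 2"
  using assms unfolding ell2_iff norm_mult power_mult_distrib by (rule summable_on_cmult_right)

text \<open>Summability of the weight also bounds it by B, so squares are at most c^2 B b n and
  their sum is at most (c B)^2.\<close>

lemma ell2_dominated:
  fixes b :: "int \<Rightarrow> real"
  assumes b: "\<And>n. 0 \<le> b n" "\<And>F. finite F \<Longrightarrow> sum b F \<le> B" and c: "c \<ge> 0"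
    and le: "\<And>n. cmod (u n) \<le> c * b n"
  shows "u \<in> ell 2" "ell_norm 2 u \<le> c * B"
proof -
  have B: "0 \<le> B" using b(2)[of "{}"] by simp
  have bB: "b n \<le> B" for n using b(2)[of "{n}"] by simp
  have fin: "(\<Sum>n\<in>F. (cmod (u n))\<^sup>2) \<le> (c * B)\<^sup>2" if "finite F" for F
  proof -
    have "(\<Sum>n\<in>F. (cmod (u n))\<^sup>2) \<le> (\<Sum>n\<in>F. c\<^sup>2 * B * b n)"
    proof (rule sum_mono)
      fix n
      have "(cmod (u n))\<^sup>2 \<le> (c * b n)\<^sup>2" by (intro power_mono le) auto
      also have "\<dots> = c\<^sup>2 * (b n * b n)" by (simp add: power2_eq_square)
      also have "\<dots> \<le> c\<^sup>2 * (B * b n)" using b bB by (intro mult_left_mono mult_right_mono) auto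
      finally show "(cmod (u n))\<^sup>2 \<le> c\<^sup>2 * B * b n" by simp
    qed
    also have "\<dots> \<le> c\<^sup>2 * B * B" unfolding sum_distrib_left[symmetric] using b(2)[OF that] B by (intro mult_left_mono) auto
    finally show ?thesis by (simp add: power2_eq_square mult_ac)
  qed
  have "(\<lambda>n. (cmod (u n))\<^sup>2) summable_on UNIV"
    by (rule nonneg_bdd_above_summable_on) (auto intro!: bdd_aboveI2 fin)
  then show "u \<in> ell 2" by (simp add: ell2_iff)
  have "(\<Sum>\<^sub>\<infinity>n. (cmod (u n))\<^sup>2) \<le> (c * B)\<^sup>2"
    using \<open>_ summable_on _\<close> by (rule infsum_le_finite_sums) (use fin in auto)
  then show "ell_norm 2 u \<le> c * B" unfolding ell2_norm using c B by (intro real_le_lsqrt) auto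
qed

text \<open>Gronwall's lemma by iteration: integrating the inequality for the derivative k times
  improves the bound D to D (\<Lambda> t)^k / k!, which tends to 0. Each step integrates one
  coordinate at a time, with a bound common to all coordinates, so the supremum over them is never
  differentiated.\<close>

lemma vanishing_of_self_bound:
  fixes v v' :: "real \<Rightarrow> 'a \<Rightarrow> complex"
  assumes deriv: "\<And>t n. ((\<lambda>t. v t n) has_vector_derivative v' t n) (at t)" and v0: "v 0 = (\<lambda>_. 0)"
    and bound: "\<And>t n. t \<in> {0..T} \<Longrightarrow> cmod (v t n) \<le> D"
    and self: "\<And>t c n. \<lbrakk>t \<in> {0..T}; \<And>n. cmod (v t n) \<le> c\<rbrakk> \<Longrightarrow> cmod (v' t n) \<le> \<Lambda> * c"
    and t: "t \<in> {0..T}"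
  shows "v t n = 0"
proof -
  have cont: "continuous_on S (\<lambda>t. v t n)" for S n
    by (rule continuous_on_vector_derivative) (use deriv has_vector_derivative_at_within in blast)
  have "\<forall>t\<in>{0..T}. \<forall>n. cmod (v t n) \<le> D * (\<Lambda> * t) ^ k / fact k" for k
  proof (induction k)
    case 0
    then show ?case using bound by simp
  next
    case (Suc k)
    show ?case
    proof (intro ballI allI)
      fix t n assume t: "t \<in> {0..T}"
      show "cmod (v t n) \<le> D * (\<Lambda> * t) ^ Suc k / fact (Suc k)"
      proof (cases "t = 0")
        case True
        then show ?thesis by (simp add: v0)
      next
        case False
        define \<phi> where "\<phi> \<tau> = D / fact (Suc k) * (\<Lambda> * \<tau>) ^ Suc k" for \<tau>
        have "norm (v t n - v 0 n) \<le> \<phi> t - \<phi> 0"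
        proof (rule differentiable_bound_general[of 0 t "\<lambda>t. v t n" \<phi> "\<lambda>t. v' t n" "\<lambda>\<tau>. \<Lambda> * (D * (\<Lambda> * \<tau>) ^ k / fact k)"])
          show "(\<phi> has_vector_derivative \<Lambda> * (D * (\<Lambda> * \<tau>) ^ k / fact k)) (at \<tau>)" for \<tau>
          proof -
            have "(\<phi> has_real_derivative D / fact (Suc k) * (real (Suc k) * (\<Lambda> * \<tau>) ^ k * \<Lambda>)) (at \<tau>)"
              unfolding \<phi>_def[abs_def] by (rule DERIV_cmult) (rule derivative_eq_intros refl | simp)+
            moreover have "D / fact (Suc k) * (real (Suc k) * (\<Lambda> * \<tau>) ^ k * \<Lambda>) = \<Lambda> * (D * (\<Lambda> * \<tau>) ^ k / fact k)"
              unfolding fact_Suc by (simp add: mult_ac del: of_nat_Suc)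
            ultimately show ?thesis by (simp only: has_real_derivative_iff_has_vector_derivative)
          qed
          show "cmod (v' \<tau> n) \<le> \<Lambda> * (D * (\<Lambda> * \<tau>) ^ k / fact k)" if "0 < \<tau>" "\<tau> < t" for \<tau>
            by (rule self) (use Suc that t in auto)
        qed (use t False cont deriv in \<open>auto simp: \<phi>_def[abs_def] intro!: continuous_intros\<close>)
        then show ?thesis by (simp add: \<phi>_def v0)
      qed
    qed
  qed
  then have "cmod (v t n) \<le> D * (\<Lambda> * t) ^ k / fact k" for k using t by blast
  moreover have "(\<lambda>k. D * (\<Lambda> * t) ^ k / fact k) \<longlonglongrightarrow> D * 0"
  proof -
    have "(\<lambda>k. D * (inverse (fact k) * (\<Lambda> * t) ^ k)) \<longlonglongrightarrow> D * 0"
      by (intro tendsto_mult tendsto_const summable_LIMSEQ_zero summable_exp)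
    then show ?thesis by (simp add: field_simps)
  qed
  ultimately have "cmod (v t n) \<le> D * 0" by (intro LIMSEQ_le_const) auto
  then show ?thesis by simp
qed

lemma has_vector_derivative_two_sided:
  fixes f :: "real \<Rightarrow> 'a::real_normed_vector"
  assumes "(f has_vector_derivative d) (at t within {t..})" "(f has_vector_derivative d) (at t within {..t})"
  shows "(f has_vector_derivative d) (at t)"
proof -
  have "{t..} \<union> {..t} = UNIV" by auto
  then show ?thesis
    using assms Lim_Un[of _ 0 t "{t..}" "{..t}"] unfolding has_vector_derivative_def has_derivative_within by auto
qed

section \<open>Solutions of the original equation: coordinates and uniqueness\<close>

context dnls
begin

text \<open>Time reversal: if y solves the truncated equation for t \<ge> 0, then the complex
  conjugate of y (- t) solves it for t \<le> 0.\<close>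

lemma rhs_cnj: "rhs R (\<lambda>n. cnj (u n)) n = - cnj (rhs R u n)"
  by (simp add: rhs_def schroedinger_op_def trunc_def algebra_simps)

text \<open>Domination by the summable weight bounds the remainder of the difference quotient at
  site n by a constant times |h| b n. Its norm in \<open>ell 2\<close> is therefore of order |h|,
  which upgrades coordinatewise differentiability.\<close>

lemma ell2_derivative_of_coordinates:
  assumes b: "\<And>n. 0 < b n" "\<And>n. b (n + 1) \<le> 2 * b n" "\<And>n. b (n - 1) \<le> 2 * b n"
      "\<And>F. finite F \<Longrightarrow> sum b F \<le> B"
    and deriv: "\<And>t n. ((\<lambda>t. \<psi> t n) has_vector_derivative rhs 1 (\<psi> t) n) (at t)"
    and dom: "\<And>T. \<exists>M\<ge>0. \<forall>t\<in>{-T..T}. \<forall>n. cmod (\<psi> t n) \<le> M * b n"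
  shows "has_ell2_derivative \<psi> (rhs 1 (\<psi> t)) t"
proof -
  note ell2 = ell2_dominated[of b B, OF less_imp_le[OF b(1)] b(4)]
  have mem: "\<psi> r \<in> ell 2" for r
  proof -
    obtain M where "M \<ge> 0" "\<forall>t\<in>{-\<bar>r\<bar>..\<bar>r\<bar>}. \<forall>n. cmod (\<psi> t n) \<le> M * b n" using dom by blast
    moreover have "r \<in> {-\<bar>r\<bar>..\<bar>r\<bar>}" by (simp add: abs_if)
    ultimately show ?thesis by (intro ell2(1)[of M]) auto
  qed
  define T where "T = \<bar>t\<bar> + 1"
  obtain M where M: "M \<ge> 0" "\<And>t n. t \<in> {-T..T} \<Longrightarrow> cmod (\<psi> t n) \<le> M * b n" using dom[of T] by blast
  define L where "L = lip 1"
  have L: "L > 0" unfolding L_def by (rule lip_pos)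
  have r: "cmod (rhs 1 (\<psi> u) n) \<le> L * M * b n" if "u \<in> {-T..T}" for u n
    using rhs_weighted_lipschitz[of 1 M "\<psi> u" "\<lambda>_. 0" b n] M that b by (simp add: L_def)
  have lin: "cmod (\<psi> u n - \<psi> t n - (u - t) *\<^sub>R rhs 1 (\<psi> t) n) \<le> norm (u - t) * E"
    if u: "u \<in> {-T..T}" and E: "\<And>z. z \<in> closed_segment t u \<Longrightarrow> cmod (rhs 1 (\<psi> z) n - rhs 1 (\<psi> t) n) \<le> E" for u n E
    by (rule vector_differentiable_bound_linearization[where S = "closed_segment t u" and f' = "\<lambda>t. rhs 1 (\<psi> t) n"])
      (auto intro: E has_vector_derivative_at_within[OF deriv])
  have seg: "z \<in> {-T..T} \<and> \<bar>z - t\<bar> \<le> \<bar>u - t\<bar>" if "z \<in> closed_segment t u" "u \<in> {-T..T}" for z u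
    using that by (auto simp: closed_segment_eq_real_ivl T_def split: if_splits)
  \<comment> \<open>The factor 3 consists of 2 for the linearization error, where both right-hand
    sides are bounded separately, and 1 for the linear term.\<close>
  have lips: "cmod (\<psi> u n - \<psi> t n) \<le> 3 * L * M * \<bar>u - t\<bar> * b n" if u: "u \<in> {-T..T}" for u n
  proof -
    have "cmod (\<psi> u n - \<psi> t n - (u - t) *\<^sub>R rhs 1 (\<psi> t) n) \<le> norm (u - t) * (L * M * b n + L * M * b n)"
    proof (rule lin[OF u])
      fix z assume z: "z \<in> closed_segment t u"
      show "cmod (rhs 1 (\<psi> z) n - rhs 1 (\<psi> t) n) \<le> L * M * b n + L * M * b n"
        using seg[OF z u] by (intro order.trans[OF norm_triangle_ineq4] add_mono r) (auto simp: T_def)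
    qed
    moreover have "cmod ((u - t) *\<^sub>R rhs 1 (\<psi> t) n) \<le> \<bar>u - t\<bar> * (L * M * b n)"
      unfolding norm_scaleR by (intro mult_mono r) (auto simp: T_def)
    moreover have "cmod (\<psi> u n - \<psi> t n) \<le> cmod (\<psi> u n - \<psi> t n - (u - t) *\<^sub>R rhs 1 (\<psi> t) n) + cmod ((u - t) *\<^sub>R rhs 1 (\<psi> t) n)"
      using norm_triangle_ineq[of "\<psi> u n - \<psi> t n - (u - t) *\<^sub>R rhs 1 (\<psi> t) n" "(u - t) *\<^sub>R rhs 1 (\<psi> t) n"] by simp
    ultimately show ?thesis by (simp add: algebra_simps)
  qed
  define M' where "M' = 3 * L * L * M"
  have M': "M' \<ge> 0" using L M by (simp add: M'_def)
  have rem: "cmod ((\<psi> (t + h) n - \<psi> t n) / of_real h - rhs 1 (\<psi> t) n) \<le> (M' * \<bar>h\<bar>) * b n"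
    if h: "h \<noteq> 0" "\<bar>h\<bar> \<le> 1" for h n
  proof -
    have u: "t + h \<in> {-T..T}" using h by (auto simp: T_def)
    have "cmod (\<psi> (t + h) n - \<psi> t n - (t + h - t) *\<^sub>R rhs 1 (\<psi> t) n) \<le> norm (t + h - t) * ((M' * \<bar>h\<bar>) * b n)"
    proof (rule lin[OF u])
      fix z assume z: "z \<in> closed_segment t (t + h)"
      have "cmod (rhs 1 (\<psi> z) n - rhs 1 (\<psi> t) n) \<le> lip 1 * ((3 * L * M * \<bar>h\<bar>) * b n)"
      proof (rule rhs_weighted_lipschitz)
        fix n
        have "cmod (\<psi> z n - \<psi> t n) \<le> 3 * L * M * \<bar>z - t\<bar> * b n" using seg[OF z u] by (intro lips) auto
        also have "\<dots> \<le> 3 * L * M * \<bar>h\<bar> * b n"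
          using seg[OF z u] L M b(1)[of n] by (intro mult_right_mono mult_left_mono) auto
        finally show "cmod (\<psi> z n - \<psi> t n) \<le> 3 * L * M * \<bar>h\<bar> * b n" .
      qed (use b L M in auto)
      then show "cmod (rhs 1 (\<psi> z) n - rhs 1 (\<psi> t) n) \<le> (M' * \<bar>h\<bar>) * b n" by (simp add: M'_def L_def mult_ac)
    qed
    moreover have "(\<psi> (t + h) n - \<psi> t n) / of_real h - rhs 1 (\<psi> t) n = (\<psi> (t + h) n - \<psi> t n - h *\<^sub>R rhs 1 (\<psi> t) n) / of_real h"
      using h by (simp add: field_simps scaleR_conv_of_real)
    ultimately show ?thesis using h by (simp add: norm_divide divide_le_eq mult_ac)
  qed
  have "((\<lambda>h. ell_norm 2 (\<lambda>n. (\<psi> (t + h) n - \<psi> t n) / of_real h - rhs 1 (\<psi> t) n)) \<longlongrightarrow> 0) (at 0)"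
  proof (rule tendsto_sandwich)
    show "\<forall>\<^sub>F h in at 0. 0 \<le> ell_norm 2 (\<lambda>n. (\<psi> (t + h) n - \<psi> t n) / of_real h - rhs 1 (\<psi> t) n)"
      by (simp add: ell_norm_def)
    show "\<forall>\<^sub>F h in at 0. ell_norm 2 (\<lambda>n. (\<psi> (t + h) n - \<psi> t n) / of_real h - rhs 1 (\<psi> t) n) \<le> M' * \<bar>h\<bar> * B"
      unfolding eventually_at using M' by (intro exI[of _ 1]) (auto intro!: ell2(2) rem simp: dist_real_def)
    have "((\<lambda>h. M' * \<bar>h\<bar> * B) \<longlongrightarrow> M' * \<bar>0\<bar> * B) (at 0)" by (intro tendsto_intros)
    then show "((\<lambda>h. M' * \<bar>h\<bar> * B) \<longlongrightarrow> 0) (at 0)" by simp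
  qed simp
  moreover have "t \<in> {-T..T}" by (auto simp: T_def)
  then have "rhs 1 (\<psi> t) \<in> ell 2" using L M(1) r by (intro ell2(1)[of "L * M"]) auto
  ultimately show ?thesis unfolding has_ell2_derivative_def using mem by simp
qed

text \<open>The \<open>ell 2\<close> norm dominates every coordinate, so an arbitrary solution is
  differentiable site by site. The norm derivative also gives a bound near each time, and a Bolzano
  argument extends it to compact intervals; there the equation coincides with its truncation at a
  sufficiently large amplitude.\<close>

lemma solution_deriv:
  assumes sol: "dnls_solution s \<sigma> V \<psi>0 \<psi>"
  obtains \<psi>' where "\<And>t n. ((\<lambda>t. \<psi> t n) has_vector_derivative \<psi>' t n) (at t)"
    "\<And>R t n. cmod (\<psi> t n) \<le> R \<Longrightarrow> \<psi>' t n = rhs R (\<psi> t) n"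
    "\<And>a b. a \<le> b \<Longrightarrow> \<exists>R. \<forall>t\<in>{a..b}. \<forall>n. cmod (\<psi> t n) \<le> R"
proof -
  obtain \<psi>' where \<psi>': "\<And>t. has_ell2_derivative \<psi> (\<psi>' t) t"
    "\<And>t n. \<i> * \<psi>' t n = schroedinger_op V (\<psi> t) n + of_real (s * cmod (\<psi> t n) powr (\<sigma> - 1)) * \<psi> t n"
    using sol unfolding dnls_solution_def by blast
  define rem where "rem t h n = (\<psi> (t + h) n - \<psi> t n) / of_real h - \<psi>' t n" for t h n
  have mem: "\<psi> t \<in> ell 2" "\<psi>' t \<in> ell 2" for t using \<psi>'(1)[of t] by (auto simp: has_ell2_derivative_def)
  have remeq: "rem t h n = (1 / of_real h) * \<psi> (t + h) n + ((- 1 / of_real h) * \<psi> t n + (-1) * \<psi>' t n)" for t h n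
    by (simp add: rem_def diff_divide_distrib)
  have remmem: "rem t h \<in> ell 2" for t h
    unfolding remeq[abs_def] by (intro ell2_add ell2_scale mem)
  have lim: "((\<lambda>h. ell_norm 2 (rem t h)) \<longlongrightarrow> 0) (at 0)" for t
    using \<psi>'(1)[of t] by (simp add: has_ell2_derivative_def rem_def[abs_def])
  have deriv: "((\<lambda>t. \<psi> t n) has_vector_derivative \<psi>' t n) (at t)" for t n
  proof -
    have "((\<lambda>h. rem t h n) \<longlongrightarrow> 0) (at 0)"
      by (rule Lim_null_comparison[OF _ lim[of t]]) (auto intro!: always_eventually ell2_coordinate_le remmem)
    then have "((\<lambda>h. cmod (rem t h n)) \<longlongrightarrow> 0) (at 0)" by (rule tendsto_norm_zero)
    moreover have "\<forall>\<^sub>F h in at 0. cmod (rem t h n) = cmod (\<psi> (t + h) n - \<psi> t n - h *\<^sub>R \<psi>' t n) / norm h"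
    proof (rule eventually_at_topological[THEN iffD2], intro exI[of _ UNIV] conjI ballI impI)
      fix h :: real assume h: "h \<noteq> 0"
      have "rem t h n = (\<psi> (t + h) n - \<psi> t n - h *\<^sub>R \<psi>' t n) / of_real h"
        using h by (simp add: rem_def field_simps scaleR_conv_of_real)
      then show "cmod (rem t h n) = cmod (\<psi> (t + h) n - \<psi> t n - h *\<^sub>R \<psi>' t n) / norm h" by (simp add: norm_divide)
    qed auto
    ultimately have "((\<lambda>h. cmod (\<psi> (t + h) n - \<psi> t n - h *\<^sub>R \<psi>' t n) / norm h) \<longlongrightarrow> 0) (at 0)"
      by (rule Lim_transform_eventually)
    then show ?thesis unfolding has_vector_derivative_def has_derivative_at by (simp add: bounded_linear_scaleR_left)
  qed
  have eq: "\<psi>' t n = rhs R (\<psi> t) n" if "cmod (\<psi> t n) \<le> R" for t n R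
  proof -
    have "\<psi>' t n = - \<i> * (\<i> * \<psi>' t n)" by simp
    then show ?thesis unfolding \<psi>'(2) using that by (simp add: rhs_def trunc_def)
  qed
  have bd: "\<exists>R. \<forall>t\<in>{a..b}. \<forall>n. cmod (\<psi> t n) \<le> R" if "a \<le> b" for a b
    using that
  proof (induction rule: Bolzano)
    case (trans a b c)
    then obtain R R' where "\<forall>t\<in>{a..b}. \<forall>n. cmod (\<psi> t n) \<le> R" "\<forall>t\<in>{b..c}. \<forall>n. cmod (\<psi> t n) \<le> R'" by blast
    then have "\<forall>t\<in>{a..c}. \<forall>n. cmod (\<psi> t n) \<le> max R R'" by (meson atLeastAtMost_iff le_cases max.coboundedI1 max.coboundedI2)
    then show ?case by blast
  next
    case (local t)
    have "\<forall>\<^sub>F h in at 0. ell_norm 2 (rem t h) < 1" by (rule order_tendstoD[OF lim]) simp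
    then obtain d where d: "d > 0" "\<And>h. \<lbrakk>h \<noteq> 0; \<bar>h\<bar> < d\<rbrakk> \<Longrightarrow> ell_norm 2 (rem t h) < 1"
      unfolding eventually_at by (auto simp: dist_real_def)
    define R where "R = ell_norm 2 (\<psi> t) + 1 * (ell_norm 2 (\<psi>' t) + 1)"
    have nn: "0 \<le> ell_norm 2 u" for u by (simp add: ell_norm_def)
    have R: "cmod (\<psi> u n) \<le> R" if u: "\<bar>u - t\<bar> < min d 1" for u n
    proof (cases "u = t")
      case True
      then show ?thesis using ell2_coordinate_le[OF mem(1), of t n] nn[of "\<psi>' t"] by (simp add: R_def)
    next
      case False
      define h where "h = u - t"
      have h: "h \<noteq> 0" "\<bar>h\<bar> < d" "\<bar>h\<bar> \<le> 1" "u = t + h" using u False by (auto simp: h_def)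
      have "\<psi> u n = \<psi> t n + of_real h * (\<psi>' t n + rem t h n)" using h by (simp add: rem_def)
      then have "cmod (\<psi> u n) \<le> cmod (\<psi> t n) + \<bar>h\<bar> * cmod (\<psi>' t n + rem t h n)"
        by (metis norm_triangle_ineq norm_mult norm_of_real)
      also have "\<dots> \<le> ell_norm 2 (\<psi> t) + 1 * (ell_norm 2 (\<psi>' t) + ell_norm 2 (rem t h))"
        using h by (intro add_mono mult_mono order.trans[OF norm_triangle_ineq] ell2_coordinate_le mem remmem) auto
      also have "\<dots> \<le> R" using d(2)[OF h(1,2)] by (simp add: R_def)
      finally show ?thesis .
    qed
    show ?case
    proof (intro exI conjI allI impI)
      show "min d 1 > 0" using d by simp
      show "\<forall>u\<in>{a..b}. \<forall>n. cmod (\<psi> u n) \<le> R" if "a \<le> t \<and> t \<le> b \<and> b - a < min d 1" for a b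
        using that by (auto intro!: R)
    qed
  qed
  show ?thesis using that[OF deriv eq bd] .
qed

text \<open>On a symmetric time interval both solutions stay below some amplitude R and so solve the
  equation truncated at R, whose right-hand side is Lipschitz in the supremum norm; the weight is
  here the constant 1. The factor \<epsilon> treats both directions of time at once.\<close>

lemma solution_unique:
  assumes sol: "dnls_solution s \<sigma> V \<psi>0 \<psi>" "dnls_solution s \<sigma> V \<psi>0 \<phi>"
  shows "\<psi> = \<phi>"
proof (intro ext)
  fix t :: real and n :: int
  obtain \<psi>' where \<psi>': "\<And>t n. ((\<lambda>t. \<psi> t n) has_vector_derivative \<psi>' t n) (at t)"
    "\<And>R t n. cmod (\<psi> t n) \<le> R \<Longrightarrow> \<psi>' t n = rhs R (\<psi> t) n"
    "\<And>a b. a \<le> b \<Longrightarrow> \<exists>R. \<forall>t\<in>{a..b}. \<forall>n. cmod (\<psi> t n) \<le> R" using solution_deriv[OF sol(1)] by blast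
  obtain \<phi>' where \<phi>': "\<And>t n. ((\<lambda>t. \<phi> t n) has_vector_derivative \<phi>' t n) (at t)"
    "\<And>R t n. cmod (\<phi> t n) \<le> R \<Longrightarrow> \<phi>' t n = rhs R (\<phi> t) n"
    "\<And>a b. a \<le> b \<Longrightarrow> \<exists>R. \<forall>t\<in>{a..b}. \<forall>n. cmod (\<phi> t n) \<le> R" using solution_deriv[OF sol(2)] by blast
  define T where "T = \<bar>t\<bar>"
  obtain A A' where "\<forall>t\<in>{-T..T}. \<forall>n. cmod (\<psi> t n) \<le> A" "\<forall>t\<in>{-T..T}. \<forall>n. cmod (\<phi> t n) \<le> A'"
    using \<psi>'(3)[of "-T" T] \<phi>'(3)[of "-T" T] by (auto simp: T_def)
  then have "\<exists>R>0. \<forall>t\<in>{-T..T}. \<forall>n. cmod (\<psi> t n) \<le> R \<and> cmod (\<phi> t n) \<le> R"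
    by (intro exI[of _ "max 1 (max A A')"]) (auto simp: le_max_iff_disj)
  then obtain R where R: "R > 0" "\<And>t n. t \<in> {-T..T} \<Longrightarrow> cmod (\<psi> t n) \<le> R" "\<And>t n. t \<in> {-T..T} \<Longrightarrow> cmod (\<phi> t n) \<le> R" by blast
  have d0: "\<psi> 0 = \<phi> 0" using sol by (simp add: dnls_solution_def)
  have bd: "cmod (\<psi> t n - \<phi> t n) \<le> R + R" if "t \<in> {-T..T}" for t n
    using that by (intro order.trans[OF norm_triangle_ineq4] add_mono R)
  have self: "cmod (\<psi>' t n - \<phi>' t n) \<le> lip R * c" if t: "t \<in> {-T..T}" and c: "\<And>n. cmod (\<psi> t n - \<phi> t n) \<le> c" for t c n
  proof -
    have "c \<ge> 0" using c[of 0] norm_ge_zero order.trans by blast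
    then have "cmod (rhs R (\<psi> t) n - rhs R (\<phi> t) n) \<le> lip R * (c * 1)"
      using c R(1) by (intro rhs_weighted_lipschitz) auto
    then show ?thesis using \<psi>'(2)[OF R(2)[OF t]] \<phi>'(2)[OF R(3)[OF t]] by simp
  qed
  have "\<psi> (\<epsilon> * T) n - \<phi> (\<epsilon> * T) n = 0" if \<epsilon>: "\<epsilon> = 1 \<or> \<epsilon> = -1" for \<epsilon> :: real
  proof (rule vanishing_of_self_bound[where v = "\<lambda>t n. \<psi> (\<epsilon> * t) n - \<phi> (\<epsilon> * t) n" and D = "R + R" and \<Lambda> = "lip R" and T = T
        and v' = "\<lambda>t n. \<epsilon> *\<^sub>R (\<psi>' (\<epsilon> * t) n - \<phi>' (\<epsilon> * t) n)"])
    show "((\<lambda>t. \<psi> (\<epsilon> * t) n - \<phi> (\<epsilon> * t) n) has_vector_derivative \<epsilon> *\<^sub>R (\<psi>' (\<epsilon> * t) n - \<phi>' (\<epsilon> * t) n)) (at t)" for t n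
    proof -
      have "((\<lambda>t. \<epsilon> * t) has_vector_derivative \<epsilon>) (at t)"
        unfolding has_real_derivative_iff_has_vector_derivative[symmetric] by (auto intro!: derivative_eq_intros)
      from vector_diff_chain_at[OF this has_vector_derivative_diff[OF \<psi>'(1)[of n "\<epsilon> * t"] \<phi>'(1)[of n "\<epsilon> * t"]]]
      show ?thesis by (simp add: comp_def)
    qed
  qed (use \<epsilon> bd self d0 in \<open>auto simp: T_def\<close>)
  from this[of 1] this[of "-1"] show "\<psi> t n = \<phi> t n" by (auto simp: T_def abs_if split: if_splits)
qed

end

section \<open>Small data\<close>

context dnls
begin

text \<open>The forward solution and the conjugated, reversed one are glued at t = 0. Their decay
  estimates keep all amplitudes at most 1, so the truncation is never active and the glued curve
  solves the original equation.\<close>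

lemma small_data_solution:
  fixes K :: "real \<Rightarrow> int \<Rightarrow> int \<Rightarrow> complex"
  assumes K0: "\<And>m n. K 0 m n = (if m = n then 1 else 0)"
    and K': "\<And>t m n. ((\<lambda>t. K t m n) has_vector_derivative
      - \<i> * (K t m (n - 1) + K t m (n + 1) + of_real (V n) * K t m n)) (at t)"
    and Kle: "\<And>t m n. t \<ge> 0 \<Longrightarrow> cmod (K t m n) \<le> C * decay_weight t"
    and small: "0 \<le> d" "d \<le> 1/2" "decay_constant C d \<le> 1/2"
    and data: "\<psi>0 \<in> ell 1" "ell_norm 1 \<psi>0 \<le> d"
  shows "\<exists>\<psi>. dnls_solution s \<sigma> V \<psi>0 \<psi> \<and> (\<forall>t n. cmod (\<psi> t n) \<le> decay_weight t)"
proof -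
  have sm: "(\<lambda>n. cmod (\<psi>0 n)) summable_on UNIV" using data(1) by (simp add: ell_def)
  have "(\<Sum>\<^sub>\<infinity>n. cmod (\<psi>0 n)) \<le> d" using data(2) by (simp add: ell_norm_def infsum_nonneg)
  then have init: "(\<Sum>n\<in>F. cmod (\<psi>0 n)) \<le> d" if "finite F" for F
    using finite_sum_le_infsum[OF sm that] by force
  obtain b B where b: "\<And>n. 0 < b n" "\<And>n. cmod (\<psi>0 n) \<le> b n" "\<And>n. b (n + 1) \<le> 2 * b n" "\<And>n. b (n - 1) \<le> 2 * b n"
    "\<And>F. finite F \<Longrightarrow> sum b F \<le> B" using dominating_weight[OF sm] by auto
  obtain x where x: "x 0 = \<psi>0"
    "\<And>t n. t \<ge> 0 \<Longrightarrow> ((\<lambda>t. x t n) has_vector_derivative rhs 1 (x t) n) (at t within {0..})"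
    "\<And>T. T \<ge> 0 \<Longrightarrow> \<exists>M\<ge>0. \<forall>t\<in>{0..T}. \<forall>n. cmod (x t n) \<le> M * b n"
    using half_line_solution[of b \<psi>0] b by auto
  obtain y where y: "y 0 = (\<lambda>n. cnj (\<psi>0 n))"
    "\<And>t n. t \<ge> 0 \<Longrightarrow> ((\<lambda>t. y t n) has_vector_derivative rhs 1 (y t) n) (at t within {0..})"
    "\<And>T. T \<ge> 0 \<Longrightarrow> \<exists>M\<ge>0. \<forall>t\<in>{0..T}. \<forall>n. cmod (y t n) \<le> M * b n"
    using half_line_solution[of b "\<lambda>n. cnj (\<psi>0 n)"] b by auto
  interpret x: half_sol \<sigma> s MV V b B d x
    by unfold_locales (use b x init small in auto)
  interpret y: half_sol \<sigma> s MV V b B d y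
    by unfold_locales (use b y init small in auto)
  define \<psi> where "\<psi> t = (if t \<ge> 0 then x t else (\<lambda>n. cnj (y (- t) n)))" for t
  have neg: "\<psi> t = (\<lambda>n. cnj (y (- t) n))" if "t \<le> 0" for t
    using that by (cases "t = 0") (auto simp: \<psi>_def x(1) y(1))
  have pos: "\<psi> t = x t" if "t \<ge> 0" for t using that by (simp add: \<psi>_def)
  have le: "cmod (\<psi> t n) \<le> decay_weight t" for t n
    using x.decay[OF K0 K' Kle small(2,3), of t n] y.decay[OF K0 K' Kle small(2,3), of "- t" n]
    by (simp add: \<psi>_def)
  have le1: "cmod (\<psi> t n) \<le> 1" for t n using le[of t n] decay_weight_le_1[of t] by linarith
  have dr: "((\<lambda>t. \<psi> t n) has_vector_derivative rhs 1 (\<psi> t) n) (at t within {0..})" if "t \<ge> 0" for t n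
    unfolding pos[OF that] by (rule has_vector_derivative_transform[OF _ _ x(2)]) (use that pos in auto)
  have dl: "((\<lambda>t. \<psi> t n) has_vector_derivative rhs 1 (\<psi> t) n) (at t within {..0})" if "t \<le> 0" for t n
  proof -
    have im: "uminus ` {..0::real} = {0..}" by (auto simp: image_iff intro: bexI[of _ "- _"])
    have "(uminus has_vector_derivative (-1::real)) (at t within {..0})"
      unfolding has_real_derivative_iff_has_vector_derivative[symmetric] by (auto intro!: derivative_eq_intros)
    from vector_diff_chain_within[OF this, unfolded im, OF y(2)[of "- t" n]]
    have "((\<lambda>t. y (- t) n) has_vector_derivative - rhs 1 (y (- t)) n) (at t within {..0})"
      using that by (simp add: comp_def)
    from bounded_linear.has_vector_derivative[OF bounded_linear_cnj this]
    have "((\<lambda>t. cnj (y (- t) n)) has_vector_derivative rhs 1 (\<psi> t) n) (at t within {..0})"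
      by (simp add: neg[OF that] rhs_cnj)
    then show ?thesis by (rule has_vector_derivative_transform[rotated 2]) (use that neg in auto)
  qed
  have deriv: "((\<lambda>t. \<psi> t n) has_vector_derivative rhs 1 (\<psi> t) n) (at t)" for t n
  proof (cases t "0::real" rule: linorder_cases)
    case less
    then show ?thesis using dl[of t n] at_within_interior[of t "{..0}"] by simp
  next
    case equal
    then show ?thesis using dl[of t n] dr[of t n] by (intro has_vector_derivative_two_sided) auto
  next
    case greater
    then show ?thesis using dr[of t n] at_within_interior[of t "{0..}"] by simp
  qed
  have dom: "\<exists>M\<ge>0. \<forall>t\<in>{-T..T}. \<forall>n. cmod (\<psi> t n) \<le> M * b n" for T
  proof -
    obtain M M' where M: "M \<ge> 0" "\<forall>t\<in>{0..\<bar>T\<bar>}. \<forall>n. cmod (x t n) \<le> M * b n"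
      and M': "M' \<ge> 0" "\<forall>t\<in>{0..\<bar>T\<bar>}. \<forall>n. cmod (y t n) \<le> M' * b n"
      using x(3)[of "\<bar>T\<bar>"] y(3)[of "\<bar>T\<bar>"] by auto
    have "cmod (\<psi> t n) \<le> (M + M') * b n" if t: "t \<in> {-T..T}" for t n
    proof (cases "t \<ge> 0")
      case True
      then have "cmod (\<psi> t n) \<le> M * b n" using t M(2) by (auto simp: pos)
      then show ?thesis using mult_nonneg_nonneg[OF M'(1) less_imp_le[OF b(1)[of n]]] by (simp add: distrib_right)
    next
      case False
      then have "cmod (\<psi> t n) \<le> M' * b n" using t M'(2) by (auto simp: neg)
      then show ?thesis using mult_nonneg_nonneg[OF M(1) less_imp_le[OF b(1)[of n]]] by (simp add: distrib_right)
    qed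
    then show ?thesis using M M' by (intro exI[of _ "M + M'"]) auto
  qed
  have "dnls_solution s \<sigma> V \<psi>0 \<psi>"
    unfolding dnls_solution_def
  proof (intro conjI exI[of _ "\<lambda>t. rhs 1 (\<psi> t)"] allI)
    show "\<psi> 0 = \<psi>0" by (simp add: pos x(1))
    show "has_ell2_derivative \<psi> (rhs 1 (\<psi> t)) t" for t
      by (rule ell2_derivative_of_coordinates[OF b(1,3,4,5) deriv dom])
    show "\<i> * rhs 1 (\<psi> t) n = schroedinger_op V (\<psi> t) n + of_real (s * cmod (\<psi> t n) powr (\<sigma> - 1)) * \<psi> t n" for t n
      using le1[of t n] by (simp add: rhs_def trunc_def)
  qed
  then show ?thesis using le by blast
qed

text \<open>The decay is proved for one constructed solution and passes to every solution by
  uniqueness. A suitable size of the data exists because \<open>decay_constant\<close> tends to 0 at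
  0.\<close>

lemma small_data_decay:
  fixes K :: "real \<Rightarrow> int \<Rightarrow> int \<Rightarrow> complex"
  assumes K0: "\<And>m n. K 0 m n = (if m = n then 1 else 0)"
    and K': "\<And>t m n. ((\<lambda>t. K t m n) has_vector_derivative
      - \<i> * (K t m (n - 1) + K t m (n + 1) + of_real (V n) * K t m n)) (at t)"
    and Kle: "\<And>t m n. t \<ge> 0 \<Longrightarrow> cmod (K t m n) \<le> C * decay_weight t"
  shows "\<exists>d>0. \<forall>\<psi>0 \<in> ell 1. ell_norm 1 \<psi>0 \<le> d \<longrightarrow> (\<exists>!\<psi>. dnls_solution s \<sigma> V \<psi>0 \<psi>) \<and>
    (\<forall>\<psi>. dnls_solution s \<sigma> V \<psi>0 \<psi> \<longrightarrow> (\<forall>t. ell_inf_norm (\<psi> t) \<le> decay_weight t))"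
proof -
  have "((\<lambda>d. decay_constant C d) \<longlongrightarrow> decay_constant C 0) (at_right 0)"
    unfolding decay_constant_def by (intro tendsto_intros) (use \<sigma> in auto)
  then have "((\<lambda>d. decay_constant C d) \<longlongrightarrow> 0) (at_right 0)" by (simp add: decay_constant_def)
  then have "\<forall>\<^sub>F d in at_right 0. decay_constant C d < 1/2" by (rule order_tendstoD) simp
  moreover have "\<forall>\<^sub>F d in at_right (0::real). d < 1/2" by (rule order_tendstoD[OF tendsto_ident_at]) simp
  ultimately have "\<forall>\<^sub>F d in at_right 0. decay_constant C d < 1/2 \<and> d < 1/2 \<and> 0 < d"
    using eventually_at_right_less[of "0::real"] by eventually_elim simp
  then obtain d where d: "decay_constant C d < 1/2" "d < 1/2" "0 < d"
    using eventually_happens' trivial_limit_at_right_real by blast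
  show ?thesis
  proof (intro exI[of _ d] conjI ballI impI d(3))
    fix \<psi>0 assume data: "\<psi>0 \<in> ell 1" "ell_norm 1 \<psi>0 \<le> d"
    obtain \<psi> where \<psi>: "dnls_solution s \<sigma> V \<psi>0 \<psi>" "\<And>t n. cmod (\<psi> t n) \<le> decay_weight t"
      using small_data_solution[OF K0 K' Kle, of d \<psi>0] d data by auto
    have uniq: "\<phi> = \<psi>" if "dnls_solution s \<sigma> V \<psi>0 \<phi>" for \<phi> using solution_unique[OF that \<psi>(1)] .
    then show "\<exists>!\<psi>. dnls_solution s \<sigma> V \<psi>0 \<psi>" using \<psi>(1) by blast
    have "ell_inf_norm (\<psi> t) \<le> decay_weight t" for t
      unfolding ell_inf_norm_def by (intro cSUP_least \<psi>(2)) auto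
    then show "\<forall>\<psi>. dnls_solution s \<sigma> V \<psi>0 \<psi> \<longrightarrow> (\<forall>t. ell_inf_norm (\<psi> t) \<le> decay_weight t)"
      using uniq by blast
  qed
qed

end

text \<open>The power t^(-1/3) is of no use near t = 0. For t < 1 the uniform bound p replaces it,
  as the decay weight is bounded below there.\<close>

lemma (in periodic_op) propagator_decay_weight:
  obtains C where "\<And>t m n. t \<ge> 0 \<Longrightarrow> cmod (propagator t m n) \<le> C * decay_weight t"
proof -
  obtain B where B: "B > 0" "\<And>t m n. t > 0 \<Longrightarrow> cmod (propagator t m n) \<le> B * t powr (-1/3)"
    using propagator_decay by blast
  have two: "(2::real) powr (1/3) \<le> 2" using powr_mono[of "1/3" 1 "2::real"] by simp
  have w: "u powr (- (1/3)) \<le> 2 * decay_weight t" if u: "u > 0" "japanese_bracket t \<le> 2 * u" for u t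
  proof -
    have "u powr (- (1/3)) = 2 powr (1/3) * (2 * u) powr (- (1/3))" using half_powr_minus[of "2 * u" "1/3"] u by simp
    also have "\<dots> \<le> 2 * decay_weight t"
      unfolding decay_weight_def minus_divide_left[symmetric] using u japanese_bracket_ge(1)[of t]
      by (intro mult_mono two powr_mono2') auto
    finally show ?thesis .
  qed
  have "cmod (propagator t m n) \<le> (2 * B + 2 * real p) * decay_weight t" if t: "t \<ge> 0" for t m n
  proof (cases "t \<ge> 1")
    case True
    have "japanese_bracket t \<le> 2 * t"
      unfolding japanese_bracket_def using True by (intro real_le_lsqrt) (auto simp: power2_eq_square intro: mult_mono add_mono order.trans)
    then have "B * t powr (-1/3) \<le> B * (2 * decay_weight t)"
      using w[of t t] True B(1) by (intro mult_left_mono) auto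
    then have "cmod (propagator t m n) \<le> B * (2 * decay_weight t)"
      using B(2)[of t m n] True by simp
    moreover have "0 \<le> 2 * real p * decay_weight t" using decay_weight_pos[of t] by simp
    ultimately show ?thesis by (simp add: algebra_simps)
  next
    case False
    then have "t\<^sup>2 \<le> 1" using t by (simp add: power_le_one)
    then have "japanese_bracket t \<le> 2" unfolding japanese_bracket_def by (intro real_le_lsqrt) auto
    then have "real p * 1 \<le> real p * (2 * decay_weight t)" using w[of 1 t] by (intro mult_left_mono) auto
    then have "cmod (propagator t m n) \<le> real p * (2 * decay_weight t)" using cmod_propagator_le[of t m n] by simp
    moreover have "0 \<le> 2 * B * decay_weight t" using decay_weight_pos[of t] B(1) by simp
    ultimately show ?thesis by (simp add: algebra_simps)
  qed
  then show ?thesis using that by blast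
qed

theorem corollary1p3:
  fixes \<sigma> s :: real and V :: "int \<Rightarrow> real"
  assumes "\<sigma> > 5"
    and "periodic_potential V"
    and "s = 1 \<or> s = -1"
  shows "\<exists>C>0. \<exists>\<delta>>0. \<forall>\<psi>0 \<in> ell 1. ell_norm 1 \<psi>0 \<le> \<delta> \<longrightarrow>
    (\<exists>!\<psi>. dnls_solution s \<sigma> V \<psi>0 \<psi>) \<and>
    (\<forall>\<psi>. dnls_solution s \<sigma> V \<psi>0 \<psi> \<longrightarrow>
      (\<forall>t. ell_inf_norm (\<psi> t) \<le> C * japanese_bracket t powr (-1/3)))"
proof -
  obtain q :: int where q: "q \<ge> 1" "\<And>n. V (n + q) = V n"
    using assms(2) unfolding periodic_potential_def by blast
  define p where "p = nat q"
  interpret periodic_op V p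
    by unfold_locales (use q in \<open>simp_all add: p_def\<close>)
  have "\<bar>V n\<bar> \<le> Max ((\<lambda>n. \<bar>V n\<bar>) ` {0..<q})" for n
  proof -
    have up: "V (n + int k * q) = V n" for n k
    proof (induction k)
      case (Suc k)
      then show ?case using q(2)[of "n + int k * q"] by (simp add: algebra_simps)
    qed simp
    have "V n = V (n mod q)"
    proof (cases "n div q \<ge> 0")
      case True
      then show ?thesis using up[of "n mod q" "nat (n div q)"] by simp
    next
      case False
      then show ?thesis using up[of n "nat (- (n div q))"] by (simp add: minus_div_mult_eq_mod)
    qed
    then show ?thesis using q(1) by (auto intro!: Max_ge imageI)
  qed
  then interpret dnls \<sigma> s "Max ((\<lambda>n. \<bar>V n\<bar>) ` {0..<q})" V
    using assms by unfold_locales auto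
  obtain B where B: "\<And>t m n. t \<ge> 0 \<Longrightarrow> cmod (propagator t m n) \<le> B * decay_weight t"
    using propagator_decay_weight by blast
  \<comment> \<open>The constant C can be 1, because the smallness of \<delta> has absorbed the
    constant of the linear estimate.\<close>
  show ?thesis
    using small_data_decay[OF propagator_0 propagator_has_derivative B]
    unfolding decay_weight_def by (intro exI[of _ 1]) simp
qed

end
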